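(* Let $R$ be an integral domain such that $R/(m)$ is finite for every $m\in R\setminus\{0\}$, and let $K$ be its field of fractions. Then the algebra $\mathfrak{A}[R]$ is $*$-isomorphic to the partial crossed product $C(\hat R_K)\rtimes_\alpha (K\rtimes K^\times)$, where $\alpha$ is the partial action of $K\rtimes K^\times$ on $C(\hat R_K)$ induced by the partial action $\theta$ of $K\rtimes K^\times$ on $\hat R_K$ described in the context. The $*$-isomorphism is given by $u^n\longmapsto 1\,\delta_{(n,1)}$ for $n\in R$ and $s_m\longmapsto 1_{(0,m)}\,\delta_{(0,m)}$ for $m\in R^\times$, where $1_{(0,m)}$ is the characteristic function of $\hat R_{(0,m)}$.
   Context: An integral domain is a unital commutative ring without zero divisors. $R^\times=R\setminus\{0\}$, $K^\times=K\setminus\{0\}$. The algebra $\mathfrak{A}[R]$ is the universal $C^*$-algebra generated by isometries $\{s_m : m\in R^\times\}$ and unitaries $\{u^n : n\in R\}$ subject to: (CL1) $s_ms_{m'}=s_{mm'}$; (CL2) $u^nu^{n'}=u^{n+n'}$; (CL3) $s_mu^n=u^{mn}s_m$; (CL4) $\sum_{l+(m)\in R/(m)}u^ls_ms_m^*u^{-l}=1$, for all $m,m'\in R^\times$, $n,n'\in R$. (The summands in (CL4) do not depend on the choice of representative $l$.) The group $K\rtimes K^\times$ consists of pairs $(u,w)$, $u\in K$, $w\in K^\times$, with $(u,w)(u',w')=(u+u'w,ww')$, $(u,w)^{-1}=(-u/w,1/w)$ and identity $(0,1)$. The ring $\hat R_K$. For $w,w'\in K^\times$ write $w\le w'$ if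 $w'=wr$ for some $r\in R$, and let $(w)=wR\subseteq K$. If $w\le w'$ let $p_{w,w'}:(R+(w'))/(w')\to(R+(w))/(w)$ be the canonical projection. Then $$\hat R_K=\Big\{(u_w+(w))_w\in\prod_{w\in K^\times}(R+(w))/(w) : p_{w,w'}(u_{w'}+(w'))=u_w+(w)\text{ whenever } w\le w'\Big\},$$ with the topology induced by the product topology, each $(R+(w))/(w)$ being discrete; it is a compact Hausdorff space. The partial action $\theta$ of $K\rtimes K^\times$ on $\hat R_K$. For $(u,w)\in K\rtimes K^\times$, $\hat R_{(u,w)}=\{(u_{w'}+(w'))_{w'}\in\hat R_K : u_w+(w)=u+(w)\}$ (equality of cosets in $K$; a clopen set), and $\theta_{(u,w)}:\hat R_{(u,w)^{-1}}\to\hat R_{(u,w)}$ is the homeomorphism $\theta_{(u,w)}((u_{w'}+(w'))_{w'})=(u+wu_{w^{-1}w'}+(w'))_{w'}$. The induced partial action $\alpha$ on $C(\hat R_K)$ has ideals $\mathcal{D}_g=C_0(\hat R_g)$ and isomorphisms $\alpha_g:\mathcal{D}_{g^{-1}}\to\mathcal{D}_g$, $\alpha_g(f)=f\circ\theta_{g^{-1}}$. Partial crossed product. For a partial action $\alpha=(\mathcal{D}_g,\alpha_g)_{g\in G}$ of a discrete group $G$ on a $C^*$-algebra $\mathcal{A}$, let $\mathcal{L}$ be the normed $*$-algebra of finite formal sums $\sum_g a_g\delta_g$, $a_g\in\mathcal{D}_g$, with $(a_g\delta_g)(a_h\delta_h)=\alpha_g(\alpha_{g^{-1}}(a_g)a_h)\delta_{gh}$,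 $(a_g\delta_g)^*=\alpha_{g^{-1}}(a_g^* )\delta_{g^{-1}}$ and $\|\sum_g a_g\delta_g\|=\sum_g\|a_g\|$. The (full) partial crossed product $\mathcal{A}\rtimes_\alpha G$ is the full cross-sectional $C^*$-algebra of the Fell bundle $(\mathcal{D}_g\delta_g)_{g\in G}$, i.e. the enveloping $C^*$-algebra of $\mathcal{L}$. *)

theory Defs
  imports
    "HOL-Analysis.Analysis"
    "HOL-Algebra.Module"
    "HOL-Computational_Algebra.Polynomial_Factorial"
begin

section \<open>C*-algebras with explicit carriers\<close>

definition complex_ring :: "complex ring" where
  "complex_ring = \<lparr>carrier = UNIV, mult = (*), one = 1, zero = 0, add = (+)\<rparr>"

text \<open>The field \<open>one\<close> inherited from rings is meaningful for unital algebras only; the locale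
  \<open>star_algebra\<close> does not mention it.\<close>

record 'a star_alg = "(complex, 'a) module" +
  star :: "'a \<Rightarrow> 'a"

record 'a normed_star_alg = "'a star_alg" +
  nrm :: "'a \<Rightarrow> real"

locale star_algebra = module complex_ring A for A :: "('a, 'm) star_alg_scheme" (structure) +
  assumes mult_closed: "\<lbrakk>x \<in> carrier A; y \<in> carrier A\<rbrakk> \<Longrightarrow> x \<otimes> y \<in> carrier A"
    and mult_assoc: "\<lbrakk>x \<in> carrier A; y \<in> carrier A; z \<in> carrier A\<rbrakk> \<Longrightarrow>
      (x \<otimes> y) \<otimes> z = x \<otimes> (y \<otimes> z)"
    and distr_l: "\<lbrakk>x \<in> carrier A; y \<in> carrier A; z \<in> carrier A\<rbrakk> \<Longrightarrow>
      (x \<oplus> y) \<otimes> z = x \<otimes> z \<oplus> y \<otimes> z"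
    and distr_r: "\<lbrakk>x \<in> carrier A; y \<in> carrier A; z \<in> carrier A\<rbrakk> \<Longrightarrow>
      z \<otimes> (x \<oplus> y) = z \<otimes> x \<oplus> z \<otimes> y"
    and smult_mult_l: "\<lbrakk>x \<in> carrier A; y \<in> carrier A\<rbrakk> \<Longrightarrow>
      (c \<odot> x) \<otimes> y = c \<odot> (x \<otimes> y)"
    and smult_mult_r: "\<lbrakk>x \<in> carrier A; y \<in> carrier A\<rbrakk> \<Longrightarrow>
      x \<otimes> (c \<odot> y) = c \<odot> (x \<otimes> y)"
    and star_closed: "x \<in> carrier A \<Longrightarrow> star A x \<in> carrier A"
    and star_star: "x \<in> carrier A \<Longrightarrow> star A (star A x) = x"
    and star_add: "\<lbrakk>x \<in> carrier A; y \<in> carrier A\<rbrakk> \<Longrightarrow>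
      star A (x \<oplus> y) = star A x \<oplus> star A y"
    and star_smult: "x \<in> carrier A \<Longrightarrow> star A (c \<odot> x) = cnj c \<odot> star A x"
    and star_mult: "\<lbrakk>x \<in> carrier A; y \<in> carrier A\<rbrakk> \<Longrightarrow>
      star A (x \<otimes> y) = star A y \<otimes> star A x"

definition unital :: "('a, 'm) star_alg_scheme \<Rightarrow> bool" where
  "unital A \<longleftrightarrow> \<one>\<^bsub>A\<^esub> \<in> carrier A \<and>
     (\<forall>x\<in>carrier A. \<one>\<^bsub>A\<^esub> \<otimes>\<^bsub>A\<^esub> x = x \<and> x \<otimes>\<^bsub>A\<^esub> \<one>\<^bsub>A\<^esub> = x)"

definition cstar_seminorm :: "('a, 'm) star_alg_scheme \<Rightarrow> ('a \<Rightarrow> real) \<Rightarrow> bool" where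
  "cstar_seminorm A p \<longleftrightarrow>
     (\<forall>x\<in>carrier A. 0 \<le> p x) \<and>
     (\<forall>x\<in>carrier A. \<forall>y\<in>carrier A. p (x \<oplus>\<^bsub>A\<^esub> y) \<le> p x + p y) \<and>
     (\<forall>c. \<forall>x\<in>carrier A. p (c \<odot>\<^bsub>A\<^esub> x) = cmod c * p x) \<and>
     (\<forall>x\<in>carrier A. \<forall>y\<in>carrier A. p (x \<otimes>\<^bsub>A\<^esub> y) \<le> p x * p y) \<and>
     (\<forall>x\<in>carrier A. p (star A x \<otimes>\<^bsub>A\<^esub> x) = (p x)\<^sup>2)"

definition cauchy_seqs :: "('a, 'm) star_alg_scheme \<Rightarrow> ('a \<Rightarrow> real) \<Rightarrow> (nat \<Rightarrow> 'a) set" where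
  "cauchy_seqs A N = {X. (\<forall>n. X n \<in> carrier A) \<and>
     (\<forall>e>0. \<exists>k. \<forall>m\<ge>k. \<forall>n\<ge>k. N (X m \<ominus>\<^bsub>A\<^esub> X n) < e)}"

locale cstar_algebra = star_algebra A for A :: "('a, 'm) normed_star_alg_scheme" (structure) +
  assumes cstar_norm: "cstar_seminorm A (nrm A)"
    and norm_zeroD: "\<lbrakk>x \<in> carrier A; nrm A x = 0\<rbrakk> \<Longrightarrow> x = \<zero>"
    and complete: "X \<in> cauchy_seqs A (nrm A) \<Longrightarrow>
      \<exists>x\<in>carrier A. (\<lambda>n. nrm A (X n \<ominus> x)) \<longlonglongrightarrow> 0"

definition star_hom :: "('a, 'm) star_alg_scheme \<Rightarrow> ('b, 'n) star_alg_scheme \<Rightarrow> ('a \<Rightarrow> 'b) \<Rightarrow> bool" where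
  "star_hom A B f \<longleftrightarrow> f \<in> carrier A \<rightarrow> carrier B \<and>
     (\<forall>x\<in>carrier A. \<forall>y\<in>carrier A. f (x \<oplus>\<^bsub>A\<^esub> y) = f x \<oplus>\<^bsub>B\<^esub> f y) \<and>
     (\<forall>c. \<forall>x\<in>carrier A. f (c \<odot>\<^bsub>A\<^esub> x) = c \<odot>\<^bsub>B\<^esub> f x) \<and>
     (\<forall>x\<in>carrier A. \<forall>y\<in>carrier A. f (x \<otimes>\<^bsub>A\<^esub> y) = f x \<otimes>\<^bsub>B\<^esub> f y) \<and>
     (\<forall>x\<in>carrier A. f (star A x) = star B (f x))"

definition star_iso :: "('a, 'm) star_alg_scheme \<Rightarrow> ('b, 'n) star_alg_scheme \<Rightarrow> ('a \<Rightarrow> 'b) \<Rightarrow> bool" where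
  "star_iso A B f \<longleftrightarrow> star_hom A B f \<and> bij_betw f (carrier A) (carrier B)"


section \<open>Completions, enveloping and universal C*-algebras\<close>

text \<open>The Hausdorff completion of a *-algebra with respect to a seminorm \<open>N\<close>: Cauchy sequences
  modulo sequences tending to zero.\<close>

definition cauchy_class :: "('a, 'm) star_alg_scheme \<Rightarrow> ('a \<Rightarrow> real) \<Rightarrow> (nat \<Rightarrow> 'a) \<Rightarrow> (nat \<Rightarrow> 'a) set" where
  "cauchy_class A N X = {Y \<in> cauchy_seqs A N. (\<lambda>n. N (Y n \<ominus>\<^bsub>A\<^esub> X n)) \<longlonglongrightarrow> 0}"

definition completion :: "('a, 'm) star_alg_scheme \<Rightarrow> ('a \<Rightarrow> real) \<Rightarrow> (nat \<Rightarrow> 'a) set normed_star_alg" where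
  "completion A N =
    \<lparr>carrier = cauchy_class A N ` cauchy_seqs A N,
     mult = (\<lambda>x y. \<Union>X\<in>x. \<Union>Y\<in>y. cauchy_class A N (\<lambda>n. X n \<otimes>\<^bsub>A\<^esub> Y n)),
     one = cauchy_class A N (\<lambda>n. \<one>\<^bsub>A\<^esub>),
     zero = cauchy_class A N (\<lambda>n. \<zero>\<^bsub>A\<^esub>),
     add = (\<lambda>x y. \<Union>X\<in>x. \<Union>Y\<in>y. cauchy_class A N (\<lambda>n. X n \<oplus>\<^bsub>A\<^esub> Y n)),
     smult = (\<lambda>c x. \<Union>X\<in>x. cauchy_class A N (\<lambda>n. c \<odot>\<^bsub>A\<^esub> X n)),
     star = (\<lambda>x. \<Union>X\<in>x. cauchy_class A N (\<lambda>n. star A (X n))),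
     nrm = (\<lambda>x. THE r. \<forall>X\<in>x. (\<lambda>n. N (X n)) \<longlonglongrightarrow> r)\<rparr>"

definition to_completion :: "('a, 'm) star_alg_scheme \<Rightarrow> ('a \<Rightarrow> real) \<Rightarrow> 'a \<Rightarrow> (nat \<Rightarrow> 'a) set" where
  "to_completion A N a = cauchy_class A N (\<lambda>n. a)"

definition sup_seminorm :: "('a \<Rightarrow> real) set \<Rightarrow> 'a \<Rightarrow> real" where
  "sup_seminorm P x = (SUP p\<in>P. p x)"

text \<open>The C*-seminorms of a *-algebra are exactly the functions \<open>x \<mapsto> \<parallel>\<pi> x\<parallel>\<close> for
  *-homomorphisms \<open>\<pi>\<close> into C*-algebras, so the suprema below are the usual ones over
  representations. For a normed *-algebra the representations are required to be contractive.
  The universal properties are proved below (\<open>universal_property\<close>, \<open>cl_algebra_universal\<close>,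
  \<open>completion_extend\<close>).\<close>

definition enveloping_norm :: "('a, 'm) normed_star_alg_scheme \<Rightarrow> 'a \<Rightarrow> real" where
  "enveloping_norm L = sup_seminorm {p. cstar_seminorm L p \<and> (\<forall>x\<in>carrier L. p x \<le> nrm L x)}"

definition enveloping_cstar :: "('a, 'm) normed_star_alg_scheme \<Rightarrow> (nat \<Rightarrow> 'a) set normed_star_alg" where
  "enveloping_cstar L = completion L (enveloping_norm L)"

text \<open>The free unital complex *-algebra on a set \<open>X\<close>: finitely supported functions on the words
  in letters \<open>(x, False)\<close>, standing for \<open>x\<close>, and \<open>(x, True)\<close>, standing for \<open>x\<^sup>*\<close>.\<close>

definition free_star_alg :: "'x set \<Rightarrow> (('x \<times> bool) list \<Rightarrow> complex) star_alg" where
  "free_star_alg X =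
    \<lparr>carrier = {f. finite {w. f w \<noteq> 0} \<and> {w. f w \<noteq> 0} \<subseteq> lists (X \<times> UNIV)},
     mult = (\<lambda>f g w. \<Sum>i\<le>length w. f (take i w) * g (drop i w)),
     one = (\<lambda>w. if w = [] then 1 else 0),
     zero = (\<lambda>w. 0),
     add = (\<lambda>f g w. f w + g w),
     smult = (\<lambda>c f w. c * f w),
     star = (\<lambda>f w. cnj (f (rev (map (\<lambda>(x, b). (x, \<not> b)) w))))\<rparr>"

definition free_gen :: "'x \<Rightarrow> ('x \<times> bool) list \<Rightarrow> complex" where
  "free_gen x = (\<lambda>w. if w = [(x, False)] then 1 else 0)"

text \<open>A pair \<open>(a, b)\<close> of elements of the free algebra encodes the relation \<open>a = b\<close>.\<close>

definition relation_seminorms :: "'x set \<Rightarrow> ((('x \<times> bool) list \<Rightarrow> complex) \<times> (('x \<times> bool) list \<Rightarrow> complex)) set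
    \<Rightarrow> ((('x \<times> bool) list \<Rightarrow> complex) \<Rightarrow> real) set" where
  "relation_seminorms X rels = {p. cstar_seminorm (free_star_alg X) p \<and>
     (\<forall>(a, b)\<in>rels. p (a \<ominus>\<^bsub>free_star_alg X\<^esub> b) = 0)}"

definition universal_norm :: "'x set \<Rightarrow> ((('x \<times> bool) list \<Rightarrow> complex) \<times> (('x \<times> bool) list \<Rightarrow> complex)) set
    \<Rightarrow> (('x \<times> bool) list \<Rightarrow> complex) \<Rightarrow> real" where
  "universal_norm X rels = sup_seminorm (relation_seminorms X rels)"

definition universal_cstar :: "'x set \<Rightarrow> ((('x \<times> bool) list \<Rightarrow> complex) \<times> (('x \<times> bool) list \<Rightarrow> complex)) set
    \<Rightarrow> (nat \<Rightarrow> ('x \<times> bool) list \<Rightarrow> complex) set normed_star_alg" where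
  "universal_cstar X rels = completion (free_star_alg X) (universal_norm X rels)"

definition universal_gen :: "'x set \<Rightarrow> ((('x \<times> bool) list \<Rightarrow> complex) \<times> (('x \<times> bool) list \<Rightarrow> complex)) set
    \<Rightarrow> 'x \<Rightarrow> (nat \<Rightarrow> ('x \<times> bool) list \<Rightarrow> complex) set" where
  "universal_gen X rels x = to_completion (free_star_alg X) (universal_norm X rels) (free_gen x)"


section \<open>The algebra \<open>\<AA>[R]\<close>\<close>

datatype 'r cl_gen = GenS 'r | GenU 'r

definition cl_gens :: "'r::idom cl_gen set" where
  "cl_gens = {GenS m |m. m \<noteq> 0} \<union> range GenU"

definition residue_classes :: "'r::idom \<Rightarrow> 'r set set" where
  "residue_classes m = range (\<lambda>l. (+) l ` range ((*) m))"

text \<open>The relations, for elements \<open>s m\<close>, \<open>m \<noteq> 0\<close>, and \<open>u n\<close> of a unital *-algebra \<open>A\<close>. In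
  \<open>CL4\<close> the function \<open>l\<close> picks a representative of every coset.\<close>

inductive_set cl_relations :: "('a, 'm) star_alg_scheme \<Rightarrow> ('r::idom \<Rightarrow> 'a) \<Rightarrow> ('r \<Rightarrow> 'a) \<Rightarrow> ('a \<times> 'a) set"
  for A (structure) and s u where
  isometry: "m \<noteq> 0 \<Longrightarrow> (star A (s m) \<otimes> s m, \<one>) \<in> cl_relations A s u"
| unitary1: "(star A (u n) \<otimes> u n, \<one>) \<in> cl_relations A s u"
| unitary2: "(u n \<otimes> star A (u n), \<one>) \<in> cl_relations A s u"
| CL1: "\<lbrakk>m \<noteq> 0; m' \<noteq> 0\<rbrakk> \<Longrightarrow> (s m \<otimes> s m', s (m * m')) \<in> cl_relations A s u"
| CL2: "(u n \<otimes> u n', u (n + n')) \<in> cl_relations A s u"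
| CL3: "m \<noteq> 0 \<Longrightarrow> (s m \<otimes> u n, u (m * n) \<otimes> s m) \<in> cl_relations A s u"
| CL4: "\<lbrakk>m \<noteq> 0; \<forall>C\<in>residue_classes m. l C \<in> C\<rbrakk> \<Longrightarrow>
    (\<Oplus>C\<in>residue_classes m. u (l C) \<otimes> s m \<otimes> star A (s m) \<otimes> u (- l C), \<one>) \<in> cl_relations A s u"

definition cl_rels :: "((('r::idom cl_gen \<times> bool) list \<Rightarrow> complex) \<times> (('r cl_gen \<times> bool) list \<Rightarrow> complex)) set" where
  "cl_rels = cl_relations (free_star_alg cl_gens) (\<lambda>m. free_gen (GenS m)) (\<lambda>n. free_gen (GenU n))"

definition cl_algebra :: "(nat \<Rightarrow> ('r::idom cl_gen \<times> bool) list \<Rightarrow> complex) set normed_star_alg" where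
  "cl_algebra = universal_cstar cl_gens cl_rels"

definition cl_s :: "'r::idom \<Rightarrow> (nat \<Rightarrow> ('r cl_gen \<times> bool) list \<Rightarrow> complex) set" where
  "cl_s m = universal_gen cl_gens cl_rels (GenS m)"

definition cl_u :: "'r::idom \<Rightarrow> (nat \<Rightarrow> ('r cl_gen \<times> bool) list \<Rightarrow> complex) set" where
  "cl_u n = universal_gen cl_gens cl_rels (GenU n)"


section \<open>Partial actions and partial crossed products\<close>

definition closed_ideal :: "('a, 'm) normed_star_alg_scheme \<Rightarrow> 'a set \<Rightarrow> bool" where
  "closed_ideal A I \<longleftrightarrow> I \<subseteq> carrier A \<and> \<zero>\<^bsub>A\<^esub> \<in> I \<and>
     (\<forall>x\<in>I. \<forall>y\<in>I. x \<oplus>\<^bsub>A\<^esub> y \<in> I) \<and>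
     (\<forall>c. \<forall>x\<in>I. c \<odot>\<^bsub>A\<^esub> x \<in> I) \<and>
     (\<forall>a\<in>carrier A. \<forall>x\<in>I. a \<otimes>\<^bsub>A\<^esub> x \<in> I \<and> x \<otimes>\<^bsub>A\<^esub> a \<in> I) \<and>
     (\<forall>X. \<forall>x\<in>carrier A. (\<forall>n. X n \<in> I) \<longrightarrow> (\<lambda>n. nrm A (X n \<ominus>\<^bsub>A\<^esub> x)) \<longlonglongrightarrow> 0 \<longrightarrow> x \<in> I)"

locale partial_action = group G + cstar_algebra A
  for G :: "('g, 'k) monoid_scheme" and A :: "('a, 'm) normed_star_alg_scheme" +
  fixes D :: "'g \<Rightarrow> 'a set" and \<alpha> :: "'g \<Rightarrow> 'a \<Rightarrow> 'a"
  assumes ideal: "g \<in> carrier G \<Longrightarrow> closed_ideal A (D g)"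
    and iso: "g \<in> carrier G \<Longrightarrow>
      star_iso (A\<lparr>carrier := D (inv\<^bsub>G\<^esub> g)\<rparr>) (A\<lparr>carrier := D g\<rparr>) (\<alpha> g)"
    and domain_one: "D \<one>\<^bsub>G\<^esub> = carrier A"
    and action_one: "a \<in> carrier A \<Longrightarrow> \<alpha> \<one>\<^bsub>G\<^esub> a = a"
    and action_domain: "\<lbrakk>g \<in> carrier G; h \<in> carrier G\<rbrakk> \<Longrightarrow>
      \<alpha> g ` (D (inv\<^bsub>G\<^esub> g) \<inter> D h) = D g \<inter> D (g \<otimes>\<^bsub>G\<^esub> h)"
    and action_mult: "\<lbrakk>g \<in> carrier G; h \<in> carrier G;
        a \<in> D (inv\<^bsub>G\<^esub> h) \<inter> D (inv\<^bsub>G\<^esub> (g \<otimes>\<^bsub>G\<^esub> h))\<rbrakk> \<Longrightarrow>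
      \<alpha> g (\<alpha> h a) = \<alpha> (g \<otimes>\<^bsub>G\<^esub> h) a"

text \<open>The normed *-algebra of finite formal sums \<open>\<Sum>g. a g \<delta>\<^sub>g\<close>, represented by their
  coefficient functions. Product and adjoint are determined by
  \<open>(a \<delta>\<^sub>g) (b \<delta>\<^sub>h) = \<alpha>\<^sub>g (\<alpha>\<^bsub>inv g\<^esub> a \<cdot> b) \<delta>\<^bsub>g h\<^esub>\<close> and
  \<open>(a \<delta>\<^sub>g)\<^sup>* = \<alpha>\<^bsub>inv g\<^esub> (a\<^sup>*) \<delta>\<^bsub>inv g\<^esub>\<close>.\<close>

definition cp_single :: "('a, 'm) star_alg_scheme \<Rightarrow> 'a \<Rightarrow> 'g \<Rightarrow> 'g \<Rightarrow> 'a" where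
  "cp_single A a g = (\<lambda>h. if h = g then a else \<zero>\<^bsub>A\<^esub>)"

definition cp_support :: "('a, 'm) star_alg_scheme \<Rightarrow> ('g \<Rightarrow> 'a) \<Rightarrow> 'g set" where
  "cp_support A a = {g. a g \<noteq> \<zero>\<^bsub>A\<^esub>}"

definition cp_sums :: "('g, 'k) monoid_scheme \<Rightarrow> ('a, 'm) normed_star_alg_scheme \<Rightarrow>
    ('g \<Rightarrow> 'a set) \<Rightarrow> ('g \<Rightarrow> 'a \<Rightarrow> 'a) \<Rightarrow> ('g \<Rightarrow> 'a) normed_star_alg" where
  "cp_sums G A D \<alpha> =
    \<lparr>carrier = {a. finite (cp_support A a) \<and> cp_support A a \<subseteq> carrier G \<and> (\<forall>g\<in>carrier G. a g \<in> D g)},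
     mult = (\<lambda>a b k. finsum A (\<lambda>(g, h). \<alpha> g (\<alpha> (inv\<^bsub>G\<^esub> g) (a g) \<otimes>\<^bsub>A\<^esub> b h))
        {(g, h). g \<in> cp_support A a \<and> h \<in> cp_support A b \<and> g \<otimes>\<^bsub>G\<^esub> h = k}),
     one = cp_single A \<one>\<^bsub>A\<^esub> \<one>\<^bsub>G\<^esub>,
     zero = (\<lambda>g. \<zero>\<^bsub>A\<^esub>),
     add = (\<lambda>a b g. a g \<oplus>\<^bsub>A\<^esub> b g),
     smult = (\<lambda>c a g. c \<odot>\<^bsub>A\<^esub> a g),
     star = (\<lambda>a g. if g \<in> carrier G then \<alpha> g (star A (a (inv\<^bsub>G\<^esub> g))) else \<zero>\<^bsub>A\<^esub>),
     nrm = (\<lambda>a. \<Sum>g\<in>cp_support A a. nrm A (a g))\<rparr>"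

definition partial_crossed_product :: "('g, 'k) monoid_scheme \<Rightarrow> ('a, 'm) normed_star_alg_scheme \<Rightarrow>
    ('g \<Rightarrow> 'a set) \<Rightarrow> ('g \<Rightarrow> 'a \<Rightarrow> 'a) \<Rightarrow> (nat \<Rightarrow> 'g \<Rightarrow> 'a) set normed_star_alg" where
  "partial_crossed_product G A D \<alpha> = enveloping_cstar (cp_sums G A D \<alpha>)"

text \<open>The image of \<open>a \<delta>\<^sub>g\<close> in the partial crossed product.\<close>

definition cp_delta :: "('g, 'k) monoid_scheme \<Rightarrow> ('a, 'm) normed_star_alg_scheme \<Rightarrow>
    ('g \<Rightarrow> 'a set) \<Rightarrow> ('g \<Rightarrow> 'a \<Rightarrow> 'a) \<Rightarrow> 'a \<Rightarrow> 'g \<Rightarrow> (nat \<Rightarrow> 'g \<Rightarrow> 'a) set" where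
  "cp_delta G A D \<alpha> a g =
     to_completion (cp_sums G A D \<alpha>) (enveloping_norm (cp_sums G A D \<alpha>)) (cp_single A a g)"


section \<open>Continuous functions on a compact space\<close>

text \<open>The C*-algebra \<open>C(X)\<close> of a compact space; functions are extended by zero outside
  \<open>topspace X\<close>.\<close>

definition cont_alg :: "'x topology \<Rightarrow> ('x \<Rightarrow> complex) normed_star_alg" where
  "cont_alg X =
    \<lparr>carrier = {f. continuous_map X euclidean f \<and> (\<forall>x. x \<notin> topspace X \<longrightarrow> f x = 0)},
     mult = (\<lambda>f g x. f x * g x),
     one = (\<lambda>x. if x \<in> topspace X then 1 else 0),
     zero = (\<lambda>x. 0),
     add = (\<lambda>f g x. f x + g x),
     smult = (\<lambda>c f x. c * f x),
     star = (\<lambda>f x. cnj (f x)),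
     nrm = (\<lambda>f. Sup (insert 0 ((\<lambda>x. cmod (f x)) ` topspace X)))\<rparr>"

text \<open>For open \<open>V\<close> this is \<open>C\<^sub>0(V)\<close>, regarded as an ideal of \<open>C(X)\<close>.\<close>

definition cont_ideal :: "'x topology \<Rightarrow> 'x set \<Rightarrow> ('x \<Rightarrow> complex) set" where
  "cont_ideal X V = {f \<in> carrier (cont_alg X). \<forall>x. x \<notin> V \<longrightarrow> f x = 0}"

text \<open>The action \<open>f \<mapsto> f \<circ> \<theta>\<^bsub>inv g\<^esub>\<close> induced by a partial action \<open>\<theta>\<^sub>g : dom (inv g) \<rightarrow> dom g\<close> on a
  space; the result is extended by zero outside \<open>dom g\<close>.\<close>

definition induced_action :: "('g, 'k) monoid_scheme \<Rightarrow> ('g \<Rightarrow> 'x set) \<Rightarrow> ('g \<Rightarrow> 'x \<Rightarrow> 'x) \<Rightarrow>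
    'g \<Rightarrow> ('x \<Rightarrow> complex) \<Rightarrow> 'x \<Rightarrow> complex" where
  "induced_action G V \<theta> g f = (\<lambda>x. if x \<in> V g then f (\<theta> (inv\<^bsub>G\<^esub> g) x) else 0)"


section \<open>The ring \<open>R\<^sub>K\<close> and the partial action of \<open>K \<rtimes> K\<^sup>\<times>\<close>\<close>

definition affine_group :: "('k::field \<times> 'k) monoid" where
  "affine_group = \<lparr>carrier = {(u, w). w \<noteq> 0},
     mult = (\<lambda>(u, w) (u', w'). (u + u' * w, w * w')),
     one = (0, 1)\<rparr>"

definition frac_le :: "'r::idom fract \<Rightarrow> 'r fract \<Rightarrow> bool" where
  "frac_le w w' \<longleftrightarrow> (\<exists>r. w' = w * to_fract r)"

definition frac_ideal :: "'r::idom fract \<Rightarrow> 'r fract set" where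
  "frac_ideal w = range (\<lambda>r. w * to_fract r)"

definition frac_coset :: "'r::idom fract \<Rightarrow> 'r fract \<Rightarrow> 'r fract set" where
  "frac_coset u w = (+) u ` frac_ideal w"

text \<open>The quotient \<open>(R + (w))/(w)\<close>.\<close>

definition frac_quot :: "'r::idom fract \<Rightarrow> 'r fract set set" where
  "frac_quot w = {frac_coset (to_fract r + v) w |r v. v \<in> frac_ideal w}"

text \<open>The projection \<open>p\<^bsub>w,w'\<^esub>\<close> sends a coset of \<open>(w') \<subseteq> (w)\<close> to the coset of \<open>(w)\<close> containing it.\<close>

definition frac_proj :: "'r::idom fract \<Rightarrow> 'r fract set \<Rightarrow> 'r fract set" where
  "frac_proj w C = (\<Union>u\<in>C. frac_coset u w)"

definition hat_set :: "('r::idom fract \<Rightarrow> 'r fract set) set" where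
  "hat_set = {x \<in> (\<Pi>\<^sub>E w\<in>UNIV - {0}. frac_quot w).
     \<forall>w w'. w \<noteq> 0 \<longrightarrow> w' \<noteq> 0 \<longrightarrow> frac_le w w' \<longrightarrow> frac_proj w (x w') = x w}"

definition hat_top :: "('r::idom fract \<Rightarrow> 'r fract set) topology" where
  "hat_top = subtopology (product_topology (\<lambda>w. discrete_topology (frac_quot w)) (UNIV - {0})) hat_set"

definition hat_dom :: "'r::idom fract \<times> 'r fract \<Rightarrow> ('r fract \<Rightarrow> 'r fract set) set" where
  "hat_dom = (\<lambda>(u, w). {x \<in> hat_set. x w = frac_coset u w})"

definition hat_theta :: "'r::idom fract \<times> 'r fract \<Rightarrow> ('r fract \<Rightarrow> 'r fract set) \<Rightarrow> ('r fract \<Rightarrow> 'r fract set)" where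
  "hat_theta = (\<lambda>(u, w) x. \<lambda>w'\<in>UNIV - {0}. (\<lambda>k. u + w * k) ` x (inverse w * w'))"

definition hat_ideal :: "'r::idom fract \<times> 'r fract \<Rightarrow> (('r fract \<Rightarrow> 'r fract set) \<Rightarrow> complex) set" where
  "hat_ideal g = cont_ideal hat_top (hat_dom g)"

definition hat_action :: "'r::idom fract \<times> 'r fract \<Rightarrow> (('r fract \<Rightarrow> 'r fract set) \<Rightarrow> complex) \<Rightarrow>
    ('r fract \<Rightarrow> 'r fract set) \<Rightarrow> complex" where
  "hat_action = induced_action affine_group hat_dom hat_theta"


section \<open>Completions of *-algebras are C*-algebras\<close>

lemma complex_ring_simps [simp]:
  "carrier complex_ring = UNIV" "mult complex_ring = (*)" "one complex_ring = 1"
  "zero complex_ring = 0" "add complex_ring = (+)"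
  by (simp_all add: complex_ring_def)

lemma complex_ring_cring: "cring complex_ring"
proof (rule cringI)
  show "abelian_group complex_ring"
  proof (rule abelian_groupI)
    fix x assume "x \<in> carrier complex_ring"
    show "\<exists>y\<in>carrier complex_ring. y \<oplus>\<^bsub>complex_ring\<^esub> x = \<zero>\<^bsub>complex_ring\<^esub>"
      by (intro bexI[of _ "- x"]) auto
  qed (auto simp: algebra_simps)
  show "Group.comm_monoid complex_ring"
    by (rule comm_monoidI) (auto simp: algebra_simps)
qed (auto simp: algebra_simps)

lemma complex_ring_a_inv [simp]: "\<ominus>\<^bsub>complex_ring\<^esub> (c::complex) = - c"
proof -
  interpret cring complex_ring by (rule complex_ring_cring)
  show ?thesis by (rule minus_equality) auto
qed

lemma star_algebraI:
  fixes A (structure)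
  assumes add: "\<And>x y. \<lbrakk>x \<in> carrier A; y \<in> carrier A\<rbrakk> \<Longrightarrow> x \<oplus> y \<in> carrier A"
    and zero: "\<zero> \<in> carrier A"
    and assoc: "\<And>x y z. \<lbrakk>x \<in> carrier A; y \<in> carrier A; z \<in> carrier A\<rbrakk> \<Longrightarrow> (x \<oplus> y) \<oplus> z = x \<oplus> (y \<oplus> z)"
    and comm: "\<And>x y. \<lbrakk>x \<in> carrier A; y \<in> carrier A\<rbrakk> \<Longrightarrow> x \<oplus> y = y \<oplus> x"
    and l_zero: "\<And>x. x \<in> carrier A \<Longrightarrow> \<zero> \<oplus> x = x"
    and smult: "\<And>c x. x \<in> carrier A \<Longrightarrow> c \<odot> x \<in> carrier A"
    and l_neg: "\<And>x. x \<in> carrier A \<Longrightarrow> (- 1 :: complex) \<odot> x \<oplus> x = \<zero>"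
    and "\<And>c d x. x \<in> carrier A \<Longrightarrow> (c + d) \<odot> x = c \<odot> x \<oplus> d \<odot> x"
    and "\<And>c x y. \<lbrakk>x \<in> carrier A; y \<in> carrier A\<rbrakk> \<Longrightarrow> c \<odot> (x \<oplus> y) = c \<odot> x \<oplus> c \<odot> y"
    and "\<And>c d x. x \<in> carrier A \<Longrightarrow> (c * d) \<odot> x = c \<odot> (d \<odot> x)"
    and "\<And>x. x \<in> carrier A \<Longrightarrow> 1 \<odot> x = x"
    and "star_algebra_axioms A"
  shows "star_algebra A"
proof -
  have "abelian_group A"
  proof (rule abelian_groupI)
    fix x assume "x \<in> carrier A"
    then show "\<exists>y\<in>carrier A. y \<oplus> x = \<zero>" using l_neg smult by blast
  qed (use assms in auto)
  then have "module complex_ring A"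
    by (intro moduleI complex_ring_cring) (use assms in auto)
  then show ?thesis using assms(12) by (rule star_algebra.intro)
qed

lemma cstar_seminormD:
  assumes "cstar_seminorm A p"
  shows "x \<in> carrier A \<Longrightarrow> 0 \<le> p x"
    and "\<lbrakk>x \<in> carrier A; y \<in> carrier A\<rbrakk> \<Longrightarrow> p (x \<oplus>\<^bsub>A\<^esub> y) \<le> p x + p y"
    and "x \<in> carrier A \<Longrightarrow> p (c \<odot>\<^bsub>A\<^esub> x) = cmod c * p x"
    and "\<lbrakk>x \<in> carrier A; y \<in> carrier A\<rbrakk> \<Longrightarrow> p (x \<otimes>\<^bsub>A\<^esub> y) \<le> p x * p y"
    and "x \<in> carrier A \<Longrightarrow> p (star A x \<otimes>\<^bsub>A\<^esub> x) = (p x)\<^sup>2"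
  using assms by (auto simp: cstar_seminorm_def)

context star_algebra
begin

lemmas smult_one_complex [simp] = smult_one[simplified]

lemma minus_eq_smult: "\<lbrakk>x \<in> carrier A; y \<in> carrier A\<rbrakk> \<Longrightarrow> x \<ominus> y = x \<oplus> (-1) \<odot> y"
  using smult_l_minus[of 1 y] smult_one by (simp add: a_minus_def)

lemma star_minus: "\<lbrakk>x \<in> carrier A; y \<in> carrier A\<rbrakk> \<Longrightarrow> star A (x \<ominus> y) = star A x \<ominus> star A y"
  by (simp add: minus_eq_smult star_add star_smult star_closed)

lemma smult_minus: "\<lbrakk>x \<in> carrier A; y \<in> carrier A\<rbrakk> \<Longrightarrow> c \<odot> (x \<ominus> y) = c \<odot> x \<ominus> c \<odot> y"
  by (simp add: minus_eq_smult smult_r_distr smult_assoc1[symmetric] mult.commute)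

lemma add_minus_add: "\<lbrakk>x \<in> carrier A; y \<in> carrier A; x' \<in> carrier A; y' \<in> carrier A\<rbrakk> \<Longrightarrow>
   (x \<oplus> y) \<ominus> (x' \<oplus> y') = (x \<ominus> x') \<oplus> (y \<ominus> y')"
  by (simp add: minus_eq_smult smult_r_distr) (simp add: M.add.m_ac)

lemma minus_chain: "\<lbrakk>x \<in> carrier A; y \<in> carrier A; z \<in> carrier A\<rbrakk> \<Longrightarrow>
   (x \<ominus> y) \<oplus> (y \<ominus> z) = x \<ominus> z"
  unfolding a_minus_def by (simp add: M.a_assoc M.r_neg1)

lemma mult_minus_mult: "\<lbrakk>x \<in> carrier A; y \<in> carrier A; x' \<in> carrier A; y' \<in> carrier A\<rbrakk> \<Longrightarrow>
   (x \<otimes> y) \<ominus> (x' \<otimes> y') = (x \<ominus> x') \<otimes> y \<oplus> x' \<otimes> (y \<ominus> y')"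
  using minus_chain[of "x \<otimes> y" "x' \<otimes> y" "x' \<otimes> y'"]
  by (simp add: minus_eq_smult distr_l distr_r smult_mult_l smult_mult_r mult_closed)

lemma seminorm_zero: "cstar_seminorm A p \<Longrightarrow> p \<zero> = 0"
  using cstar_seminormD(3)[of A p \<zero> 0] by simp

lemma seminorm_minus_commute:
  assumes "cstar_seminorm A p" "x \<in> carrier A" "y \<in> carrier A"
  shows "p (x \<ominus> y) = p (y \<ominus> x)"
proof -
  have "y \<ominus> x = (-1) \<odot> (x \<ominus> y)"
    using assms by (simp add: minus_eq_smult smult_r_distr smult_assoc1[symmetric] M.a_comm)
  then show ?thesis using assms cstar_seminormD(3)[OF assms(1), of "x \<ominus> y" "-1"] by simp
qed

lemma seminorm_triangle:
  assumes "cstar_seminorm A p" "x \<in> carrier A" "y \<in> carrier A" "z \<in> carrier A"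
  shows "p (x \<ominus> z) \<le> p (x \<ominus> y) + p (y \<ominus> z)"
  using cstar_seminormD(2)[OF assms(1), of "x \<ominus> y" "y \<ominus> z"] assms minus_chain by simp

lemma seminorm_diff_le:
  assumes "cstar_seminorm A p" "x \<in> carrier A" "y \<in> carrier A"
  shows "\<bar>p x - p y\<bar> \<le> p (x \<ominus> y)"
proof -
  have *: "p x \<le> p (x \<ominus> y) + p y" if "x \<in> carrier A" "y \<in> carrier A" for x y
  proof -
    have "x = (x \<ominus> y) \<oplus> y" using that by (simp add: a_minus_def M.a_assoc M.l_neg)
    then show ?thesis using cstar_seminormD(2)[OF assms(1), of "x \<ominus> y" y] that by simp
  qed
  show ?thesis using *[of x y] *[of y x] assms seminorm_minus_commute[OF assms] by linarith
qed

lemma seminorm_self: "cstar_seminorm A p \<Longrightarrow> x \<in> carrier A \<Longrightarrow> p (x \<ominus> x) = 0"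
  by (simp add: a_minus_def M.r_neg seminorm_zero)

lemma seminorm_star:
  assumes p: "cstar_seminorm A p" and x: "x \<in> carrier A"
  shows "p (star A x) = p x"
proof -
  have le: "p y \<le> p (star A y)" if y: "y \<in> carrier A" for y
  proof (cases "p y = 0")
    case True then show ?thesis using cstar_seminormD(1)[OF p star_closed[OF y]] by simp
  next
    case False
    have "p y * p y \<le> p (star A y) * p y"
      using cstar_seminormD(4)[OF p star_closed[OF y] y] cstar_seminormD(5)[OF p y]
      by (simp add: power2_eq_square)
    then show ?thesis using False cstar_seminormD(1)[OF p y] by simp
  qed
  show ?thesis using le[OF x] le[OF star_closed[OF x]] x by (simp add: star_star)
qed

lemma sup_seminorm_cstar:
  assumes ne: "P \<noteq> {}" and P: "\<And>p. p \<in> P \<Longrightarrow> cstar_seminorm A p"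
    and bdd: "\<And>x. x \<in> carrier A \<Longrightarrow> \<exists>B. \<forall>p\<in>P. p x \<le> B"
  shows "cstar_seminorm A (sup_seminorm P)"
proof -
  have bd: "bdd_above ((\<lambda>p. p x) ` P)" if "x \<in> carrier A" for x
    using bdd[OF that] by (auto simp: bdd_above_def)
  have up: "p x \<le> sup_seminorm P x" if "x \<in> carrier A" "p \<in> P" for p x
    unfolding sup_seminorm_def using that bd by (intro cSUP_upper) auto
  have least: "sup_seminorm P x \<le> B" if "\<And>p. p \<in> P \<Longrightarrow> p x \<le> B" for x B
    unfolding sup_seminorm_def using that ne by (intro cSUP_least) auto
  obtain q where q: "q \<in> P" using ne by auto
  have nn: "0 \<le> sup_seminorm P x" if "x \<in> carrier A" for x
    using up[OF that q] cstar_seminormD(1)[OF P[OF q] that] by linarith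
  have hom: "sup_seminorm P (c \<odot> x) \<le> cmod c * sup_seminorm P x" if "x \<in> carrier A" for c x
    using that up[OF that] by (intro least) (auto simp: cstar_seminormD(3)[OF P] intro!: mult_left_mono)
  show ?thesis
    unfolding cstar_seminorm_def
  proof (intro conjI ballI allI)
    fix x assume x: "x \<in> carrier A"
    show "0 \<le> sup_seminorm P x" by (rule nn[OF x])
    show "sup_seminorm P (star A x \<otimes> x) = (sup_seminorm P x)\<^sup>2"
    proof (rule antisym)
      show "sup_seminorm P (star A x \<otimes> x) \<le> (sup_seminorm P x)\<^sup>2"
        using up[OF x] x by (intro least) (auto simp: cstar_seminormD(5)[OF P] intro!: power_mono cstar_seminormD(1)[OF P])
      have "p x \<le> sqrt (sup_seminorm P (star A x \<otimes> x))" if p: "p \<in> P" for p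
        using up[of "star A x \<otimes> x" p] x p cstar_seminormD(5)[OF P[OF p] x]
        by (intro real_le_rsqrt) (auto simp: mult_closed star_closed)
      then have "sup_seminorm P x \<le> sqrt (sup_seminorm P (star A x \<otimes> x))" by (rule least)
      then show "(sup_seminorm P x)\<^sup>2 \<le> sup_seminorm P (star A x \<otimes> x)"
        using nn[OF x] nn[of "star A x \<otimes> x"] x
        by (metis mult_closed power_mono real_sqrt_pow2 star_closed)
    qed
    fix y assume y: "y \<in> carrier A"
    show "sup_seminorm P (x \<oplus> y) \<le> sup_seminorm P x + sup_seminorm P y"
      using up[OF x] up[OF y] by (intro least) (meson P add_mono cstar_seminormD(2) order_trans x y)
    show "sup_seminorm P (x \<otimes> y) \<le> sup_seminorm P x * sup_seminorm P y"
    proof (rule least)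
      fix p assume p: "p \<in> P"
      have "p (x \<otimes> y) \<le> p x * p y" using cstar_seminormD(4)[OF P[OF p] x y] .
      also have "\<dots> \<le> sup_seminorm P x * sup_seminorm P y"
        by (intro mult_mono up p x y nn cstar_seminormD(1)[OF P[OF p]])
      finally show "p (x \<otimes> y) \<le> sup_seminorm P x * sup_seminorm P y" .
    qed
  next
    fix c x assume x: "x \<in> carrier A"
    show "sup_seminorm P (c \<odot> x) = cmod c * sup_seminorm P x"
    proof (cases "c = 0")
      case True
      have "sup_seminorm P \<zero> = 0"
        using hom[of \<zero> 0] nn[of \<zero>] by simp
      then show ?thesis using True smult_l_null[OF x] by simp
    next
      case False
      have "inverse c \<odot> (c \<odot> x) = x"
        using smult_assoc1[of "inverse c" c x] x False by simp
      then have "sup_seminorm P x \<le> cmod (inverse c) * sup_seminorm P (c \<odot> x)"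
        using hom[of "c \<odot> x" "inverse c"] x by simp
      then have "cmod c * sup_seminorm P x \<le> sup_seminorm P (c \<odot> x)"
        using False by (simp add: norm_inverse norm_divide field_simps)
      then show ?thesis using hom[OF x, of c] by simp
    qed
  qed
qed

end

lemma enveloping_norm_cstar:
  assumes L: "star_algebra L" and nn: "\<And>x. x \<in> carrier L \<Longrightarrow> 0 \<le> nrm L x"
  shows "cstar_seminorm L (enveloping_norm L)"
  unfolding enveloping_norm_def
proof (rule star_algebra.sup_seminorm_cstar[OF L])
  let ?P = "{p. cstar_seminorm L p \<and> (\<forall>x\<in>carrier L. p x \<le> nrm L x)}"
  have "(\<lambda>x. 0) \<in> ?P" using nn by (simp add: cstar_seminorm_def)
  then show "?P \<noteq> {}" by blast
  show "\<exists>K. \<forall>p\<in>?P. p x \<le> K" if "x \<in> carrier L" for x using that by blast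
qed blast

locale seminormed_star_algebra = star_algebra A for A :: "('a, 'm) star_alg_scheme" (structure) +
  fixes N :: "'a \<Rightarrow> real"
  assumes seminorm: "cstar_seminorm A N"
begin

abbreviation "CS \<equiv> cauchy_seqs A N"
abbreviation "CC \<equiv> cauchy_class A N"
abbreviation "B \<equiv> completion A N"

lemmas N_nonneg = cstar_seminormD(1)[OF seminorm]
  and N_add = cstar_seminormD(2)[OF seminorm]
  and N_smult = cstar_seminormD(3)[OF seminorm]
  and N_mult = cstar_seminormD(4)[OF seminorm]
  and N_cstar = cstar_seminormD(5)[OF seminorm]
  and N_zero = seminorm_zero[OF seminorm]
  and N_commute = seminorm_minus_commute[OF seminorm]
  and N_triangle = seminorm_triangle[OF seminorm]
  and N_diff_le = seminorm_diff_le[OF seminorm]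
  and N_self = seminorm_self[OF seminorm]
  and N_star = seminorm_star[OF seminorm]

lemma CS_closed: "X \<in> CS \<Longrightarrow> X n \<in> carrier A"
  by (simp add: cauchy_seqs_def)

lemma CS_I:
  assumes "\<And>n. X n \<in> carrier A" and "\<And>e. e > 0 \<Longrightarrow> \<exists>k. \<forall>m\<ge>k. \<forall>n\<ge>k. N (X m \<ominus> X n) < e"
  shows "X \<in> CS"
  using assms by (simp add: cauchy_seqs_def)

lemma CS_D: "X \<in> CS \<Longrightarrow> e > 0 \<Longrightarrow> \<exists>k. \<forall>m\<ge>k. \<forall>n\<ge>k. N (X m \<ominus> X n) < e"
  by (simp add: cauchy_seqs_def)

lemma null_le:
  assumes "\<And>n. X n \<in> carrier A" and "\<And>n. N (X n) \<le> g n" and "g \<longlonglongrightarrow> (0::real)"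
  shows "(\<lambda>n. N (X n)) \<longlonglongrightarrow> 0"
  by (rule tendsto_sandwich[OF _ _ tendsto_const assms(3)]) (auto simp: assms N_nonneg)

lemma CS_bounded:
  assumes X: "X \<in> CS" obtains K where "K > 0" "\<And>n. N (X n) \<le> K"
proof -
  obtain k where k: "\<And>m n. m \<ge> k \<Longrightarrow> n \<ge> k \<Longrightarrow> N (X m \<ominus> X n) < 1"
    using CS_D[OF X, of 1] by auto
  define K where "K = Max (insert 1 ((\<lambda>n. N (X n)) ` {..k})) + 1"
  have 1: "N (X n) \<le> K - 1" if "n \<le> k" for n
  proof -
    have "N (X n) \<le> Max (insert 1 ((\<lambda>n. N (X n)) ` {..k}))" by (rule Max_ge) (use that in auto)
    then show ?thesis unfolding K_def by linarith
  qed
  have "N (X n) \<le> K" for n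
  proof (cases "n \<le> k")
    case True then show ?thesis using 1[of n] by simp
  next
    case False
    then have "\<bar>N (X n) - N (X k)\<bar> < 1"
      using N_diff_le[OF CS_closed[OF X] CS_closed[OF X], of n k] k[of n k] by simp
    then show ?thesis using 1[of k] by simp
  qed
  moreover have "K > 0"
    unfolding K_def using Max_ge[of "insert 1 ((\<lambda>n. N (X n)) ` {..k})" 1] by fastforce
  ultimately show ?thesis using that by blast
qed

lemma const_CS: "x \<in> carrier A \<Longrightarrow> (\<lambda>n. x) \<in> CS"
  by (rule CS_I) (auto simp: N_self)

lemma add_CS:
  assumes X: "X \<in> CS" and Y: "Y \<in> CS" shows "(\<lambda>n. X n \<oplus> Y n) \<in> CS"
proof (rule CS_I)
  fix e :: real assume e: "e > 0"
  obtain k where k: "\<And>m n. m \<ge> k \<Longrightarrow> n \<ge> k \<Longrightarrow> N (X m \<ominus> X n) < e/2"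
    using CS_D[OF X, of "e/2"] e by auto
  obtain l where l: "\<And>m n. m \<ge> l \<Longrightarrow> n \<ge> l \<Longrightarrow> N (Y m \<ominus> Y n) < e/2"
    using CS_D[OF Y, of "e/2"] e by auto
  have "N ((X m \<oplus> Y m) \<ominus> (X n \<oplus> Y n)) < e" if "m \<ge> max k l" "n \<ge> max k l" for m n
    using k[of m n] l[of m n] that N_add[of "X m \<ominus> X n" "Y m \<ominus> Y n"]
    by (simp add: add_minus_add CS_closed[OF X] CS_closed[OF Y])
  then show "\<exists>k. \<forall>m\<ge>k. \<forall>n\<ge>k. N ((X m \<oplus> Y m) \<ominus> (X n \<oplus> Y n)) < e" by blast
qed (simp add: CS_closed[OF X] CS_closed[OF Y])

lemma smult_CS:
  assumes X: "X \<in> CS" shows "(\<lambda>n. c \<odot> X n) \<in> CS"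
proof (rule CS_I)
  fix e :: real assume e: "e > 0"
  have e': "e / (cmod c + 1) > 0" using e by (simp add: add_nonneg_pos)
  obtain k where k: "\<And>m n. m \<ge> k \<Longrightarrow> n \<ge> k \<Longrightarrow> N (X m \<ominus> X n) < e / (cmod c + 1)"
    using CS_D[OF X e'] by auto
  have "N (c \<odot> X m \<ominus> c \<odot> X n) < e" if mn: "m \<ge> k" "n \<ge> k" for m n
  proof -
    have "N (c \<odot> X m \<ominus> c \<odot> X n) = cmod c * N (X m \<ominus> X n)"
      by (simp add: smult_minus[symmetric] CS_closed[OF X] N_smult)
    also have "\<dots> \<le> (cmod c + 1) * N (X m \<ominus> X n)"
      by (simp add: distrib_right N_nonneg CS_closed[OF X])
    also have "\<dots> < (cmod c + 1) * (e / (cmod c + 1))"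
      using k[OF mn] by (intro mult_strict_left_mono) (auto simp: add_nonneg_pos)
    also have "\<dots> = e"
    proof -
      have "cmod c + 1 \<noteq> 0" using norm_ge_zero[of c] by linarith
      then show ?thesis by simp
    qed
    finally show ?thesis .
  qed
  then show "\<exists>k. \<forall>m\<ge>k. \<forall>n\<ge>k. N (c \<odot> X m \<ominus> c \<odot> X n) < e" by blast
qed (simp add: CS_closed[OF X])

lemma star_CS:
  assumes X: "X \<in> CS" shows "(\<lambda>n. star A (X n)) \<in> CS"
  by (rule CS_I)
    (use CS_D[OF X] in \<open>auto simp: CS_closed[OF X] star_closed star_minus[symmetric] N_star\<close>)

lemma N_mult_diff:
  assumes "x \<in> carrier A" "y \<in> carrier A" "x' \<in> carrier A" "y' \<in> carrier A"
  shows "N ((x \<otimes> y) \<ominus> (x' \<otimes> y')) \<le> N (x \<ominus> x') * N y + N x' * N (y \<ominus> y')"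
proof -
  have "N ((x \<otimes> y) \<ominus> (x' \<otimes> y')) \<le> N ((x \<ominus> x') \<otimes> y) + N (x' \<otimes> (y \<ominus> y'))"
    using assms by (simp add: mult_minus_mult N_add mult_closed)
  also have "\<dots> \<le> N (x \<ominus> x') * N y + N x' * N (y \<ominus> y')"
    using assms by (intro add_mono N_mult) auto
  finally show ?thesis .
qed

lemma mult_CS:
  assumes X: "X \<in> CS" and Y: "Y \<in> CS" shows "(\<lambda>n. X n \<otimes> Y n) \<in> CS"
proof (rule CS_I)
  fix e :: real assume e: "e > 0"
  obtain K where K: "K > 0" "\<And>n. N (X n) \<le> K" using CS_bounded[OF X] by blast
  obtain L where L: "L > 0" "\<And>n. N (Y n) \<le> L" using CS_bounded[OF Y] by blast
  obtain k where k: "\<And>m n. m \<ge> k \<Longrightarrow> n \<ge> k \<Longrightarrow> N (X m \<ominus> X n) < e / (2 * L)"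
    using CS_D[OF X, of "e / (2 * L)"] e L by auto
  obtain l where l: "\<And>m n. m \<ge> l \<Longrightarrow> n \<ge> l \<Longrightarrow> N (Y m \<ominus> Y n) < e / (2 * K)"
    using CS_D[OF Y, of "e / (2 * K)"] e K by auto
  have "N ((X m \<otimes> Y m) \<ominus> (X n \<otimes> Y n)) < e" if mn: "m \<ge> max k l" "n \<ge> max k l" for m n
  proof -
    have "N ((X m \<otimes> Y m) \<ominus> (X n \<otimes> Y n)) \<le> N (X m \<ominus> X n) * N (Y m) + N (X n) * N (Y m \<ominus> Y n)"
      by (intro N_mult_diff CS_closed[OF X] CS_closed[OF Y])
    also have "\<dots> \<le> N (X m \<ominus> X n) * L + K * N (Y m \<ominus> Y n)"
      by (intro add_mono mult_mono) (auto simp: K L less_imp_le[OF K(1)] N_nonneg CS_closed[OF X] CS_closed[OF Y])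
    also have "\<dots> < e / (2 * L) * L + K * (e / (2 * K))"
      using k[of m n] l[of m n] mn K L
      by (intro add_strict_mono mult_strict_right_mono mult_strict_left_mono) auto
    also have "\<dots> = e" using K L by simp
    finally show ?thesis .
  qed
  then show "\<exists>k. \<forall>m\<ge>k. \<forall>n\<ge>k. N ((X m \<otimes> Y m) \<ominus> (X n \<otimes> Y n)) < e" by blast
qed (simp add: CS_closed[OF X] CS_closed[OF Y] mult_closed)

lemma CC_self: "X \<in> CS \<Longrightarrow> X \<in> CC X"
  by (simp add: cauchy_class_def N_self CS_closed)

lemma CC_D: "Y \<in> CC X \<Longrightarrow> Y \<in> CS" "Y \<in> CC X \<Longrightarrow> (\<lambda>n. N (Y n \<ominus> X n)) \<longlonglongrightarrow> 0"
  by (simp_all add: cauchy_class_def)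

lemma CC_eqI:
  assumes X: "X \<in> CS" and Y: "Y \<in> CS" and lim: "(\<lambda>n. N (X n \<ominus> Y n)) \<longlonglongrightarrow> 0"
  shows "CC X = CC Y"
proof -
  have *: "CC X \<subseteq> CC Y" if X: "X \<in> CS" and Y: "Y \<in> CS" and lim: "(\<lambda>n. N (X n \<ominus> Y n)) \<longlonglongrightarrow> 0" for X Y
  proof
    fix Z assume Z: "Z \<in> CC X"
    have "(\<lambda>n. N (Z n \<ominus> Y n)) \<longlonglongrightarrow> 0"
      by (rule null_le[where g = "\<lambda>n. N (Z n \<ominus> X n) + N (X n \<ominus> Y n)"])
        (auto intro!: N_triangle tendsto_add_zero lim CC_D(2)[OF Z] simp: CS_closed[OF X] CS_closed[OF Y] CS_closed[OF CC_D(1)[OF Z]])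
    then show "Z \<in> CC Y" using CC_D(1)[OF Z] by (simp add: cauchy_class_def)
  qed
  have "(\<lambda>n. N (Y n \<ominus> X n)) \<longlonglongrightarrow> 0"
    using lim by (simp add: N_commute CS_closed X Y)
  then show ?thesis using * X Y lim by blast
qed

lemma CC_eq_iff:
  assumes X: "X \<in> CS" and Y: "Y \<in> CS"
  shows "CC X = CC Y \<longleftrightarrow> (\<lambda>n. N (X n \<ominus> Y n)) \<longlonglongrightarrow> 0"
  using CC_eqI[OF X Y] CC_self[OF X] CC_D(2)[of X Y] by auto

lemma carrier_B: "carrier B = CC ` CS" by (simp add: completion_def)

lemma CC_carrier [simp]: "X \<in> CS \<Longrightarrow> CC X \<in> carrier B"
  by (simp add: carrier_B)

lemma zero_B: "\<zero>\<^bsub>B\<^esub> = CC (\<lambda>n. \<zero>)" and one_B: "\<one>\<^bsub>B\<^esub> = CC (\<lambda>n. \<one>)"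
  by (simp_all add: completion_def)

lemma add_B:
  assumes X: "X \<in> CS" and Y: "Y \<in> CS"
  shows "CC X \<oplus>\<^bsub>B\<^esub> CC Y = CC (\<lambda>n. X n \<oplus> Y n)"
proof -
  have "CC (\<lambda>n. X' n \<oplus> Y' n) = CC (\<lambda>n. X n \<oplus> Y n)" if "X' \<in> CC X" "Y' \<in> CC Y" for X' Y'
  proof (rule CC_eqI)
    have X': "X' \<in> CS" and Y': "Y' \<in> CS" using that CC_D(1) by blast+
    show "(\<lambda>n. N ((X' n \<oplus> Y' n) \<ominus> (X n \<oplus> Y n))) \<longlonglongrightarrow> 0"
      by (rule null_le[where g = "\<lambda>n. N (X' n \<ominus> X n) + N (Y' n \<ominus> Y n)"])
        (auto simp: add_minus_add CS_closed X Y X' Y' intro!: N_add tendsto_add_zero CC_D(2) that)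
  qed (use that CC_D(1) in \<open>auto intro!: add_CS X Y\<close>)
  then have "(\<Union>X'\<in>CC X. \<Union>Y'\<in>CC Y. CC (\<lambda>n. X' n \<oplus> Y' n)) = CC (\<lambda>n. X n \<oplus> Y n)"
    using CC_self[OF X] CC_self[OF Y] by blast
  then show ?thesis by (simp add: completion_def)
qed

lemma smult_B:
  assumes X: "X \<in> CS" shows "c \<odot>\<^bsub>B\<^esub> CC X = CC (\<lambda>n. c \<odot> X n)"
proof -
  have "CC (\<lambda>n. c \<odot> X' n) = CC (\<lambda>n. c \<odot> X n)" if "X' \<in> CC X" for X'
  proof (rule CC_eqI)
    have X': "X' \<in> CS" using that CC_D(1) by blast
    show "(\<lambda>n. N (c \<odot> X' n \<ominus> c \<odot> X n)) \<longlonglongrightarrow> 0"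
      by (simp add: smult_minus[symmetric] CS_closed X X' N_smult tendsto_mult_right_zero CC_D(2)[OF that])
  qed (use that CC_D(1) in \<open>auto intro!: smult_CS X\<close>)
  then have "(\<Union>X'\<in>CC X. CC (\<lambda>n. c \<odot> X' n)) = CC (\<lambda>n. c \<odot> X n)"
    using CC_self[OF X] by blast
  then show ?thesis by (simp add: completion_def)
qed

lemma star_B:
  assumes X: "X \<in> CS" shows "star B (CC X) = CC (\<lambda>n. star A (X n))"
proof -
  have "CC (\<lambda>n. star A (X' n)) = CC (\<lambda>n. star A (X n))" if "X' \<in> CC X" for X'
  proof (rule CC_eqI)
    have X': "X' \<in> CS" using that CC_D(1) by blast
    show "(\<lambda>n. N (star A (X' n) \<ominus> star A (X n))) \<longlonglongrightarrow> 0"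
      by (simp add: star_minus[symmetric] CS_closed X X' N_star CC_D(2)[OF that])
  qed (use that CC_D(1) in \<open>auto intro!: star_CS X\<close>)
  then have "(\<Union>X'\<in>CC X. CC (\<lambda>n. star A (X' n))) = CC (\<lambda>n. star A (X n))"
    using CC_self[OF X] by blast
  then show ?thesis by (simp add: completion_def)
qed

lemma mult_B:
  assumes X: "X \<in> CS" and Y: "Y \<in> CS"
  shows "CC X \<otimes>\<^bsub>B\<^esub> CC Y = CC (\<lambda>n. X n \<otimes> Y n)"
proof -
  have "CC (\<lambda>n. X' n \<otimes> Y' n) = CC (\<lambda>n. X n \<otimes> Y n)" if "X' \<in> CC X" "Y' \<in> CC Y" for X' Y'
  proof (rule CC_eqI)
    have X': "X' \<in> CS" and Y': "Y' \<in> CS" using that CC_D(1) by blast+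
    obtain K where K: "K > 0" "\<And>n. N (X n) \<le> K" using CS_bounded[OF X] by blast
    obtain L where L: "L > 0" "\<And>n. N (Y' n) \<le> L" using CS_bounded[OF Y'] by blast
    have "N ((X' n \<otimes> Y' n) \<ominus> (X n \<otimes> Y n)) \<le> N (X' n \<ominus> X n) * L + K * N (Y' n \<ominus> Y n)" for n
    proof -
      have "N ((X' n \<otimes> Y' n) \<ominus> (X n \<otimes> Y n)) \<le> N (X' n \<ominus> X n) * N (Y' n) + N (X n) * N (Y' n \<ominus> Y n)"
        by (intro N_mult_diff CS_closed X Y X' Y')
      also have "\<dots> \<le> N (X' n \<ominus> X n) * L + K * N (Y' n \<ominus> Y n)"
        by (intro add_mono mult_mono) (auto simp: K L less_imp_le[OF K(1)] N_nonneg CS_closed X Y X' Y')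
      finally show ?thesis .
    qed
    moreover have "(\<lambda>n. N (X' n \<ominus> X n) * L + K * N (Y' n \<ominus> Y n)) \<longlonglongrightarrow> 0"
      by (intro tendsto_add_zero tendsto_mult_left_zero tendsto_mult_right_zero CC_D(2) that)
    ultimately show "(\<lambda>n. N ((X' n \<otimes> Y' n) \<ominus> (X n \<otimes> Y n))) \<longlonglongrightarrow> 0"
      by (intro null_le) (auto simp: CS_closed X Y X' Y' mult_closed)
  qed (use that CC_D(1) in \<open>auto intro!: mult_CS X Y\<close>)
  then have "(\<Union>X'\<in>CC X. \<Union>Y'\<in>CC Y. CC (\<lambda>n. X' n \<otimes> Y' n)) = CC (\<lambda>n. X n \<otimes> Y n)"
    using CC_self[OF X] CC_self[OF Y] by blast
  then show ?thesis by (simp add: completion_def)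
qed

lemma nrm_B_lim:
  assumes X: "X \<in> CS"
  shows "(\<lambda>n. N (X n)) \<longlonglongrightarrow> nrm B (CC X)"
proof -
  have "Cauchy (\<lambda>n. N (X n))"
  proof (rule metric_CauchyI)
    fix e :: real assume "e > 0"
    then obtain k where "\<And>m n. m \<ge> k \<Longrightarrow> n \<ge> k \<Longrightarrow> N (X m \<ominus> X n) < e"
      using CS_D[OF X] by blast
    then show "\<exists>k. \<forall>m\<ge>k. \<forall>n\<ge>k. dist (N (X m)) (N (X n)) < e"
      unfolding dist_real_def using N_diff_le[OF CS_closed[OF X] CS_closed[OF X]] by (meson le_less_trans)
  qed
  then obtain r where r: "(\<lambda>n. N (X n)) \<longlonglongrightarrow> r" using Cauchy_convergent convergentD by blast
  have "(\<lambda>n. N (Y n)) \<longlonglongrightarrow> r" if Y: "Y \<in> CC X" for Y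
  proof -
    have "(\<lambda>n. N (Y n) - N (X n)) \<longlonglongrightarrow> 0"
      by (rule Lim_null_comparison[OF _ CC_D(2)[OF Y]])
        (auto intro!: always_eventually N_diff_le CS_closed X CC_D(1)[OF Y])
    from tendsto_add[OF this r] show ?thesis by simp
  qed
  then have "nrm B (CC X) = r"
    unfolding completion_def
    by (simp, intro the_equality) (use CC_self[OF X] r LIMSEQ_unique in blast)+
  then show ?thesis using r by simp
qed

lemma nrm_B_const: "x \<in> carrier A \<Longrightarrow> nrm B (CC (\<lambda>n. x)) = N x"
  using nrm_B_lim[OF const_CS] LIMSEQ_unique[OF _ tendsto_const] by fastforce

lemma star_algebra_B: "star_algebra B"
proof (rule star_algebraI)
  show "star_algebra_axioms B"
  proof
    fix x y z c
    assume "x \<in> carrier B"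
    then obtain X where X: "X \<in> CS" "x = CC X" by (auto simp: carrier_B)
    show "star B x \<in> carrier B" "star B (star B x) = x"  "star B (c \<odot>\<^bsub>B\<^esub> x) = cnj c \<odot>\<^bsub>B\<^esub> star B x"
      by (simp_all add: X star_B star_CS star_star CS_closed star_smult smult_B smult_CS)
    assume "y \<in> carrier B"
    then obtain Y where Y: "Y \<in> CS" "y = CC Y" by (auto simp: carrier_B)
    show "x \<otimes>\<^bsub>B\<^esub> y \<in> carrier B" "c \<odot>\<^bsub>B\<^esub> x \<otimes>\<^bsub>B\<^esub> y = c \<odot>\<^bsub>B\<^esub> (x \<otimes>\<^bsub>B\<^esub> y)"
      "x \<otimes>\<^bsub>B\<^esub> (c \<odot>\<^bsub>B\<^esub> y) = c \<odot>\<^bsub>B\<^esub> (x \<otimes>\<^bsub>B\<^esub> y)"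
      "star B (x \<oplus>\<^bsub>B\<^esub> y) = star B x \<oplus>\<^bsub>B\<^esub> star B y" "star B (x \<otimes>\<^bsub>B\<^esub> y) = star B y \<otimes>\<^bsub>B\<^esub> star B x"
      by (simp_all add: X Y star_B star_CS CS_closed smult_B smult_CS mult_B mult_CS add_B add_CS
          smult_mult_l smult_mult_r star_add star_mult)
    assume "z \<in> carrier B"
    then obtain Z where Z: "Z \<in> CS" "z = CC Z" by (auto simp: carrier_B)
    show "x \<otimes>\<^bsub>B\<^esub> y \<otimes>\<^bsub>B\<^esub> z = x \<otimes>\<^bsub>B\<^esub> (y \<otimes>\<^bsub>B\<^esub> z)"
      "(x \<oplus>\<^bsub>B\<^esub> y) \<otimes>\<^bsub>B\<^esub> z = x \<otimes>\<^bsub>B\<^esub> z \<oplus>\<^bsub>B\<^esub> y \<otimes>\<^bsub>B\<^esub> z"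
      "z \<otimes>\<^bsub>B\<^esub> (x \<oplus>\<^bsub>B\<^esub> y) = z \<otimes>\<^bsub>B\<^esub> x \<oplus>\<^bsub>B\<^esub> z \<otimes>\<^bsub>B\<^esub> y"
      by (simp_all add: X Y Z CS_closed mult_B mult_CS add_B add_CS mult_assoc distr_l distr_r)
  qed
  fix x y z c d
  show "\<zero>\<^bsub>B\<^esub> \<in> carrier B" by (simp add: zero_B const_CS)
  assume "x \<in> carrier B"
  then obtain X where X: "X \<in> CS" "x = CC X" by (auto simp: carrier_B)
  show "\<zero>\<^bsub>B\<^esub> \<oplus>\<^bsub>B\<^esub> x = x" "c \<odot>\<^bsub>B\<^esub> x \<in> carrier B" "(c + d) \<odot>\<^bsub>B\<^esub> x = c \<odot>\<^bsub>B\<^esub> x \<oplus>\<^bsub>B\<^esub> d \<odot>\<^bsub>B\<^esub> x"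
    "(c * d) \<odot>\<^bsub>B\<^esub> x = c \<odot>\<^bsub>B\<^esub> (d \<odot>\<^bsub>B\<^esub> x)" "1 \<odot>\<^bsub>B\<^esub> x = x"
    using smult_l_distr[of c d] smult_assoc1[of c d]
    by (simp_all add: X zero_B add_B const_CS CS_closed smult_B smult_CS)
  have "(- 1 :: complex) \<odot> X n \<oplus> X n = \<zero>" for n
    using smult_l_distr[of "-1" 1 "X n"] smult_l_null[of "X n"] by (simp add: X CS_closed)
  then show "(- 1 :: complex) \<odot>\<^bsub>B\<^esub> x \<oplus>\<^bsub>B\<^esub> x = \<zero>\<^bsub>B\<^esub>"
    by (simp_all add: X zero_B add_B const_CS CS_closed smult_B smult_CS)
  assume "y \<in> carrier B"
  then obtain Y where Y: "Y \<in> CS" "y = CC Y" by (auto simp: carrier_B)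
  show "x \<oplus>\<^bsub>B\<^esub> y \<in> carrier B" "x \<oplus>\<^bsub>B\<^esub> y = y \<oplus>\<^bsub>B\<^esub> x" "c \<odot>\<^bsub>B\<^esub> (x \<oplus>\<^bsub>B\<^esub> y) = c \<odot>\<^bsub>B\<^esub> x \<oplus>\<^bsub>B\<^esub> c \<odot>\<^bsub>B\<^esub> y"
    by (simp_all add: X Y add_B add_CS CS_closed smult_B smult_CS smult_r_distr M.a_comm)
  assume "z \<in> carrier B"
  then obtain Z where Z: "Z \<in> CS" "z = CC Z" by (auto simp: carrier_B)
  show "x \<oplus>\<^bsub>B\<^esub> y \<oplus>\<^bsub>B\<^esub> z = x \<oplus>\<^bsub>B\<^esub> (y \<oplus>\<^bsub>B\<^esub> z)"
    by (simp add: X Y Z add_B add_CS CS_closed M.a_assoc)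
qed

sublocale B: star_algebra B by (rule star_algebra_B)

lemma minus_B:
  assumes "X \<in> CS" "Y \<in> CS"
  shows "CC X \<ominus>\<^bsub>B\<^esub> CC Y = CC (\<lambda>n. X n \<ominus> Y n)" and "(\<lambda>n. X n \<ominus> Y n) \<in> CS"
  using assms add_CS[OF assms(1) smult_CS[OF assms(2), of "-1"]]
  by (simp_all add: minus_eq_smult B.minus_eq_smult smult_B add_B smult_CS CS_closed)

lemma seminorm_B: "cstar_seminorm B (nrm B)"
  unfolding cstar_seminorm_def
proof (intro conjI ballI allI)
  fix x c assume "x \<in> carrier B"
  then obtain X where X: "X \<in> CS" "x = CC X" by (auto simp: carrier_B)
  note lx = nrm_B_lim[OF X(1)]
  show "0 \<le> nrm B x"
    unfolding X by (rule LIMSEQ_le_const[OF lx]) (auto simp: N_nonneg CS_closed X)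
  show "nrm B (c \<odot>\<^bsub>B\<^esub> x) = cmod c * nrm B x"
    using nrm_B_lim[OF smult_CS[OF X(1), of c]] tendsto_mult_left[OF lx, of "cmod c"]
    by (auto simp: X smult_B N_smult CS_closed intro: LIMSEQ_unique)
  show "nrm B (star B x \<otimes>\<^bsub>B\<^esub> x) = (nrm B x)\<^sup>2"
    using nrm_B_lim[OF mult_CS[OF star_CS[OF X(1)] X(1)]] tendsto_power[OF lx, of 2]
    by (auto simp: X star_B mult_B star_CS N_cstar CS_closed intro: LIMSEQ_unique)
  fix y assume "y \<in> carrier B"
  then obtain Y where Y: "Y \<in> CS" "y = CC Y" by (auto simp: carrier_B)
  note ly = nrm_B_lim[OF Y(1)]
  show "nrm B (x \<oplus>\<^bsub>B\<^esub> y) \<le> nrm B x + nrm B y"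
    unfolding X Y add_B[OF X(1) Y(1)]
    by (rule LIMSEQ_le[OF nrm_B_lim[OF add_CS[OF X(1) Y(1)]] tendsto_add[OF lx ly]])
      (auto simp: N_add CS_closed X Y)
  show "nrm B (x \<otimes>\<^bsub>B\<^esub> y) \<le> nrm B x * nrm B y"
    unfolding X Y mult_B[OF X(1) Y(1)]
    by (rule LIMSEQ_le[OF nrm_B_lim[OF mult_CS[OF X(1) Y(1)]] tendsto_mult[OF lx ly]])
      (auto simp: N_mult CS_closed X Y)
qed

lemma dense_B:
  assumes "x \<in> carrier B" "e > 0"
  shows "\<exists>a\<in>carrier A. nrm B (x \<ominus>\<^bsub>B\<^esub> CC (\<lambda>n. a)) < e"
proof -
  obtain X where X: "X \<in> CS" "x = CC X" using assms by (auto simp: carrier_B)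
  obtain k where k: "\<And>m n. m \<ge> k \<Longrightarrow> n \<ge> k \<Longrightarrow> N (X m \<ominus> X n) < e/2"
    using CS_D[OF X(1), of "e/2"] assms by auto
  have c: "(\<lambda>n. X k) \<in> CS" by (simp add: const_CS CS_closed X)
  have "nrm B (CC (\<lambda>n. X n \<ominus> X k)) \<le> e/2"
    by (rule LIMSEQ_le_const2[OF nrm_B_lim[OF minus_B(2)[OF X(1) c]]]) (use k in \<open>auto intro!: less_imp_le exI[of _ k]\<close>)
  then show ?thesis using assms X c by (intro bexI[of _ "X k"]) (auto simp: minus_B CS_closed)
qed

theorem completion_cstar: "cstar_algebra B"
proof
  show "cstar_seminorm B (nrm B)" by (rule seminorm_B)
  show "x = \<zero>\<^bsub>B\<^esub>" if x: "x \<in> carrier B" "nrm B x = 0" for x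
  proof -
    obtain X where X: "X \<in> CS" "x = CC X" using x(1) by (auto simp: carrier_B)
    have "(\<lambda>n. N (X n \<ominus> \<zero>)) \<longlonglongrightarrow> 0"
      using nrm_B_lim[OF X(1)] x X smult_r_null[of "-1"]
      by (simp add: minus_eq_smult CS_closed)
    then show ?thesis by (simp add: X zero_B CC_eq_iff const_CS)
  qed
  fix Xs assume Xs: "Xs \<in> cauchy_seqs B (nrm B)"
  have Xc: "Xs n \<in> carrier B" for n using Xs by (simp add: cauchy_seqs_def)
  have "\<exists>a\<in>carrier A. nrm B (Xs n \<ominus>\<^bsub>B\<^esub> CC (\<lambda>_. a)) < 1 / Suc n" for n
    by (rule dense_B) (auto simp: Xc)
  then obtain a where a: "\<And>n. a n \<in> carrier A" "\<And>n. nrm B (Xs n \<ominus>\<^bsub>B\<^esub> CC (\<lambda>_. a n)) < 1 / Suc n"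
    by metis
  define b where "b n = CC (\<lambda>_. a n)" for n
  have bc: "b n \<in> carrier B" for n by (simp add: b_def const_CS a)
  have ab: "nrm B (Xs n \<ominus>\<^bsub>B\<^esub> b n) < 1 / Suc n" for n using a by (simp add: b_def)
  have ba: "nrm B (b n \<ominus>\<^bsub>B\<^esub> Xs n) < 1 / Suc n" for n
    using ab[of n] B.seminorm_minus_commute[OF seminorm_B Xc bc, of n n] by simp
  note tri = B.seminorm_triangle[OF seminorm_B]
  have N_b: "N (a m \<ominus> a n) = nrm B (b m \<ominus>\<^bsub>B\<^esub> b n)" for m n
    using a by (simp add: b_def minus_B const_CS nrm_B_const)
  have aCS: "a \<in> CS"
  proof (rule CS_I)
    fix e :: real assume e: "e > 0"
    obtain k where k: "\<And>m n. m \<ge> k \<Longrightarrow> n \<ge> k \<Longrightarrow> nrm B (Xs m \<ominus>\<^bsub>B\<^esub> Xs n) < e/3"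
    proof -
      have "e/3 > 0" using e by simp
      then have "\<exists>k. \<forall>m\<ge>k. \<forall>n\<ge>k. nrm B (Xs m \<ominus>\<^bsub>B\<^esub> Xs n) < e/3"
        using Xs unfolding cauchy_seqs_def by blast
      then show ?thesis using that by blast
    qed
    obtain l where l: "1 / Suc l < e/3" using e nat_approx_posE[of "e/3"] by auto
    have l': "1 / Suc n < e/3" if "n \<ge> l" for n
    proof -
      have "1 / real (Suc n) \<le> 1 / real (Suc l)" using that by (simp add: frac_le)
      then show ?thesis using l by linarith
    qed
    have "N (a m \<ominus> a n) < e" if "m \<ge> max k l" "n \<ge> max k l" for m n
      using tri[OF bc[of m] Xc[of m] bc[of n]] tri[OF Xc[of m] Xc[of n] bc[of n]]
        k[of m n] l'[of m] l'[of n] ba[of m] ab[of n] that by (simp only: N_b) linarith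
    then show "\<exists>k. \<forall>m\<ge>k. \<forall>n\<ge>k. N (a m \<ominus> a n) < e" by blast
  qed (rule a)
  define x where "x = CC a"
  have xc: "x \<in> carrier B" using aCS by (simp add: x_def)
  have bx: "(\<lambda>n. nrm B (b n \<ominus>\<^bsub>B\<^esub> x)) \<longlonglongrightarrow> 0"
  proof (rule LIMSEQ_I)
    fix e :: real assume e: "e > 0"
    obtain k where k: "\<And>m n. m \<ge> k \<Longrightarrow> n \<ge> k \<Longrightarrow> N (a m \<ominus> a n) < e/2"
      using CS_D[OF aCS, of "e/2"] e by auto
    have "nrm B (b n \<ominus>\<^bsub>B\<^esub> x) \<le> e/2" if n: "n \<ge> k" for n
    proof -
      have "b n \<ominus>\<^bsub>B\<^esub> x = CC (\<lambda>m. a n \<ominus> a m)"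
        unfolding b_def x_def using a aCS by (simp add: minus_B const_CS)
      moreover have "nrm B (CC (\<lambda>m. a n \<ominus> a m)) \<le> e/2"
        by (rule LIMSEQ_le_const2[OF nrm_B_lim[OF minus_B(2)[OF const_CS[OF a(1)] aCS]]])
          (use k n in \<open>auto intro!: less_imp_le exI[of _ k]\<close>)
      ultimately show ?thesis by simp
    qed
    then show "\<exists>no. \<forall>n\<ge>no. norm (nrm B (b n \<ominus>\<^bsub>B\<^esub> x) - 0) < e"
      using e cstar_seminormD(1)[OF seminorm_B B.minus_closed[OF bc xc]]
      by (intro exI[of _ k]) (fastforce simp: abs_of_nonneg)
  qed
  have "(\<lambda>n. nrm B (Xs n \<ominus>\<^bsub>B\<^esub> x)) \<longlonglongrightarrow> 0"
  proof (rule tendsto_sandwich[OF _ _ tendsto_const])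
    show "\<forall>\<^sub>F n in sequentially. 0 \<le> nrm B (Xs n \<ominus>\<^bsub>B\<^esub> x)"
      by (intro always_eventually allI cstar_seminormD(1)[OF seminorm_B] B.minus_closed Xc xc)
    show "\<forall>\<^sub>F n in sequentially. nrm B (Xs n \<ominus>\<^bsub>B\<^esub> x) \<le> 1 / Suc n + nrm B (b n \<ominus>\<^bsub>B\<^esub> x)"
    proof (intro always_eventually allI)
      fix n show "nrm B (Xs n \<ominus>\<^bsub>B\<^esub> x) \<le> 1 / Suc n + nrm B (b n \<ominus>\<^bsub>B\<^esub> x)"
        using tri[OF Xc[of n] bc[of n] xc] ab[of n] by linarith
    qed
    show "(\<lambda>n. 1 / Suc n + nrm B (b n \<ominus>\<^bsub>B\<^esub> x)) \<longlonglongrightarrow> 0"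
      using tendsto_add[OF lim_inverse_n' [THEN LIMSEQ_Suc] bx] by simp
  qed
  then show "\<exists>x\<in>carrier B. (\<lambda>n. nrm B (Xs n \<ominus>\<^bsub>B\<^esub> x)) \<longlonglongrightarrow> 0" using xc by blast
qed

lemma unital_B: "unital A \<Longrightarrow> unital B"
  unfolding unital_def
  by (auto simp: one_B carrier_B const_CS mult_B CS_closed)

lemma to_completion_hom: "star_hom A B (to_completion A N)"
  unfolding star_hom_def to_completion_def
  by (auto simp: const_CS add_B smult_B star_B mult_B)

end

theorem enveloping_cstar:
  assumes "star_algebra L" "\<And>x. x \<in> carrier L \<Longrightarrow> 0 \<le> nrm L x"
  shows "cstar_algebra (enveloping_cstar L)"
  unfolding enveloping_cstar_def
  by (intro seminormed_star_algebra.completion_cstar seminormed_star_algebra.intro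
      seminormed_star_algebra_axioms.intro enveloping_norm_cstar assms)


section \<open>The free *-algebra\<close>

definition free_word :: "('x \<times> bool) list \<Rightarrow> ('x \<times> bool) list \<Rightarrow> complex" where
  "free_word v = (\<lambda>w. if w = v then 1 else 0)"

definition free_support :: "(('x \<times> bool) list \<Rightarrow> complex) \<Rightarrow> ('x \<times> bool) list set" where
  "free_support f = {w. f w \<noteq> 0}"

definition words :: "'x set \<Rightarrow> ('x \<times> bool) list set" where
  "words X = lists (X \<times> UNIV)"

lemma words_simps [simp]: "[] \<in> words X" "l # w \<in> words X \<longleftrightarrow> fst l \<in> X \<and> w \<in> words X"
    "v @ w \<in> words X \<longleftrightarrow> v \<in> words X \<and> w \<in> words X"
  by (auto simp: words_def mem_Times_iff)

definition flip_word :: "('x \<times> bool) list \<Rightarrow> ('x \<times> bool) list" where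
  "flip_word w = rev (map (\<lambda>(x, b). (x, \<not> b)) w)"

lemma flip_flip [simp]: "flip_word (flip_word w) = w"
  by (simp add: flip_word_def rev_map comp_def case_prod_beta)

lemma flip_simps [simp]: "flip_word [] = []" "flip_word (l # w) = flip_word w @ [(fst l, \<not> snd l)]"
    "length (flip_word w) = length w"
  by (simp_all add: flip_word_def case_prod_beta)

lemma flip_in_lists [simp]: "flip_word w \<in> words X \<longleftrightarrow> w \<in> words X"
  by (induction w) auto

lemma free_simps:
  "mult (free_star_alg X) = (\<lambda>f g w. \<Sum>i\<le>length w. f (take i w) * g (drop i w))"
  "one (free_star_alg X) = free_word []"
  "zero (free_star_alg X) = (\<lambda>w. 0)"
  "add (free_star_alg X) = (\<lambda>f g w. f w + g w)"
  "smult (free_star_alg X) = (\<lambda>c f w. c * f w)"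
  "star (free_star_alg X) = (\<lambda>f w. cnj (f (flip_word w)))"
  by (simp_all add: free_star_alg_def free_word_def flip_word_def)

lemma free_carrier: "f \<in> carrier (free_star_alg X) \<longleftrightarrow>
    finite (free_support f) \<and> free_support f \<subseteq> words X"
  by (simp add: free_star_alg_def free_support_def words_def)

lemma free_carrierI:
  assumes "finite T" "T \<subseteq> words X" "\<And>w. f w \<noteq> 0 \<Longrightarrow> w \<in> T"
  shows "f \<in> carrier (free_star_alg X)"
  unfolding free_carrier free_support_def
  using finite_subset[of "{w. f w \<noteq> 0}" T] assms by blast

lemma free_word_carrier: "v \<in> words X \<Longrightarrow> free_word v \<in> carrier (free_star_alg X)"
  by (rule free_carrierI[of "{v}"]) (auto simp: free_word_def split: if_splits)

lemma free_gen_word: "free_gen x = free_word [(x, False)]"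
  by (simp add: free_gen_def free_word_def)

lemma free_mult_assoc:
  fixes f g h :: "'c list \<Rightarrow> complex"
  shows "(\<Sum>i\<le>length w. (\<Sum>j\<le>length (take i w). f (take j (take i w)) * g (drop j (take i w))) * h (drop i w)) =
    (\<Sum>i\<le>length w. f (take i w) * (\<Sum>j\<le>length (drop i w). g (take j (drop i w)) * h (drop j (drop i w))))"
proof -
  let ?n = "length w"
  define F where "F j k = f (take j w) * g (take k (drop j w)) * h (drop (j + k) w)" for j k
  have "(\<Sum>i\<le>?n. (\<Sum>j\<le>length (take i w). f (take j (take i w)) * g (drop j (take i w))) * h (drop i w))
      = (\<Sum>i\<le>?n. \<Sum>j\<le>i. F j (i - j))"
    by (intro sum.cong refl) (auto simp: F_def sum_distrib_right min_def drop_take intro!: sum.cong)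
  also have "\<dots> = (\<Sum>(j, k)\<in>{(j, k). j + k \<le> ?n}. F j k)"
    by (rule sum.triangle_reindex_eq[symmetric])
  also have "{(j, k). j + k \<le> ?n} = (SIGMA j:{..?n}. {..?n - j})" by auto
  also have "(\<Sum>(j, k)\<in>(SIGMA j:{..?n}. {..?n - j}). F j k) = (\<Sum>j\<le>?n. \<Sum>k\<le>?n - j. F j k)"
    by (rule sum.Sigma[symmetric]) auto
  also have "\<dots> = (\<Sum>i\<le>?n. f (take i w) * (\<Sum>j\<le>length (drop i w). g (take j (drop i w)) * h (drop j (drop i w))))"
    by (intro sum.cong refl) (auto simp: F_def sum_distrib_left mult.assoc add.commute intro!: sum.cong)
  finally show ?thesis .
qed

lemma free_mult_carrier:
  assumes f: "f \<in> carrier (free_star_alg X)" and g: "g \<in> carrier (free_star_alg X)"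
  shows "f \<otimes>\<^bsub>free_star_alg X\<^esub> g \<in> carrier (free_star_alg X)"
proof (rule free_carrierI)
  let ?T = "(\<lambda>(u, v). u @ v) ` (free_support f \<times> free_support g)"
  show "finite ?T" using f g by (auto simp: free_carrier)
  show "?T \<subseteq> words X" using f g by (auto simp: free_carrier)
  fix w assume "(f \<otimes>\<^bsub>free_star_alg X\<^esub> g) w \<noteq> 0"
  then obtain i where "f (take i w) * g (drop i w) \<noteq> 0"
    by (metis (mono_tags, lifting) free_simps(1) sum.not_neutral_contains_not_neutral)
  then have "(take i w, drop i w) \<in> free_support f \<times> free_support g"
    by (auto simp: free_support_def)
  then show "w \<in> ?T" by (rule rev_image_eqI) simp
qed

lemmas (in star_algebra) smult_closed_complex [simp, intro] = smult_closed[simplified]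

lemma star_algebra_free: "star_algebra (free_star_alg (X :: 'x set))"
proof (rule star_algebraI)
  let ?F = "free_star_alg X"
  show "star_algebra_axioms ?F"
  proof
    fix x y z c assume x: "x \<in> carrier ?F"
    show "star ?F x \<in> carrier ?F"
    proof (rule free_carrierI)
      show "finite (flip_word ` free_support x)" "flip_word ` free_support x \<subseteq> words X"
        using x by (auto simp: free_carrier subset_iff )
      fix w assume "star ?F x w \<noteq> 0"
      then have "flip_word w \<in> free_support x" by (simp add: free_simps free_support_def)
      then show "w \<in> flip_word ` free_support x" by (intro image_eqI[of _ _ "flip_word w"]) auto
    qed
    show "star ?F (star ?F x) = x" "star ?F (c \<odot>\<^bsub>?F\<^esub> x) = cnj c \<odot>\<^bsub>?F\<^esub> star ?F x"
      by (simp_all only: free_simps flip_flip complex_cnj_cnj complex_cnj_mult)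
    assume y: "y \<in> carrier ?F"
    show "x \<otimes>\<^bsub>?F\<^esub> y \<in> carrier ?F" by (rule free_mult_carrier[OF x y])
    show "c \<odot>\<^bsub>?F\<^esub> x \<otimes>\<^bsub>?F\<^esub> y = c \<odot>\<^bsub>?F\<^esub> (x \<otimes>\<^bsub>?F\<^esub> y)"
      "x \<otimes>\<^bsub>?F\<^esub> (c \<odot>\<^bsub>?F\<^esub> y) = c \<odot>\<^bsub>?F\<^esub> (x \<otimes>\<^bsub>?F\<^esub> y)"
      "star ?F (x \<oplus>\<^bsub>?F\<^esub> y) = star ?F x \<oplus>\<^bsub>?F\<^esub> star ?F y"
      by (simp_all add: free_simps sum_distrib_left ac_simps)
    show "star ?F (x \<otimes>\<^bsub>?F\<^esub> y) = star ?F y \<otimes>\<^bsub>?F\<^esub> star ?F x"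
    proof
      fix w
      have "star ?F (x \<otimes>\<^bsub>?F\<^esub> y) w =
          (\<Sum>i\<le>length w. cnj (x (take i (flip_word w))) * cnj (y (drop i (flip_word w))))"
        by (simp add: free_simps)
      also have "\<dots> = (\<Sum>i\<le>length w. cnj (x (take (length w - i) (flip_word w))) * cnj (y (drop (length w - i) (flip_word w))))"
        by (rule sum.reindex_bij_witness[of _ "\<lambda>i. length w - i" "\<lambda>i. length w - i"]) auto
      also have "\<dots> = (star ?F y \<otimes>\<^bsub>?F\<^esub> star ?F x) w"
        by (simp add: free_simps flip_word_def take_rev drop_rev take_map drop_map mult.commute)
      finally show "star ?F (x \<otimes>\<^bsub>?F\<^esub> y) w = (star ?F y \<otimes>\<^bsub>?F\<^esub> star ?F x) w" .
    qed
    show "x \<otimes>\<^bsub>?F\<^esub> y \<otimes>\<^bsub>?F\<^esub> z = x \<otimes>\<^bsub>?F\<^esub> (y \<otimes>\<^bsub>?F\<^esub> z)"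
      unfolding free_simps by (rule ext) (rule free_mult_assoc)
    show "(x \<oplus>\<^bsub>?F\<^esub> y) \<otimes>\<^bsub>?F\<^esub> z = x \<otimes>\<^bsub>?F\<^esub> z \<oplus>\<^bsub>?F\<^esub> y \<otimes>\<^bsub>?F\<^esub> z"
      "z \<otimes>\<^bsub>?F\<^esub> (x \<oplus>\<^bsub>?F\<^esub> y) = z \<otimes>\<^bsub>?F\<^esub> x \<oplus>\<^bsub>?F\<^esub> z \<otimes>\<^bsub>?F\<^esub> y"
      by (simp_all add: free_simps algebra_simps sum.distrib)
  qed
  fix x y c assume x: "x \<in> carrier ?F"
  show "c \<odot>\<^bsub>?F\<^esub> x \<in> carrier ?F"
    by (rule free_carrierI[of "free_support x"]) (use x in \<open>auto simp: free_carrier free_simps free_support_def\<close>)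
  assume y: "y \<in> carrier ?F"
  show "x \<oplus>\<^bsub>?F\<^esub> y \<in> carrier ?F"
    by (rule free_carrierI[of "free_support x \<union> free_support y"])
      (use x y in \<open>auto simp: free_carrier free_simps free_support_def\<close>)
next
  show "\<zero>\<^bsub>free_star_alg X\<^esub> \<in> carrier (free_star_alg X)"
    by (rule free_carrierI[of "{}"]) (simp_all add: free_simps)
next
  fix x y z :: "('x \<times> bool) list \<Rightarrow> complex" and c d :: complex
  let ?F = "free_star_alg X"
  show "x \<oplus>\<^bsub>?F\<^esub> y \<oplus>\<^bsub>?F\<^esub> z = x \<oplus>\<^bsub>?F\<^esub> (y \<oplus>\<^bsub>?F\<^esub> z)"
    unfolding free_simps by (rule ext) (rule add.assoc)
  show "x \<oplus>\<^bsub>?F\<^esub> y = y \<oplus>\<^bsub>?F\<^esub> x"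
    unfolding free_simps by (rule ext) (rule add.commute)
  show "\<zero>\<^bsub>?F\<^esub> \<oplus>\<^bsub>?F\<^esub> x = x" "(- 1) \<odot>\<^bsub>?F\<^esub> x \<oplus>\<^bsub>?F\<^esub> x = \<zero>\<^bsub>?F\<^esub>" "1 \<odot>\<^bsub>?F\<^esub> x = x"
    unfolding free_simps by simp_all
  show "(c + d) \<odot>\<^bsub>?F\<^esub> x = c \<odot>\<^bsub>?F\<^esub> x \<oplus>\<^bsub>?F\<^esub> d \<odot>\<^bsub>?F\<^esub> x"
    unfolding free_simps by (rule ext) (rule distrib_right)
  show "c \<odot>\<^bsub>?F\<^esub> (x \<oplus>\<^bsub>?F\<^esub> y) = c \<odot>\<^bsub>?F\<^esub> x \<oplus>\<^bsub>?F\<^esub> c \<odot>\<^bsub>?F\<^esub> y"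
    unfolding free_simps by (rule ext) (rule distrib_left)
  show "(c * d) \<odot>\<^bsub>?F\<^esub> x = c \<odot>\<^bsub>?F\<^esub> (d \<odot>\<^bsub>?F\<^esub> x)"
    unfolding free_simps by (rule ext) (rule mult.assoc)
qed

interpretation F: star_algebra "free_star_alg X" for X :: "'x set" by (rule star_algebra_free)

lemma unital_free: "unital (free_star_alg X)"
  unfolding unital_def
proof (intro conjI ballI)
  show "\<one>\<^bsub>free_star_alg X\<^esub> \<in> carrier (free_star_alg X)"
    by (simp add: free_simps free_word_carrier)
  fix f :: "('a \<times> bool) list \<Rightarrow> complex"
  show "\<one>\<^bsub>free_star_alg X\<^esub> \<otimes>\<^bsub>free_star_alg X\<^esub> f = f"
  proof
    fix w :: "('a \<times> bool) list"
    have "(\<Sum>i\<le>length w. free_word [] (take i w) * f (drop i w)) = (\<Sum>i\<in>{0}. f (drop i w))"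
      by (rule sum.mono_neutral_cong_right) (auto simp: free_word_def)
    then show "(\<one>\<^bsub>free_star_alg X\<^esub> \<otimes>\<^bsub>free_star_alg X\<^esub> f) w = f w" by (simp add: free_simps)
  qed
  show "f \<otimes>\<^bsub>free_star_alg X\<^esub> \<one>\<^bsub>free_star_alg X\<^esub> = f"
  proof
    fix w :: "('a \<times> bool) list"
    have "(\<Sum>i\<le>length w. f (take i w) * free_word [] (drop i w)) = (\<Sum>i\<in>{length w}. f (take i w))"
      by (rule sum.mono_neutral_cong_right) (auto simp: free_word_def)
    then show "(f \<otimes>\<^bsub>free_star_alg X\<^esub> \<one>\<^bsub>free_star_alg X\<^esub>) w = f w" by (simp add: free_simps)
  qed
qed

lemma free_word_mult: "free_word u \<otimes>\<^bsub>free_star_alg X\<^esub> free_word v = free_word (u @ v)"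
proof
  fix w :: "('a \<times> bool) list"
  have "(\<Sum>i\<le>length w. free_word u (take i w) * free_word v (drop i w)) = free_word (u @ v) w"
  proof (cases "w = u @ v")
    case True
    have "i = length u" if "i \<le> length w" "take i w = u" for i
      using that by (metis length_take min.absorb2)
    then have "(\<Sum>i\<le>length w. free_word u (take i w) * free_word v (drop i w)) =
        (\<Sum>i\<in>{length u}. free_word u (take i w) * free_word v (drop i w))"
      using True by (intro sum.mono_neutral_right) (auto simp: free_word_def simp del: take_append drop_append)
    then show ?thesis using True by (simp add: free_word_def)
  next
    case False
    then have "(\<Sum>i\<le>length w. free_word u (take i w) * free_word v (drop i w)) = 0"
      by (intro sum.neutral) (auto simp: free_word_def)
    then show ?thesis using False by (simp add: free_word_def)
  qed
  then show "(free_word u \<otimes>\<^bsub>free_star_alg X\<^esub> free_word v) w = free_word (u @ v) w"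
    by (simp add: free_simps)
qed

lemma free_star_word: "star (free_star_alg X) (free_word v) = free_word (flip_word v)"
  unfolding free_simps free_word_def by (rule ext) (metis complex_cnj_one complex_cnj_zero flip_flip)

lemma free_induct [consumes 1, case_names zero word add]:
  assumes f: "f \<in> carrier (free_star_alg X)"
    and zero: "P (\<lambda>w. 0)"
    and word: "\<And>c v. v \<in> words X \<Longrightarrow> P (c \<odot>\<^bsub>free_star_alg X\<^esub> free_word v)"
    and add: "\<And>f g. \<lbrakk>f \<in> carrier (free_star_alg X); g \<in> carrier (free_star_alg X); P f; P g\<rbrakk>
      \<Longrightarrow> P (f \<oplus>\<^bsub>free_star_alg X\<^esub> g)"
  shows "P f"
proof -
  have "P f" if "finite T" "free_support f \<subseteq> T" "T \<subseteq> words X" for T f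
    using that
  proof (induction T arbitrary: f)
    case empty
    then have "f = (\<lambda>w. 0)" by (auto simp: free_support_def)
    then show ?case using zero by simp
  next
    case (insert v T)
    let ?g = "f(v := 0)"
    have g: "free_support ?g \<subseteq> T" using insert by (auto simp: free_support_def)
    then have gc: "?g \<in> carrier (free_star_alg X)"
      using insert finite_subset[OF g] by (auto simp: free_carrier)
    have eq: "f = ?g \<oplus>\<^bsub>free_star_alg X\<^esub> (f v \<odot>\<^bsub>free_star_alg X\<^esub> free_word v)"
      by (auto simp: free_simps free_word_def)
    have v: "v \<in> words X" using insert.prems by blast
    have "P (?g \<oplus>\<^bsub>free_star_alg X\<^esub> (f v \<odot>\<^bsub>free_star_alg X\<^esub> free_word v))"
      by (intro add gc F.smult_closed_complex free_word_carrier v insert.IH g word)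
        (use insert.prems in blast)
    then show ?case using eq by simp
  qed
  then show ?thesis using f unfolding free_carrier by blast
qed

text \<open>Evaluation of elements of the free algebra in a unital *-algebra.\<close>

primrec word_value :: "('a, 'm) star_alg_scheme \<Rightarrow> ('x \<Rightarrow> 'a) \<Rightarrow> ('x \<times> bool) list \<Rightarrow> 'a" where
  "word_value B f [] = \<one>\<^bsub>B\<^esub>"
| "word_value B f (l # w) = (if snd l then star B (f (fst l)) else f (fst l)) \<otimes>\<^bsub>B\<^esub> word_value B f w"

definition free_value :: "('a, 'm) star_alg_scheme \<Rightarrow> ('x \<Rightarrow> 'a) \<Rightarrow> (('x \<times> bool) list \<Rightarrow> complex) \<Rightarrow> 'a" where
  "free_value B f a = (\<Oplus>\<^bsub>B\<^esub>w\<in>free_support a. a w \<odot>\<^bsub>B\<^esub> word_value B f w)"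

locale free_evaluation = star_algebra B for B :: "('a, 'm) star_alg_scheme" (structure) +
  fixes X :: "'x set" and f :: "'x \<Rightarrow> 'a"
  assumes unital_B: "unital B" and f_closed: "x \<in> X \<Longrightarrow> f x \<in> carrier B"
begin

abbreviation "FX \<equiv> free_star_alg X"

lemma one_closed: "\<one> \<in> carrier B" and one_l: "x \<in> carrier B \<Longrightarrow> \<one> \<otimes> x = x"
  and one_r: "x \<in> carrier B \<Longrightarrow> x \<otimes> \<one> = x"
  using unital_B by (auto simp: unital_def)

lemma star_one: "star B \<one> = \<one>"
proof -
  have "star B (star B \<one> \<otimes> \<one>) = star B \<one> \<otimes> star B (star B \<one>)"
    by (rule star_mult) (simp_all add: one_closed star_closed)
  then show ?thesis by (simp add: one_r one_closed star_closed star_star)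
qed

lemma word_closed: "w \<in> words X \<Longrightarrow> word_value B f w \<in> carrier B"
  by (induction w) (auto simp: one_closed mult_closed star_closed f_closed)

lemma word_append: "\<lbrakk>u \<in> words X; w \<in> words X\<rbrakk> \<Longrightarrow>
    word_value B f (u @ w) = word_value B f u \<otimes> word_value B f w"
  by (induction u) (auto simp: one_l word_closed mult_assoc star_closed f_closed mult_closed)

lemma word_flip: "w \<in> words X \<Longrightarrow> word_value B f (flip_word w) = star B (word_value B f w)"
proof (induction w)
  case Nil then show ?case by (simp add: star_one)
next
  case (Cons l w)
  obtain x b where l: "l = (x, b)" by force
  have 1: "flip_word w \<in> words X" "[(x, \<not> b)] \<in> words X" "x \<in> X" "w \<in> words X"
    using Cons.prems l by (simp_all only: flip_in_lists) auto
  have "word_value B f (flip_word (l # w)) = word_value B f (flip_word w @ [(x, \<not> b)])"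
    by (simp add: l)
  also have "\<dots> = word_value B f (flip_word w) \<otimes> word_value B f [(x, \<not> b)]"
    by (rule word_append) (use 1 in auto)
  also have "\<dots> = star B (word_value B f (l # w))"
    using 1 Cons.IH by (simp add: l star_mult word_closed star_closed f_closed star_star one_r)
  finally show ?case .
qed

lemma value_superset:
  assumes "finite T" "T \<subseteq> words X" "free_support a \<subseteq> T"
  shows "free_value B f a = (\<Oplus>w\<in>T. a w \<odot> word_value B f w)"
  unfolding free_value_def
  by (rule M.add.finprod_mono_neutral_cong_left)
    (use assms smult_l_null word_closed in \<open>auto simp: free_support_def subset_iff\<close>)

lemma value_add:
  assumes a: "a \<in> carrier FX" and b: "b \<in> carrier FX"
  shows "free_value B f (a \<oplus>\<^bsub>FX\<^esub> b) = free_value B f a \<oplus> free_value B f b"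
proof -
  let ?T = "free_support a \<union> free_support b"
  have T: "finite ?T" "?T \<subseteq> words X" using a b by (auto simp: free_carrier)
  have s: "free_support (a \<oplus>\<^bsub>FX\<^esub> b) \<subseteq> ?T" by (auto simp: free_support_def free_simps)
  have "free_value B f (a \<oplus>\<^bsub>FX\<^esub> b) = (\<Oplus>w\<in>?T. a w \<odot> word_value B f w \<oplus> b w \<odot> word_value B f w)"
    unfolding value_superset[OF T s]
    by (rule M.finsum_cong') (use T word_closed in \<open>auto simp: free_simps smult_l_distr[simplified]\<close>)
  also have "\<dots> = (\<Oplus>w\<in>?T. a w \<odot> word_value B f w) \<oplus> (\<Oplus>w\<in>?T. b w \<odot> word_value B f w)"
    by (rule M.finsum_addf) (use T word_closed in auto)
  also have "\<dots> = free_value B f a \<oplus> free_value B f b"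
    using value_superset[OF T] by simp
  finally show ?thesis .
qed

lemma value_word_smult:
  assumes "v \<in> words X"
  shows "free_value B f (c \<odot>\<^bsub>FX\<^esub> free_word v) = c \<odot> word_value B f v"
proof -
  have "free_value B f (c \<odot>\<^bsub>FX\<^esub> free_word v) =
      (\<Oplus>w\<in>{v}. (c \<odot>\<^bsub>FX\<^esub> free_word v) w \<odot> word_value B f w)"
    by (rule value_superset) (use assms in \<open>auto simp: free_support_def free_simps free_word_def split: if_splits\<close>)
  then show ?thesis using word_closed[OF assms] by (simp add: free_simps free_word_def)
qed

lemma value_word: "v \<in> words X \<Longrightarrow> free_value B f (free_word v) = word_value B f v"
  using value_word_smult[of v 1] word_closed[of v] by (simp add: free_simps)

lemma value_zero: "free_value B f (\<lambda>w. 0) = \<zero>"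
  by (simp add: free_value_def free_support_def)

lemma value_closed: "a \<in> carrier FX \<Longrightarrow> free_value B f a \<in> carrier B"
  unfolding free_value_def
  by (rule M.finsum_closed) (use word_closed in \<open>auto simp: free_carrier\<close>)

lemma value_smult:
  assumes "a \<in> carrier FX"
  shows "free_value B f (c \<odot>\<^bsub>FX\<^esub> a) = c \<odot> free_value B f a"
  using assms
proof (induction a rule: free_induct)
  case zero then show ?case using smult_r_null[of c] by (simp add: free_simps value_zero)
next
  case (word d v)
  then show ?case
    using F.smult_assoc1[of c d "free_word v" X] smult_assoc1[of c d "word_value B f v"]
    using value_word_smult[OF word, of "c * d"] by (simp add: free_word_carrier value_word_smult word_closed)
next
  case (add a b)
  then show ?case
    by (simp add: F.smult_r_distr value_add F.smult_closed smult_r_distr value_closed)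
qed

lemma value_star:
  assumes "a \<in> carrier FX"
  shows "free_value B f (star FX a) = star B (free_value B f a)"
  using assms
proof (induction a rule: free_induct)
  case zero
  have "star B \<zero> = \<zero>" using star_smult[of \<zero> 0] smult_l_null[of \<zero>] smult_l_null[of "star B \<zero>"] by (simp add: star_closed)
  then show ?case by (simp add: free_simps value_zero)
next
  case (word c v)
  have v: "flip_word v \<in> words X" using word by (simp only: flip_in_lists)
  show ?case
    by (simp only: F.star_smult free_word_carrier[OF word] free_star_word value_word_smult[OF word]
        value_word_smult[OF v] word_flip[OF word] star_smult word_closed[OF word])
next
  case (add a b)
  then show ?case by (simp add: F.star_add value_add F.star_closed star_add value_closed)
qed

lemma value_mult:
  assumes a: "a \<in> carrier FX" and b: "b \<in> carrier FX"
  shows "free_value B f (a \<otimes>\<^bsub>FX\<^esub> b) = free_value B f a \<otimes> free_value B f b"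
  using a
proof (induction a rule: free_induct)
  case zero
  have "\<zero>\<^bsub>FX\<^esub> \<otimes>\<^bsub>FX\<^esub> b = \<zero>\<^bsub>FX\<^esub>" by (simp add: free_simps)
  moreover have "\<zero> \<otimes> free_value B f b = \<zero>"
    using smult_mult_l[of \<zero> "free_value B f b" 0] smult_l_null[of \<zero>]
      smult_l_null[of "\<zero> \<otimes> free_value B f b"] value_closed[OF b] by (simp add: mult_closed)
  ultimately show ?case by (simp add: free_simps value_zero)
next
  case (word c u)
  have wb: "free_value B f (free_word u \<otimes>\<^bsub>FX\<^esub> b) = word_value B f u \<otimes> free_value B f b"
    using b
  proof (induction b rule: free_induct)
    case zero
    have "free_word u \<otimes>\<^bsub>FX\<^esub> \<zero>\<^bsub>FX\<^esub> = \<zero>\<^bsub>FX\<^esub>" by (simp add: free_simps)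
    moreover have "word_value B f u \<otimes> \<zero> = \<zero>"
      using smult_mult_r[of "word_value B f u" \<zero> 0] smult_l_null[of \<zero>]
        smult_l_null[of "word_value B f u \<otimes> \<zero>"] word_closed[OF word] by (simp add: mult_closed)
    ultimately show ?case by (simp add: free_simps value_zero)
  next
    case (word d v)
    have "free_word u \<otimes>\<^bsub>FX\<^esub> (d \<odot>\<^bsub>FX\<^esub> free_word v) = d \<odot>\<^bsub>FX\<^esub> free_word (u @ v)"
      using word \<open>u \<in> words X\<close> by (simp add: F.smult_mult_r free_word_carrier free_word_mult)
    then show ?case using word \<open>u \<in> words X\<close>
      by (simp add: value_word_smult word_append smult_mult_r word_closed)
  next
    case (add a b)
    then show ?case using word
      by (simp add: F.distr_r free_word_carrier value_add F.mult_closed distr_r value_closed word_closed)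
  qed
  show ?case using word b
    by (simp add: F.smult_mult_l free_word_carrier value_smult F.mult_closed wb value_word
        smult_mult_l word_closed value_closed)
next
  case (add a a')
  then show ?case using b
    by (simp add: F.distr_l value_add F.mult_closed distr_l value_closed)
qed

lemma value_hom: "star_hom FX B (free_value B f)"
  by (auto simp: star_hom_def value_closed value_add value_smult value_mult value_star)

lemma value_one: "free_value B f \<one>\<^bsub>FX\<^esub> = \<one>"
  by (simp add: free_simps value_word)

lemma value_gen: "x \<in> X \<Longrightarrow> free_value B f (free_gen x) = f x"
  by (simp add: free_gen_word value_word one_r f_closed)

lemma value_unique:
  assumes h: "star_hom FX B h" and one: "h \<one>\<^bsub>FX\<^esub> = \<one>" and gen: "\<And>x. x \<in> X \<Longrightarrow> h (free_gen x) = f x"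
    and a: "a \<in> carrier FX"
  shows "h a = free_value B f a"
proof -
  note h' = h[unfolded star_hom_def]
  have w: "h (free_word v) = word_value B f v" if "v \<in> words X" for v
    using that
  proof (induction v)
    case Nil then show ?case using one by (simp add: free_simps)
  next
    case (Cons l v)
    obtain x b where l: "l = (x, b)" by force
    have x: "x \<in> X" and v: "v \<in> words X" using Cons.prems by (auto simp: l)
    have 1: "free_word (l # v) = free_word [(x, b)] \<otimes>\<^bsub>FX\<^esub> free_word v"
      by (simp add: free_word_mult l)
    have g: "free_gen x \<in> carrier FX" using x by (simp add: free_gen_word free_word_carrier)
    have "free_word [(x, True)] = star FX (free_gen x)"
      by (simp add: free_gen_word free_star_word)
    then have 2: "h (free_word [(x, b)]) = (if b then star B (f x) else f x)"
      using h' g gen[OF x] by (cases b) (auto simp: free_gen_word)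
    have "h (free_word (l # v)) = h (free_word [(x, b)]) \<otimes> h (free_word v)"
      unfolding 1 using h' x v free_word_carrier[of v X] free_word_carrier[of "[(x, b)]" X] by auto
    then show ?case using 2 Cons v by (simp add: l)
  qed
  show ?thesis using a
  proof (induction a rule: free_induct)
    case zero
    have "h \<zero>\<^bsub>FX\<^esub> = 0 \<odot> h \<zero>\<^bsub>FX\<^esub>"
      using h' F.zero_closed F.smult_l_null[of "\<zero>\<^bsub>FX\<^esub>" X] by (metis complex_ring_simps(4))
    also have "\<dots> = \<zero>" using smult_l_null[of "h \<zero>\<^bsub>FX\<^esub>"] h' F.zero_closed[of X] by auto
    finally show ?case by (simp add: free_simps value_zero)
  next
    case (word c v) then show ?case using h' w free_word_carrier[of v X] by (simp add: value_word_smult)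
  next
    case (add a b) then show ?case using h' by (simp add: value_add)
  qed
qed

end


lemma tendsto_unique_null:
  assumes "star_algebra B" "cstar_seminorm B p" "\<And>n::nat. Y n \<in> carrier B" "y \<in> carrier B" "z \<in> carrier B"
    and "(\<lambda>n. p (Y n \<ominus>\<^bsub>B\<^esub> y)) \<longlonglongrightarrow> 0" "(\<lambda>n. p (Y n \<ominus>\<^bsub>B\<^esub> z)) \<longlonglongrightarrow> 0"
  shows "p (y \<ominus>\<^bsub>B\<^esub> z) = 0"
proof -
  interpret B: star_algebra B by fact
  have "p (y \<ominus>\<^bsub>B\<^esub> z) \<le> 0"
  proof (rule LIMSEQ_le_const)
    show "(\<lambda>n. p (Y n \<ominus>\<^bsub>B\<^esub> y) + p (Y n \<ominus>\<^bsub>B\<^esub> z)) \<longlonglongrightarrow> 0"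
      by (intro tendsto_add_zero assms)
    show "\<exists>N. \<forall>n\<ge>N. p (y \<ominus>\<^bsub>B\<^esub> z) \<le> p (Y n \<ominus>\<^bsub>B\<^esub> y) + p (Y n \<ominus>\<^bsub>B\<^esub> z)"
      using B.seminorm_triangle[OF assms(2) assms(4) assms(3) assms(5)]
        B.seminorm_minus_commute[OF assms(2) assms(3) assms(4)] by auto
  qed
  then show ?thesis using cstar_seminormD(1)[OF assms(2), of "y \<ominus>\<^bsub>B\<^esub> z"] assms(4,5) by simp
qed

lemma (in cstar_algebra) norm_minus_zeroD:
  assumes "x \<in> carrier A" "y \<in> carrier A" "nrm A (x \<ominus> y) = 0" shows "x = y"
proof -
  have "x \<ominus> y = \<zero>" using assms by (intro norm_zeroD) auto
  have "x = (x \<ominus> y) \<oplus> y" using assms by (simp add: a_minus_def M.a_assoc M.l_neg)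
  also have "\<dots> = y" using \<open>x \<ominus> y = \<zero>\<close> assms by simp
  finally show ?thesis .
qed

text \<open>A *-homomorphism into a C*-algebra bounded by the seminorm extends to the completion.\<close>

lemma (in seminormed_star_algebra) completion_extend:
  assumes C: "cstar_algebra C" and h: "star_hom A C h"
    and bound: "\<And>a. a \<in> carrier A \<Longrightarrow> nrm C (h a) \<le> N a"
  shows "\<exists>\<Phi>. star_hom B C \<Phi> \<and> (\<forall>a\<in>carrier A. \<Phi> (to_completion A N a) = h a) \<and>
    (\<forall>x\<in>carrier B. nrm C (\<Phi> x) \<le> nrm B x)"
proof -
  interpret C: cstar_algebra C by fact
  note h' = h[unfolded star_hom_def]
  have hc: "h a \<in> carrier C" if "a \<in> carrier A" for a using h' that by blast
  have h_minus: "h (a \<ominus> b) = h a \<ominus>\<^bsub>C\<^esub> h b" if "a \<in> carrier A" "b \<in> carrier A" for a b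
    using h' that by (simp add: minus_eq_smult C.minus_eq_smult hc)
  have hX: "(\<lambda>n. h (X n)) \<in> cauchy_seqs C (nrm C)" if X: "X \<in> CS" for X
    unfolding cauchy_seqs_def
  proof (intro CollectI conjI allI impI)
    fix e :: real assume "e > 0"
    then obtain k where k: "\<And>m n. m \<ge> k \<Longrightarrow> n \<ge> k \<Longrightarrow> N (X m \<ominus> X n) < e" using CS_D[OF X] by blast
    have "nrm C (h (X m) \<ominus>\<^bsub>C\<^esub> h (X n)) < e" if "m \<ge> k" "n \<ge> k" for m n
      using k[OF that] bound[of "X m \<ominus> X n"] by (simp add: h_minus CS_closed[OF X])
    then show "\<exists>k. \<forall>m\<ge>k. \<forall>n\<ge>k. nrm C (h (X m) \<ominus>\<^bsub>C\<^esub> h (X n)) < e" by blast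
  qed (simp add: hc CS_closed[OF X])
  define L where "L X y \<longleftrightarrow> y \<in> carrier C \<and> (\<lambda>n. nrm C (h (X n) \<ominus>\<^bsub>C\<^esub> y)) \<longlonglongrightarrow> 0" for X y
  have L_ex: "\<exists>y. L X y" if "X \<in> CS" for X
    using C.complete[OF hX[OF that]] by (auto simp: L_def)
  have L_unique: "y = z" if "X \<in> CS" "L X y" "L X z" for X y z
    using that tendsto_unique_null[OF C.star_algebra_axioms C.cstar_norm, of "\<lambda>n. h (X n)" y z]
    by (intro C.norm_minus_zeroD) (auto simp: L_def hc CS_closed)
  have C_null: "(\<lambda>n. nrm C (Z n)) \<longlonglongrightarrow> 0"
    if "\<And>n. Z n \<in> carrier C" "\<And>n. nrm C (Z n) \<le> g n" "g \<longlonglongrightarrow> 0" for Z :: "nat \<Rightarrow> _" and g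
    by (rule tendsto_sandwich[OF _ _ tendsto_const that(3)])
      (auto simp: that cstar_seminormD(1)[OF C.cstar_norm])
  have L_class: "L Y y" if X: "X \<in> CS" and Y: "Y \<in> CC X" and y: "L X y" for X Y y
    unfolding L_def
  proof (intro conjI)
    show yc: "y \<in> carrier C" using y by (simp add: L_def)
    have Yc: "Y n \<in> carrier A" "X n \<in> carrier A" for n using CC_D(1)[OF Y] X by (simp_all add: CS_closed)
    have "nrm C (h (Y n) \<ominus>\<^bsub>C\<^esub> y) \<le> N (Y n \<ominus> X n) + nrm C (h (X n) \<ominus>\<^bsub>C\<^esub> y)" for n
      using C.seminorm_triangle[OF C.cstar_norm hc[OF Yc(1)] hc[OF Yc(2)] yc, of n n]
        bound[of "Y n \<ominus> X n"] Yc h_minus[OF Yc, of n n] by simp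
    then show "(\<lambda>n. nrm C (h (Y n) \<ominus>\<^bsub>C\<^esub> y)) \<longlonglongrightarrow> 0"
      by (rule C_null[rotated]) (use y CC_D(2)[OF Y] in \<open>auto simp: L_def hc Yc yc intro!: tendsto_add_zero\<close>)
  qed
  define \<Phi> where "\<Phi> x = (SOME y. \<exists>X\<in>CS. x = CC X \<and> L X y)" for x
  have \<Phi>: "\<Phi> (CC X) = y" if X: "X \<in> CS" and y: "L X y" for X y
  proof -
    have "\<exists>X'\<in>CS. CC X = CC X' \<and> L X' (\<Phi> (CC X))"
      unfolding \<Phi>_def by (rule someI_ex) (use X y in blast)
    then obtain X' where X': "X' \<in> CS" "CC X = CC X'" "L X' (\<Phi> (CC X))" by blast
    then have "L X (\<Phi> (CC X))" using L_class[of X' X] CC_self[OF X] by blast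
    then show ?thesis using L_unique[OF X] y by blast
  qed
  have \<Phi>L: "L X (\<Phi> (CC X))" if "X \<in> CS" for X
    using L_ex[OF that] \<Phi>[OF that] by blast
  have \<Phi>c: "\<Phi> (CC X) \<in> carrier C" "(\<lambda>n. nrm C (h (X n) \<ominus>\<^bsub>C\<^esub> \<Phi> (CC X))) \<longlonglongrightarrow> 0" if "X \<in> CS" for X
    using \<Phi>L[OF that] by (simp_all add: L_def)
  have contr: "nrm C (\<Phi> x) \<le> nrm B x" if x: "x \<in> carrier B" for x
  proof -
    obtain X where X: "X \<in> CS" "x = CC X" using x by (auto simp: carrier_B)
    have "(\<lambda>n. N (X n) + nrm C (h (X n) \<ominus>\<^bsub>C\<^esub> \<Phi> x)) \<longlonglongrightarrow> nrm B x"
      using tendsto_add[OF nrm_B_lim[OF X(1)] \<Phi>c(2)[OF X(1)]] by (simp add: X)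
    moreover have "nrm C (\<Phi> x) \<le> N (X n) + nrm C (h (X n) \<ominus>\<^bsub>C\<^esub> \<Phi> x)" for n
      using C.seminorm_diff_le[OF C.cstar_norm hc[OF CS_closed[OF X(1)]] \<Phi>c(1)[OF X(1)], of n]
        bound[OF CS_closed[OF X(1)], of n] by (simp add: X)
    ultimately show ?thesis by (intro LIMSEQ_le_const[where X = "\<lambda>n. N (X n) + nrm C (h (X n) \<ominus>\<^bsub>C\<^esub> \<Phi> x)"]) auto
  qed
  have ext: "\<Phi> (to_completion A N a) = h a" if "a \<in> carrier A" for a
    unfolding to_completion_def
    by (rule \<Phi>) (use that in \<open>simp_all add: const_CS L_def hc C.seminorm_self[OF C.cstar_norm]\<close>)
  have "star_hom B C \<Phi>"
    unfolding star_hom_def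
  proof (intro conjI ballI allI funcsetI)
    fix x c assume "x \<in> carrier B"
    then obtain X where X: "X \<in> CS" "x = CC X" by (auto simp: carrier_B)
    note Xc = CS_closed[OF X(1)] hc[OF CS_closed[OF X(1)]] \<Phi>c(1)[OF X(1)]
    show "\<Phi> x \<in> carrier C" using Xc X by simp
    show "\<Phi> (c \<odot>\<^bsub>B\<^esub> x) = c \<odot>\<^bsub>C\<^esub> \<Phi> x"
      unfolding X smult_B[OF X(1)]
    proof (rule \<Phi>[OF smult_CS[OF X(1)]], unfold L_def, intro conjI)
      have "nrm C (h (c \<odot> X n) \<ominus>\<^bsub>C\<^esub> c \<odot>\<^bsub>C\<^esub> \<Phi> (CC X)) = cmod c * nrm C (h (X n) \<ominus>\<^bsub>C\<^esub> \<Phi> (CC X))" for n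
        using h' Xc by (simp add: C.smult_minus[symmetric] cstar_seminormD(3)[OF C.cstar_norm])
      then show "(\<lambda>n. nrm C (h (c \<odot> X n) \<ominus>\<^bsub>C\<^esub> c \<odot>\<^bsub>C\<^esub> \<Phi> (CC X))) \<longlonglongrightarrow> 0"
        using tendsto_mult_right_zero[OF \<Phi>c(2)[OF X(1)]] by simp
    qed (use Xc in simp)
    show "\<Phi> (star B x) = star C (\<Phi> x)"
      unfolding X star_B[OF X(1)]
    proof (rule \<Phi>[OF star_CS[OF X(1)]], unfold L_def, intro conjI)
      have "nrm C (h (star A (X n)) \<ominus>\<^bsub>C\<^esub> star C (\<Phi> (CC X))) = nrm C (h (X n) \<ominus>\<^bsub>C\<^esub> \<Phi> (CC X))" for n
        using h' Xc by (simp add: C.star_minus[symmetric] C.seminorm_star[OF C.cstar_norm])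
      then show "(\<lambda>n. nrm C (h (star A (X n)) \<ominus>\<^bsub>C\<^esub> star C (\<Phi> (CC X)))) \<longlonglongrightarrow> 0"
        using \<Phi>c(2)[OF X(1)] by simp
    qed (use Xc C.star_closed in simp)
    fix y assume "y \<in> carrier B"
    then obtain Y where Y: "Y \<in> CS" "y = CC Y" by (auto simp: carrier_B)
    note Yc = CS_closed[OF Y(1)] hc[OF CS_closed[OF Y(1)]] \<Phi>c(1)[OF Y(1)]
    show "\<Phi> (x \<oplus>\<^bsub>B\<^esub> y) = \<Phi> x \<oplus>\<^bsub>C\<^esub> \<Phi> y"
      unfolding X Y add_B[OF X(1) Y(1)]
    proof (rule \<Phi>[OF add_CS[OF X(1) Y(1)]], unfold L_def, intro conjI)
      have le: "nrm C (h (X n \<oplus> Y n) \<ominus>\<^bsub>C\<^esub> (\<Phi> (CC X) \<oplus>\<^bsub>C\<^esub> \<Phi> (CC Y)))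
          \<le> nrm C (h (X n) \<ominus>\<^bsub>C\<^esub> \<Phi> (CC X)) + nrm C (h (Y n) \<ominus>\<^bsub>C\<^esub> \<Phi> (CC Y))" for n
        using h' Xc Yc by (simp add: C.add_minus_add cstar_seminormD(2)[OF C.cstar_norm])
      show "(\<lambda>n. nrm C (h (X n \<oplus> Y n) \<ominus>\<^bsub>C\<^esub> (\<Phi> (CC X) \<oplus>\<^bsub>C\<^esub> \<Phi> (CC Y)))) \<longlonglongrightarrow> 0"
        by (rule C_null[OF _ le tendsto_add_zero[OF \<Phi>c(2)[OF X(1)] \<Phi>c(2)[OF Y(1)]]])
          (use Xc Yc hc in simp)
    qed (use Xc Yc in simp)
    show "\<Phi> (x \<otimes>\<^bsub>B\<^esub> y) = \<Phi> x \<otimes>\<^bsub>C\<^esub> \<Phi> y"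
      unfolding X Y mult_B[OF X(1) Y(1)]
    proof (rule \<Phi>[OF mult_CS[OF X(1) Y(1)]], unfold L_def, intro conjI)
      obtain K where K: "K > 0" "\<And>n. N (Y n) \<le> K" using CS_bounded[OF Y(1)] by blast
      interpret SC: seminormed_star_algebra C "nrm C" by standard (rule C.cstar_norm)
      have le: "nrm C (h (X n \<otimes> Y n) \<ominus>\<^bsub>C\<^esub> (\<Phi> (CC X) \<otimes>\<^bsub>C\<^esub> \<Phi> (CC Y)))
          \<le> nrm C (h (X n) \<ominus>\<^bsub>C\<^esub> \<Phi> (CC X)) * K
            + nrm C (\<Phi> (CC X)) * nrm C (h (Y n) \<ominus>\<^bsub>C\<^esub> \<Phi> (CC Y))" for n
      proof -
        have "h (X n \<otimes> Y n) = h (X n) \<otimes>\<^bsub>C\<^esub> h (Y n)" using h' Xc Yc by blast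
        then have "nrm C (h (X n \<otimes> Y n) \<ominus>\<^bsub>C\<^esub> (\<Phi> (CC X) \<otimes>\<^bsub>C\<^esub> \<Phi> (CC Y)))
          \<le> nrm C (h (X n) \<ominus>\<^bsub>C\<^esub> \<Phi> (CC X)) * nrm C (h (Y n))
            + nrm C (\<Phi> (CC X)) * nrm C (h (Y n) \<ominus>\<^bsub>C\<^esub> \<Phi> (CC Y))"
          using SC.N_mult_diff[OF Xc(2) Yc(2) Xc(3) Yc(3), of n n] by simp
        moreover have "nrm C (h (Y n)) \<le> K" using bound[OF Yc(1), of n] K(2)[of n] by linarith
        moreover have "0 \<le> nrm C (h (X n) \<ominus>\<^bsub>C\<^esub> \<Phi> (CC X))"
          using Xc by (intro cstar_seminormD(1)[OF C.cstar_norm]) auto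
        ultimately show ?thesis by (meson add_mono mult_left_mono order_refl order_trans)
      qed
      show "(\<lambda>n. nrm C (h (X n \<otimes> Y n) \<ominus>\<^bsub>C\<^esub> (\<Phi> (CC X) \<otimes>\<^bsub>C\<^esub> \<Phi> (CC Y)))) \<longlonglongrightarrow> 0"
        by (rule C_null[OF _ le]) (use Xc Yc hc in \<open>auto simp: mult_closed C.mult_closed
            intro!: tendsto_add_zero tendsto_mult_left_zero tendsto_mult_right_zero \<Phi>c(2) X(1) Y(1)\<close>)
    qed (use Xc Yc C.mult_closed in simp)
  qed
  then show ?thesis using ext contr by blast
qed

text \<open>A contractive *-homomorphism on the completion is determined by its values on the image of
  the algebra.\<close>

lemma (in seminormed_star_algebra) completion_hom_unique:
  assumes C: "cstar_algebra C" and h: "star_hom B C \<Phi>" and k: "star_hom B C \<Psi>"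
    and ch: "\<And>x. x \<in> carrier B \<Longrightarrow> nrm C (\<Phi> x) \<le> nrm B x"
    and ck: "\<And>x. x \<in> carrier B \<Longrightarrow> nrm C (\<Psi> x) \<le> nrm B x"
    and eq: "\<And>a. a \<in> carrier A \<Longrightarrow> \<Phi> (to_completion A N a) = \<Psi> (to_completion A N a)"
    and x: "x \<in> carrier B"
  shows "\<Phi> x = \<Psi> x"
proof -
  interpret C: cstar_algebra C by fact
  have minus: "f (y \<ominus>\<^bsub>B\<^esub> z) = f y \<ominus>\<^bsub>C\<^esub> f z" if "star_hom B C f" "y \<in> carrier B" "z \<in> carrier B" for f y z
  proof -
    note f = that(1)[unfolded star_hom_def]
    have "f y \<in> carrier C" "f z \<in> carrier C" using f that by blast+
    then show ?thesis using f that by (simp add: B.minus_eq_smult C.minus_eq_smult)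
  qed
  have cl: "\<Phi> y \<in> carrier C" "\<Psi> y \<in> carrier C" if "y \<in> carrier B" for y
    using h k that by (auto simp: star_hom_def)
  have "nrm C (\<Phi> x \<ominus>\<^bsub>C\<^esub> \<Psi> x) \<le> e" if "e > 0" for e
  proof -
    obtain a where a: "a \<in> carrier A" "nrm B (x \<ominus>\<^bsub>B\<^esub> to_completion A N a) < e/2"
      using dense_B[OF x, of "e/2"] \<open>e > 0\<close> by (auto simp: to_completion_def)
    let ?y = "to_completion A N a"
    have y: "?y \<in> carrier B" using to_completion_hom a by (auto simp: star_hom_def)
    have "nrm C (\<Phi> x \<ominus>\<^bsub>C\<^esub> \<Phi> ?y) \<le> e/2" "nrm C (\<Psi> x \<ominus>\<^bsub>C\<^esub> \<Phi> ?y) \<le> e/2"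
      using ch[of "x \<ominus>\<^bsub>B\<^esub> ?y"] ck[of "x \<ominus>\<^bsub>B\<^esub> ?y"] a x y
      by (simp_all add: minus[OF h] minus[OF k] eq)
    then show ?thesis
      using C.seminorm_triangle[OF C.cstar_norm cl(1)[OF x] cl(1)[OF y] cl(2)[OF x]]
        C.seminorm_minus_commute[OF C.cstar_norm cl(2)[OF x] cl(1)[OF y]] by simp
  qed
  then have "nrm C (\<Phi> x \<ominus>\<^bsub>C\<^esub> \<Psi> x) \<le> 0" by (rule field_le_epsilon[of _ 0, simplified]) 
  then show ?thesis
    using cstar_seminormD(1)[OF C.cstar_norm, of "\<Phi> x \<ominus>\<^bsub>C\<^esub> \<Psi> x"] cl[OF x]
    by (intro C.norm_minus_zeroD) auto
qed

section \<open>Universal C*-algebras\<close>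

lemma seminorm_one_le:
  assumes "unital A" "star_algebra A" "cstar_seminorm A p"
  shows "p \<one>\<^bsub>A\<^esub> \<le> 1"
proof -
  interpret star_algebra A by fact
  have o: "\<one>\<^bsub>A\<^esub> \<in> carrier A" using assms(1) by (simp add: unital_def)
  have "star A \<one>\<^bsub>A\<^esub> \<otimes>\<^bsub>A\<^esub> \<one>\<^bsub>A\<^esub> = star A \<one>\<^bsub>A\<^esub>"
    using assms(1) o star_closed[OF o] by (simp add: unital_def)
  then have "p \<one>\<^bsub>A\<^esub> = (p \<one>\<^bsub>A\<^esub>)\<^sup>2"
    using cstar_seminormD(5)[OF assms(3) o] seminorm_star[OF assms(3) o] by simp
  then have "p \<one>\<^bsub>A\<^esub> * (1 - p \<one>\<^bsub>A\<^esub>) = 0" by (simp add: power2_eq_square algebra_simps)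
  then show ?thesis by auto
qed

lemma relation_seminorms_bounded:
  assumes gens: "\<And>x. x \<in> X \<Longrightarrow> \<exists>K. \<forall>p\<in>relation_seminorms X rels. p (free_gen x) \<le> K"
    and a: "a \<in> carrier (free_star_alg X)"
  shows "\<exists>K. \<forall>p\<in>relation_seminorms X rels. p a \<le> K"
proof -
  let ?F = "free_star_alg X"
  have P: "cstar_seminorm ?F p" if "p \<in> relation_seminorms X rels" for p
    using that by (simp add: relation_seminorms_def)
  have w: "\<exists>K\<ge>0. \<forall>p\<in>relation_seminorms X rels. p (free_word v) \<le> K" if "v \<in> words X" for v
    using that
  proof (induction v)
    case Nil
    then show ?case
      using seminorm_one_le[OF unital_free star_algebra_free P] by (intro exI[of _ 1]) (simp add: free_simps)
  next
    case (Cons l v)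
    obtain x b where l: "l = (x, b)" by force
    have x: "x \<in> X" and v: "v \<in> words X" using Cons.prems by (auto simp: l)
    obtain K where K: "K \<ge> 0" "\<And>p. p \<in> relation_seminorms X rels \<Longrightarrow> p (free_word v) \<le> K" using Cons v by blast
    obtain L where L: "\<And>p. p \<in> relation_seminorms X rels \<Longrightarrow> p (free_gen x) \<le> L" using gens[OF x] by blast
    have g: "free_gen x \<in> carrier ?F" using x by (simp add: free_gen_word free_word_carrier)
    have w1: "free_word [(x, b)] \<in> carrier ?F" using x by (simp add: free_word_carrier)
    have L': "p (free_word [(x, b)]) \<le> \<bar>L\<bar>" if p: "p \<in> relation_seminorms X rels" for p
    proof (cases b)
      case True
      have "free_word [(x, True)] = star ?F (free_gen x)" by (simp add: free_gen_word free_star_word)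
      then show ?thesis using True L[OF p] F.seminorm_star[OF P[OF p] g] by simp
    next
      case False
      then show ?thesis using L[OF p] by (simp add: free_gen_word)
    qed
    have "p (free_word (l # v)) \<le> \<bar>L\<bar> * K" if p: "p \<in> relation_seminorms X rels" for p
    proof -
      have "p (free_word (l # v)) \<le> p (free_word [(x, b)]) * p (free_word v)"
        using cstar_seminormD(4)[OF P[OF p] w1 free_word_carrier[OF v]] by (simp add: free_word_mult l)
      also have "\<dots> \<le> \<bar>L\<bar> * K"
        using mult_mono[OF L'[OF p] K(2)[OF p]] cstar_seminormD(1)[OF P[OF p] free_word_carrier[OF v]] by simp
      finally show ?thesis .
    qed
    then show ?case using K by (intro exI[of _ "\<bar>L\<bar> * K"]) auto
  qed
  show ?thesis using a
  proof (induction a rule: free_induct)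
    case zero
    have "p (\<lambda>w. 0) = 0" if "p \<in> relation_seminorms X rels" for p
      using F.seminorm_zero[OF P[OF that]] by (simp add: free_simps)
    then show ?case by (metis order_refl)
  next
    case (word c v)
    then obtain K where K: "\<forall>p\<in>relation_seminorms X rels. p (free_word v) \<le> K" using w by blast
    have "p (c \<odot>\<^bsub>?F\<^esub> free_word v) \<le> cmod c * K" if "p \<in> relation_seminorms X rels" for p
      using cstar_seminormD(3)[OF P[OF that] free_word_carrier[OF word]] K that
      by (simp add: mult_left_mono)
    then show ?case by blast
  next
    case (add a b)
    then obtain K L where K: "\<forall>p\<in>relation_seminorms X rels. p a \<le> K" and L: "\<forall>p\<in>relation_seminorms X rels. p b \<le> L"
      by blast
    have "p (a \<oplus>\<^bsub>?F\<^esub> b) \<le> K + L" if "p \<in> relation_seminorms X rels" for p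
      using cstar_seminormD(2)[OF P[OF that] add(1,2)] K L that by fastforce
    then show ?case by blast
  qed
qed

locale admissible_relations =
  fixes X :: "'x set" and rels
  assumes rels_carrier: "rels \<subseteq> carrier (free_star_alg X) \<times> carrier (free_star_alg X)"
    and gens_bounded: "x \<in> X \<Longrightarrow> \<exists>K. \<forall>p\<in>relation_seminorms X rels. p (free_gen x) \<le> K"
begin

lemma seminorms_bounded:
  assumes "a \<in> carrier (free_star_alg X)"
  shows "\<exists>K. \<forall>p\<in>relation_seminorms X rels. p a \<le> K"
  using gens_bounded assms by (rule relation_seminorms_bounded)

lemma zero_seminorm: "(\<lambda>a. 0) \<in> relation_seminorms X rels"
  by (auto simp: relation_seminorms_def cstar_seminorm_def)

lemma universal_norm: "cstar_seminorm (free_star_alg X) (universal_norm X rels)"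
  unfolding universal_norm_def
proof (rule F.sup_seminorm_cstar)
  show "relation_seminorms X rels \<noteq> {}" using zero_seminorm by blast
next
  fix p assume "p \<in> relation_seminorms X rels"
  then show "cstar_seminorm (free_star_alg X) p" by (simp add: relation_seminorms_def)
next
  fix a assume "a \<in> carrier (free_star_alg X)"
  then show "\<exists>K. \<forall>p\<in>relation_seminorms X rels. p a \<le> K"
    by (rule seminorms_bounded)
qed

sublocale U: seminormed_star_algebra "free_star_alg X" "universal_norm X rels"
  by (intro seminormed_star_algebra.intro star_algebra_free seminormed_star_algebra_axioms.intro universal_norm)

lemma universal_cstar: "cstar_algebra (universal_cstar X rels)" "unital (universal_cstar X rels)"
  unfolding universal_cstar_def by (rule U.completion_cstar, rule U.unital_B[OF unital_free])

lemma universal_norm_upper: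
  assumes "p \<in> relation_seminorms X rels" "a \<in> carrier (free_star_alg X)"
  shows "p a \<le> universal_norm X rels a"
  unfolding universal_norm_def sup_seminorm_def
  using seminorms_bounded[OF assms(2)] assms(1)
  by (intro cSUP_upper) (auto simp: bdd_above_def)

lemma universal_relations:
  assumes "(a, b) \<in> rels"
  shows "to_completion (free_star_alg X) (universal_norm X rels) a =
    to_completion (free_star_alg X) (universal_norm X rels) b"
proof -
  have ab: "a \<in> carrier (free_star_alg X)" "b \<in> carrier (free_star_alg X)"
    using rels_carrier assms by auto
  have "(\<lambda>p. p (a \<ominus>\<^bsub>free_star_alg X\<^esub> b)) ` relation_seminorms X rels = {0}"
    using zero_seminorm assms by (force simp: relation_seminorms_def)
  then have "universal_norm X rels (a \<ominus>\<^bsub>free_star_alg X\<^esub> b) = 0"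
    by (simp add: universal_norm_def sup_seminorm_def)
  then show ?thesis
    unfolding to_completion_def using ab by (intro U.CC_eqI U.const_CS) simp_all
qed

theorem universal_property:
  assumes C: "cstar_algebra C" "unital C" and f: "\<And>x. x \<in> X \<Longrightarrow> f x \<in> carrier C"
    and sat: "\<And>a b. (a, b) \<in> rels \<Longrightarrow> free_value C f a = free_value C f b"
  shows "\<exists>\<Phi>. star_hom (universal_cstar X rels) C \<Phi> \<and> \<Phi> \<one>\<^bsub>universal_cstar X rels\<^esub> = \<one>\<^bsub>C\<^esub> \<and>
    (\<forall>x\<in>X. \<Phi> (universal_gen X rels x) = f x)"
proof -
  interpret C: cstar_algebra C by fact
  interpret free_evaluation C X f by standard (use C f in auto)
  note hom = value_hom[unfolded star_hom_def]
  have "(\<lambda>a. nrm C (free_value C f a)) \<in> relation_seminorms X rels"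
    unfolding relation_seminorms_def
  proof (intro CollectI conjI)
    show "cstar_seminorm FX (\<lambda>a. nrm C (free_value C f a))"
      unfolding cstar_seminorm_def
      by (simp add: value_closed value_add value_smult value_mult value_star F.mult_closed F.star_closed
          cstar_seminormD[OF C.cstar_norm])
    show "\<forall>(a, b)\<in>rels. nrm C (free_value C f (a \<ominus>\<^bsub>FX\<^esub> b)) = 0"
    proof clarify
      fix a b assume ab: "(a, b) \<in> rels"
      then have "a \<in> carrier FX" "b \<in> carrier FX" using rels_carrier by auto
      then have "free_value C f (a \<ominus>\<^bsub>FX\<^esub> b) = free_value C f a \<ominus>\<^bsub>C\<^esub> free_value C f b"
        by (simp add: F.minus_eq_smult C.minus_eq_smult value_add value_smult value_closed)
      then show "nrm C (free_value C f (a \<ominus>\<^bsub>FX\<^esub> b)) = 0"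
        using sat[OF ab] value_closed[OF \<open>b \<in> carrier FX\<close>] by (simp add: C.seminorm_self[OF C.cstar_norm])
    qed
  qed
  from U.completion_extend[OF C(1) value_hom universal_norm_upper[OF this]]
  obtain \<Phi> where "star_hom (universal_cstar X rels) C \<Phi>"
    "\<And>a. a \<in> carrier FX \<Longrightarrow> \<Phi> (to_completion FX (universal_norm X rels) a) = free_value C f a"
    unfolding universal_cstar_def by blast
  moreover have "\<one>\<^bsub>universal_cstar X rels\<^esub> = to_completion FX (universal_norm X rels) \<one>\<^bsub>FX\<^esub>"
    by (simp add: universal_cstar_def U.one_B to_completion_def)
  moreover have "free_gen x \<in> carrier FX" if "x \<in> X" for x
    using that by (simp add: free_gen_word free_word_carrier)
  ultimately show ?thesis
    using unital_free[of X] by (intro exI[of _ \<Phi>])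
      (auto simp: unital_def value_one universal_gen_def value_gen)
qed

end


section \<open>The universal property of \<open>\<AA>[R]\<close>\<close>

lemma (in star_algebra) smult_zero_complex: "x \<in> carrier A \<Longrightarrow> 0 \<odot> x = \<zero>"
  using smult_l_null[of x] by simp

lemma star_hom_zero:
  assumes "star_algebra A" "star_algebra B" "star_hom A B h"
  shows "h \<zero>\<^bsub>A\<^esub> = \<zero>\<^bsub>B\<^esub>"
proof -
  interpret A: star_algebra A by fact
  interpret B: star_algebra B by fact
  note h = assms(3)[unfolded star_hom_def]
  have "h (0 \<odot>\<^bsub>A\<^esub> \<zero>\<^bsub>A\<^esub>) = 0 \<odot>\<^bsub>B\<^esub> h \<zero>\<^bsub>A\<^esub>" using h A.zero_closed by blast
  moreover have "h \<zero>\<^bsub>A\<^esub> \<in> carrier B" using h A.zero_closed by blast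
  ultimately show ?thesis by (simp add: A.smult_zero_complex B.smult_zero_complex)
qed

lemma star_hom_finsum:
  assumes "star_algebra A" "star_algebra B" "star_hom A B h" and "\<And>i. i \<in> I \<Longrightarrow> g i \<in> carrier A"
  shows "h (finsum A g I) = finsum B (\<lambda>i. h (g i)) I"
proof -
  interpret A: star_algebra A by fact
  interpret B: star_algebra B by fact
  note h = assms(3)[unfolded star_hom_def]
  show ?thesis using assms(4)
  proof (induction I rule: infinite_finite_induct)
    case (insert i I)
    have "finsum A g I \<in> carrier A" using insert by (intro A.M.finsum_closed) auto
    moreover have "(\<lambda>i. h (g i)) \<in> I \<rightarrow> carrier B" using h insert by auto
    ultimately show ?case using insert h by (simp add: Pi_iff)
  qed (simp_all add: star_hom_zero[OF assms(1-3)] A.M.finsum_infinite B.M.finsum_infinite)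
qed

lemma cl_relations_hom:
  fixes s u :: "'r::idom \<Rightarrow> 'a"
  assumes A: "star_algebra A" "unital A" and B: "star_algebra B" and h: "star_hom A B h"
    and one: "h \<one>\<^bsub>A\<^esub> = \<one>\<^bsub>B\<^esub>"
    and s: "\<And>m. m \<noteq> 0 \<Longrightarrow> s m \<in> carrier A" and u: "\<And>n. u n \<in> carrier A"
  shows "(a, b) \<in> cl_relations A s u \<Longrightarrow> (h a, h b) \<in> cl_relations B (\<lambda>m. h (s m)) (\<lambda>n. h (u n))"
    and "(a, b) \<in> cl_relations A s u \<Longrightarrow> a \<in> carrier A \<and> b \<in> carrier A"
    and "(a', b') \<in> cl_relations B (\<lambda>m. h (s m)) (\<lambda>n. h (u n)) \<Longrightarrow>
      \<exists>a b. (a, b) \<in> cl_relations A s u \<and> a' = h a \<and> b' = h b"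
proof -
  interpret A: star_algebra A by fact
  interpret B: star_algebra B by fact
  note h' = h[unfolded star_hom_def]
  have oc: "\<one>\<^bsub>A\<^esub> \<in> carrier A" using A(2) by (simp add: unital_def)
  note [simp] = s u oc A.mult_closed A.star_closed one
  have hm: "h (x \<otimes>\<^bsub>A\<^esub> y) = h x \<otimes>\<^bsub>B\<^esub> h y" if "x \<in> carrier A" "y \<in> carrier A" for x y
    using h' that by blast
  have hs: "h (star A x) = star B (h x)" if "x \<in> carrier A" for x
    using h' that by blast
  have fin: "h (\<Oplus>\<^bsub>A\<^esub>C\<in>residue_classes m. u (l C) \<otimes>\<^bsub>A\<^esub> s m \<otimes>\<^bsub>A\<^esub> star A (s m) \<otimes>\<^bsub>A\<^esub> u (- l C)) =
    (\<Oplus>\<^bsub>B\<^esub>C\<in>residue_classes m. h (u (l C)) \<otimes>\<^bsub>B\<^esub> h (s m) \<otimes>\<^bsub>B\<^esub> star B (h (s m)) \<otimes>\<^bsub>B\<^esub> h (u (- l C)))"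
    if "m \<noteq> 0" for m l
    using that by (subst star_hom_finsum[OF A(1) B h]) (simp_all add: hm hs)
  show "(h a, h b) \<in> cl_relations B (\<lambda>m. h (s m)) (\<lambda>n. h (u n))" if "(a, b) \<in> cl_relations A s u"
    using that
    by cases (simp_all add: hm hs fin cl_relations.intros[where s = "\<lambda>m. h (s m)" and u = "\<lambda>n. h (u n)"])
  show "a \<in> carrier A \<and> b \<in> carrier A" if "(a, b) \<in> cl_relations A s u"
    using that by cases (simp_all add: Pi_iff)
  assume "(a', b') \<in> cl_relations B (\<lambda>m. h (s m)) (\<lambda>n. h (u n))"
  then show "\<exists>a b. (a, b) \<in> cl_relations A s u \<and> a' = h a \<and> b' = h b"
  proof cases
    case (isometry m)
    show ?thesis
      by (intro exI conjI, rule cl_relations.isometry[where m = m])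
        (use isometry in \<open>simp_all add: hm hs\<close>)
  next
    case (unitary1 n)
    show ?thesis
      by (intro exI conjI, rule cl_relations.unitary1[where n = n])
        (use unitary1 in \<open>simp_all add: hm hs\<close>)
  next
    case (unitary2 n)
    show ?thesis
      by (intro exI conjI, rule cl_relations.unitary2[where n = n])
        (use unitary2 in \<open>simp_all add: hm hs\<close>)
  next
    case (CL1 m m')
    show ?thesis
      by (intro exI conjI, rule cl_relations.CL1[where m = m and m' = m'])
        (use CL1 in \<open>simp_all add: hm hs\<close>)
  next
    case (CL2 n n')
    show ?thesis
      by (intro exI conjI, rule cl_relations.CL2[where n = n and n' = n'])
        (use CL2 in \<open>simp_all add: hm hs\<close>)
  next
    case (CL3 m n)
    show ?thesis
      by (intro exI conjI, rule cl_relations.CL3[where m = m and n = n])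
        (use CL3 in \<open>simp_all add: hm hs\<close>)
  next
    case (CL4 m l)
    show ?thesis
      by (intro exI conjI, rule cl_relations.CL4[where m = m and l = l])
        (use CL4 in \<open>simp_all add: fin\<close>)
  qed
qed

lemma cl_gens_closed:
  "m \<noteq> 0 \<Longrightarrow> free_gen (GenS m) \<in> carrier (free_star_alg cl_gens)"
  "free_gen (GenU n) \<in> carrier (free_star_alg cl_gens)"
  by (auto simp: free_gen_word cl_gens_def intro!: free_word_carrier)

lemma star_hom_id: "star_algebra A \<Longrightarrow> star_hom A A (\<lambda>x. x)"
  by (simp add: star_hom_def)

interpretation CL: admissible_relations "cl_gens :: 'r::idom cl_gen set" cl_rels
proof
  let ?F = "free_star_alg (cl_gens :: 'r cl_gen set)"
  show "(cl_rels :: (_ \<times> (('r cl_gen \<times> bool) list \<Rightarrow> complex)) set) \<subseteq> carrier ?F \<times> carrier ?F"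
  proof (rule subrelI)
    fix a b :: "('r cl_gen \<times> bool) list \<Rightarrow> complex" assume "(a, b) \<in> cl_rels"
    then have "(a, b) \<in> cl_relations ?F (\<lambda>m::'r. free_gen (GenS m)) (\<lambda>n. free_gen (GenU n))"
      by (simp add: cl_rels_def)
    then have "a \<in> carrier ?F \<and> b \<in> carrier ?F"
      by (rule cl_relations_hom(2)[OF star_algebra_free unital_free star_algebra_free
            star_hom_id[OF star_algebra_free] _ _ _, rotated 3]) (simp_all add: cl_gens_closed)
    then show "(a, b) \<in> carrier ?F \<times> carrier ?F" by simp
  qed
  fix x :: "'r cl_gen" assume x: "x \<in> cl_gens"
  have "(star ?F (free_gen x) \<otimes>\<^bsub>?F\<^esub> free_gen x, \<one>\<^bsub>?F\<^esub>) \<in> cl_rels"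
    using x unfolding cl_gens_def cl_rels_def by (auto intro: cl_relations.intros)
  moreover have g: "free_gen x \<in> carrier ?F" using x by (simp add: free_gen_word free_word_carrier)
  ultimately have "p (free_gen x) \<le> 1" if p: "p \<in> relation_seminorms cl_gens cl_rels" for p
  proof -
    have P: "cstar_seminorm ?F p" using p by (simp add: relation_seminorms_def)
    have o: "\<one>\<^bsub>?F\<^esub> \<in> carrier ?F" using unital_free[of cl_gens] unfolding unital_def by blast
    have sg: "star ?F (free_gen x) \<otimes>\<^bsub>?F\<^esub> free_gen x \<in> carrier ?F"
      by (intro F.mult_closed F.star_closed g)
    have "p (star ?F (free_gen x) \<otimes>\<^bsub>?F\<^esub> free_gen x \<ominus>\<^bsub>?F\<^esub> \<one>\<^bsub>?F\<^esub>) = 0"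
      using p \<open>_ \<in> cl_rels\<close> unfolding relation_seminorms_def by blast
    then have "(p (free_gen x))\<^sup>2 = p \<one>\<^bsub>?F\<^esub>"
      using F.seminorm_diff_le[OF P sg o] cstar_seminormD(5)[OF P g] by linarith
    also have "\<dots> \<le> 1\<^sup>2" using seminorm_one_le[OF unital_free star_algebra_free P] by (simp only: power_one)
    finally show ?thesis by (rule power2_le_imp_le) simp
  qed
  then show "\<exists>K. \<forall>p\<in>relation_seminorms cl_gens cl_rels. p (free_gen x) \<le> K" by blast
qed

theorem cl_algebra_cstar: "cstar_algebra cl_algebra" "unital cl_algebra"
  unfolding cl_algebra_def by (rule CL.universal_cstar)+

theorem cl_algebra_relations:
  assumes "(a, b) \<in> cl_relations cl_algebra (cl_s :: 'r::idom \<Rightarrow> _) cl_u"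
  shows "a = b"
proof -
  let ?h = "to_completion (free_star_alg cl_gens) (universal_norm cl_gens cl_rels)"
  have "?h \<one>\<^bsub>free_star_alg cl_gens\<^esub> = \<one>\<^bsub>cl_algebra\<^esub>"
    by (simp add: to_completion_def cl_algebra_def universal_cstar_def CL.U.one_B)
  moreover have "star_hom (free_star_alg cl_gens) cl_algebra ?h" "star_algebra (cl_algebra :: (nat \<Rightarrow> ('r cl_gen \<times> bool) list \<Rightarrow> complex) set normed_star_alg)"
    unfolding cl_algebra_def universal_cstar_def
    by (rule CL.U.to_completion_hom, rule CL.U.star_algebra_B)
  moreover have "(a, b) \<in> cl_relations cl_algebra (\<lambda>m. ?h (free_gen (GenS m))) (\<lambda>n. ?h (free_gen (GenU n)))"
    using assms unfolding cl_s_def[abs_def] cl_u_def[abs_def] universal_gen_def .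
  ultimately obtain a' b' where "(a', b') \<in> cl_relations (free_star_alg cl_gens) (\<lambda>m::'r. free_gen (GenS m)) (\<lambda>n. free_gen (GenU n))"
    "a = ?h a'" "b = ?h b'"
    using cl_relations_hom(3)[OF star_algebra_free unital_free, where s = "\<lambda>m::'r. free_gen (GenS m)"
        and u = "\<lambda>n. free_gen (GenU n)" and h = ?h and B = cl_algebra] cl_gens_closed by blast
  then show ?thesis using CL.universal_relations unfolding cl_rels_def by blast
qed

theorem cl_algebra_universal:
  fixes s u :: "'r::idom \<Rightarrow> 'a"
  assumes C: "cstar_algebra C" "unital C"
    and s: "\<And>m. m \<noteq> 0 \<Longrightarrow> s m \<in> carrier C" and u: "\<And>n. u n \<in> carrier C"
    and rels: "\<And>a b. (a, b) \<in> cl_relations C s u \<Longrightarrow> a = b"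
  shows "\<exists>\<Phi>. star_hom cl_algebra C \<Phi> \<and> \<Phi> \<one>\<^bsub>cl_algebra\<^esub> = \<one>\<^bsub>C\<^esub> \<and>
    (\<forall>m. m \<noteq> 0 \<longrightarrow> \<Phi> (cl_s m) = s m) \<and> (\<forall>n. \<Phi> (cl_u n) = u n)"
proof -
  interpret C: cstar_algebra C by fact
  define f where "f x = (case x of GenS m \<Rightarrow> if m = 0 then \<one>\<^bsub>C\<^esub> else s m | GenU n \<Rightarrow> u n)" for x
  have fc: "f x \<in> carrier C" if "x \<in> cl_gens" for x
    using that s u C(2) by (auto simp: f_def unital_def split: cl_gen.split)
  interpret free_evaluation C cl_gens f by standard (use C fc in auto)
  have v: "free_value C f (free_gen (GenU n)) = u n"
     "m \<noteq> 0 \<Longrightarrow> free_value C f (free_gen (GenS m)) = s m" for n m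
    by (simp_all add: value_gen cl_gens_def f_def)
  have sub: "(a, b) \<in> cl_relations C s2 u" if "(a, b) \<in> cl_relations C s1 u" "\<And>m. m \<noteq> 0 \<Longrightarrow> s1 m = s2 m"
    for s1 s2 a b
    using that(1) by cases (simp_all add: that(2) cl_relations.intros)
  have sat: "free_value C f a = free_value C f b" if "(a, b) \<in> cl_rels" for a b
  proof (rule rels[OF sub])
    show "(free_value C f a, free_value C f b) \<in> cl_relations C (\<lambda>m. free_value C f (free_gen (GenS m))) u"
      using cl_relations_hom(1)[where A = FX and B = C and h = "free_value C f"
            and s = "\<lambda>m. free_gen (GenS m)" and u = "\<lambda>n. free_gen (GenU n)",
          OF star_algebra_free unital_free C.star_algebra_axioms value_hom value_one] that cl_gens_closed
      unfolding cl_rels_def v(1) by blast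
  qed (simp add: v)
  obtain \<Phi> where "star_hom (universal_cstar cl_gens cl_rels) C \<Phi>"
    "\<Phi> \<one>\<^bsub>universal_cstar cl_gens cl_rels\<^esub> = \<one>\<^bsub>C\<^esub>"
    "\<And>x. x \<in> cl_gens \<Longrightarrow> \<Phi> (universal_gen cl_gens cl_rels x) = f x"
    using CL.universal_property[OF C fc sat] by blast
  moreover have "m \<noteq> 0 \<Longrightarrow> GenS m \<in> cl_gens" "GenU n \<in> cl_gens" for m n :: 'r
    by (auto simp: cl_gens_def)
  ultimately show ?thesis
    unfolding cl_algebra_def cl_s_def cl_u_def by (intro exI[of _ \<Phi>]) (simp add: f_def)
qed


section \<open>\<open>C(X)\<close> is a C*-algebra\<close>

lemma continuous_map_tendsto:
  fixes f :: "'x \<Rightarrow> 'y::topological_space"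
  shows "continuous_map X euclidean f \<longleftrightarrow> (\<forall>x\<in>topspace X. (f \<longlongrightarrow> f x) (atin X x))"
  by (simp add: continuous_map_atin)

lemma cont_alg_simps:
  "mult (cont_alg X) = (\<lambda>f g x. f x * g x)"
  "one (cont_alg X) = (\<lambda>x. if x \<in> topspace X then 1 else 0)"
  "zero (cont_alg X) = (\<lambda>x. 0)"
  "add (cont_alg X) = (\<lambda>f g x. f x + g x)"
  "smult (cont_alg X) = (\<lambda>c f x. c * f x)"
  "star (cont_alg X) = (\<lambda>f x. cnj (f x))"
  "nrm (cont_alg X) f = Sup (insert 0 ((\<lambda>x. cmod (f x)) ` topspace X))"
  by (simp_all add: cont_alg_def)

lemma cont_alg_carrier:
  "f \<in> carrier (cont_alg X) \<longleftrightarrow> continuous_map X euclidean f \<and> (\<forall>x. x \<notin> topspace X \<longrightarrow> f x = 0)"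
  by (simp add: cont_alg_def)

lemma star_algebra_cont: "star_algebra (cont_alg X)"
proof (rule star_algebraI)
  fix x y assume "x \<in> carrier (cont_alg X)" "y \<in> carrier (cont_alg X)"
  then show "x \<oplus>\<^bsub>cont_alg X\<^esub> y \<in> carrier (cont_alg X)"
    by (auto simp: cont_alg_carrier cont_alg_simps continuous_map_tendsto intro: tendsto_add)
next
  fix x c assume "x \<in> carrier (cont_alg X)"
  then show "c \<odot>\<^bsub>cont_alg X\<^esub> x \<in> carrier (cont_alg X)"
    by (auto simp: cont_alg_carrier cont_alg_simps continuous_map_tendsto intro: tendsto_mult_left)
next
  show "\<zero>\<^bsub>cont_alg X\<^esub> \<in> carrier (cont_alg X)"
    by (auto simp: cont_alg_carrier cont_alg_simps)
  show "star_algebra_axioms (cont_alg X)"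
  proof
    fix x assume x: "x \<in> carrier (cont_alg X)"
    then show "star (cont_alg X) x \<in> carrier (cont_alg X)"
      by (auto simp: cont_alg_carrier cont_alg_simps continuous_map_tendsto intro: tendsto_cnj)
    fix y assume "y \<in> carrier (cont_alg X)"
    with x show "x \<otimes>\<^bsub>cont_alg X\<^esub> y \<in> carrier (cont_alg X)"
      by (auto simp: cont_alg_carrier cont_alg_simps continuous_map_tendsto intro: tendsto_mult)
  qed (simp_all add: cont_alg_simps fun_eq_iff algebra_simps)
qed (simp_all add: cont_alg_simps fun_eq_iff algebra_simps)

interpretation CX: star_algebra "cont_alg X" for X :: "'x topology" by (rule star_algebra_cont)

lemma unital_cont: "unital (cont_alg X)"
proof -
  have "\<one>\<^bsub>cont_alg X\<^esub> \<in> carrier (cont_alg X)"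
  proof -
    have "continuous_map X euclidean (\<lambda>x. if x \<in> topspace X then 1 else (0::complex))"
      by (rule continuous_map_eq[of X euclidean "\<lambda>x. 1"]) auto
    then show ?thesis by (simp add: cont_alg_carrier cont_alg_simps)
  qed
  then show ?thesis by (auto simp: unital_def cont_alg_simps cont_alg_carrier fun_eq_iff)
qed

lemma cont_alg_minus:
  "\<lbrakk>f \<in> carrier (cont_alg X); g \<in> carrier (cont_alg X)\<rbrakk> \<Longrightarrow> (f \<ominus>\<^bsub>cont_alg X\<^esub> g) = (\<lambda>x. f x - g x)"
  by (simp add: CX.minus_eq_smult) (simp add: cont_alg_simps)

lemma cont_norm_le:
  assumes "B \<ge> 0" "\<And>x. x \<in> topspace X \<Longrightarrow> cmod (f x) \<le> B"
  shows "nrm (cont_alg X) f \<le> B"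
  unfolding cont_alg_simps by (rule cSup_least) (use assms in auto)

context
  fixes X :: "'x topology" assumes X: "compact_space X"
begin

lemma cont_norm_bdd:
  assumes "f \<in> carrier (cont_alg X)"
  shows "bdd_above (insert 0 ((\<lambda>x. cmod (f x)) ` topspace X))"
proof -
  have "compactin euclidean (f ` topspace X)"
    using assms X by (intro image_compactin[of X]) (auto simp: cont_alg_carrier compact_space_def)
  then have "bounded (f ` topspace X)" by (simp add: compact_imp_bounded)
  then obtain K where "\<And>x. x \<in> topspace X \<Longrightarrow> cmod (f x) \<le> K" by (auto simp: bounded_iff)
  then show ?thesis by (intro bdd_aboveI[of _ "max 0 K"]) (auto simp: le_max_iff_disj)
qed

lemma cont_norm_upper: "f \<in> carrier (cont_alg X) \<Longrightarrow> x \<in> topspace X \<Longrightarrow> cmod (f x) \<le> nrm (cont_alg X) f"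
  unfolding cont_alg_simps by (rule cSup_upper) (blast, erule cont_norm_bdd)

lemma cont_norm_nonneg: "f \<in> carrier (cont_alg X) \<Longrightarrow> 0 \<le> nrm (cont_alg X) f"
  unfolding cont_alg_simps by (rule cSup_upper) (blast, erule cont_norm_bdd)

lemma cont_norm_cstar: "cstar_seminorm (cont_alg X) (nrm (cont_alg X))"
  unfolding cstar_seminorm_def
proof (intro conjI ballI allI)
  let ?A = "cont_alg X"
  fix f assume f: "f \<in> carrier ?A"
  note uf = cont_norm_upper[OF f]
  show n0: "0 \<le> nrm ?A f" by (rule cont_norm_nonneg[OF f])
  show "nrm ?A (star ?A f \<otimes>\<^bsub>?A\<^esub> f) = (nrm ?A f)\<^sup>2"
  proof (rule antisym)
    have sq: "cmod ((star ?A f \<otimes>\<^bsub>?A\<^esub> f) x) = (cmod (f x))\<^sup>2" for x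
      by (simp add: cont_alg_simps norm_mult power2_eq_square)
    show "nrm ?A (star ?A f \<otimes>\<^bsub>?A\<^esub> f) \<le> (nrm ?A f)\<^sup>2"
      by (rule cont_norm_le) (auto simp: sq intro!: power_mono uf)
    have ff: "star ?A f \<otimes>\<^bsub>?A\<^esub> f \<in> carrier ?A" using f by (simp add: CX.mult_closed CX.star_closed)
    have "nrm ?A f \<le> sqrt (nrm ?A (star ?A f \<otimes>\<^bsub>?A\<^esub> f))"
      using cont_norm_upper[OF ff] cont_norm_nonneg[OF ff] by (intro cont_norm_le) (auto simp: sq real_le_rsqrt)
    then have "(nrm ?A f)\<^sup>2 \<le> (sqrt (nrm ?A (star ?A f \<otimes>\<^bsub>?A\<^esub> f)))\<^sup>2" using n0 by (rule power_mono)
    then show "(nrm ?A f)\<^sup>2 \<le> nrm ?A (star ?A f \<otimes>\<^bsub>?A\<^esub> f)" using cont_norm_nonneg[OF ff] by simp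
  qed
  fix g assume g: "g \<in> carrier ?A"
  note ug = cont_norm_upper[OF g]
  show "nrm ?A (f \<oplus>\<^bsub>?A\<^esub> g) \<le> nrm ?A f + nrm ?A g"
    by (rule cont_norm_le)
      (auto simp: cont_norm_nonneg f g cont_alg_simps(4) intro!: order_trans[OF norm_triangle_ineq] add_mono uf ug)
  show "nrm ?A (f \<otimes>\<^bsub>?A\<^esub> g) \<le> nrm ?A f * nrm ?A g"
    by (rule cont_norm_le)
      (auto simp: cont_norm_nonneg f g cont_alg_simps(1) norm_mult intro!: mult_mono uf ug)
next
  let ?A = "cont_alg X"
  have le: "nrm ?A (c \<odot>\<^bsub>?A\<^esub> f) \<le> cmod c * nrm ?A f" if f: "f \<in> carrier ?A" for f c
    by (rule cont_norm_le)
      (auto simp: cont_norm_nonneg f cont_alg_simps(5) norm_mult intro!: mult_left_mono cont_norm_upper)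
  fix c f assume f: "f \<in> carrier ?A"
  show "nrm ?A (c \<odot>\<^bsub>?A\<^esub> f) = cmod c * nrm ?A f"
  proof (cases "c = 0")
    case True
    then show ?thesis using le[OF f, of c] cont_norm_nonneg[of "c \<odot>\<^bsub>?A\<^esub> f"] f by simp
  next
    case False
    have "inverse c \<odot>\<^bsub>?A\<^esub> (c \<odot>\<^bsub>?A\<^esub> f) = f" using False by (simp add: cont_alg_simps fun_eq_iff)
    then have "nrm ?A f \<le> cmod (inverse c) * nrm ?A (c \<odot>\<^bsub>?A\<^esub> f)"
      using le[of "c \<odot>\<^bsub>?A\<^esub> f" "inverse c"] f by simp
    then have "cmod c * nrm ?A f \<le> nrm ?A (c \<odot>\<^bsub>?A\<^esub> f)"
      using False by (simp add: norm_inverse norm_divide field_simps)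
    then show ?thesis using le[OF f, of c] by simp
  qed
qed

lemma cstar_cont: "cstar_algebra (cont_alg X)"
proof
  let ?A = "cont_alg X"
  show "cstar_seminorm ?A (nrm ?A)" by (rule cont_norm_cstar)
  show "f = \<zero>\<^bsub>?A\<^esub>" if f: "f \<in> carrier ?A" "nrm ?A f = 0" for f
    using cont_norm_upper[OF f(1)] f by (auto simp: cont_alg_carrier cont_alg_simps(3) fun_eq_iff)
  fix F assume F: "F \<in> cauchy_seqs ?A (nrm ?A)"
  have Fc: "F n \<in> carrier ?A" for n using F by (simp add: cauchy_seqs_def)
  have small: "\<exists>k. \<forall>m\<ge>k. \<forall>n\<ge>k. \<forall>x\<in>topspace X. cmod (F m x - F n x) < e" if e: "e > 0" for e
  proof -
    obtain k where k: "\<forall>m\<ge>k. \<forall>n\<ge>k. nrm ?A (F m \<ominus>\<^bsub>?A\<^esub> F n) < e"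
      using F e unfolding cauchy_seqs_def by blast
    have "cmod (F m x - F n x) < e" if "m \<ge> k" "n \<ge> k" "x \<in> topspace X" for m n x
      using k that cont_norm_upper[OF CX.minus_closed[OF Fc Fc] that(3), of m n]
      by (simp add: cont_alg_minus Fc) (meson le_less_trans)
    then show ?thesis by blast
  qed
  have "Cauchy (\<lambda>n. F n x)" for x
  proof (cases "x \<in> topspace X")
    case True
    show ?thesis
      by (rule metric_CauchyI) (use small True in \<open>fastforce simp: dist_norm\<close>)
  next
    case False
    then have "(\<lambda>n. F n x) = (\<lambda>n. 0)" using Fc by (auto simp: cont_alg_carrier)
    then show ?thesis by (simp add: Cauchy_def)
  qed
  then have "\<exists>l. (\<lambda>n. F n x) \<longlonglongrightarrow> l" for x using Cauchy_convergent convergentD by blast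
  then obtain g where g: "\<And>x. (\<lambda>n. F n x) \<longlonglongrightarrow> g x" by metis
  have close: "\<exists>k. \<forall>n\<ge>k. \<forall>x\<in>topspace X. cmod (F n x - g x) \<le> e" if e: "e > 0" for e
  proof -
    obtain k where k: "\<And>m n x. \<lbrakk>m \<ge> k; n \<ge> k; x \<in> topspace X\<rbrakk> \<Longrightarrow> cmod (F m x - F n x) < e"
      using small[OF e] by blast
    have "cmod (F n x - g x) \<le> e" if "n \<ge> k" "x \<in> topspace X" for n x
    proof (rule LIMSEQ_le_const2)
      show "(\<lambda>m. cmod (F n x - F m x)) \<longlonglongrightarrow> cmod (F n x - g x)" by (intro tendsto_intros g)
      show "\<exists>N. \<forall>m\<ge>N. cmod (F n x - F m x) \<le> e" using k that by (meson less_imp_le)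
    qed
    then show ?thesis by blast
  qed
  have "continuous_map X Met_TC.mtopology g"
  proof (rule Met_TC.continuous_map_uniform_limit[of _ F sequentially])
    show "\<forall>\<^sub>F n in sequentially. continuous_map X Met_TC.mtopology (F n)"
      using Fc by (simp add: cont_alg_carrier)
    show "\<forall>\<^sub>F n in sequentially. \<forall>x\<in>topspace X. g x \<in> UNIV \<and> dist (F n x) (g x) < e" if e: "e > 0" for e
    proof -
      obtain k where "\<forall>n\<ge>k. \<forall>x\<in>topspace X. cmod (F n x - g x) \<le> e/2" using close[OF half_gt_zero[OF e]] by blast
      then have "\<forall>n\<ge>k. \<forall>x\<in>topspace X. dist (F n x) (g x) < e" using e by (fastforce simp: dist_norm)
      then show ?thesis unfolding eventually_sequentially by blast
    qed
  qed simp
  moreover have "g x = 0" if "x \<notin> topspace X" for x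
  proof -
    have "(\<lambda>n. F n x) = (\<lambda>n. 0)" using Fc that by (auto simp: cont_alg_carrier)
    then show ?thesis using g[of x] by (simp add: LIMSEQ_const_iff)
  qed
  ultimately have gc: "g \<in> carrier ?A" by (simp add: cont_alg_carrier)
  have "(\<lambda>n. nrm ?A (F n \<ominus>\<^bsub>?A\<^esub> g)) \<longlonglongrightarrow> 0"
  proof (rule LIMSEQ_I)
    fix e :: real assume e: "e > 0"
    obtain k where k: "\<forall>n\<ge>k. \<forall>x\<in>topspace X. cmod (F n x - g x) \<le> e/2" using close[of "e/2"] e by auto
    have "norm (nrm ?A (F n \<ominus>\<^bsub>?A\<^esub> g) - 0) < e" if n: "n \<ge> k" for n
    proof -
      have "nrm ?A (F n \<ominus>\<^bsub>?A\<^esub> g) \<le> e/2"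
        by (rule cont_norm_le) (use k n e in \<open>auto simp: cont_alg_minus Fc gc\<close>)
      moreover have "0 \<le> nrm ?A (F n \<ominus>\<^bsub>?A\<^esub> g)" by (intro cont_norm_nonneg CX.minus_closed Fc gc)
      ultimately show ?thesis using e by simp
    qed
    then show "\<exists>k. \<forall>n\<ge>k. norm (nrm ?A (F n \<ominus>\<^bsub>?A\<^esub> g) - 0) < e" by blast
  qed
  then show "\<exists>g\<in>carrier ?A. (\<lambda>n. nrm ?A (F n \<ominus>\<^bsub>?A\<^esub> g)) \<longlonglongrightarrow> 0" using gc by blast
qed

end

section \<open>Partial actions on \<open>C(X)\<close> induced by partial actions on \<open>X\<close>\<close>

locale clopen_partial_action = group G for G :: "('g, 'k) monoid_scheme" (structure) +
  fixes X :: "'x topology" and V :: "'g \<Rightarrow> 'x set" and \<theta> :: "'g \<Rightarrow> 'x \<Rightarrow> 'x"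
  assumes compact: "compact_space X"
    and clopen: "g \<in> carrier G \<Longrightarrow> openin X (V g) \<and> closedin X (V g)"
    and theta_cont: "g \<in> carrier G \<Longrightarrow> continuous_map (subtopology X (V (inv g))) X (\<theta> g)"
    and theta_range: "\<lbrakk>g \<in> carrier G; x \<in> V (inv g)\<rbrakk> \<Longrightarrow> \<theta> g x \<in> V g"
    and V_one: "V \<one> = topspace X"
    and theta_one: "x \<in> topspace X \<Longrightarrow> \<theta> \<one> x = x"
    and theta_mult: "\<lbrakk>g \<in> carrier G; h \<in> carrier G; x \<in> V (inv h); x \<in> V (inv (g \<otimes> h))\<rbrakk> \<Longrightarrow>
      \<theta> g (\<theta> h x) = \<theta> (g \<otimes> h) x"
    and theta_dom: "\<lbrakk>g \<in> carrier G; h \<in> carrier G; x \<in> V (inv g); x \<in> V h\<rbrakk> \<Longrightarrow> \<theta> g x \<in> V (g \<otimes> h)"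
begin

abbreviation "act \<equiv> induced_action G V \<theta>"
abbreviation "ID g \<equiv> cont_ideal X (V g)"

lemma V_sub: "g \<in> carrier G \<Longrightarrow> V g \<subseteq> topspace X"
  using clopen openin_subset by blast

lemma theta_inv: "\<lbrakk>g \<in> carrier G; x \<in> V g\<rbrakk> \<Longrightarrow> \<theta> g (\<theta> (inv g) x) = x"
  using theta_mult[of g "inv g" x] V_sub[of g] V_one theta_one by (auto simp: subset_iff)

lemma ID_iff: "f \<in> ID g \<longleftrightarrow> f \<in> carrier (cont_alg X) \<and> (\<forall>x. x \<notin> V g \<longrightarrow> f x = 0)"
  by (simp add: cont_ideal_def)

lemma act_apply: "act g f x = (if x \<in> V g then f (\<theta> (inv g) x) else 0)"
  by (simp add: induced_action_def)

lemma act_closed: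
  assumes g: "g \<in> carrier G" and f: "f \<in> carrier (cont_alg X)"
  shows "act g f \<in> ID g"
proof -
  have fc: "continuous_map X euclidean f" using f by (simp add: cont_alg_carrier)
  have tc: "continuous_map (subtopology X (V g)) X (\<theta> (inv g))"
    using theta_cont[of "inv g"] g by simp
  have c: "continuous_map (subtopology X (V g)) euclidean (\<lambda>x. f (\<theta> (inv g) x))"
    using continuous_map_compose[OF tc fc] by (simp add: comp_def)
  have "continuous_map X euclidean (act g f)"
    unfolding continuous_map_def
  proof (intro conjI allI impI)
    fix W :: "complex set" assume W: "openin euclidean W"
    have "openin X {x \<in> topspace (subtopology X (V g)). f (\<theta> (inv g) x) \<in> W}"
      by (rule openin_trans_full[OF openin_continuous_map_preimage[OF c W]]) (use clopen g in blast)
    moreover have "openin X (if 0 \<in> W then topspace X - V g else {})"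
      using clopen[OF g] by (auto simp: closedin_def)
    ultimately have "openin X ({x \<in> topspace (subtopology X (V g)). f (\<theta> (inv g) x) \<in> W} \<union>
        (if 0 \<in> W then topspace X - V g else {}))" by (rule openin_Un)
    also have "\<dots> = {x \<in> topspace X. act g f x \<in> W}" by (auto simp: act_apply)
    finally show "openin X {x \<in> topspace X. act g f x \<in> W}" .
  qed simp
  then show ?thesis using V_sub[OF g] by (auto simp: ID_iff cont_alg_carrier act_apply)
qed

lemma act_inv:
  assumes g: "g \<in> carrier G" and f: "f \<in> ID g" shows "act g (act (inv g) f) = f"
proof
  fix x show "act g (act (inv g) f) x = f x"
    using f g theta_range[of "inv g" x] theta_inv[of g x] by (auto simp: act_apply ID_iff)
qed

lemma ideal_ID: assumes g: "g \<in> carrier G" shows "closed_ideal (cont_alg X) (ID g)"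
  unfolding closed_ideal_def
proof (intro conjI ballI allI impI)
  show "ID g \<subseteq> carrier (cont_alg X)" "\<zero>\<^bsub>cont_alg X\<^esub> \<in> ID g"
    using CX.zero_closed[of X] by (auto simp: ID_iff) (simp add: cont_alg_simps)
next
  fix x y assume "x \<in> ID g" "y \<in> ID g"
  then show "x \<oplus>\<^bsub>cont_alg X\<^esub> y \<in> ID g" by (auto simp: ID_iff) (simp add: cont_alg_simps)
next
  fix c x assume "x \<in> ID g"
  then show "c \<odot>\<^bsub>cont_alg X\<^esub> x \<in> ID g" by (auto simp: ID_iff) (simp add: cont_alg_simps)
next
  fix a x assume "a \<in> carrier (cont_alg X)" "x \<in> ID g"
  then show "a \<otimes>\<^bsub>cont_alg X\<^esub> x \<in> ID g" "x \<otimes>\<^bsub>cont_alg X\<^esub> a \<in> ID g"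
    by (auto simp: ID_iff CX.mult_closed) (simp_all add: cont_alg_simps)
next
  fix F f assume f: "f \<in> carrier (cont_alg X)" and F: "\<forall>n. F n \<in> ID g"
    and lim: "(\<lambda>n. nrm (cont_alg X) (F n \<ominus>\<^bsub>cont_alg X\<^esub> f)) \<longlonglongrightarrow> 0"
  have Fc: "F n \<in> carrier (cont_alg X)" for n using F by (simp add: ID_iff)
  have "f x = 0" if x: "x \<in> topspace X" "x \<notin> V g" for x
  proof -
    have "cmod (f x) \<le> nrm (cont_alg X) (F n \<ominus>\<^bsub>cont_alg X\<^esub> f)" for n
      using cont_norm_upper[OF compact CX.minus_closed[OF Fc f] x(1), of n] F x(2)
      by (simp add: cont_alg_minus Fc f ID_iff)
    then have "cmod (f x) \<le> 0" by (intro LIMSEQ_le_const[OF lim]) auto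
    then show ?thesis by simp
  qed
  then show "f \<in> ID g" using f by (auto simp: ID_iff cont_alg_carrier)
qed

lemma iso_act:
  assumes g: "g \<in> carrier G"
  shows "star_iso (cont_alg X\<lparr>carrier := ID (inv g)\<rparr>) (cont_alg X\<lparr>carrier := ID g\<rparr>) (act g)"
  unfolding star_iso_def
proof
  have c: "act g f \<in> ID g" if "f \<in> ID (inv g)" for f
    using that act_closed[OF g, of f] by (simp add: ID_iff)
  have c': "act (inv g) f \<in> ID (inv g)" if "f \<in> ID g" for f
    using that act_closed[of "inv g" f] g by (simp add: ID_iff)
  show "star_hom (cont_alg X\<lparr>carrier := ID (inv g)\<rparr>) (cont_alg X\<lparr>carrier := ID g\<rparr>) (act g)"
    unfolding star_hom_def using c by (auto simp: cont_alg_simps act_apply fun_eq_iff)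
  show "bij_betw (act g) (carrier (cont_alg X\<lparr>carrier := ID (inv g)\<rparr>)) (carrier (cont_alg X\<lparr>carrier := ID g\<rparr>))"
    by (rule bij_betw_byWitness[where f' = "act (inv g)"])
      (use c c' act_inv[OF g] act_inv[of "inv g"] g in auto)
qed

theorem partial_action_cont: "partial_action G (cont_alg X) ID act"
proof (intro partial_action.intro partial_action_axioms.intro)
  show "group G" by (rule is_group)
  show "cstar_algebra (cont_alg X)" by (rule cstar_cont[OF compact])
  show "ID \<one> = carrier (cont_alg X)" by (auto simp: cont_ideal_def V_one cont_alg_carrier)
  show "act \<one> f = f" if "f \<in> carrier (cont_alg X)" for f
    using that theta_one by (auto simp: act_apply V_one cont_alg_carrier fun_eq_iff)
next
  fix g h assume g: "g \<in> carrier G" and h: "h \<in> carrier G"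
  have sub: "act g f \<in> ID g \<inter> ID (g \<otimes> h)" if f: "f \<in> ID (inv g) \<inter> ID h" and g: "g \<in> carrier G" and h: "h \<in> carrier G" for f g h
  proof
    have fc: "f \<in> carrier (cont_alg X)" using f by (simp add: ID_iff)
    show "act g f \<in> ID g" by (rule act_closed[OF g fc])
    have "act g f x = 0" if x: "x \<notin> V (g \<otimes> h)" for x
    proof (cases "x \<in> V g")
      case True
      have "\<theta> (inv g) x \<notin> V h"
        using x True g h theta_dom[of g h "\<theta> (inv g) x"] theta_range[of "inv g" x] theta_inv[of g x] by auto
      then show ?thesis using f by (simp add: act_apply ID_iff)
    qed (simp add: act_apply)
    then show "act g f \<in> ID (g \<otimes> h)" using act_closed[OF g fc] by (simp add: ID_iff)
  qed
  show "act g ` (ID (inv g) \<inter> ID h) = ID g \<inter> ID (g \<otimes> h)"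
  proof (intro subset_antisym subsetI)
    fix f assume f: "f \<in> ID g \<inter> ID (g \<otimes> h)"
    have "act (inv g) f \<in> ID (inv g) \<inter> ID (inv g \<otimes> (g \<otimes> h))"
      by (rule sub) (use f g h in auto)
    also have "inv g \<otimes> (g \<otimes> h) = h" using g h by (simp add: m_assoc[symmetric])
    finally show "f \<in> act g ` (ID (inv g) \<inter> ID h)" using act_inv[OF g, of f] f by (metis IntD1 image_eqI)
  qed (use sub g h in blast)
  fix f assume f: "f \<in> ID (inv h) \<inter> ID (inv (g \<otimes> h))"
  show "act g (act h f) = act (g \<otimes> h) f"
  proof
    fix x
    have gh: "inv (g \<otimes> h) = inv h \<otimes> inv g" using g h by (simp add: inv_mult_group)
    show "act g (act h f) x = act (g \<otimes> h) f x"
    proof (cases "x \<in> V g")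
      case True
      have *: "\<theta> (inv g) x \<in> V h \<longleftrightarrow> x \<in> V (g \<otimes> h)"
      proof
        assume "\<theta> (inv g) x \<in> V h"
        then show "x \<in> V (g \<otimes> h)"
          using theta_dom[of g h "\<theta> (inv g) x"] theta_range[of "inv g" x] theta_inv[of g x] True g h by auto
      next
        assume "x \<in> V (g \<otimes> h)"
        then have "\<theta> (inv g) x \<in> V (inv g \<otimes> (g \<otimes> h))"
          using theta_dom[of "inv g" "g \<otimes> h" x] True g h by auto
        then show "\<theta> (inv g) x \<in> V h" using g h by (simp add: m_assoc[symmetric])
      qed
      have "\<theta> (inv h) (\<theta> (inv g) x) = \<theta> (inv (g \<otimes> h)) x" if "x \<in> V (g \<otimes> h)"
        using theta_mult[of "inv h" "inv g" x] that True g h by (simp add: gh[symmetric])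
      then show ?thesis using True * by (simp add: act_apply)
    next
      case False
      have "f (\<theta> (inv (g \<otimes> h)) x) = 0" if x: "x \<in> V (g \<otimes> h)"
      proof -
        have "\<theta> (inv (g \<otimes> h)) x \<notin> V (inv h)"
        proof
          assume "\<theta> (inv (g \<otimes> h)) x \<in> V (inv h)"
          then have "\<theta> (g \<otimes> h) (\<theta> (inv (g \<otimes> h)) x) \<in> V (g \<otimes> h \<otimes> inv h)"
            using theta_dom[of "g \<otimes> h" "inv h"] theta_range[of "inv (g \<otimes> h)" x] x g h by auto
          then show False using False theta_inv[of "g \<otimes> h" x] x g h by (simp add: m_assoc)
        qed
        then show ?thesis using f by (simp add: ID_iff)
      qed
      then show ?thesis using False by (simp add: act_apply)
    qed
  qed
qed (rule ideal_ID, assumption, rule iso_act)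

end


section \<open>The partial action of \<open>K \<rtimes> K\<^sup>\<times>\<close>\<close>

lemma affine_group_simps [simp]:
  "(u, w) \<in> carrier affine_group \<longleftrightarrow> w \<noteq> 0"
  "(u, w) \<otimes>\<^bsub>affine_group\<^esub> (u', w') = (u + u' * w, w * w')"
  "\<one>\<^bsub>affine_group\<^esub> = (0, 1)"
  by (simp_all add: affine_group_def)

lemma group_affine: "group (affine_group :: ('k::field \<times> 'k) monoid)"
proof (rule groupI)
  fix x :: "'k \<times> 'k" assume "x \<in> carrier affine_group"
  then show "\<exists>y\<in>carrier affine_group. y \<otimes>\<^bsub>affine_group\<^esub> x = \<one>\<^bsub>affine_group\<^esub>"
    by (intro bexI[of _ "(- fst x / snd x, 1 / snd x)"]) (cases x; simp add: field_simps)+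
qed (auto simp: affine_group_def algebra_simps)

lemma affine_inv [simp]:
  "w \<noteq> 0 \<Longrightarrow> inv\<^bsub>affine_group\<^esub> (u, w) = (- u / w, 1 / (w :: 'k::field))"
  by (rule group.inv_equality[OF group_affine]) (auto simp: field_simps)

lemma to_fract_mult: "to_fract (x * y) = to_fract x * to_fract y"
  by simp

lemma frac_ideal_iff: "z \<in> frac_ideal w \<longleftrightarrow> (\<exists>r. z = w * to_fract r)"
  by (auto simp: frac_ideal_def)

lemma frac_ideal_add: "\<lbrakk>a \<in> frac_ideal w; b \<in> frac_ideal w\<rbrakk> \<Longrightarrow> a + b \<in> frac_ideal w"
  unfolding frac_ideal_iff by (metis distrib_left to_fract_add)

lemma frac_ideal_uminus: "a \<in> frac_ideal w \<Longrightarrow> - a \<in> frac_ideal w"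
  unfolding frac_ideal_iff by (metis mult_minus_right to_fract_uminus)

lemma frac_ideal_zero [simp]: "0 \<in> frac_ideal w"
  unfolding frac_ideal_iff by (metis mult_zero_right to_fract_0)

lemma frac_ideal_mono: "frac_le w w' \<Longrightarrow> frac_ideal w' \<subseteq> frac_ideal w"
  unfolding frac_le_def frac_ideal_def
  by (auto simp: mult.assoc simp flip: to_fract_mult)

lemma frac_coset_iff: "z \<in> frac_coset u w \<longleftrightarrow> z - u \<in> frac_ideal w"
  by (auto simp: frac_coset_def image_iff) (metis add_diff_cancel_left' diff_add_cancel add.commute)

lemma frac_coset_eq_iff: "frac_coset u w = frac_coset v w \<longleftrightarrow> u - v \<in> frac_ideal w"
proof
  assume "frac_coset u w = frac_coset v w"
  then show "u - v \<in> frac_ideal w" using frac_coset_iff[of u u w] frac_coset_iff[of u v w] by simp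
next
  assume uv: "u - v \<in> frac_ideal w"
  show "frac_coset u w = frac_coset v w"
  proof (rule Set.set_eqI)
    fix z
    show "z \<in> frac_coset u w \<longleftrightarrow> z \<in> frac_coset v w"
      using frac_ideal_add[OF uv, of "z - u"] frac_ideal_add[OF frac_ideal_uminus[OF uv], of "z - v"]
      by (auto simp: frac_coset_iff)
  qed
qed

lemma frac_coset_image: "(\<lambda>k. u + w * k) ` frac_coset v z = frac_coset (u + w * v) (w * z)"
  by (auto simp: frac_coset_def frac_ideal_def image_image distrib_left mult.assoc add.assoc)

lemma frac_quot_eq: "frac_quot w = range (\<lambda>r. frac_coset (to_fract r) w)"
proof -
  have "frac_coset (to_fract r + v) w = frac_coset (to_fract r) w" if "v \<in> frac_ideal w" for r v
    using that by (simp add: frac_coset_eq_iff)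
  then show ?thesis unfolding frac_quot_def using frac_ideal_zero by fastforce
qed

text \<open>The projections are well defined.\<close>

lemma frac_proj_coset: "frac_le w w' \<Longrightarrow> frac_proj w (frac_coset u w') = frac_coset u w"
proof -
  assume le: "frac_le w w'"
  have "frac_coset v w = frac_coset u w" if "v \<in> frac_coset u w'" for v
    using that frac_ideal_mono[OF le] by (auto simp: frac_coset_eq_iff frac_coset_iff)
  moreover have "u \<in> frac_coset u w'" by (simp add: frac_coset_iff)
  ultimately show ?thesis unfolding frac_proj_def by blast
qed

lemma frac_coset_one: "frac_coset (to_fract r) 1 = frac_coset 0 1"
  by (auto simp: frac_coset_eq_iff frac_ideal_iff)

lemma hat_closed: "x \<in> hat_set \<Longrightarrow> w \<noteq> 0 \<Longrightarrow> x w \<in> frac_quot w"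
  by (auto simp: hat_set_def PiE_iff)

lemma hat_compat: "\<lbrakk>x \<in> hat_set; w \<noteq> 0; w' \<noteq> 0; frac_le w w'\<rbrakk> \<Longrightarrow> frac_proj w (x w') = x w"
  by (simp add: hat_set_def)

lemma fract_eq_divide:
  obtains a b :: "'r::idom" where "b \<noteq> 0" "w = to_fract a / to_fract b"
  by (cases w) (auto simp: to_fract_def)

lemma frac_upper_bound:
  assumes "w1 \<noteq> 0" "w2 \<noteq> (0 :: 'r::idom fract)"
  obtains v where "v \<noteq> 0" "frac_le w1 v" "frac_le w2 v"
proof -
  obtain a b where a: "b \<noteq> 0" "w1 = to_fract a / to_fract b" by (rule fract_eq_divide)
  obtain c d where c: "d \<noteq> 0" "w2 = to_fract c / to_fract d" by (rule fract_eq_divide)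
  show ?thesis
  proof (rule that[of "to_fract (a * c)"])
    show "to_fract (a * c) \<noteq> 0" using assms a c by auto
    show "frac_le w1 (to_fract (a * c))" unfolding frac_le_def
      by (rule exI[of _ "b * c"]) (use a in \<open>simp add: field_simps\<close>)
    show "frac_le w2 (to_fract (a * c))" unfolding frac_le_def
      by (rule exI[of _ "a * d"]) (use c in \<open>simp add: field_simps\<close>)
  qed
qed

lemma frac_le_trans: "frac_le u v \<Longrightarrow> frac_le v w \<Longrightarrow> frac_le u w"
  unfolding frac_le_def by (metis mult.assoc to_fract_mult)

lemma hat_common_rep:
  assumes x: "x \<in> hat_set" and w: "w1 \<noteq> 0" "w2 \<noteq> 0" "w3 \<noteq> 0"
  obtains r where "x w1 = frac_coset (to_fract r) w1" "x w2 = frac_coset (to_fract r) w2"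
    "x w3 = frac_coset (to_fract r) w3"
proof -
  obtain v' where v': "v' \<noteq> 0" "frac_le w1 v'" "frac_le w2 v'" using frac_upper_bound w by blast
  obtain v where v: "v \<noteq> 0" "frac_le v' v" "frac_le w3 v" using frac_upper_bound v' w by blast
  obtain r where r: "x v = frac_coset (to_fract r) v"
    using hat_closed[OF x v(1)] by (auto simp: frac_quot_eq)
  have "x w = frac_coset (to_fract r) w" if "frac_le w v" "w \<noteq> 0" for w
    using hat_compat[OF x that(2) v(1) that(1)] by (simp add: r frac_proj_coset[OF that(1)])
  then show ?thesis using that w v v' frac_le_trans by blast
qed

lemma hat_eqI: "\<lbrakk>x \<in> hat_set; y \<in> hat_set; \<And>w. w \<noteq> 0 \<Longrightarrow> x w = y w\<rbrakk> \<Longrightarrow> x = y"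
  by (rule PiE_ext[of _ "UNIV - {0}"]) (auto simp: hat_set_def)

lemma topspace_hat: "topspace hat_top = hat_set"
  by (auto simp: hat_top_def hat_set_def)

lemma hat_dom_iff: "x \<in> hat_dom (u, w) \<longleftrightarrow> x \<in> hat_set \<and> x w = frac_coset u w"
  by (simp add: hat_dom_def)

lemma hat_theta_apply: "z \<noteq> 0 \<Longrightarrow> hat_theta (u, w) x z = (\<lambda>k. u + w * k) ` x (inverse w * z)"
  by (simp add: hat_theta_def)

lemma hat_theta_range:
  assumes w: "w \<noteq> 0" and x: "x \<in> hat_dom (- u / w, 1 / w)"
  shows "hat_theta (u, w) x \<in> hat_dom (u, w)"
proof -
  let ?y = "hat_theta (u, w) x"
  have xh: "x \<in> hat_set" and xw: "x (1 / w) = frac_coset (- u / w) (1 / w)"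
    using x by (auto simp: hat_dom_iff)
  have rep: "\<exists>t. ?y z1 = frac_coset (to_fract t) z1 \<and> ?y z2 = frac_coset (to_fract t) z2"
    if z: "z1 \<noteq> 0" "z2 \<noteq> 0" for z1 z2
  proof -
    obtain r where r: "x (1 / w) = frac_coset (to_fract r) (1 / w)"
      "x (inverse w * z1) = frac_coset (to_fract r) (inverse w * z1)"
      "x (inverse w * z2) = frac_coset (to_fract r) (inverse w * z2)"
      by (rule hat_common_rep[OF xh, of "1 / w" "inverse w * z1" "inverse w * z2"]) (use w z in auto)
    have "to_fract r - (- u / w) \<in> frac_ideal (1 / w)" using r(1) xw by (metis frac_coset_eq_iff)
    then obtain t where "to_fract r - (- u / w) = 1 / w * to_fract t" by (auto simp: frac_ideal_iff)
    then have t: "u + w * to_fract r = to_fract t" using w by (simp add: field_simps)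
    have "?y z = frac_coset (to_fract t) z" if "z \<noteq> 0" "x (inverse w * z) = frac_coset (to_fract r) (inverse w * z)" for z
      using that w t by (simp add: hat_theta_apply frac_coset_image mult.assoc[symmetric])
    then show ?thesis using r z by blast
  qed
  have "?y \<in> hat_set"
    unfolding hat_set_def
  proof (intro CollectI conjI allI impI PiE_I)
    fix z :: "'a fract" assume "z \<in> UNIV - {0}"
    then show "?y z \<in> frac_quot z" using rep[of z z] by (auto simp: frac_quot_eq)
  next
    fix z :: "'a fract" assume "z \<notin> UNIV - {0}"
    then show "?y z = undefined" by (simp add: hat_theta_def)
  next
    fix z1 z2 :: "'a fract" assume z: "z1 \<noteq> 0" "z2 \<noteq> 0" "frac_le z1 z2"
    then show "frac_proj z1 (?y z2) = ?y z1" using rep[of z1 z2] by (auto simp: frac_proj_coset)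
  qed
  moreover obtain r where "x 1 = frac_coset (to_fract r) 1"
    using hat_closed[OF xh, of 1] by (auto simp: frac_quot_eq)
  then have "?y w = frac_coset u w"
    using w by (simp add: hat_theta_apply frac_coset_one frac_coset_image)
  ultimately show ?thesis by (simp add: hat_dom_iff)
qed

lemma hat_theta_dom:
  assumes w: "w \<noteq> 0" "w' \<noteq> 0" and x: "x \<in> hat_dom (- u / w, 1 / w)" "x \<in> hat_dom (u', w')"
  shows "hat_theta (u, w) x \<in> hat_dom (u + u' * w, w * w')"
  using hat_theta_range[OF w(1) x(1)] x w
  by (simp add: hat_dom_iff hat_theta_apply frac_coset_image mult.assoc[symmetric]) (simp add: mult.commute)

lemma hat_theta_mult:
  assumes "w \<noteq> 0" "w' \<noteq> 0"
  shows "hat_theta (u, w) (hat_theta (u', w') x) = hat_theta (u + u' * w, w * w') x"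
proof
  fix z
  show "hat_theta (u, w) (hat_theta (u', w') x) z = hat_theta (u + u' * w, w * w') x z"
  proof (cases "z = 0")
    case True then show ?thesis by (simp add: hat_theta_def)
  next
    case False
    then show ?thesis using assms
      by (simp add: hat_theta_apply image_image algebra_simps)
  qed
qed

lemma hat_theta_one: "x \<in> hat_set \<Longrightarrow> hat_theta (0, 1) x = x"
proof
  fix z assume x: "x \<in> hat_set"
  show "hat_theta (0, 1) x z = x z"
  proof (cases "z = 0")
    case True
    then show ?thesis using x by (auto simp: hat_theta_def hat_set_def PiE_iff extensional_def)
  qed (simp add: hat_theta_apply)
qed

lemma hat_proj_cont:
  "w \<noteq> 0 \<Longrightarrow> continuous_map hat_top (discrete_topology (frac_quot w)) (\<lambda>x. x w)"
  unfolding hat_top_def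
  by (intro continuous_map_from_subtopology continuous_map_product_projection) auto

lemma hat_proj_fun_cont:
  assumes "w \<noteq> 0"
  shows "continuous_map hat_top (discrete_topology UNIV) (\<lambda>x. F (x w))"
proof -
  have "continuous_map (discrete_topology (frac_quot w)) (discrete_topology UNIV) F" by simp
  from continuous_map_compose[OF hat_proj_cont[OF assms] this] show ?thesis by (simp add: comp_def)
qed

lemma hat_dom_clopen:
  assumes "w \<noteq> 0"
  shows "openin hat_top (hat_dom (u, w))" "closedin hat_top (hat_dom (u, w))"
proof -
  have eq: "hat_dom (u, w) = {x \<in> topspace hat_top. x w \<in> {frac_coset u w}}"
    by (auto simp: hat_dom_iff topspace_hat)
  show "openin hat_top (hat_dom (u, w))"
    unfolding eq by (rule openin_continuous_map_preimage[OF hat_proj_fun_cont[OF assms, where F = "\<lambda>C. C"]]) simp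
  show "closedin hat_top (hat_dom (u, w))"
    unfolding eq by (rule closedin_continuous_map_preimage[OF hat_proj_fun_cont[OF assms, where F = "\<lambda>C. C"]]) simp
qed

lemma hat_theta_cont:
  assumes w: "w \<noteq> 0"
  shows "continuous_map (subtopology hat_top (hat_dom (- u / w, 1 / w))) hat_top (hat_theta (u, w))"
proof -
  let ?V = "hat_dom (- u / w, 1 / w)"
  have range: "hat_theta (u, w) x \<in> hat_set" if "x \<in> topspace (subtopology hat_top ?V)" for x
    using hat_theta_range[OF w, of x u] that by (auto simp: hat_dom_iff)
  have "continuous_map (subtopology hat_top ?V)
      (product_topology (\<lambda>w. discrete_topology (frac_quot w)) (UNIV - {0})) (hat_theta (u, w))"
    unfolding continuous_map_componentwise
  proof (intro conjI ballI)
    show "hat_theta (u, w) ` topspace (subtopology hat_top ?V) \<subseteq> extensional (UNIV - {0})"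
      by (auto simp: hat_theta_def)
    fix z :: "'a fract" assume z: "z \<in> UNIV - {0}"
    have "continuous_map (subtopology hat_top ?V) (discrete_topology UNIV) (\<lambda>x. (\<lambda>k. u + w * k) ` x (inverse w * z))"
      by (rule continuous_map_from_subtopology, rule hat_proj_fun_cont) (use w z in simp)
    then have "continuous_map (subtopology hat_top ?V) (discrete_topology UNIV) (\<lambda>x. hat_theta (u, w) x z)"
      using z by (simp add: hat_theta_apply)
    then have "continuous_map (subtopology hat_top ?V) (subtopology (discrete_topology UNIV) (frac_quot z)) (\<lambda>x. hat_theta (u, w) x z)"
      by (rule continuous_map_into_subtopology) (use range z hat_closed in blast)
    then show "continuous_map (subtopology hat_top ?V) (discrete_topology (frac_quot z)) (\<lambda>x. hat_theta (u, w) x z)"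
      by simp
  qed
  then show ?thesis
    unfolding hat_top_def by (intro continuous_map_into_subtopology) (use range in \<open>auto simp: hat_top_def\<close>)
qed

lemma finite_frac_quot:
  assumes fin: "\<And>m::'r::idom. m \<noteq> 0 \<Longrightarrow> finite (residue_classes m)" and w: "w \<noteq> (0 :: 'r fract)"
  shows "finite (frac_quot w)"
proof -
  obtain a b where a: "b \<noteq> 0" "w = to_fract a / to_fract b" by (rule fract_eq_divide)
  have a0: "a \<noteq> 0" using a w by auto
  have aw: "to_fract (a * r) = w * to_fract (b * r)" for r using a by simp
  have "frac_coset (to_fract r) w = (\<Union>c\<in>(+) r ` range ((*) a). frac_coset (to_fract c) w)" for r
  proof -
    have "frac_coset (to_fract (r + a * s)) w = frac_coset (to_fract r) w" for s
      unfolding frac_coset_eq_iff frac_ideal_iff using aw[of s] by (intro exI[of _ "b * s"]) simp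
    then show ?thesis by (auto simp: image_image)
  qed
  then have "frac_quot w = (\<lambda>C. \<Union>c\<in>C. frac_coset (to_fract c) w) ` residue_classes a"
    unfolding frac_quot_eq residue_classes_def image_image by (rule image_cong[OF refl])
  then show ?thesis using fin[OF a0] by simp
qed

lemma compact_hat:
  assumes fin: "\<And>m::'r::idom. m \<noteq> 0 \<Longrightarrow> finite (residue_classes m)"
  shows "compact_space (hat_top :: ('r fract \<Rightarrow> 'r fract set) topology)"
proof -
  let ?P = "product_topology (\<lambda>w::'r fract. discrete_topology (frac_quot w)) (UNIV - {0})"
  have "compact_space ?P"
    using finite_frac_quot[OF fin] by (auto simp: compact_space_product_topology compact_space_discrete_topology)
  moreover have "closedin ?P hat_set"
  proof -
    define E where "E w w' = {x \<in> topspace ?P. frac_proj w (x w') = x w}" for w w' :: "'r fract"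
    have E: "closedin ?P (E w w')" if "w \<noteq> 0" "w' \<noteq> 0" for w w'
    proof -
      have c: "continuous_map ?P (discrete_topology UNIV) (\<lambda>x. F (x w))" if "w \<noteq> 0" for F :: "'r fract set \<Rightarrow> 'r fract set" and w
        using continuous_map_compose[OF continuous_map_product_projection[of w "UNIV - {0}"],
            of "\<lambda>w. discrete_topology (frac_quot w)" "discrete_topology UNIV" F] that
        by (simp add: comp_def)
      show ?thesis unfolding E_def
        by (rule closedin_continuous_maps_eq[where Y = "discrete_topology UNIV"])
          (use c[OF that(1), of "\<lambda>C. C"] c[OF that(2), of "frac_proj w"] in auto)
    qed
    have eq: "hat_set = \<Inter> (insert (topspace ?P) {E w w' |w w'. w \<noteq> 0 \<and> w' \<noteq> 0 \<and> frac_le w w'})"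
      by (auto simp: hat_set_def E_def)
    show ?thesis unfolding eq by (rule closedin_Inter) (use E closedin_topspace in blast)+
  qed
  ultimately show ?thesis
    unfolding hat_top_def by (intro compact_space_subtopology closedin_compact_space)
qed

theorem hat_partial_action:
  assumes fin: "\<And>m::'r::idom. m \<noteq> 0 \<Longrightarrow> finite (residue_classes m)"
  shows "partial_action affine_group (cont_alg hat_top) (hat_ideal :: 'r fract \<times> _ \<Rightarrow> _) hat_action"
proof -
  interpret clopen_partial_action affine_group hat_top "hat_dom :: 'r fract \<times> _ \<Rightarrow> _" hat_theta
  proof (intro clopen_partial_action.intro clopen_partial_action_axioms.intro group_affine)
    show "compact_space (hat_top :: ('r fract \<Rightarrow> 'r fract set) topology)" by (rule compact_hat[OF fin])
    show "hat_dom \<one>\<^bsub>affine_group\<^esub> = topspace (hat_top :: ('r fract \<Rightarrow> 'r fract set) topology)"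
    proof -
      have "x 1 = frac_coset 0 1" if x: "x \<in> hat_set" for x :: "'r fract \<Rightarrow> 'r fract set"
        using hat_closed[OF x, of 1] by (auto simp: frac_quot_eq frac_coset_one)
      then show ?thesis by (auto simp: topspace_hat hat_dom_iff)
    qed
  qed (auto simp: hat_dom_clopen hat_theta_cont[simplified] hat_theta_range hat_theta_one hat_theta_mult
      hat_theta_dom topspace_hat)
  have "hat_ideal = (\<lambda>g. cont_ideal hat_top (hat_dom (g :: 'r fract \<times> _)))"
    by (simp add: hat_ideal_def fun_eq_iff)
  then show ?thesis using partial_action_cont by (simp add: hat_action_def)
qed

end

theory Submission
  imports Defs
begin

text \<open>Both algebras are completions: \<open>\<AA>[R]\<close> of the free *-algebra \<open>F\<close> on the generators, with respect to the
  largest C*-seminorm \<open>N\<close> that respects the relations, and the crossed product of the algebra \<open>L\<close> of finite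
  sums \<open>\<Sum>g. f\<^sub>g \<delta>\<^sub>g\<close>, with respect to the largest C*-seminorm \<open>M\<close> below the \<open>\<ell>\<^sup>1\<close>-norm. The
  elements \<open>1\<^bsub>(0,m)\<^esub> \<delta>\<^bsub>(0,m)\<^esub>\<close> and \<open>1 \<delta>\<^bsub>(n,1)\<^esub>\<close> of \<open>L\<close> satisfy the
  relations (\<open>crossed_relations\<close>) and so define a *-homomorphism \<open>\<rho> : F \<rightarrow> L\<close>. It suffices that \<open>\<rho>\<close> has
  dense range and that \<open>M (\<rho> a) = N a\<close>; then \<open>completion_iso\<close> yields the isomorphism.

  Density (\<open>rep_dense\<close>): by compactness a continuous function on \<open>R\<^sub>K\<close> is uniformly close to one that
  depends on a single coordinate \<open>m \<in> R\<close>, hence to a combination of indicators of the cylinders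
  \<open>l + (m)\<close>. For a cylinder contained in the domain of \<open>g\<close>, the element \<open>1\<^bsub>(l,m)\<^esub> \<delta>\<^sub>g\<close> is the
  image of a monomial \<open>u\<^sup>l s\<^sub>m s\<^sub>k\<^sup>* u\<^sup>-\<^sup>j\<close>, where \<open>g = (l - j m / k, m / k)\<close>.

  Isometry (\<open>rep_isometric\<close>): \<open>M \<circ> \<rho> \<le> N\<close> because \<open>M \<circ> \<rho>\<close> respects the relations. For the converse
  the key is \<open>N a \<le> \<parallel>\<rho> a\<parallel>\<^sub>1\<close> (\<open>universal_norm_le_l1\<close>): it makes \<open>N\<close> descend along \<open>\<rho>\<close> to a seminorm on a
  dense subalgebra of \<open>L\<close>, which extends to a C*-seminorm on \<open>L\<close> below the \<open>\<ell>\<^sup>1\<close>-norm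
  (\<open>extend_cstar_seminorm\<close>) and is therefore at most \<open>M\<close>.

  To see \<open>N a \<le> \<parallel>\<rho> a\<parallel>\<^sub>1\<close>, the relations are used to rewrite every word as a sum of monomials
  \<open>u\<^sup>l s\<^sub>m s\<^sub>k\<^sup>* u\<^sup>-\<^sup>j\<close>. The rewriting is the same in \<open>\<AA>[R]\<close> and in \<open>L\<close> (\<open>common_normal_form\<close>), so both
  norms can be read off one list of weighted monomials. Group the list by \<open>g\<close>. Within one group a
  refinement to a common \<open>m\<close> turns the sum into \<open>\<Sum>l. d\<^sub>l W\<^sub>l\<close>, where the \<open>W\<^sub>l\<close> are partial isometries
  with orthogonal ranges and supports, whose C*-norm is at most \<open>max \<bar>d\<^sub>l\<bar>\<close>; and \<open>d\<^sub>l\<close> is the value of the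
  coefficient function \<open>f\<^sub>g\<close> at the point \<open>l \<in> R\<close> of \<open>R\<^sub>K\<close> (\<open>combination_norm\<close>, \<open>combination_weights\<close>).

  One analytic point is hidden in the rewriting, the orthogonality \<open>s\<^sub>m\<^sup>* u\<^sup>t s\<^sub>m = 0\<close> for \<open>m\<close> not dividing
  \<open>t\<close>. Among the relations there is only the sum \<open>CL4\<close>, and that projections with sum one are orthogonal
  is a fact about C*-norms (\<open>projections_orthogonal\<close>).\<close>

section \<open>Seminorms on dense subalgebras and isomorphisms of completions\<close>

locale normed_star_algebra = star_algebra A for A :: "('a, 'm) normed_star_alg_scheme" (structure) +
  assumes nrm_nonneg: "x \<in> carrier A \<Longrightarrow> 0 \<le> nrm A x"
    and nrm_add: "\<lbrakk>x \<in> carrier A; y \<in> carrier A\<rbrakk> \<Longrightarrow> nrm A (x \<oplus> y) \<le> nrm A x + nrm A y"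
    and nrm_smult: "x \<in> carrier A \<Longrightarrow> nrm A (c \<odot> x) = cmod c * nrm A x"
    and nrm_mult: "\<lbrakk>x \<in> carrier A; y \<in> carrier A\<rbrakk> \<Longrightarrow> nrm A (x \<otimes> y) \<le> nrm A x * nrm A y"
    and nrm_star: "x \<in> carrier A \<Longrightarrow> nrm A (star A x) = nrm A x"
begin

lemma nrm_minus_commute:
  assumes "x \<in> carrier A" "y \<in> carrier A" shows "nrm A (x \<ominus> y) = nrm A (y \<ominus> x)"
proof -
  have "y \<ominus> x = (-1) \<odot> (x \<ominus> y)"
    using assms by (simp add: minus_eq_smult smult_r_distr smult_assoc1[symmetric] M.a_comm)
  then show ?thesis using assms nrm_smult[of "x \<ominus> y" "-1"] by simp
qed

lemma nrm_triangle:
  assumes "x \<in> carrier A" "y \<in> carrier A" "z \<in> carrier A"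
  shows "nrm A (x \<ominus> z) \<le> nrm A (x \<ominus> y) + nrm A (y \<ominus> z)"
  using nrm_add[of "x \<ominus> y" "y \<ominus> z"] assms minus_chain by simp

lemma nrm_le_add_minus:
  assumes "x \<in> carrier A" "y \<in> carrier A"
  shows "nrm A y \<le> nrm A x + nrm A (x \<ominus> y)"
proof -
  have "y = (y \<ominus> x) \<oplus> x" using assms by (simp add: a_minus_def M.a_assoc M.l_neg)
  then show ?thesis using nrm_add[of "y \<ominus> x" x] nrm_minus_commute[OF assms] assms by simp
qed

lemma nrm_null_le:
  assumes "\<And>n. f n \<in> carrier A" "\<And>n. nrm A (f n) \<le> g n" "g \<longlonglongrightarrow> 0"
  shows "(\<lambda>n. nrm A (f n)) \<longlonglongrightarrow> 0"
  by (rule tendsto_sandwich[OF _ _ tendsto_const assms(3)]) (auto simp: assms nrm_nonneg)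

text \<open>A seminorm \<open>p\<close> on \<open>F\<close> that is dominated along \<open>h\<close> by the norm of \<open>A\<close> is a Lipschitz function of
  \<open>h a\<close>. It therefore extends to a Lipschitz function on the closure of the range, that is on \<open>A\<close>, and
  the C*-conditions, being closed conditions, pass to the limit.\<close>

theorem extend_cstar_seminorm:
  assumes F: "star_algebra F" and h: "star_hom F A h" and p: "cstar_seminorm F p"
    and bound: "\<And>a. a \<in> carrier F \<Longrightarrow> p a \<le> nrm A (h a)"
    and dense: "\<And>x e. x \<in> carrier A \<Longrightarrow> e > 0 \<Longrightarrow> \<exists>a\<in>carrier F. nrm A (x \<ominus> h a) < e"
  obtains q where "cstar_seminorm A q" "\<And>x. x \<in> carrier A \<Longrightarrow> q x \<le> nrm A x"
    "\<And>a. a \<in> carrier F \<Longrightarrow> q (h a) = p a"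
proof -
  interpret F: star_algebra F by fact
  note h' = h[unfolded star_hom_def]
  have hc [simp]: "h a \<in> carrier A" if "a \<in> carrier F" for a using h' that by blast
  have h_add: "h (a \<oplus>\<^bsub>F\<^esub> b) = h a \<oplus> h b" and h_mult: "h (a \<otimes>\<^bsub>F\<^esub> b) = h a \<otimes> h b"
    if "a \<in> carrier F" "b \<in> carrier F" for a b using h' that by blast+
  have h_smult: "h (c \<odot>\<^bsub>F\<^esub> a) = c \<odot> h a" and h_star: "h (star F a) = star A (h a)"
    if "a \<in> carrier F" for a c using h' that by blast+
  have h_minus: "h (a \<ominus>\<^bsub>F\<^esub> b) = h a \<ominus> h b" if "a \<in> carrier F" "b \<in> carrier F" for a b
    using that by (simp add: minus_eq_smult F.minus_eq_smult h_add h_smult)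
  note p' = cstar_seminormD[OF p]
  \<comment> \<open>the largest extension with Lipschitz constant one\<close>
  define q where "q x = (INF a\<in>carrier F. p a + nrm A (x \<ominus> h a))" for x
  have near: "\<bar>q x - p a\<bar> \<le> nrm A (x \<ominus> h a)" if x: "x \<in> carrier A" and a: "a \<in> carrier F" for x a
  proof -
    have "bdd_below ((\<lambda>a. p a + nrm A (x \<ominus> h a)) ` carrier F)"
      by (rule bdd_belowI[of _ 0]) (use x p'(1) nrm_nonneg in auto)
    then have "q x \<le> p a + nrm A (x \<ominus> h a)"
      unfolding q_def using a by (rule cINF_lower)
    moreover have "p a - nrm A (x \<ominus> h a) \<le> q x"
      unfolding q_def
    proof (rule cINF_greatest)
      fix b assume b: "b \<in> carrier F"
      have "p a \<le> p b + p (a \<ominus>\<^bsub>F\<^esub> b)" using F.seminorm_diff_le[OF p a b] by linarith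
      also have "p (a \<ominus>\<^bsub>F\<^esub> b) \<le> nrm A (h a \<ominus> h b)"
        using bound[of "a \<ominus>\<^bsub>F\<^esub> b"] a b by (simp add: h_minus)
      also have "\<dots> \<le> nrm A (x \<ominus> h a) + nrm A (x \<ominus> h b)"
        using nrm_triangle[of "h a" x "h b"] nrm_minus_commute[of x "h a"] a b x by simp
      finally show "p a - nrm A (x \<ominus> h a) \<le> p b + nrm A (x \<ominus> h b)" by simp
    qed (use a in blast)
    ultimately show ?thesis by linarith
  qed
  have lim: "(\<lambda>n. p (a n)) \<longlonglongrightarrow> q x"
    if "x \<in> carrier A" "\<And>n. a n \<in> carrier F" "(\<lambda>n. nrm A (x \<ominus> h (a n))) \<longlonglongrightarrow> 0" for x and a :: "nat \<Rightarrow> _"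
  proof -
    have "(\<lambda>n. p (a n) - q x) \<longlonglongrightarrow> 0"
      by (rule Lim_null_comparison[OF _ that(3)])
        (use near[OF that(1,2)] in \<open>auto simp: abs_minus_commute intro!: always_eventually\<close>)
    from tendsto_add[OF this tendsto_const[of "q x"]] show ?thesis by simp
  qed
  have seq: "\<exists>a. (\<forall>n. a n \<in> carrier F) \<and> (\<lambda>n. nrm A (x \<ominus> h (a n))) \<longlonglongrightarrow> 0"
    if x: "x \<in> carrier A" for x
  proof -
    have "\<exists>a\<in>carrier F. nrm A (x \<ominus> h a) < 1 / Suc n" for n by (rule dense[OF x]) simp
    then obtain a where a: "\<And>n. a n \<in> carrier F" "\<And>n::nat. nrm A (x \<ominus> h (a n)) < 1 / Suc n" by metis
    have "(\<lambda>n. nrm A (x \<ominus> h (a n))) \<longlonglongrightarrow> 0"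
      by (rule nrm_null_le[OF _ _ LIMSEQ_Suc[OF lim_inverse_n']])
        (use a x less_imp_le[OF a(2)] in auto)
    then show ?thesis using a by blast
  qed
  have qh: "q (h a) = p a" if "a \<in> carrier F" for a
  proof -
    have "nrm A (h a \<ominus> h a) = 0"
      using that nrm_smult[of "\<zero>" 0] smult_l_null[of "\<zero>"] by (simp add: a_minus_def M.r_neg)
    then show ?thesis using near[of "h a" a] that by simp
  qed
  have bnd: "\<exists>K. \<forall>n. nrm A (h (a n)) \<le> K"
    if x: "x \<in> carrier A" and a: "\<And>n. a n \<in> carrier F" and la: "(\<lambda>n. nrm A (x \<ominus> h (a n))) \<longlonglongrightarrow> 0"
    for x and a :: "nat \<Rightarrow> _"
  proof -
    obtain K where K: "\<And>n. norm (nrm A (x \<ominus> h (a n))) \<le> K"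
      using convergent_imp_Bseq[OF convergentI[OF la]] by (auto simp: Bseq_def)
    have "nrm A (h (a n)) \<le> nrm A x + K" for n
      using K[of n] nrm_le_add_minus[OF x hc[OF a], of n] by (simp add: abs_le_iff)
    then show ?thesis by blast
  qed
  have "cstar_seminorm A q"
    unfolding cstar_seminorm_def
  proof (intro conjI ballI allI)
    fix x c assume x: "x \<in> carrier A"
    obtain a where a: "\<And>n. a n \<in> carrier F" and la: "(\<lambda>n. nrm A (x \<ominus> h (a n))) \<longlonglongrightarrow> 0"
      using seq[OF x] by blast
    note pa = lim[OF x a la]
    show "0 \<le> q x" by (rule LIMSEQ_le_const[OF pa]) (use p'(1)[OF a] in blast)
    have "(\<lambda>n. p (c \<odot>\<^bsub>F\<^esub> a n)) \<longlonglongrightarrow> q (c \<odot> x)"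
    proof (rule lim)
      have "nrm A (c \<odot> x \<ominus> h (c \<odot>\<^bsub>F\<^esub> a n)) = cmod c * nrm A (x \<ominus> h (a n))" for n
        using x a by (simp add: h_smult smult_minus[symmetric] nrm_smult)
      then show "(\<lambda>n. nrm A (c \<odot> x \<ominus> h (c \<odot>\<^bsub>F\<^esub> a n))) \<longlonglongrightarrow> 0"
        using tendsto_mult_right_zero[OF la, of "cmod c"] by simp
    qed (use x a in auto)
    moreover have "(\<lambda>n. p (c \<odot>\<^bsub>F\<^esub> a n)) \<longlonglongrightarrow> cmod c * q x"
      using tendsto_mult_left[OF pa] a by (simp add: p'(3))
    ultimately show "q (c \<odot> x) = cmod c * q x" by (rule LIMSEQ_unique)
    have prod: "(\<lambda>n. p (b n \<otimes>\<^bsub>F\<^esub> a n)) \<longlonglongrightarrow> q (y \<otimes> x)"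
      if y: "y \<in> carrier A" and b: "\<And>n. b n \<in> carrier F" and lb: "(\<lambda>n. nrm A (y \<ominus> h (b n))) \<longlonglongrightarrow> 0" for y b
    proof (rule lim)
      obtain K where K: "\<And>n. nrm A (h (b n)) \<le> K" using bnd[OF y b lb] by blast
      show "(\<lambda>n. nrm A (y \<otimes> x \<ominus> h (b n \<otimes>\<^bsub>F\<^esub> a n))) \<longlonglongrightarrow> 0"
      proof (rule nrm_null_le)
        fix n
        have "nrm A (y \<otimes> x \<ominus> h (b n \<otimes>\<^bsub>F\<^esub> a n))
            \<le> nrm A ((y \<ominus> h (b n)) \<otimes> x) + nrm A (h (b n) \<otimes> (x \<ominus> h (a n)))"
          using x y a b by (simp add: h_mult mult_minus_mult nrm_add mult_closed)
        also have "\<dots> \<le> nrm A (y \<ominus> h (b n)) * nrm A x + K * nrm A (x \<ominus> h (a n))"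
          using x y a b K by (intro add_mono order_trans[OF nrm_mult] mult_right_mono nrm_nonneg) auto
        finally show "nrm A (y \<otimes> x \<ominus> h (b n \<otimes>\<^bsub>F\<^esub> a n)) \<le> nrm A (y \<ominus> h (b n)) * nrm A x + K * nrm A (x \<ominus> h (a n))" .
      next
        show "(\<lambda>n. nrm A (y \<ominus> h (b n)) * nrm A x + K * nrm A (x \<ominus> h (a n))) \<longlonglongrightarrow> 0"
          by (intro tendsto_add_zero tendsto_mult_right_zero tendsto_mult_left_zero la lb)
      qed (use x y a b in \<open>auto simp: F.mult_closed mult_closed\<close>)
    qed (use x y a b in \<open>auto simp: F.mult_closed mult_closed\<close>)
    have "(\<lambda>n. p (star F (a n) \<otimes>\<^bsub>F\<^esub> a n)) \<longlonglongrightarrow> q (star A x \<otimes> x)"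
    proof (rule prod)
      have "nrm A (star A x \<ominus> h (star F (a n))) = nrm A (x \<ominus> h (a n))" for n
        using x a by (simp add: h_star star_minus[symmetric] nrm_star)
      then show "(\<lambda>n. nrm A (star A x \<ominus> h (star F (a n)))) \<longlonglongrightarrow> 0" using la by simp
    qed (use x a in \<open>auto simp: star_closed F.star_closed\<close>)
    moreover have "(\<lambda>n. p (star F (a n) \<otimes>\<^bsub>F\<^esub> a n)) \<longlonglongrightarrow> (q x)\<^sup>2"
      using tendsto_power[OF pa, of 2] a by (simp add: p'(5))
    ultimately show "q (star A x \<otimes> x) = (q x)\<^sup>2" by (rule LIMSEQ_unique)
    fix y assume y: "y \<in> carrier A"
    obtain b where b: "\<And>n. b n \<in> carrier F" and lb: "(\<lambda>n. nrm A (y \<ominus> h (b n))) \<longlonglongrightarrow> 0"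
      using seq[OF y] by blast
    note pb = lim[OF y b lb]
    show "q (y \<otimes> x) \<le> q y * q x"
      by (rule LIMSEQ_le[OF prod[OF y b lb] tendsto_mult[OF pb pa]]) (use p'(4)[OF b a] in blast)
    have "(\<lambda>n. p (a n \<oplus>\<^bsub>F\<^esub> b n)) \<longlonglongrightarrow> q (x \<oplus> y)"
    proof (rule lim)
      show "(\<lambda>n. nrm A (x \<oplus> y \<ominus> h (a n \<oplus>\<^bsub>F\<^esub> b n))) \<longlonglongrightarrow> 0"
        by (rule nrm_null_le[OF _ _ tendsto_add_zero[OF la lb]])
          (use x y a b in \<open>auto simp: h_add add_minus_add intro!: nrm_add\<close>)
    qed (use x y a b in auto)
    then show "q (x \<oplus> y) \<le> q x + q y"
      by (rule LIMSEQ_le[OF _ tendsto_add[OF pa pb]]) (use p'(2)[OF a b] in blast)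
  qed
  moreover have "q x \<le> nrm A x" if x: "x \<in> carrier A" for x
  proof -
    have "h \<zero>\<^bsub>F\<^esub> = \<zero>"
      using h_minus[of "\<zero>\<^bsub>F\<^esub>" "\<zero>\<^bsub>F\<^esub>"] by (simp add: a_minus_def M.r_neg F.M.r_neg)
    then show ?thesis using near[OF x, of "\<zero>\<^bsub>F\<^esub>"] x F.seminorm_zero[OF p] smult_r_null[of "-1"] by (simp add: minus_eq_smult)
  qed
  ultimately show ?thesis using that qh by blast
qed

end


text \<open>The map induced on the completions preserves norms, because it does so on the dense image of \<open>F\<close>;
  its range is complete, hence closed, and dense.\<close>

theorem completion_iso:
  assumes F: "seminormed_star_algebra F N" and L: "seminormed_star_algebra L M"
    and h: "star_hom F L h" and iso: "\<And>a. a \<in> carrier F \<Longrightarrow> M (h a) = N a"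
    and dense: "\<And>x e. x \<in> carrier L \<Longrightarrow> e > 0 \<Longrightarrow> \<exists>a\<in>carrier F. M (x \<ominus>\<^bsub>L\<^esub> h a) < e"
  obtains \<Phi> where "star_iso (completion F N) (completion L M) \<Phi>"
    "\<And>a. a \<in> carrier F \<Longrightarrow> \<Phi> (to_completion F N a) = to_completion L M (h a)"
proof -
  interpret F: seminormed_star_algebra F N by fact
  interpret L: seminormed_star_algebra L M by fact
  interpret FB: cstar_algebra F.B by (rule F.completion_cstar)
  interpret LB: cstar_algebra L.B by (rule L.completion_cstar)
  note h' = h[unfolded star_hom_def]
  note tL = L.to_completion_hom[unfolded star_hom_def]
  note tF = F.to_completion_hom[unfolded star_hom_def]
  define k where "k a = to_completion L M (h a)" for a
  have hc: "h a \<in> carrier L" if "a \<in> carrier F" for a using h' that by blast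
  have kc: "k a \<in> carrier L.B" if "a \<in> carrier F" for a using tL hc that unfolding k_def by blast
  have tc: "to_completion F N a \<in> carrier F.B" if "a \<in> carrier F" for a using tF that by blast
  have k: "star_hom F L.B k"
    unfolding star_hom_def k_def using h' tL by (auto simp: Pi_iff)
  have nk: "nrm L.B (k a) = N a" if "a \<in> carrier F" for a
    using that by (simp add: k_def to_completion_def L.nrm_B_const hc iso)
  obtain \<Phi> where \<Phi>: "star_hom F.B L.B \<Phi>" "\<And>a. a \<in> carrier F \<Longrightarrow> \<Phi> (to_completion F N a) = k a"
    and contr: "\<And>x. x \<in> carrier F.B \<Longrightarrow> nrm L.B (\<Phi> x) \<le> nrm F.B x"
    using F.completion_extend[OF L.completion_cstar k] nk by auto
  note \<Phi>' = \<Phi>(1)[unfolded star_hom_def]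
  have \<Phi>c: "\<Phi> x \<in> carrier L.B" if "x \<in> carrier F.B" for x using \<Phi>' that by blast
  have \<Phi>_minus: "\<Phi> (x \<ominus>\<^bsub>F.B\<^esub> y) = \<Phi> x \<ominus>\<^bsub>L.B\<^esub> \<Phi> y" if "x \<in> carrier F.B" "y \<in> carrier F.B" for x y
    using \<Phi>' that by (simp add: F.B.minus_eq_smult L.B.minus_eq_smult \<Phi>c)
  have ge: "nrm F.B x \<le> nrm L.B (\<Phi> x)" if x: "x \<in> carrier F.B" for x
  proof (rule field_le_epsilon)
    fix e :: real assume "e > 0"
    then obtain a where a: "a \<in> carrier F" "nrm F.B (x \<ominus>\<^bsub>F.B\<^esub> to_completion F N a) < e/2"
      using F.dense_B[OF x, of "e/2"] by (auto simp: to_completion_def)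
    let ?y = "to_completion F N a"
    have "nrm F.B ?y = nrm L.B (\<Phi> ?y)"
      using a by (simp add: \<Phi>(2) nk) (simp add: to_completion_def F.nrm_B_const)
    moreover have "\<bar>nrm F.B x - nrm F.B ?y\<bar> \<le> nrm F.B (x \<ominus>\<^bsub>F.B\<^esub> ?y)"
      by (rule F.B.seminorm_diff_le[OF FB.cstar_norm x tc[OF a(1)]])
    moreover have "\<bar>nrm L.B (\<Phi> x) - nrm L.B (\<Phi> ?y)\<bar> \<le> nrm L.B (\<Phi> (x \<ominus>\<^bsub>F.B\<^esub> ?y))"
      using L.B.seminorm_diff_le[OF LB.cstar_norm \<Phi>c[OF x] \<Phi>c[OF tc[OF a(1)]]] x tc[OF a(1)]
      by (simp add: \<Phi>_minus)
    moreover have "nrm L.B (\<Phi> (x \<ominus>\<^bsub>F.B\<^esub> ?y)) \<le> nrm F.B (x \<ominus>\<^bsub>F.B\<^esub> ?y)"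
      using x tc[OF a(1)] by (intro contr) auto
    ultimately show "nrm F.B x \<le> nrm L.B (\<Phi> x) + e" using a(2) by linarith
  qed
  have inj: "inj_on \<Phi> (carrier F.B)"
  proof (rule inj_onI)
    fix x y assume xy: "x \<in> carrier F.B" "y \<in> carrier F.B" "\<Phi> x = \<Phi> y"
    have "nrm F.B (x \<ominus>\<^bsub>F.B\<^esub> y) \<le> 0"
      using ge[of "x \<ominus>\<^bsub>F.B\<^esub> y"] xy L.B.seminorm_self[OF LB.cstar_norm \<Phi>c[OF xy(2)]] by (simp add: \<Phi>_minus)
    then show "x = y"
      using cstar_seminormD(1)[OF FB.cstar_norm, of "x \<ominus>\<^bsub>F.B\<^esub> y"] xy by (intro FB.norm_minus_zeroD) auto
  qed
  have surj: "\<exists>x\<in>carrier F.B. \<Phi> x = y" if y: "y \<in> carrier L.B" for y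
  proof -
    have "\<exists>a\<in>carrier F. nrm L.B (y \<ominus>\<^bsub>L.B\<^esub> k a) < e" if e: "e > 0" for e
    proof -
      obtain z where z: "z \<in> carrier L" "nrm L.B (y \<ominus>\<^bsub>L.B\<^esub> to_completion L M z) < e/2"
        using L.dense_B[OF y, of "e/2"] e by (auto simp: to_completion_def)
      obtain a where a: "a \<in> carrier F" "M (z \<ominus>\<^bsub>L\<^esub> h a) < e/2" using dense[OF z(1), of "e/2"] e by auto
      have tz: "to_completion L M z \<in> carrier L.B" using tL z by blast
      have "nrm L.B (to_completion L M z \<ominus>\<^bsub>L.B\<^esub> k a) = M (z \<ominus>\<^bsub>L\<^esub> h a)"
        using z a hc by (simp add: k_def to_completion_def L.minus_B L.const_CS L.nrm_B_const)
      then show ?thesis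
        using L.B.seminorm_triangle[OF LB.cstar_norm y tz kc[OF a(1)]] a z by (intro bexI[of _ a]) auto
    qed
    then have "\<exists>a\<in>carrier F. nrm L.B (y \<ominus>\<^bsub>L.B\<^esub> k a) < 1 / Suc n" for n by simp
    then obtain a where a: "\<And>n. a n \<in> carrier F" "\<And>n::nat. nrm L.B (y \<ominus>\<^bsub>L.B\<^esub> k (a n)) < 1 / Suc n" by metis
    define b where "b n = to_completion F N (a n)" for n
    have bc: "b n \<in> carrier F.B" and \<Phi>b: "\<Phi> (b n) = k (a n)" for n using a by (auto simp: b_def tc \<Phi>(2))
    have ka: "(\<lambda>n. nrm L.B (y \<ominus>\<^bsub>L.B\<^esub> k (a n))) \<longlonglongrightarrow> 0"
      by (rule tendsto_sandwich[OF _ _ tendsto_const LIMSEQ_Suc[OF lim_inverse_n']])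
        (use a y kc less_imp_le[OF a(2)] in \<open>auto intro!: always_eventually cstar_seminormD(1)[OF LB.cstar_norm]\<close>)
    have "b \<in> cauchy_seqs F.B (nrm F.B)"
      unfolding cauchy_seqs_def
    proof (intro CollectI conjI allI impI)
      fix e :: real assume "e > 0"
      then obtain n0 where n0: "\<And>n. n \<ge> n0 \<Longrightarrow> nrm L.B (y \<ominus>\<^bsub>L.B\<^esub> k (a n)) < e/2"
        using order_tendstoD(2)[OF ka, of "e/2"] by (auto simp: eventually_sequentially)
      have "nrm F.B (b m \<ominus>\<^bsub>F.B\<^esub> b n) < e" if "m \<ge> n0" "n \<ge> n0" for m n
      proof -
        have "nrm F.B (b m \<ominus>\<^bsub>F.B\<^esub> b n) \<le> nrm L.B (k (a m) \<ominus>\<^bsub>L.B\<^esub> k (a n))"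
          using ge[of "b m \<ominus>\<^bsub>F.B\<^esub> b n"] bc by (simp add: \<Phi>_minus \<Phi>b)
        also have "\<dots> \<le> nrm L.B (k (a m) \<ominus>\<^bsub>L.B\<^esub> y) + nrm L.B (y \<ominus>\<^bsub>L.B\<^esub> k (a n))"
          by (rule L.B.seminorm_triangle[OF LB.cstar_norm]) (use kc a y in auto)
        also have "\<dots> < e"
          using n0[OF that(1)] n0[OF that(2)] L.B.seminorm_minus_commute[OF LB.cstar_norm kc[OF a(1)] y, of m] by simp
        finally show ?thesis .
      qed
      then show "\<exists>k. \<forall>m\<ge>k. \<forall>n\<ge>k. nrm F.B (b m \<ominus>\<^bsub>F.B\<^esub> b n) < e" by blast
    qed (rule bc)
    then obtain x where x: "x \<in> carrier F.B" and bx: "(\<lambda>n. nrm F.B (b n \<ominus>\<^bsub>F.B\<^esub> x)) \<longlonglongrightarrow> 0"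
      using FB.complete by blast
    have "(\<lambda>n. nrm L.B (k (a n) \<ominus>\<^bsub>L.B\<^esub> \<Phi> x)) \<longlonglongrightarrow> 0"
    proof (rule tendsto_sandwich[OF _ _ tendsto_const bx])
      show "\<forall>\<^sub>F n in sequentially. nrm L.B (k (a n) \<ominus>\<^bsub>L.B\<^esub> \<Phi> x) \<le> nrm F.B (b n \<ominus>\<^bsub>F.B\<^esub> x)"
        using contr[of "b _ \<ominus>\<^bsub>F.B\<^esub> x"] bc x by (intro always_eventually allI) (simp add: \<Phi>_minus \<Phi>b[symmetric])
    qed (use kc a \<Phi>c x in \<open>auto intro!: always_eventually cstar_seminormD(1)[OF LB.cstar_norm]\<close>)
    moreover have "(\<lambda>n. nrm L.B (k (a n) \<ominus>\<^bsub>L.B\<^esub> y)) \<longlonglongrightarrow> 0"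
      using ka L.B.seminorm_minus_commute[OF LB.cstar_norm kc[OF a(1)] y] by simp
    ultimately have "nrm L.B (\<Phi> x \<ominus>\<^bsub>L.B\<^esub> y) = 0"
      by (intro tendsto_unique_null[OF L.B.star_algebra_axioms LB.cstar_norm, of "\<lambda>n. k (a n)"] kc a(1) \<Phi>c x y)
    then show ?thesis using LB.norm_minus_zeroD[OF \<Phi>c[OF x] y] x by blast
  qed
  have "bij_betw \<Phi> (carrier F.B) (carrier L.B)"
    unfolding bij_betw_def using inj surj \<Phi>c by blast
  then show ?thesis using that[of \<Phi>] \<Phi> by (auto simp: star_iso_def k_def)
qed

section \<open>The normed *-algebra of a clopen partial action\<close>

lemma cont_finsum_apply:
  assumes "\<And>i. i \<in> I \<Longrightarrow> F i \<in> carrier (cont_alg X)"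
  shows "finsum (cont_alg X) F I x = (\<Sum>i\<in>I. F i x)"
  using assms
proof (induction I rule: infinite_finite_induct)
  case (insert i I)
  then show ?case by (simp add: Pi_iff) (simp add: cont_alg_simps)
qed (simp_all add: CX.M.finsum_infinite, simp_all add: cont_alg_simps)

context clopen_partial_action
begin

abbreviation "CA \<equiv> cont_alg X"
abbreviation "L \<equiv> cp_sums G CA ID act"
abbreviation "supp \<equiv> cp_support CA"

lemma supp_iff: "g \<in> supp a \<longleftrightarrow> a g \<noteq> (\<lambda>x. 0)"
  by (simp add: cp_support_def cont_alg_simps)

lemma L_carrier: "a \<in> carrier L \<longleftrightarrow>
   finite (supp a) \<and> supp a \<subseteq> carrier G \<and> (\<forall>g\<in>carrier G. a g \<in> ID g)"
  by (simp add: cp_sums_def)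

lemma L_simps:
  "one L = cp_single CA \<one>\<^bsub>CA\<^esub> \<one>" "zero L = (\<lambda>g x. 0)" "add L = (\<lambda>a b g x. a g x + b g x)"
  "smult L = (\<lambda>c a g x. c * a g x)"
  "star L a g x = (if g \<in> carrier G \<and> x \<in> V g then cnj (a (inv g) (\<theta> (inv g) x)) else 0)"
  "nrm L a = (\<Sum>g\<in>supp a. nrm CA (a g))"
  by (simp_all add: cp_sums_def cont_alg_simps(2-6) induced_action_def)

lemma L_closed: "a \<in> carrier L \<Longrightarrow> a g \<in> carrier CA"
  using CX.zero_closed[of X] by (cases "g \<in> supp a") (auto simp: L_carrier ID_iff supp_iff cont_alg_simps(3))

lemma L_outside: "a \<in> carrier L \<Longrightarrow> x \<notin> V g \<Longrightarrow> a g x = 0"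
  by (cases "g \<in> supp a") (auto simp: L_carrier ID_iff supp_iff)

lemma L_zero: "a \<in> carrier L \<Longrightarrow> g \<notin> carrier G \<Longrightarrow> a g x = 0"
  using supp_iff[of g a] by (auto simp: L_carrier)

lemma L_finite: "a \<in> carrier L \<Longrightarrow> finite (supp a)" and L_supp: "a \<in> carrier L \<Longrightarrow> supp a \<subseteq> carrier G"
  by (simp_all add: L_carrier)

lemma L_carrierI:
  assumes "finite T" "T \<subseteq> carrier G" "\<And>g. g \<notin> T \<Longrightarrow> a g = (\<lambda>x. 0)"
    and "\<And>g. g \<in> T \<Longrightarrow> a g \<in> ID g"
  shows "a \<in> carrier L"
proof -
  have "supp a \<subseteq> T" using assms(3) unfolding subset_iff supp_iff by blast
  moreover have "a g \<in> ID g" if "g \<in> carrier G" for g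
    using assms(3,4)[of g] CX.zero_closed[of X] by (cases "g \<in> T") (auto simp: ID_iff cont_alg_simps(3))
  ultimately show ?thesis using assms(1,2) finite_subset by (auto simp: L_carrier)
qed

lemma L_mult_pairs:
  assumes a: "a \<in> carrier L" and b: "b \<in> carrier L"
  shows "(a \<otimes>\<^bsub>L\<^esub> b) k x =
    (\<Sum>(g, h)\<in>{(g, h). g \<in> supp a \<and> h \<in> supp b \<and> g \<otimes> h = k}. a g x * b h (\<theta> (inv g) x))"
    and "(a \<otimes>\<^bsub>L\<^esub> b) k \<in> carrier CA"
proof -
  let ?P = "{(g, h). g \<in> supp a \<and> h \<in> supp b \<and> g \<otimes> h = k}"
  let ?F = "\<lambda>(g, h). act g (act (inv g) (a g) \<otimes>\<^bsub>CA\<^esub> b h)"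
  have c: "act g (act (inv g) (a g) \<otimes>\<^bsub>CA\<^esub> b h) \<in> carrier CA" if "g \<in> supp a" for g h
  proof -
    have g: "g \<in> carrier G" using L_supp[OF a] that by blast
    have "act (inv g) (a g) \<in> carrier CA"
      using act_closed[of "inv g" "a g"] g L_closed[OF a] by (simp add: ID_iff)
    then have "act (inv g) (a g) \<otimes>\<^bsub>CA\<^esub> b h \<in> carrier CA" by (intro CX.mult_closed L_closed[OF b])
    from act_closed[OF g this] show ?thesis by (simp add: ID_iff)
  qed
  have eq: "(a \<otimes>\<^bsub>L\<^esub> b) k = finsum CA ?F ?P" by (simp add: cp_sums_def)
  show "(a \<otimes>\<^bsub>L\<^esub> b) k \<in> carrier CA" unfolding eq by (intro CX.M.finsum_closed) (use c in auto)
  have "(a \<otimes>\<^bsub>L\<^esub> b) k x = (\<Sum>p\<in>?P. ?F p x)" unfolding eq by (rule cont_finsum_apply) (use c in auto)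
  also have "\<dots> = (\<Sum>(g, h)\<in>?P. a g x * b h (\<theta> (inv g) x))"
  proof (rule sum.cong[OF refl])
    fix p assume "p \<in> ?P"
    then obtain g h where p: "p = (g, h)" "g \<in> supp a" "g \<otimes> h = k" by auto
    have g: "g \<in> carrier G" using L_supp[OF a] p by blast
    show "?F p x = (case p of (g, h) \<Rightarrow> a g x * b h (\<theta> (inv g) x))"
    proof (cases "x \<in> V g")
      case True
      then have "\<theta> (inv g) x \<in> V (inv g)" using theta_range[of "inv g" x] g by simp
      then show ?thesis using True g theta_inv[OF g True] by (simp add: p act_apply) (simp add: cont_alg_simps act_apply)
    next
      case False
      then show ?thesis using L_outside[OF a False] by (simp add: p act_apply)
    qed
  qed
  finally show "(a \<otimes>\<^bsub>L\<^esub> b) k x = (\<Sum>(g, h)\<in>?P. a g x * b h (\<theta> (inv g) x))" .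
qed

text \<open>The product of \<open>L\<close> is the convolution on the groupoid of pairs \<open>(g, x)\<close> with \<open>x \<in> V g\<close>. The sum may
  run over any finite \<open>T\<close> containing the support, which lets two products be compared over a common index set.\<close>

lemma L_mult_apply:
  assumes a: "a \<in> carrier L" and b: "b \<in> carrier L" and k: "k \<in> carrier G"
    and T: "finite T" "supp a \<subseteq> T" "T \<subseteq> carrier G"
  shows "(a \<otimes>\<^bsub>L\<^esub> b) k x = (\<Sum>g\<in>T. a g x * b (inv g \<otimes> k) (\<theta> (inv g) x))"
proof -
  let ?P = "{(g, h). g \<in> supp a \<and> h \<in> supp b \<and> g \<otimes> h = k}"
  let ?S = "{g \<in> supp a. inv g \<otimes> k \<in> supp b}"
  have "(a \<otimes>\<^bsub>L\<^esub> b) k x = (\<Sum>(g, h)\<in>?P. a g x * b h (\<theta> (inv g) x))" by (rule L_mult_pairs[OF a b])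
  also have "\<dots> = (\<Sum>g\<in>?S. a g x * b (inv g \<otimes> k) (\<theta> (inv g) x))"
  proof (rule sum.reindex_bij_witness[of _ "\<lambda>g. (g, inv g \<otimes> k)" fst], goal_cases)
    case (1 p) then show ?case using L_supp[OF a] L_supp[OF b] by (auto simp: subset_iff m_assoc[symmetric])
  next
    case (2 p) then show ?case using L_supp[OF a] L_supp[OF b] by (auto simp: subset_iff m_assoc[symmetric])
  next
    case (4 g) then show ?case using L_supp[OF a] L_supp[OF b] k by (auto simp: subset_iff m_assoc[symmetric])
  next
    case (5 p) then show ?case using L_supp[OF a] L_supp[OF b] by (auto simp: subset_iff m_assoc[symmetric])
  qed auto
  also have "\<dots> = (\<Sum>g\<in>T. a g x * b (inv g \<otimes> k) (\<theta> (inv g) x))"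
  proof (rule sum.mono_neutral_left)
    have "a g x * b (inv g \<otimes> k) (\<theta> (inv g) x) = 0" if "g \<notin> ?S" for g
      using that supp_iff[of g a] supp_iff[of "inv g \<otimes> k" b] by auto
    then show "\<forall>g\<in>T - ?S. a g x * b (inv g \<otimes> k) (\<theta> (inv g) x) = 0" by blast
  qed (use T in auto)
  finally show ?thesis .
qed

text \<open>With \<open>theta_comp\<close> below, this is the groupoid law: \<open>\<theta>\<^sub>h\<^sup>-\<^sup>1 \<theta>\<^sub>g\<^sup>-\<^sup>1\<close> is defined at a point of \<open>V g\<close>
  exactly where \<open>\<theta>\<close> of the inverse of \<open>g h\<close> is, and there the two agree.\<close>

lemma theta_dom_iff:
  assumes g: "g \<in> carrier G" and h: "h \<in> carrier G" and x: "x \<in> V g"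
  shows "\<theta> (inv g) x \<in> V h \<longleftrightarrow> x \<in> V (g \<otimes> h)"
proof
  assume "\<theta> (inv g) x \<in> V h"
  then show "x \<in> V (g \<otimes> h)"
    using theta_dom[of g h "\<theta> (inv g) x"] theta_range[of "inv g" x] theta_inv[of g x] x g h by auto
next
  assume "x \<in> V (g \<otimes> h)"
  then have "\<theta> (inv g) x \<in> V (inv g \<otimes> (g \<otimes> h))"
    using theta_dom[of "inv g" "g \<otimes> h" x] x g h by auto
  then show "\<theta> (inv g) x \<in> V h" using g h by (simp add: m_assoc[symmetric])
qed

lemma theta_comp:
  assumes g: "g \<in> carrier G" and h: "h \<in> carrier G" and x: "x \<in> V g" "x \<in> V (g \<otimes> h)"
  shows "\<theta> (inv h) (\<theta> (inv g) x) = \<theta> (inv (g \<otimes> h)) x"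
  using theta_mult[of "inv h" "inv g" x] g h x by (simp add: inv_mult_group)

lemma L_mult_closed:
  assumes a: "a \<in> carrier L" and b: "b \<in> carrier L"
  shows "a \<otimes>\<^bsub>L\<^esub> b \<in> carrier L"
proof (rule L_carrierI[of "(\<lambda>(g, h). g \<otimes> h) ` (supp a \<times> supp b)"])
  fix k assume "k \<notin> (\<lambda>(g, h). g \<otimes> h) ` (supp a \<times> supp b)"
  then have "{(g, h). g \<in> supp a \<and> h \<in> supp b \<and> g \<otimes> h = k} = {}" by auto
  then show "(a \<otimes>\<^bsub>L\<^esub> b) k = (\<lambda>x. 0)" by (simp only: L_mult_pairs(1)[OF a b] fun_eq_iff sum.empty) simp
next
  fix k
  have "(a \<otimes>\<^bsub>L\<^esub> b) k x = 0" if x: "x \<notin> V k" for x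
  proof -
    have "a g x * b h (\<theta> (inv g) x) = 0" if "g \<in> supp a" "h \<in> supp b" "g \<otimes> h = k" for g h
    proof (cases "x \<in> V g")
      case True
      then have "\<theta> (inv g) x \<notin> V h"
        using theta_dom_iff[of g h x] that x L_supp[OF a] L_supp[OF b] by auto
      then show ?thesis using L_outside[OF b] by simp
    qed (simp add: L_outside[OF a])
    then show ?thesis unfolding L_mult_pairs(1)[OF a b] by (intro sum.neutral) auto
  qed
  then show "(a \<otimes>\<^bsub>L\<^esub> b) k \<in> ID k" using L_mult_pairs(2)[OF a b] by (simp add: ID_iff)
qed (use L_finite[OF a] L_finite[OF b] L_supp[OF a] L_supp[OF b] in auto)

lemma L_add_closed:
  assumes a: "a \<in> carrier L" and b: "b \<in> carrier L" shows "a \<oplus>\<^bsub>L\<^esub> b \<in> carrier L"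
proof (rule L_carrierI[of "supp a \<union> supp b"])
  fix g assume g: "g \<in> supp a \<union> supp b"
  have "a g \<oplus>\<^bsub>CA\<^esub> b g \<in> carrier CA" by (intro CX.M.a_closed L_closed a b)
  then show "(a \<oplus>\<^bsub>L\<^esub> b) g \<in> ID g"
    using L_outside[OF a] L_outside[OF b] by (simp add: ID_iff L_simps) (simp add: cont_alg_simps)
qed (use L_finite[OF a] L_finite[OF b] L_supp[OF a] L_supp[OF b] in \<open>auto simp: supp_iff L_simps\<close>)

lemma L_smult_closed:
  assumes a: "a \<in> carrier L" shows "c \<odot>\<^bsub>L\<^esub> a \<in> carrier L"
proof (rule L_carrierI[of "supp a"])
  fix g assume g: "g \<in> supp a"
  have "c \<odot>\<^bsub>CA\<^esub> a g \<in> carrier CA" by (intro CX.smult_closed_complex L_closed a)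
  then show "(c \<odot>\<^bsub>L\<^esub> a) g \<in> ID g"
    using L_outside[OF a] by (simp add: ID_iff L_simps) (simp add: cont_alg_simps)
qed (use L_finite[OF a] L_supp[OF a] in \<open>auto simp: supp_iff L_simps\<close>)

lemma L_star_closed:
  assumes a: "a \<in> carrier L" shows "star L a \<in> carrier L"
proof (rule L_carrierI[of "m_inv G ` supp a"])
  fix g assume "g \<notin> m_inv G ` supp a"
  then have "g \<in> carrier G \<Longrightarrow> inv g \<notin> supp a" by (metis image_eqI inv_inv)
  then show "star L a g = (\<lambda>x. 0)" by (auto simp: fun_eq_iff L_simps supp_iff)
next
  fix g assume "g \<in> m_inv G ` supp a"
  then have g: "g \<in> carrier G" using L_supp[OF a] by auto
  have "act g (star CA (a (inv g))) \<in> ID g" by (intro act_closed g CX.star_closed L_closed a)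
  moreover have "star L a g = act g (star CA (a (inv g)))"
    by (auto simp: fun_eq_iff L_simps g act_apply) (simp add: cont_alg_simps)
  ultimately show "star L a g \<in> ID g" by simp
qed (use L_finite[OF a] L_supp[OF a] in auto)

lemma L_mult_outside:
  assumes a: "a \<in> carrier L" and b: "b \<in> carrier L" and k: "k \<notin> carrier G"
  shows "(a \<otimes>\<^bsub>L\<^esub> b) k x = 0"
  by (rule L_zero[OF L_mult_closed[OF a b] k])

text \<open>Both sides are sums over pairs of group elements; the substitution \<open>h = g h'\<close> matches them. A term in
  which the composite of the partial maps is not defined vanishes on both sides.\<close>

lemma L_mult_assoc:
  assumes a: "a \<in> carrier L" and b: "b \<in> carrier L" and c: "c \<in> carrier L"
  shows "(a \<otimes>\<^bsub>L\<^esub> b) \<otimes>\<^bsub>L\<^esub> c = a \<otimes>\<^bsub>L\<^esub> (b \<otimes>\<^bsub>L\<^esub> c)"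
proof (intro ext)
  fix k x
  note ab = L_mult_closed[OF a b] and bc = L_mult_closed[OF b c]
  show "((a \<otimes>\<^bsub>L\<^esub> b) \<otimes>\<^bsub>L\<^esub> c) k x = (a \<otimes>\<^bsub>L\<^esub> (b \<otimes>\<^bsub>L\<^esub> c)) k x"
  proof (cases "k \<in> carrier G")
    case False then show ?thesis by (simp add: L_mult_outside a b c ab bc)
  next
    case k: True
    define T where "T = (\<lambda>(g, h). g \<otimes> h) ` (supp a \<times> supp b) \<union> supp (a \<otimes>\<^bsub>L\<^esub> b)"
    have T: "finite T" "supp (a \<otimes>\<^bsub>L\<^esub> b) \<subseteq> T" "T \<subseteq> carrier G"
      using L_finite a b ab L_supp by (auto simp: T_def subset_iff)
    have "((a \<otimes>\<^bsub>L\<^esub> b) \<otimes>\<^bsub>L\<^esub> c) k x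
       = (\<Sum>h\<in>T. (\<Sum>g\<in>supp a. a g x * b (inv g \<otimes> h) (\<theta> (inv g) x)) * c (inv h \<otimes> k) (\<theta> (inv h) x))"
      using T by (simp add: L_mult_apply[OF ab c k T]
          L_mult_apply[OF a b _ L_finite[OF a] order_refl L_supp[OF a]] subset_iff cong: sum.cong)
    also have "\<dots> = (\<Sum>g\<in>supp a. \<Sum>h\<in>T. a g x * b (inv g \<otimes> h) (\<theta> (inv g) x) * c (inv h \<otimes> k) (\<theta> (inv h) x))"
      by (subst sum.swap) (simp add: sum_distrib_right)
    also have "\<dots> = (\<Sum>g\<in>supp a. a g x * (b \<otimes>\<^bsub>L\<^esub> c) (inv g \<otimes> k) (\<theta> (inv g) x))"
    proof (rule sum.cong[OF refl])
      fix g assume gs: "g \<in> supp a"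
      then have g: "g \<in> carrier G" using L_supp[OF a] by blast
      show "(\<Sum>h\<in>T. a g x * b (inv g \<otimes> h) (\<theta> (inv g) x) * c (inv h \<otimes> k) (\<theta> (inv h) x))
          = a g x * (b \<otimes>\<^bsub>L\<^esub> c) (inv g \<otimes> k) (\<theta> (inv g) x)"
      proof (cases "x \<in> V g")
        case False then show ?thesis by (simp add: L_outside[OF a])
      next
        case x: True
        let ?y = "\<theta> (inv g) x"
        let ?T = "(\<lambda>h. inv g \<otimes> h) ` T"
        have T': "finite ?T" "supp b \<subseteq> ?T" "?T \<subseteq> carrier G"
        proof -
          show "supp b \<subseteq> ?T"
          proof
            fix h assume h: "h \<in> supp b"
            then have "h = inv g \<otimes> (g \<otimes> h)" using g L_supp[OF b] by (auto simp: m_assoc[symmetric] subset_iff)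
            then show "h \<in> ?T" using h gs unfolding T_def by blast
          qed
        qed (use T g in auto)
        have inj: "inj_on (\<lambda>h. inv g \<otimes> h) T" using T g by (intro inj_onI) (auto simp: subset_iff)
        have "(b \<otimes>\<^bsub>L\<^esub> c) (inv g \<otimes> k) ?y = (\<Sum>h'\<in>?T. b h' ?y * c (inv h' \<otimes> (inv g \<otimes> k)) (\<theta> (inv h') ?y))"
          by (rule L_mult_apply[OF b c _ T']) (use g k in simp)
        also have "\<dots> = (\<Sum>h\<in>T. b (inv g \<otimes> h) ?y * c (inv (inv g \<otimes> h) \<otimes> (inv g \<otimes> k)) (\<theta> (inv (inv g \<otimes> h)) ?y))"
          by (rule sum.reindex[OF inj, unfolded comp_def])
        also have "\<dots> = (\<Sum>h\<in>T. b (inv g \<otimes> h) ?y * c (inv h \<otimes> k) (\<theta> (inv h) x))"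
        proof (rule sum.cong[OF refl])
          fix h assume "h \<in> T"
          then have h: "h \<in> carrier G" using T by blast
          have 1: "g \<otimes> (inv g \<otimes> h) = h" using g h by (simp add: m_assoc[symmetric])
          have 2: "inv (inv g \<otimes> h) \<otimes> (inv g \<otimes> k) = inv h \<otimes> k"
            using g h k by (simp add: inv_mult_group) (simp add: m_assoc, simp add: m_assoc[symmetric])
          show "b (inv g \<otimes> h) ?y * c (inv (inv g \<otimes> h) \<otimes> (inv g \<otimes> k)) (\<theta> (inv (inv g \<otimes> h)) ?y)
              = b (inv g \<otimes> h) ?y * c (inv h \<otimes> k) (\<theta> (inv h) x)"
          proof (cases "?y \<in> V (inv g \<otimes> h)")
            case True
            then have "x \<in> V h" using theta_dom_iff[OF g _ x, of "inv g \<otimes> h"] g h 1 by simp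
            then show ?thesis using theta_comp[OF g _ x, of "inv g \<otimes> h"] g h by (simp add: 1 2)
          qed (simp add: L_outside[OF b])
        qed
        finally show ?thesis by (simp add: sum_distrib_left mult.assoc)
      qed
    qed
    also have "\<dots> = (a \<otimes>\<^bsub>L\<^esub> (b \<otimes>\<^bsub>L\<^esub> c)) k x"
      by (rule L_mult_apply[symmetric, OF a bc k L_finite[OF a] order_refl L_supp[OF a]])
    finally show ?thesis .
  qed
qed

lemma L_star_mult:
  assumes a: "a \<in> carrier L" and b: "b \<in> carrier L"
  shows "star L (a \<otimes>\<^bsub>L\<^esub> b) = star L b \<otimes>\<^bsub>L\<^esub> star L a"
proof (intro ext)
  fix k x
  note sa = L_star_closed[OF a] and sb = L_star_closed[OF b] and ab = L_mult_closed[OF a b]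
  show "star L (a \<otimes>\<^bsub>L\<^esub> b) k x = (star L b \<otimes>\<^bsub>L\<^esub> star L a) k x"
  proof (cases "k \<in> carrier G \<and> x \<in> V k")
    case False
    then show ?thesis
      using L_zero[OF L_mult_closed[OF sb sa], of k x] L_outside[OF L_mult_closed[OF sb sa], of x k]
      by (auto simp: L_simps(5)[of "a \<otimes>\<^bsub>L\<^esub> b"])
  next
    case True
    then have k: "k \<in> carrier G" and x: "x \<in> V k" by auto
    let ?y = "\<theta> (inv k) x"
    have y: "?y \<in> V (inv k)" using theta_range[of "inv k" x] k x by simp
    define T where "T = (\<lambda>g. k \<otimes> g) ` supp a \<union> supp (star L b)"
    have T: "finite T" "supp (star L b) \<subseteq> T" "T \<subseteq> carrier G"
      using L_finite[OF a] L_finite[OF sb] L_supp[OF a] L_supp[OF sb] k by (auto simp: T_def)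
    let ?T = "(\<lambda>h. inv k \<otimes> h) ` T"
    have T': "finite ?T" "supp a \<subseteq> ?T" "?T \<subseteq> carrier G"
    proof -
      show "supp a \<subseteq> ?T"
      proof
        fix h assume h: "h \<in> supp a"
        then have "h = inv k \<otimes> (k \<otimes> h)" using k L_supp[OF a] by (auto simp: m_assoc[symmetric] subset_iff)
        then show "h \<in> ?T" using h unfolding T_def by blast
      qed
    qed (use T k in auto)
    have inj: "inj_on (\<lambda>h. inv k \<otimes> h) T" using T k by (intro inj_onI) (auto simp: subset_iff)
    have "star L (a \<otimes>\<^bsub>L\<^esub> b) k x = cnj ((a \<otimes>\<^bsub>L\<^esub> b) (inv k) ?y)" using k x by (simp add: L_simps(5))
    also have "(a \<otimes>\<^bsub>L\<^esub> b) (inv k) ?y = (\<Sum>g\<in>?T. a g ?y * b (inv g \<otimes> inv k) (\<theta> (inv g) ?y))"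
      by (rule L_mult_apply[OF a b _ T']) (use k in simp)
    also have "\<dots> = (\<Sum>h\<in>T. a (inv k \<otimes> h) ?y * b (inv (inv k \<otimes> h) \<otimes> inv k) (\<theta> (inv (inv k \<otimes> h)) ?y))"
      by (rule sum.reindex[OF inj, unfolded comp_def])
    also have "cnj \<dots> = (\<Sum>h\<in>T. star L b h x * star L a (inv h \<otimes> k) (\<theta> (inv h) x))"
      unfolding cnj_sum
    proof (rule sum.cong[OF refl])
      fix h assume "h \<in> T"
      then have h: "h \<in> carrier G" using T by blast
      have 1: "inv (inv k \<otimes> h) \<otimes> inv k = inv h" "inv (inv h \<otimes> k) = inv k \<otimes> h" "k \<otimes> (inv k \<otimes> h) = h"
          "h \<otimes> (inv h \<otimes> k) = k"
        using h k by (simp_all add: inv_mult_group m_assoc, simp_all add: m_assoc[symmetric])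
      show "cnj (a (inv k \<otimes> h) ?y * b (inv (inv k \<otimes> h) \<otimes> inv k) (\<theta> (inv (inv k \<otimes> h)) ?y))
        = star L b h x * star L a (inv h \<otimes> k) (\<theta> (inv h) x)"
      proof (cases "x \<in> V h")
        case True
        have "\<theta> (inv (inv k \<otimes> h)) ?y = \<theta> (inv h) x"
          using theta_comp[OF k _ x, of "inv k \<otimes> h"] True k h by (simp add: 1)
        moreover have "\<theta> (inv h) x \<in> V (inv h \<otimes> k)"
          using theta_dom_iff[OF h _ True, of "inv h \<otimes> k"] x k h by (simp add: 1)
        moreover have "\<theta> (inv (inv h \<otimes> k)) (\<theta> (inv h) x) = ?y"
          using theta_comp[OF h _ True, of "inv h \<otimes> k"] x k h by (simp add: 1)
        ultimately show ?thesis using True k h by (simp add: L_simps(5) 1)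
      next
        case False
        then have "?y \<notin> V (inv k \<otimes> h)" using theta_dom_iff[OF k _ x, of "inv k \<otimes> h"] k h by (simp add: 1)
        then show ?thesis using False L_outside[OF a] by (simp add: L_simps(5))
      qed
    qed
    also have "\<dots> = (star L b \<otimes>\<^bsub>L\<^esub> star L a) k x"
      by (rule L_mult_apply[symmetric, OF sb sa k T])
    finally show ?thesis .
  qed
qed

lemma L_zero_closed: "\<zero>\<^bsub>L\<^esub> \<in> carrier L"
  by (rule L_carrierI[of "{}"]) (auto simp: L_simps)

lemma star_algebra_L: "star_algebra L"
proof (rule star_algebraI)
  show "star_algebra_axioms L"
  proof
    fix a b c assume a: "a \<in> carrier L"
    show "star L a \<in> carrier L" by (rule L_star_closed[OF a])
    show "star L (star L a) = a"
    proof (intro ext)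
      fix g x show "star L (star L a) g x = a g x"
        using theta_range[of "inv g" x] theta_inv[of g x] L_outside[OF a, of x g] L_zero[OF a, of g x]
        by (auto simp: L_simps(5))
    qed
    show "star L (z \<odot>\<^bsub>L\<^esub> a) = cnj z \<odot>\<^bsub>L\<^esub> star L a" for z
      by (auto simp: L_simps fun_eq_iff)
    assume b: "b \<in> carrier L"
    show "a \<otimes>\<^bsub>L\<^esub> b \<in> carrier L" by (rule L_mult_closed[OF a b])
    show "star L (a \<oplus>\<^bsub>L\<^esub> b) = star L a \<oplus>\<^bsub>L\<^esub> star L b"
      by (auto simp: L_simps fun_eq_iff)
    show "star L (a \<otimes>\<^bsub>L\<^esub> b) = star L b \<otimes>\<^bsub>L\<^esub> star L a" by (rule L_star_mult[OF a b])
    show "(z \<odot>\<^bsub>L\<^esub> a) \<otimes>\<^bsub>L\<^esub> b = z \<odot>\<^bsub>L\<^esub> (a \<otimes>\<^bsub>L\<^esub> b)" for z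
    proof (intro ext)
      fix k x
      have za: "z \<odot>\<^bsub>L\<^esub> a \<in> carrier L" by (rule L_smult_closed[OF a])
      have s: "supp (z \<odot>\<^bsub>L\<^esub> a) \<subseteq> supp a" by (auto simp: supp_iff L_simps)
      show "((z \<odot>\<^bsub>L\<^esub> a) \<otimes>\<^bsub>L\<^esub> b) k x = (z \<odot>\<^bsub>L\<^esub> (a \<otimes>\<^bsub>L\<^esub> b)) k x"
      proof (cases "k \<in> carrier G")
        case k: True
        show ?thesis
          by (subst L_mult_apply[OF za b k L_finite[OF a] s L_supp[OF a]])
            (simp add: L_simps(4) L_mult_apply[OF a b k L_finite[OF a] order_refl L_supp[OF a]] sum_distrib_left mult.assoc)
      next
        case False
        then show ?thesis using L_mult_outside[OF za b] L_mult_outside[OF a b] by (simp add: L_simps(4))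
      qed
    qed
    show "a \<otimes>\<^bsub>L\<^esub> (z \<odot>\<^bsub>L\<^esub> b) = z \<odot>\<^bsub>L\<^esub> (a \<otimes>\<^bsub>L\<^esub> b)" for z
    proof (intro ext)
      fix k x
      have zb: "z \<odot>\<^bsub>L\<^esub> b \<in> carrier L" by (rule L_smult_closed[OF b])
      show "(a \<otimes>\<^bsub>L\<^esub> (z \<odot>\<^bsub>L\<^esub> b)) k x = (z \<odot>\<^bsub>L\<^esub> (a \<otimes>\<^bsub>L\<^esub> b)) k x"
      proof (cases "k \<in> carrier G")
        case k: True
        show ?thesis
          by (subst L_mult_apply[OF a zb k L_finite[OF a] order_refl L_supp[OF a]])
            (simp add: L_simps(4) L_mult_apply[OF a b k L_finite[OF a] order_refl L_supp[OF a]] sum_distrib_left mult.left_commute)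
      next
        case False
        then show ?thesis using L_mult_outside[OF a zb] L_mult_outside[OF a b] by (simp add: L_simps(4))
      qed
    qed
    assume c: "c \<in> carrier L"
    show "a \<otimes>\<^bsub>L\<^esub> b \<otimes>\<^bsub>L\<^esub> c = a \<otimes>\<^bsub>L\<^esub> (b \<otimes>\<^bsub>L\<^esub> c)" by (rule L_mult_assoc[OF a b c])
    show "(a \<oplus>\<^bsub>L\<^esub> b) \<otimes>\<^bsub>L\<^esub> c = a \<otimes>\<^bsub>L\<^esub> c \<oplus>\<^bsub>L\<^esub> b \<otimes>\<^bsub>L\<^esub> c"
    proof (intro ext)
      fix k x
      have ab: "a \<oplus>\<^bsub>L\<^esub> b \<in> carrier L" by (rule L_add_closed[OF a b])
      let ?T = "supp a \<union> supp b"
      have T: "finite ?T" "supp a \<subseteq> ?T" "supp b \<subseteq> ?T" "supp (a \<oplus>\<^bsub>L\<^esub> b) \<subseteq> ?T" "?T \<subseteq> carrier G"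
        using L_finite[OF a] L_finite[OF b] L_supp[OF a] L_supp[OF b] by (auto simp: supp_iff L_simps)
      show "((a \<oplus>\<^bsub>L\<^esub> b) \<otimes>\<^bsub>L\<^esub> c) k x = (a \<otimes>\<^bsub>L\<^esub> c \<oplus>\<^bsub>L\<^esub> b \<otimes>\<^bsub>L\<^esub> c) k x"
      proof (cases "k \<in> carrier G")
        case k: True
        show ?thesis
          by (subst L_mult_apply[OF ab c k T(1,4,5)])
            (simp add: L_simps(3) L_mult_apply[OF a c k T(1,2,5)] L_mult_apply[OF b c k T(1,3,5)]
              sum.distrib distrib_right)
      next
        case False
        then show ?thesis
          using L_mult_outside[OF ab c] by (simp add: L_mult_outside[OF a c] L_mult_outside[OF b c] L_simps(3))
      qed
    qed
    show "c \<otimes>\<^bsub>L\<^esub> (a \<oplus>\<^bsub>L\<^esub> b) = c \<otimes>\<^bsub>L\<^esub> a \<oplus>\<^bsub>L\<^esub> c \<otimes>\<^bsub>L\<^esub> b"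
    proof (intro ext)
      fix k x
      have ab: "a \<oplus>\<^bsub>L\<^esub> b \<in> carrier L" by (rule L_add_closed[OF a b])
      note T = L_finite[OF c] order_refl L_supp[OF c]
      show "(c \<otimes>\<^bsub>L\<^esub> (a \<oplus>\<^bsub>L\<^esub> b)) k x = (c \<otimes>\<^bsub>L\<^esub> a \<oplus>\<^bsub>L\<^esub> c \<otimes>\<^bsub>L\<^esub> b) k x"
      proof (cases "k \<in> carrier G")
        case k: True
        show ?thesis
          by (subst L_mult_apply[OF c ab k T])
            (simp add: L_simps(3) L_mult_apply[OF c a k T] L_mult_apply[OF c b k T] sum.distrib distrib_left)
      next
        case False
        then show ?thesis
          using L_mult_outside[OF c ab] by (simp add: L_mult_outside[OF c a] L_mult_outside[OF c b] L_simps(3))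
      qed
    qed
  qed
qed (auto simp: L_add_closed L_smult_closed L_zero_closed, auto simp: L_simps fun_eq_iff algebra_simps)

lemma single_carrier: "g \<in> carrier G \<Longrightarrow> f \<in> ID g \<Longrightarrow> cp_single CA f g \<in> carrier L"
  by (rule L_carrierI[of "{g}"]) (auto simp: cp_single_def cont_alg_simps)

lemma single_mult:
  assumes "g \<in> carrier G" "f \<in> ID g" "b \<in> carrier L" "k \<in> carrier G"
  shows "(cp_single CA f g \<otimes>\<^bsub>L\<^esub> b) k x = f x * b (inv g \<otimes> k) (\<theta> (inv g) x)"
proof -
  have "supp (cp_single CA f g) \<subseteq> {g}" by (auto simp: supp_iff cp_single_def cont_alg_simps split: if_splits)
  then have "(cp_single CA f g \<otimes>\<^bsub>L\<^esub> b) k x = (\<Sum>h\<in>{g}. cp_single CA f g h x * b (inv h \<otimes> k) (\<theta> (inv h) x))"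
    by (intro L_mult_apply single_carrier) (use assms in auto)
  then show ?thesis by (simp add: cp_single_def)
qed

lemma mult_single:
  assumes a: "a \<in> carrier L" and g: "g \<in> carrier G" "f \<in> ID g"  and k: "k \<in> carrier G"
  shows "(a \<otimes>\<^bsub>L\<^esub> cp_single CA f g) k x = a (k \<otimes> inv g) x * f (\<theta> (g \<otimes> inv k) x)"
proof -
  let ?h = "k \<otimes> inv g"
  have h: "?h \<in> carrier G" "inv ?h = g \<otimes> inv k" using g k by (simp_all add: inv_mult_group)
  have iff: "inv h \<otimes> k = g \<longleftrightarrow> h = ?h" if "h \<in> carrier G" for h

  proof
    assume "inv h \<otimes> k = g"
    then have "k = h \<otimes> g" using that k by (auto simp: m_assoc[symmetric])
    then show "h = ?h" using that g by (simp add: m_assoc)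
  next
    assume "h = ?h"
    then have "k = h \<otimes> g" using g k by (simp add: m_assoc)
    then show "inv h \<otimes> k = g" using that g by (simp add: m_assoc[symmetric])
  qed
  let ?T = "insert ?h (supp a)"
  have "(a \<otimes>\<^bsub>L\<^esub> cp_single CA f g) k x = (\<Sum>h\<in>?T. a h x * cp_single CA f g (inv h \<otimes> k) (\<theta> (inv h) x))"
    by (rule L_mult_apply[OF a single_carrier[OF g] k]) (use h L_finite[OF a] L_supp[OF a] in auto)
  also have "\<dots> = (\<Sum>h\<in>{?h}. a h x * cp_single CA f g (inv h \<otimes> k) (\<theta> (inv h) x))"
    by (rule sum.mono_neutral_right) (use h L_finite[OF a] L_supp[OF a] iff in \<open>auto simp: cp_single_def cont_alg_simps\<close>)
  also have "\<dots> = a ?h x * f (\<theta> (g \<otimes> inv k) x)" using iff[OF h(1)] h by (simp add: cp_single_def)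
  finally show ?thesis .
qed

lemma one_ID: "\<one>\<^bsub>CA\<^esub> \<in> ID \<one>"
  using unital_cont[of X] by (auto simp: unital_def cont_ideal_def V_one) (simp add: cont_alg_simps)

lemma unital_L: "unital L"
  unfolding unital_def
proof (intro conjI ballI)
  show o: "\<one>\<^bsub>L\<^esub> \<in> carrier L" unfolding L_simps by (intro single_carrier one_ID) simp
  fix a assume a: "a \<in> carrier L"
  show "\<one>\<^bsub>L\<^esub> \<otimes>\<^bsub>L\<^esub> a = a"
  proof (intro ext)
    fix k x
    have "a k x = 0" if "x \<notin> topspace X" using L_closed[OF a, of k] that by (simp add: cont_alg_carrier)
    then show "(\<one>\<^bsub>L\<^esub> \<otimes>\<^bsub>L\<^esub> a) k x = a k x"
      using L_mult_outside[OF o a, of k x] single_mult[OF one_closed one_ID a, of k x] L_zero[OF a, of k x]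
      by (cases "k \<in> carrier G"; cases "x \<in> topspace X") (simp_all add: L_simps(1) cont_alg_simps theta_one)
  qed
  show "a \<otimes>\<^bsub>L\<^esub> \<one>\<^bsub>L\<^esub> = a"
  proof (intro ext)
    fix k x
    have "\<theta> (inv k) x \<in> topspace X" if "x \<in> V k" "k \<in> carrier G"
      using that theta_range[of "inv k" x] V_sub[of "inv k"] by auto
    then show "(a \<otimes>\<^bsub>L\<^esub> \<one>\<^bsub>L\<^esub>) k x = a k x"
      using L_outside[OF a, of x k] L_mult_outside[OF a o, of k x] mult_single[OF a one_closed one_ID, of k x] L_zero[OF a, of k x]
      by (cases "k \<in> carrier G"; cases "x \<in> V k") (simp_all add: L_simps(1) cont_alg_simps)
  qed
qed

lemma norm_bound: "a \<in> carrier L \<Longrightarrow> cmod (a g x) \<le> nrm CA (a g)"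
  using cont_norm_upper[OF compact L_closed, of a x g] cont_norm_nonneg[OF compact L_closed, of a g]
    L_closed[of a g] by (cases "x \<in> topspace X") (auto simp: cont_alg_carrier)

lemma nrm_CA_zero: "nrm CA (\<lambda>x. 0) = 0"
  using CX.seminorm_zero[OF cont_norm_cstar[OF compact]] by (simp add: cont_alg_simps(3))

lemma nrm_superset: "a \<in> carrier L \<Longrightarrow> finite T \<Longrightarrow> supp a \<subseteq> T \<Longrightarrow> nrm L a = (\<Sum>g\<in>T. nrm CA (a g))"
  unfolding L_simps(6) by (rule sum.mono_neutral_left) (auto simp: supp_iff nrm_CA_zero)

lemma nrm_subset: "a \<in> carrier L \<Longrightarrow> finite T \<Longrightarrow> (\<Sum>g\<in>T. nrm CA (a g)) \<le> nrm L a"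
  using nrm_superset[of a "T \<union> supp a"] L_finite[of a]
  by (auto intro!: sum_mono2 cont_norm_nonneg[OF compact] L_closed)

text \<open>The norm is submultiplicative because convolution is dominated by the convolution of the functions
  \<open>g \<mapsto> \<parallel>a g\<parallel>\<close> and \<open>h \<mapsto> \<parallel>b h\<parallel>\<close> on the group.\<close>

theorem normed_star_algebra_L: "normed_star_algebra L"
proof (intro normed_star_algebra.intro normed_star_algebra_axioms.intro star_algebra_L)
  interpret Lalg: star_algebra L by (rule star_algebra_L)
  note cn = cstar_seminormD[OF cont_norm_cstar[OF compact]]
  fix a assume a: "a \<in> carrier L"
  show "0 \<le> nrm L a" unfolding L_simps by (intro sum_nonneg cont_norm_nonneg[OF compact] L_closed a)
  show "nrm L (c \<odot>\<^bsub>L\<^esub> a) = cmod c * nrm L a" for c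
  proof -
    have "(c \<odot>\<^bsub>L\<^esub> a) g = c \<odot>\<^bsub>CA\<^esub> a g" for g by (simp add: L_simps cont_alg_simps)
    moreover have "supp (c \<odot>\<^bsub>L\<^esub> a) \<subseteq> supp a" by (auto simp: supp_iff L_simps)
    ultimately have "nrm L (c \<odot>\<^bsub>L\<^esub> a) = (\<Sum>g\<in>supp a. nrm CA (c \<odot>\<^bsub>CA\<^esub> a g))"
      using nrm_superset[OF L_smult_closed[OF a] L_finite[OF a]] by simp
    then show ?thesis by (simp add: cn(3)[OF L_closed[OF a]] L_simps(6) sum_distrib_left)
  qed
  have star_le: "nrm L (star L a) \<le> nrm L a" if a: "a \<in> carrier L" for a
  proof -
    have s: "supp (star L a) \<subseteq> carrier G" by (rule L_supp[OF L_star_closed[OF a]])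
    have "nrm L (star L a) \<le> (\<Sum>g\<in>supp (star L a). nrm CA (a (inv g)))"
      unfolding L_simps(6)
    proof (rule sum_mono)
      fix g
      show "nrm CA (star L a g) \<le> nrm CA (a (inv g))"
        by (rule cont_norm_le) (auto simp: L_simps norm_bound a intro!: cont_norm_nonneg[OF compact] L_closed[OF a])
    qed
    also have "\<dots> = (\<Sum>h\<in>m_inv G ` supp (star L a). nrm CA (a h))"
      by (rule sum.reindex_bij_witness[of _ "m_inv G" "m_inv G"]) (use s in auto)
    also have "\<dots> \<le> nrm L a"
      using L_finite[OF L_star_closed[OF a]] by (intro nrm_subset a) simp
    finally show ?thesis .
  qed
  show "nrm L (star L a) = nrm L a"
    using star_le[OF a] star_le[OF L_star_closed[OF a]] by (simp add: Lalg.star_star a)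
  fix b assume b: "b \<in> carrier L"
  show "nrm L (a \<oplus>\<^bsub>L\<^esub> b) \<le> nrm L a + nrm L b"
  proof -
    let ?T = "supp a \<union> supp b"
    have T: "finite ?T" "supp (a \<oplus>\<^bsub>L\<^esub> b) \<subseteq> ?T" using L_finite a b by (auto simp: supp_iff L_simps)
    have "(a \<oplus>\<^bsub>L\<^esub> b) g = a g \<oplus>\<^bsub>CA\<^esub> b g" for g by (simp add: L_simps cont_alg_simps)
    then have "nrm L (a \<oplus>\<^bsub>L\<^esub> b) \<le> (\<Sum>g\<in>?T. nrm CA (a g) + nrm CA (b g))"
      unfolding nrm_superset[OF L_add_closed[OF a b] T] by (auto intro!: sum_mono cn(2) L_closed a b)
    then show ?thesis
      using nrm_superset[OF a T(1)] nrm_superset[OF b T(1)] by (simp add: sum.distrib)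
  qed
  show "nrm L (a \<otimes>\<^bsub>L\<^esub> b) \<le> nrm L a * nrm L b"
  proof -
    let ?T = "supp (a \<otimes>\<^bsub>L\<^esub> b)"
    have ab: "a \<otimes>\<^bsub>L\<^esub> b \<in> carrier L" by (rule L_mult_closed[OF a b])
    have T: "finite ?T" "?T \<subseteq> carrier G" by (rule L_finite[OF ab], rule L_supp[OF ab])
    have nn: "0 \<le> nrm CA (a g)" "0 \<le> nrm CA (b g)" for g
      by (intro cont_norm_nonneg[OF compact] L_closed a b)+
    have "nrm L (a \<otimes>\<^bsub>L\<^esub> b) \<le> (\<Sum>k\<in>?T. \<Sum>g\<in>supp a. nrm CA (a g) * nrm CA (b (inv g \<otimes> k)))"
      unfolding L_simps(6)
    proof (rule sum_mono)
      fix k assume "k \<in> ?T"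
      then have k: "k \<in> carrier G" using T by blast
      show "nrm CA ((a \<otimes>\<^bsub>L\<^esub> b) k) \<le> (\<Sum>g\<in>supp a. nrm CA (a g) * nrm CA (b (inv g \<otimes> k)))"
      proof (rule cont_norm_le)
        fix x
        have "cmod ((a \<otimes>\<^bsub>L\<^esub> b) k x) \<le> (\<Sum>g\<in>supp a. cmod (a g x * b (inv g \<otimes> k) (\<theta> (inv g) x)))"
          unfolding L_mult_apply[OF a b k L_finite[OF a] order_refl L_supp[OF a]] by (rule norm_sum)
        also have "\<dots> \<le> (\<Sum>g\<in>supp a. nrm CA (a g) * nrm CA (b (inv g \<otimes> k)))"
          by (intro sum_mono) (auto simp: norm_mult intro!: mult_mono norm_bound a b nn)
        finally show "cmod ((a \<otimes>\<^bsub>L\<^esub> b) k x) \<le> (\<Sum>g\<in>supp a. nrm CA (a g) * nrm CA (b (inv g \<otimes> k)))" .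
      qed (intro sum_nonneg mult_nonneg_nonneg nn)
    qed
    also have "\<dots> = (\<Sum>g\<in>supp a. nrm CA (a g) * (\<Sum>k\<in>?T. nrm CA (b (inv g \<otimes> k))))"
      by (subst sum.swap) (simp add: sum_distrib_left)
    also have "\<dots> \<le> (\<Sum>g\<in>supp a. nrm CA (a g) * nrm L b)"
    proof (intro sum_mono mult_left_mono nn)
      fix g assume "g \<in> supp a"
      then have g: "g \<in> carrier G" using L_supp[OF a] by blast
      have "inj_on (\<lambda>k. inv g \<otimes> k) ?T" using T g by (intro inj_onI) (auto simp: subset_iff)
      then have "(\<Sum>k\<in>?T. nrm CA (b (inv g \<otimes> k))) = (\<Sum>h\<in>(\<lambda>k. inv g \<otimes> k) ` ?T. nrm CA (b h))"
        by (simp add: sum.reindex)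
      also have "\<dots> \<le> nrm L b" using T by (intro nrm_subset b) simp
      finally show "(\<Sum>k\<in>?T. nrm CA (b (inv g \<otimes> k))) \<le> nrm L b" .
    qed
    also have "\<dots> = nrm L a * nrm L b" by (simp add: L_simps(6) sum_distrib_right)
    finally show ?thesis .
  qed
qed

end

section \<open>Normal forms\<close>

text \<open>Normal forms are lists and not sets: a monomial may occur several times, and the expansion of a letter
  concatenates lists.\<close>

definition lsum :: "('a, 'm) star_alg_scheme \<Rightarrow> ('q \<Rightarrow> 'a) \<Rightarrow> 'q list \<Rightarrow> 'a" where
  "lsum A f xs = foldr (\<lambda>x y. f x \<oplus>\<^bsub>A\<^esub> y) xs \<zero>\<^bsub>A\<^esub>"

lemma lsum_simps [simp]: "lsum A f [] = \<zero>\<^bsub>A\<^esub>" "lsum A f (x # xs) = f x \<oplus>\<^bsub>A\<^esub> lsum A f xs"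
  by (simp_all add: lsum_def)

lemma lsum_map: "lsum A f (map g xs) = lsum A (\<lambda>x. f (g x)) xs"
  by (induction xs) auto

lemma lsum_cong: "(\<And>x. x \<in> set xs \<Longrightarrow> f x = g x) \<Longrightarrow> lsum A f xs = lsum A g xs"
  by (induction xs) auto

context star_algebra
begin

lemma lsum_closed: "(\<And>x. x \<in> set xs \<Longrightarrow> f x \<in> carrier A) \<Longrightarrow> lsum A f xs \<in> carrier A"
  by (induction xs) auto

lemma lsum_append:
  "(\<And>x. x \<in> set xs \<union> set ys \<Longrightarrow> f x \<in> carrier A) \<Longrightarrow> lsum A f (xs @ ys) = lsum A f xs \<oplus> lsum A f ys"
  by (induction xs) (auto simp: lsum_closed M.a_assoc)

lemma lsum_concat:
  "(\<And>x y. x \<in> set xs \<Longrightarrow> y \<in> set (g x) \<Longrightarrow> f y \<in> carrier A) \<Longrightarrow>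
    lsum A f (concat (map g xs)) = lsum A (\<lambda>x. lsum A f (g x)) xs"
proof (induction xs)
  case (Cons x xs)
  have "lsum A f (g x @ concat (map g xs)) = lsum A f (g x) \<oplus> lsum A f (concat (map g xs))"
    by (rule lsum_append) (use Cons.prems in auto)
  moreover have "lsum A f (concat (map g xs)) = lsum A (\<lambda>x. lsum A f (g x)) xs"
    by (rule Cons.IH) (use Cons.prems in auto)
  ultimately show ?case by simp
qed simp

lemma lsum_filter:
  "(\<And>x. x \<in> set xs \<Longrightarrow> P x \<Longrightarrow> f x \<in> carrier A) \<Longrightarrow>
    lsum A f (filter P xs) = lsum A (\<lambda>x. if P x then f x else \<zero>) xs"
  by (induction xs) (auto simp: lsum_closed)

lemma zero_mult: "x \<in> carrier A \<Longrightarrow> \<zero> \<otimes> x = \<zero>" and mult_zero: "x \<in> carrier A \<Longrightarrow> x \<otimes> \<zero> = \<zero>"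
  using smult_mult_l[of "\<zero>" x 0] smult_mult_r[of x "\<zero>" 0]
  by (simp_all add: smult_zero_complex mult_closed)

lemma star_zero: "star A \<zero> = \<zero>"
  using star_smult[of "\<zero>" 0] by (simp add: smult_zero_complex star_closed)

lemma mult_lsum:
  assumes "a \<in> carrier A"
  shows "(\<And>x. x \<in> set xs \<Longrightarrow> f x \<in> carrier A) \<Longrightarrow> a \<otimes> lsum A f xs = lsum A (\<lambda>x. a \<otimes> f x) xs"
  by (induction xs) (auto simp: mult_zero assms distr_r lsum_closed)

lemma lsum_mult:
  assumes "a \<in> carrier A"
  shows "(\<And>x. x \<in> set xs \<Longrightarrow> f x \<in> carrier A) \<Longrightarrow> lsum A f xs \<otimes> a = lsum A (\<lambda>x. f x \<otimes> a) xs"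
  by (induction xs) (auto simp: zero_mult assms distr_l lsum_closed)

lemma smult_lsum:
  "(\<And>x. x \<in> set xs \<Longrightarrow> f x \<in> carrier A) \<Longrightarrow> c \<odot> lsum A f xs = lsum A (\<lambda>x. c \<odot> f x) xs"
  by (induction xs) (use smult_r_null[of c] in \<open>auto simp: smult_r_distr lsum_closed\<close>)

lemma lsum_finsum:
  "distinct xs \<Longrightarrow> (\<And>x. x \<in> set xs \<Longrightarrow> f x \<in> carrier A) \<Longrightarrow> lsum A f xs = finsum A f (set xs)"
  by (induction xs) (auto simp: Pi_iff)

end

definition residue_reps :: "'r::idom \<Rightarrow> 'r list" where
  "residue_reps m = map (\<lambda>C. SOME l. l \<in> C) (SOME Cs. distinct Cs \<and> set Cs = residue_classes m)"

definition exact_quot :: "'r::idom \<Rightarrow> 'r \<Rightarrow> 'r" where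
  "exact_quot m t = (SOME d. t = m * d)"

lemma exact_quot: "m dvd t \<Longrightarrow> m * exact_quot m t = t"
  unfolding exact_quot_def by (metis (mono_tags) dvdE someI)

lemma class_iff: "x \<in> (+) l ` range ((*) m) \<longleftrightarrow> m dvd x - (l :: 'r::idom)"
proof
  assume "m dvd x - l"
  then obtain k where "x - l = m * k" by (elim dvdE)
  then have "x = l + m * k" by (simp add: diff_eq_eq add.commute)
  then show "x \<in> (+) l ` range ((*) m)" by blast
qed auto

lemma class_eqI: "C \<in> residue_classes m \<Longrightarrow> D \<in> residue_classes m \<Longrightarrow> x \<in> C \<Longrightarrow> y \<in> D \<Longrightarrow> m dvd x - y \<Longrightarrow> C = D"
proof -
  assume "C \<in> residue_classes m" "D \<in> residue_classes m" and xy: "x \<in> C" "y \<in> D" "m dvd x - y"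
  then obtain c d where C: "C = (+) c ` range ((*) m)" and D: "D = (+) d ` range ((*) m)" by (auto simp: residue_classes_def)
  have cd: "m dvd c - d"
  proof -
    have "m dvd x - c" "m dvd y - d" using xy C D by (auto simp only: class_iff)
    moreover have "c - d = (x - y) - (x - c) + (y - d)" by simp
    ultimately show ?thesis using xy(3) by (metis dvd_add dvd_diff)
  qed
  show "C = D" unfolding C D set_eq_iff class_iff
  proof
    fix z
    have "z - c + (c - d) = z - d" "z - d - (c - d) = z - c" by simp_all
    then show "m dvd z - c \<longleftrightarrow> m dvd z - d" using cd by (metis dvd_add dvd_diff)
  qed
qed

text \<open>The first three parts say that the list is a transversal. The others expose the choice behind it, so that
  sums over the list become sums over residue classes as in \<open>CL4\<close>.\<close>

lemma residue_reps:
  fixes m :: "'r::idom"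
  assumes fin: "finite (residue_classes m)"
  shows "distinct (residue_reps m)" "\<exists>i\<in>set (residue_reps m). m dvd t - i"
    "\<lbrakk>i \<in> set (residue_reps m); j \<in> set (residue_reps m); m dvd i - j\<rbrakk> \<Longrightarrow> i = j"
    and "residue_reps m = map (\<lambda>C. SOME l. l \<in> C) (SOME Cs. distinct Cs \<and> set Cs = residue_classes m)"
    and "distinct (SOME Cs. distinct Cs \<and> set Cs = residue_classes m)"
    "set (SOME Cs. distinct Cs \<and> set Cs = residue_classes m) = residue_classes m"
    and "C \<in> residue_classes m \<Longrightarrow> (SOME l. l \<in> C) \<in> C"
proof -
  let ?Cs = "SOME Cs. distinct Cs \<and> set Cs = residue_classes m" and ?r = "\<lambda>C :: 'r set. SOME l. l \<in> C"
  have "\<exists>Cs. distinct Cs \<and> set Cs = residue_classes m" using finite_distinct_list[OF fin] by blast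
  then have Cs: "distinct ?Cs \<and> set ?Cs = residue_classes m" by (rule someI_ex)
  then show 1: "distinct ?Cs" and 2: "set ?Cs = residue_classes m" by auto
  show 3: "residue_reps m = map ?r ?Cs" by (simp add: residue_reps_def)
  have r: "?r C \<in> C" if "C \<in> residue_classes m" for C
  proof (rule someI_ex)
    from that show "\<exists>l. l \<in> C" unfolding residue_classes_def by blast
  qed
  then show "C \<in> residue_classes m \<Longrightarrow> ?r C \<in> C" .
  have inj: "C = D" if "C \<in> residue_classes m" "D \<in> residue_classes m" "m dvd ?r C - ?r D" for C D
    using class_eqI[OF that(1,2) r[OF that(1)] r[OF that(2)] that(3)] .
  show "distinct (residue_reps m)"
    unfolding 3 distinct_map 2 using 1 inj by (intro conjI inj_onI) simp_all
  show "i = j" if ij: "i \<in> set (residue_reps m)" "j \<in> set (residue_reps m)" "m dvd i - j"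
  proof -
    obtain C D where "i = ?r C" "j = ?r D" "C \<in> residue_classes m" "D \<in> residue_classes m"
      using ij(1,2) 2 unfolding 3 set_map by blast
    then show ?thesis using inj ij(3) by blast
  qed
  let ?T = "(+) t ` range ((*) m)"
  have T: "?T \<in> residue_classes m" by (auto simp: residue_classes_def)
  have "m dvd ?r ?T - t" using r[OF T] unfolding class_iff .
  then have "m dvd t - ?r ?T" by (metis dvd_minus_iff minus_diff_eq)
  moreover have "?r ?T \<in> set (residue_reps m)" unfolding 3 set_map 2 using T by blast
  ultimately show "\<exists>i\<in>set (residue_reps m). m dvd t - i" by blast
qed

text \<open>The relations are imposed on elements of an arbitrary *-algebra, so that one computation serves both
  \<open>\<AA>[R]\<close> and the dense subalgebra of the crossed product.\<close>

locale cl_family = star_algebra A for A :: "('a, 'm) star_alg_scheme" (structure) +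
  fixes s u :: "'r::idom \<Rightarrow> 'a"
  assumes fin: "m \<noteq> 0 \<Longrightarrow> finite (residue_classes (m::'r))"
    and unital: "unital A"
    and s_closed [simp]: "m \<noteq> 0 \<Longrightarrow> s m \<in> carrier A" and u_closed [simp]: "u n \<in> carrier A"
    and rels: "(a, b) \<in> cl_relations A s u \<Longrightarrow> a = b"
begin

lemmas mult_closed_simp [simp] = mult_closed star_closed
lemmas zero_simps [simp] = zero_mult mult_zero star_zero

lemma one_closed [simp]: "\<one> \<in> carrier A" and one_l [simp]: "x \<in> carrier A \<Longrightarrow> \<one> \<otimes> x = x"
  and one_r [simp]: "x \<in> carrier A \<Longrightarrow> x \<otimes> \<one> = x"
  using unital by (auto simp: unital_def)

lemma iso: "m \<noteq> 0 \<Longrightarrow> star A (s m) \<otimes> s m = \<one>"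
  and u_iso: "star A (u n) \<otimes> u n = \<one>"
  and s_mult: "\<lbrakk>m \<noteq> 0; m' \<noteq> 0\<rbrakk> \<Longrightarrow> s m \<otimes> s m' = s (m * m')"
  and u_mult: "u n \<otimes> u n' = u (n + n')"
  and s_u: "m \<noteq> 0 \<Longrightarrow> s m \<otimes> u n = u (m * n) \<otimes> s m"
  by (rule rels, simp add: cl_relations.intros)+

lemma u_zero: "u 0 = \<one>"
proof -
  have "u 0 = (star A (u 0) \<otimes> u 0) \<otimes> u 0" by (simp only: u_iso) simp
  also have "\<dots> = star A (u 0) \<otimes> (u 0 \<otimes> u 0)" by (rule mult_assoc) simp_all
  also have "\<dots> = \<one>" by (simp add: u_mult u_iso)
  finally show ?thesis .
qed

lemma s_one: "s 1 = \<one>"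
proof -
  have "s 1 = (star A (s 1) \<otimes> s 1) \<otimes> s 1" using iso[of 1] by simp
  also have "\<dots> = star A (s 1) \<otimes> (s 1 \<otimes> s 1)" by (rule mult_assoc) simp_all
  also have "\<dots> = \<one>" by (simp add: s_mult iso)
  finally show ?thesis .
qed

lemma star_u: "star A (u n) = u (- n)"
proof -
  have "star A (u n) = star A (u n) \<otimes> (u n \<otimes> u (- n))" by (simp add: u_mult u_zero)
  also have "\<dots> = u (- n)" by (simp add: mult_assoc[symmetric] u_iso)
  finally show ?thesis .
qed

text \<open>The primed versions are the relations with a further factor \<open>z\<close>, for rewriting inside products that
  are nested to the right.\<close>

lemma iso': "m \<noteq> 0 \<Longrightarrow> z \<in> carrier A \<Longrightarrow> star A (s m) \<otimes> (s m \<otimes> z) = z"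
  by (simp add: mult_assoc[symmetric] iso)

lemma u_mult': "z \<in> carrier A \<Longrightarrow> u n \<otimes> (u n' \<otimes> z) = u (n + n') \<otimes> z"
  by (simp add: mult_assoc[symmetric] u_mult)

lemma s_mult': "\<lbrakk>m \<noteq> 0; m' \<noteq> 0; z \<in> carrier A\<rbrakk> \<Longrightarrow> s m \<otimes> (s m' \<otimes> z) = s (m * m') \<otimes> z"
  by (simp add: mult_assoc[symmetric] s_mult)

lemma s_u': "m \<noteq> 0 \<Longrightarrow> z \<in> carrier A \<Longrightarrow> s m \<otimes> (u n \<otimes> z) = u (m * n) \<otimes> (s m \<otimes> z)"
  by (simp add: mult_assoc[symmetric] s_u)

lemma u_star_s: "m \<noteq> 0 \<Longrightarrow> u n \<otimes> star A (s m) = star A (s m) \<otimes> u (m * n)"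
  using arg_cong[OF s_u[of m "- n"], of "star A"] by (simp add: star_mult star_u)

lemma u_star_s': "m \<noteq> 0 \<Longrightarrow> z \<in> carrier A \<Longrightarrow> u n \<otimes> (star A (s m) \<otimes> z) = star A (s m) \<otimes> (u (m * n) \<otimes> z)"
  by (simp add: mult_assoc[symmetric] u_star_s)

lemma star_s_mult: "\<lbrakk>m \<noteq> 0; m' \<noteq> 0\<rbrakk> \<Longrightarrow> star A (s m) \<otimes> star A (s m') = star A (s (m * m'))"
  using s_mult[of m' m] by (simp add: star_mult[symmetric] mult.commute)

lemma star_s_mult': "\<lbrakk>m \<noteq> 0; m' \<noteq> 0; z \<in> carrier A\<rbrakk> \<Longrightarrow>
    star A (s m) \<otimes> (star A (s m') \<otimes> z) = star A (s (m * m')) \<otimes> z"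
  by (simp add: mult_assoc[symmetric] star_s_mult)

text \<open>The summands of \<open>CL4\<close>; in \<open>C(R\<^sub>K)\<close> this is the indicator of the cylinder \<open>l + (m)\<close>.\<close>

definition proj :: "'r \<Rightarrow> 'r \<Rightarrow> 'a" where
  "proj m l = u l \<otimes> (s m \<otimes> (star A (s m) \<otimes> u (- l)))"

lemma proj_closed [simp]: "m \<noteq> 0 \<Longrightarrow> proj m l \<in> carrier A"
  by (simp add: proj_def)

lemma proj_idem: "m \<noteq> 0 \<Longrightarrow> proj m l \<otimes> proj m l = proj m l"
  by (simp add: proj_def mult_assoc u_mult' u_zero iso')

lemma proj_star: "m \<noteq> 0 \<Longrightarrow> star A (proj m l) = proj m l"
  by (simp add: proj_def star_mult star_u star_star mult_assoc)

lemma sum_proj: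
  assumes m: "m \<noteq> 0" and l: "\<And>C. C \<in> residue_classes m \<Longrightarrow> l C \<in> C"
  shows "(\<Oplus>C\<in>residue_classes m. proj m (l C)) = \<one>"
  using rels[OF CL4[OF m, of l]] l m by (simp add: proj_def mult_assoc)

lemma lsum_proj:
  assumes m: "m \<noteq> 0"
  shows "lsum A (proj m) (residue_reps m) = \<one>"
  using residue_reps(5-7)[OF fin[OF m]] m sum_proj[OF m, of "\<lambda>C. SOME l. l \<in> C"]
  by (simp add: residue_reps(4)[OF fin[OF m]] lsum_map lsum_finsum)

text \<open>These elements span a *-algebra: they are closed under left multiplication by the generators and their
  adjoints, up to finite sums.\<close>

definition monomial :: "'r \<times> 'r \<times> 'r \<times> 'r \<Rightarrow> 'a" where
  "monomial = (\<lambda>(l, m, k, j). u l \<otimes> (s m \<otimes> (star A (s k) \<otimes> u (- j))))"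

end

definition index_ok :: "'r::idom \<times> 'r \<times> 'r \<times> 'r \<Rightarrow> bool" where
  "index_ok = (\<lambda>(l, m, k, j). m \<noteq> 0 \<and> k \<noteq> 0)"

text \<open>The expansion of a letter times a monomial into monomials. Only \<open>s\<^sub>n\<^sup>*\<close> needs more than one term: there
  \<open>CL4\<close> is inserted behind \<open>s\<^sub>m\<close>, and the summand \<open>i\<close> survives if \<open>n\<close> divides \<open>l + m i\<close>.\<close>

primrec letter_step :: "'r::idom cl_gen \<Rightarrow> bool \<Rightarrow> 'r \<times> 'r \<times> 'r \<times> 'r \<Rightarrow> ('r \<times> 'r \<times> 'r \<times> 'r) list" where
  "letter_step (GenU n) b = (\<lambda>(l, m, k, j). [((if b then - n else n) + l, m, k, j)])"
| "letter_step (GenS n) b = (\<lambda>(l, m, k, j).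
     if b then map (\<lambda>i. (exact_quot n (l + m * i), m, n * k, j + k * i))
       (filter (\<lambda>i. n dvd l + m * i) (residue_reps n))
     else [(n * l, n * m, k, j)])"

primrec normal_form :: "('r::idom cl_gen \<times> bool) list \<Rightarrow> ('r \<times> 'r \<times> 'r \<times> 'r) list" where
  "normal_form [] = [(0, 1, 1, 0)]"
| "normal_form (x # w) = concat (map (letter_step (fst x) (snd x)) (normal_form w))"

lemma cl_gens_iff: "GenS m \<in> cl_gens \<longleftrightarrow> m \<noteq> 0" "GenU n \<in> cl_gens"
  by (auto simp: cl_gens_def)

lemma letter_step_ok: "x \<in> cl_gens \<Longrightarrow> index_ok q \<Longrightarrow> p \<in> set (letter_step x b q) \<Longrightarrow> index_ok p"
  by (cases x) (auto simp: index_ok_def cl_gens_iff split: if_splits)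

lemma normal_form_ok: "w \<in> words cl_gens \<Longrightarrow> q \<in> set (normal_form w) \<Longrightarrow> index_ok q"
proof (induction w arbitrary: q)
  case Nil then show ?case by (simp add: index_ok_def)
next
  case (Cons x w)
  from Cons.prems(2) obtain p where "p \<in> set (normal_form w)" "q \<in> set (letter_step (fst x) (snd x) p)"
    by auto
  with Cons show ?case using letter_step_ok[of "fst x" p q] by simp
qed

text \<open>The orthogonality is a separate assumption, since its two proofs have nothing in common: in \<open>\<AA>[R]\<close> it
  needs the C*-norm, in the crossed product it is a computation with disjoint sets.\<close>

locale orthogonal_cl_family = cl_family A s u
  for A :: "('a, 'm) star_alg_scheme" (structure) and s u :: "'r::idom \<Rightarrow> 'a" +
  assumes orth: "\<lbrakk>m \<noteq> 0; \<not> m dvd t\<rbrakk> \<Longrightarrow> star A (s m) \<otimes> (u t \<otimes> s m) = \<zero>"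
begin

lemma monomial_closed [simp]: "index_ok q \<Longrightarrow> monomial q \<in> carrier A"
  by (auto simp: monomial_def index_ok_def split: prod.splits)

lemma star_s_u_s: "m \<noteq> 0 \<Longrightarrow> star A (s m) \<otimes> (u t \<otimes> s m) = (if m dvd t then u (exact_quot m t) else \<zero>)"
proof (cases "m dvd t")
  case True
  assume m: "m \<noteq> 0"
  have "u t \<otimes> s m = s m \<otimes> u (exact_quot m t)" using m True by (simp add: s_u exact_quot)
  then show ?thesis using True m by (simp add: iso')
qed (simp add: orth)

lemma star_s_u_s': "m \<noteq> 0 \<Longrightarrow> z \<in> carrier A \<Longrightarrow>
   star A (s m) \<otimes> (u t \<otimes> (s m \<otimes> z)) = (if m dvd t then u (exact_quot m t) \<otimes> z else \<zero>)"
  using arg_cong[OF star_s_u_s[of m t], of "\<lambda>x. x \<otimes> z"] by (auto simp: mult_assoc split: if_splits)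

lemma letter_u: "index_ok q \<Longrightarrow> u n \<otimes> monomial q = lsum A monomial (letter_step (GenU n) False q)"
  by (auto simp: monomial_def index_ok_def u_mult' split: prod.splits)

lemma letter_star_u: "index_ok q \<Longrightarrow> star A (u n) \<otimes> monomial q = lsum A monomial (letter_step (GenU n) True q)"
  by (auto simp: monomial_def index_ok_def u_mult' star_u split: prod.splits)

lemma letter_s: "n \<noteq> 0 \<Longrightarrow> index_ok q \<Longrightarrow> s n \<otimes> monomial q = lsum A monomial (letter_step (GenS n) False q)"
  by (auto simp: monomial_def index_ok_def s_u' s_mult' split: prod.splits)

text \<open>After inserting \<open>1 = \<Sum>i. u\<^sup>i s\<^sub>n s\<^sub>n\<^sup>* u\<^sup>-\<^sup>i\<close> behind \<open>s\<^sub>m\<close>, the left half of each summand is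
  \<open>s\<^sub>n\<^sup>* u\<^bsup>l + m i\<^esup> s\<^sub>n s\<^sub>m\<close>, and \<open>s\<^sub>n\<^sup>* u\<^sup>t s\<^sub>n\<close> is either zero or a power of \<open>u\<close>.\<close>

lemma letter_star_s:
  assumes n: "n \<noteq> 0" and q: "index_ok q"
  shows "star A (s n) \<otimes> monomial q = lsum A monomial (letter_step (GenS n) True q)"
proof -
  obtain l m k j where q_eq: "q = (l, m, k, j)" by (cases q)
  have mk: "m \<noteq> 0" "k \<noteq> 0" using q by (auto simp: q_eq index_ok_def)
  let ?z = "star A (s k) \<otimes> u (- j)"
  let ?F = "\<lambda>i. (exact_quot n (l + m * i), m, n * k, j + k * i)"
  have summand: "star A (s n) \<otimes> (u l \<otimes> (s m \<otimes> (proj n i \<otimes> ?z))) =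
     (if n dvd l + m * i then monomial (?F i) else \<zero>)" for i
  proof -
    have "star A (s n) \<otimes> (u l \<otimes> (s m \<otimes> (proj n i \<otimes> ?z)))
      = star A (s n) \<otimes> (u (l + m * i) \<otimes> (s n \<otimes> (s m \<otimes> (star A (s n) \<otimes> (u (- i) \<otimes> ?z)))))"
      using n mk by (simp add: proj_def mult_assoc s_u' u_mult' s_mult' mult.commute)
    also have "\<dots> = (if n dvd l + m * i then u (exact_quot n (l + m * i)) \<otimes> (s m \<otimes> (star A (s n) \<otimes> (u (- i) \<otimes> ?z))) else \<zero>)"
      using n mk by (simp add: star_s_u_s')
    also have "u (- i) \<otimes> ?z = star A (s k) \<otimes> u (- (j + k * i))"
    proof -
      have "k * - i + - j = - (j + k * i)" by simp
      then show ?thesis by (simp only: u_star_s'[OF mk(2) u_closed] u_mult)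
    qed
    finally show ?thesis using n mk by (simp add: monomial_def star_s_mult')
  qed
  have "star A (s n) \<otimes> monomial q = star A (s n) \<otimes> (u l \<otimes> (s m \<otimes> (lsum A (proj n) (residue_reps n) \<otimes> ?z)))"
    using n mk by (simp add: lsum_proj q_eq monomial_def)
  also have "\<dots> = lsum A (\<lambda>i. star A (s n) \<otimes> (u l \<otimes> (s m \<otimes> (proj n i \<otimes> ?z)))) (residue_reps n)"
    using n mk by (simp add: lsum_mult mult_lsum)
  also have "\<dots> = lsum A monomial (letter_step (GenS n) True q)"
    using n mk by (simp add: summand q_eq lsum_map lsum_filter index_ok_def)
  finally show ?thesis .
qed

text \<open>\<open>GenS 0\<close> is not a generator; it gets the value one so that all values lie in the carrier.\<close>

definition gen_value :: "'r cl_gen \<Rightarrow> 'a" where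
  "gen_value x = (case x of GenS m \<Rightarrow> if m = 0 then \<one> else s m | GenU n \<Rightarrow> u n)"

lemma gen_closed: "gen_value x \<in> carrier A"
  by (auto simp: gen_value_def split: cl_gen.split)

lemma letter_value:
  assumes "x \<in> cl_gens" "index_ok q"
  shows "(if b then star A (gen_value x) else gen_value x) \<otimes> monomial q = lsum A monomial (letter_step x b q)"
  using assms letter_u letter_star_u letter_s letter_star_s
  by (cases x; cases b) (simp_all add: gen_value_def cl_gens_iff del: letter_step.simps)

lemma word_normal_form:
  "w \<in> words cl_gens \<Longrightarrow> word_value A gen_value w = lsum A monomial (normal_form w)"
proof (induction w)
  case Nil
  then show ?case by (simp add: monomial_def u_zero s_one iso[of 1, unfolded s_one, simplified])
next
  case (Cons x w)
  have x: "fst x \<in> cl_gens" and w: "w \<in> words cl_gens" using Cons.prems by auto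
  let ?a = "if snd x then star A (gen_value (fst x)) else gen_value (fst x)"
  have "word_value A gen_value (x # w) = ?a \<otimes> lsum A monomial (normal_form w)"
    using Cons.IH[OF w] by simp
  also have "\<dots> = lsum A (\<lambda>q. ?a \<otimes> monomial q) (normal_form w)"
    using normal_form_ok[OF w] by (intro mult_lsum) (auto simp: gen_closed)
  also have "\<dots> = lsum A (\<lambda>q. lsum A monomial (letter_step (fst x) (snd x) q)) (normal_form w)"
    by (intro lsum_cong letter_value x normal_form_ok[OF w])
  also have "\<dots> = lsum A monomial (normal_form (x # w))"
    unfolding normal_form.simps
    by (rule lsum_concat[symmetric], rule monomial_closed, rule letter_step_ok[OF x normal_form_ok[OF w]])
  finally show ?case .
qed

end

definition combination :: "('a, 'm) star_alg_scheme \<Rightarrow> ('q \<Rightarrow> 'a) \<Rightarrow> (complex \<times> 'q) list \<Rightarrow> 'a" where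
  "combination A f = lsum A (\<lambda>x. fst x \<odot>\<^bsub>A\<^esub> f (snd x))"

lemma (in orthogonal_cl_family) combination_append:
  assumes "\<forall>x\<in>set xs. index_ok (snd x)" "\<forall>x\<in>set ys. index_ok (snd x)"
  shows "combination A monomial (xs @ ys) = combination A monomial xs \<oplus> combination A monomial ys"
  unfolding combination_def
proof (rule lsum_append)
  fix x assume "x \<in> set xs \<union> set ys"
  then have "index_ok (snd x)" using assms by auto
  then show "fst x \<odot> monomial (snd x) \<in> carrier A" by (rule smult_closed_complex[OF monomial_closed])
qed

lemma (in orthogonal_cl_family) free_evaluation: "free_evaluation A cl_gens gen_value"
  by (rule free_evaluation.intro[OF star_algebra_axioms free_evaluation_axioms.intro[OF unital gen_closed]])

lemma (in orthogonal_cl_family) combination_word: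
  assumes w: "w \<in> words cl_gens"
  shows "free_value A gen_value (c \<odot>\<^bsub>free_star_alg cl_gens\<^esub> free_word w)
    = combination A monomial (map (\<lambda>q. (c, q)) (normal_form w))"
proof -
  interpret V: free_evaluation A cl_gens gen_value by (rule free_evaluation)
  have "free_value A gen_value (c \<odot>\<^bsub>free_star_alg cl_gens\<^esub> free_word w) = c \<odot> lsum A monomial (normal_form w)"
    using w by (simp add: V.value_word_smult word_normal_form)
  also have "\<dots> = combination A monomial (map (\<lambda>q. (c, q)) (normal_form w))"
    unfolding combination_def lsum_map fst_conv snd_conv
    by (rule smult_lsum, rule monomial_closed, rule normal_form_ok[OF w])
  finally show ?thesis .
qed

text \<open>The rewriting of a word depends on the word alone. Hence one list of weighted monomials evaluates to the
  image of \<open>a\<close> in both families at once.\<close>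

lemma common_normal_form:
  fixes s1 u1 :: "'r::idom \<Rightarrow> 'a" and s2 u2 :: "'r \<Rightarrow> 'b"
  assumes A: "orthogonal_cl_family A s1 u1" and B: "orthogonal_cl_family B s2 u2"
    and a: "a \<in> carrier (free_star_alg cl_gens)"
  shows "\<exists>xs. (\<forall>x\<in>set xs. index_ok (snd x)) \<and>
    free_value A (orthogonal_cl_family.gen_value A s1 u1) a = combination A (cl_family.monomial A s1 u1) xs \<and>
    free_value B (orthogonal_cl_family.gen_value B s2 u2) a = combination B (cl_family.monomial B s2 u2) xs"
    (is "\<exists>xs. ?P a xs")
  using a
proof (induction a rule: free_induct)
  case zero
  show ?case
    using free_evaluation.value_zero[OF orthogonal_cl_family.free_evaluation[OF A]]
      free_evaluation.value_zero[OF orthogonal_cl_family.free_evaluation[OF B]]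
    by (intro exI[of _ "[]"]) (simp add: combination_def)
next
  case (word c v)
  have "\<forall>x\<in>set (map (\<lambda>q. (c, q)) (normal_form v)). index_ok (snd x)"
    using normal_form_ok[OF word] by auto
  then show ?case
    using orthogonal_cl_family.combination_word[OF A word] orthogonal_cl_family.combination_word[OF B word] by blast
next
  case (add f g)
  then obtain xs ys where xs: "?P f xs" and ys: "?P g ys" by blast
  have "?P (f \<oplus>\<^bsub>free_star_alg cl_gens\<^esub> g) (xs @ ys)"
    using xs ys add.hyps
    by (simp add: free_evaluation.value_add[OF orthogonal_cl_family.free_evaluation[OF A]]
        free_evaluation.value_add[OF orthogonal_cl_family.free_evaluation[OF B]]
        orthogonal_cl_family.combination_append[OF A] orthogonal_cl_family.combination_append[OF B] ball_Un)
  then show ?case by blast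
qed

section \<open>Projections in C*-algebras\<close>

text \<open>The unit \<open>q\<close> of a corner \<open>q A q\<close> is an extreme point of the unit ball: if \<open>q + x\<close> and \<open>q - x\<close> have norm
  at most one, then \<open>x = 0\<close>. The proof avoids spectral theory. The set of all such \<open>x\<close> has norm bound
  \<open>1/2\<close>, and it is mapped into itself by \<open>x \<mapsto> (3 x - x\<^sup>3) / 2\<close>, which enlarges the norm by the factor
  \<open>11/8\<close> or more; so only \<open>x = 0\<close> is left.\<close>

locale extremal_perturbation = star_algebra A for A :: "('a, 'm) star_alg_scheme" (structure) +
  fixes p :: "'a \<Rightarrow> real" and q :: 'a
  assumes p: "cstar_seminorm A p" and q [simp]: "q \<in> carrier A" "q \<otimes> q = q"
begin

definition perturbation :: "'a \<Rightarrow> bool" where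
  "perturbation x \<longleftrightarrow> x \<in> carrier A \<and> q \<otimes> x = x \<and> x \<otimes> q = x \<and> p (q \<oplus> x) \<le> 1 \<and> p (q \<oplus> (-1) \<odot> x) \<le> 1"

text \<open>Writing polynomials in \<open>x\<close> by their coefficients reduces the identities below to arithmetic in the
  complex numbers.\<close>

definition cubic :: "'a \<Rightarrow> complex \<Rightarrow> complex \<Rightarrow> complex \<Rightarrow> complex \<Rightarrow> 'a" where
  "cubic x a b c d = a \<odot> q \<oplus> (b \<odot> x \<oplus> (c \<odot> (x \<otimes> x) \<oplus> d \<odot> (x \<otimes> (x \<otimes> x))))"

context
  fixes x assumes x: "perturbation x"
begin

lemma x_simps: "x \<in> carrier A" "q \<otimes> x = x" "x \<otimes> q = x"
  using x by (auto simp: perturbation_def)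

lemma x_simps': "q \<otimes> (x \<otimes> x) = x \<otimes> x" "x \<otimes> x \<otimes> q = x \<otimes> x"  "x \<otimes> x \<in> carrier A" "x \<otimes> (x \<otimes> x) \<in> carrier A"
    "q \<otimes> (x \<otimes> (x \<otimes> x)) = x \<otimes> (x \<otimes> x)" "x \<otimes> (x \<otimes> x) \<otimes> q = x \<otimes> (x \<otimes> x)"
  using x_simps by (simp_all add: mult_closed mult_assoc[symmetric]) (simp_all add: mult_assoc mult_closed)

lemma cubic_closed: "cubic x a b c d \<in> carrier A"
  using x_simps by (simp add: cubic_def mult_closed)

lemma cubic_add: "cubic x a b c d \<oplus> cubic x a' b' c' d' = cubic x (a + a') (b + b') (c + c') (d + d')"
  unfolding cubic_def using smult_l_distr[simplified] x_simps x_simps' by (simp add: M.a_ac)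

lemma cubic_smult: "e \<odot> cubic x a b c d = cubic x (e * a) (e * b) (e * c) (e * d)"
  unfolding cubic_def using smult_assoc1[simplified] x_simps x_simps' by (simp add: smult_r_distr)

lemma cubic_mult: "cubic x a b 0 0 \<otimes> cubic x a' b' c' 0 = cubic x (a * a') (a * b' + b * a') (a * c' + b * b') (b * c')"
proof -
  have 1: "cubic x a b 0 0 = a \<odot> q \<oplus> b \<odot> x" for a b
    unfolding cubic_def using x_simps x_simps' by (simp add: smult_zero_complex)
  have 2: "cubic x a' b' c' 0 = a' \<odot> q \<oplus> (b' \<odot> x \<oplus> c' \<odot> (x \<otimes> x))"
    unfolding cubic_def using x_simps x_simps' by (simp add: smult_zero_complex)
  have "cubic x a b 0 0 \<otimes> cubic x a' b' c' 0 =
    (a * a') \<odot> q \<oplus> (a * b') \<odot> x \<oplus> (a * c') \<odot> (x \<otimes> x) \<oplus>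
     ((b * a') \<odot> x \<oplus> (b * b') \<odot> (x \<otimes> x) \<oplus> (b * c') \<odot> (x \<otimes> (x \<otimes> x)))"
    unfolding 1 2 using x_simps x_simps'
    by (simp add: distr_l distr_r smult_mult_l smult_mult_r mult_closed smult_r_distr
        smult_assoc1[simplified, symmetric] mult.commute M.a_ac)
  also have "\<dots> = cubic x (a * a') (a * b' + b * a') (a * c' + b * b') (b * c')"
    unfolding cubic_def using smult_l_distr[simplified] x_simps x_simps' by (simp add: M.a_ac)
  finally show ?thesis .
qed

lemma cubic_eqs: "q = cubic x 1 0 0 0" "x = cubic x 0 1 0 0" "q \<oplus> x = cubic x 1 1 0 0" "q \<oplus> (-1) \<odot> x = cubic x 1 (-1) 0 0"
  unfolding cubic_def using x_simps x_simps' by (simp_all add: smult_zero_complex)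

lemma plus_le: "p (cubic x 1 1 0 0) \<le> 1" and minus_le: "p (cubic x 1 (-1) 0 0) \<le> 1"
  using x unfolding perturbation_def cubic_eqs(3,4)[symmetric] by auto

lemmas p_add = cstar_seminormD(2)[OF p cubic_closed cubic_closed]
  and p_smult = cstar_seminormD(3)[OF p cubic_closed]
  and p_mult = cstar_seminormD(4)[OF p]
  and p_nonneg = cstar_seminormD(1)[OF p]

lemma prod_le: "y \<in> carrier A \<Longrightarrow> z \<in> carrier A \<Longrightarrow> p y \<le> 1 \<Longrightarrow> p z \<le> 1 \<Longrightarrow> p (y \<otimes> z) \<le> 1"
  using p_mult[of y z] p_nonneg[of y] p_nonneg[of z] mult_le_one[of "p y" "p z"] by linarith

lemma p_scale: "p (cubic x (e * a) (e * b) (e * c) (e * d)) = cmod e * p (cubic x a b c d)"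
  using p_smult[of e a b c d] by (simp only: cubic_smult)

lemma q_le: "p (cubic x 1 0 0 0) \<le> 1"
  using p_add[of 1 1 0 0 1 "-1" 0 0] p_scale[of 2 1 0 0 0] plus_le minus_le by (simp add: cubic_add)

text \<open>Because \<open>4 x = (q + x)\<^sup>2 - (q - x)\<^sup>2\<close>.\<close>

lemma perturbation_le_half: "p x \<le> 1 / 2"
proof -
  have "p (cubic x 1 2 1 0) \<le> 1" "p (cubic x 1 (-2) 1 0) \<le> 1"
    using prod_le[OF cubic_closed cubic_closed plus_le plus_le] prod_le[OF cubic_closed cubic_closed minus_le minus_le]
    by (simp_all add: cubic_mult)
  then have "p (cubic x 0 4 0 0) \<le> 2"
    using p_add[of 1 2 1 0 "-1" 2 "-1" 0] p_smult[of "-1" 1 "-2" 1 0] by (simp add: cubic_add cubic_smult)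
  moreover have "p (cubic x 0 4 0 0) = 4 * p x"
    using p_scale[of 4 0 1 0 0] by (simp flip: cubic_eqs(2))
  ultimately show ?thesis by simp
qed

text \<open>For \<open>y = (3 x - x\<^sup>3) / 2\<close> one has \<open>q + y = (q + x)\<^sup>2 (q - x / 2)\<close> and
  \<open>q - y = (q - x)\<^sup>2 (q + x / 2)\<close>. The factors \<open>q \<plusminus> x\<close> are contractions, and \<open>q \<plusminus> x / 2\<close> are averages
  of \<open>q\<close> and \<open>q \<plusminus> x\<close>.\<close>

lemma perturbation_amplify: "perturbation (cubic x 0 (3/2) 0 (-1/2))"
  unfolding perturbation_def
proof (intro conjI)
  let ?y = "cubic x 0 (3/2) 0 (-1/2)"
  show "?y \<in> carrier A" by (rule cubic_closed)
  show "q \<otimes> ?y = ?y" "?y \<otimes> q = ?y"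
    unfolding cubic_def using x_simps x_simps'
    by (simp_all add: distr_l distr_r smult_mult_l smult_mult_r smult_zero_complex mult_closed)
  have half: "p (cubic x 1 (1/2) 0 0) \<le> 1" "p (cubic x 1 (-1/2) 0 0) \<le> 1"
  proof -
    have "p (cubic x 2 1 0 0) \<le> 2" "p (cubic x 2 (-1) 0 0) \<le> 2"
      using p_add[of 1 0 0 0 1 1 0 0] p_add[of 1 0 0 0 1 "-1" 0 0] q_le plus_le minus_le
      by (simp_all add: cubic_add)
    then show "p (cubic x 1 (1/2) 0 0) \<le> 1" "p (cubic x 1 (-1/2) 0 0) \<le> 1"
      using p_smult[of "1/2" 2 1 0 0] p_smult[of "1/2" 2 "-1" 0 0] by (simp_all add: cubic_smult norm_divide)
  qed
  have "cubic x 1 1 0 0 \<otimes> (cubic x 1 1 0 0 \<otimes> cubic x 1 (-1/2) 0 0) = q \<oplus> ?y"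
    "cubic x 1 (-1) 0 0 \<otimes> (cubic x 1 (-1) 0 0 \<otimes> cubic x 1 (1/2) 0 0) = q \<oplus> (-1) \<odot> ?y"
    by (subst cubic_eqs(1), simp add: cubic_mult cubic_add cubic_smult)+
  moreover have "p (cubic x 1 1 0 0 \<otimes> (cubic x 1 1 0 0 \<otimes> cubic x 1 (-1/2) 0 0)) \<le> 1"
      "p (cubic x 1 (-1) 0 0 \<otimes> (cubic x 1 (-1) 0 0 \<otimes> cubic x 1 (1/2) 0 0)) \<le> 1"
    by (intro prod_le mult_closed cubic_closed plus_le minus_le half)+
  ultimately show "p (q \<oplus> ?y) \<le> 1" "p (q \<oplus> (-1) \<odot> ?y) \<le> 1" by simp_all
qed

text \<open>The cubic term is small: \<open>\<parallel>x\<^sup>3\<parallel> \<le> \<parallel>x\<parallel> / 4\<close>.\<close>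

lemma amplified_norm: "11 / 8 * p x \<le> p (cubic x 0 (3/2) 0 (-1/2))"
proof -
  have "3 / 2 * p x = p (cubic x 0 (3/2) 0 0)"
    using p_scale[of "3/2" 0 1 0 0] by (simp add: norm_divide flip: cubic_eqs(2))
  also have "\<dots> \<le> p (cubic x 0 (3/2) 0 (-1/2)) + p (cubic x 0 0 0 (1/2))"
    using p_add[of 0 "3/2" 0 "-1/2" 0 0 0 "1/2"] by (simp add: cubic_add)
  also have "p (cubic x 0 0 0 (1/2)) = 1 / 2 * p (x \<otimes> (x \<otimes> x))"
    using p_smult[of "1/2" 0 0 0 1] x_simps x_simps'
    by (simp add: cubic_smult norm_divide) (simp add: cubic_def smult_zero_complex)
  also have "p (x \<otimes> (x \<otimes> x)) \<le> p x * (1/2 * (1/2))"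
    using perturbation_le_half p_nonneg[OF x_simps(1)] p_nonneg[OF x_simps'(3)] x_simps x_simps'
    by (intro order_trans[OF p_mult] mult_left_mono order_trans[OF p_mult] mult_mono) auto
  finally show ?thesis by simp
qed

end

lemma perturbation_null: "perturbation x \<Longrightarrow> p x = 0"
proof -
  have *: "p x \<le> 1 / 2 * (8 / 11) ^ n" if "perturbation x" for n x
    using that
  proof (induction n arbitrary: x)
    case 0 then show ?case using perturbation_le_half by simp
  next
    case (Suc n)
    have "11 / 8 * p x \<le> 1 / 2 * (8 / 11) ^ n"
      using amplified_norm[OF Suc.prems] Suc.IH[OF perturbation_amplify[OF Suc.prems]] by linarith
    then show ?case by simp
  qed
  assume x: "perturbation x"
  have "(\<lambda>n. 1 / 2 * (8 / 11) ^ n) \<longlonglongrightarrow> (0::real)"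
    using tendsto_mult_left[OF LIMSEQ_power_zero[of "8 / 11 :: real"], of "1/2"] by simp
  then have "p x \<le> 0" by (rule LIMSEQ_le_const) (use *[OF x] in blast)
  then show "p x = 0" using cstar_seminormD(1)[OF p, of x] x by (simp add: perturbation_def)
qed

end

context star_algebra
begin

lemma mult_finsum:
  assumes "a \<in> carrier A" "\<And>i. i \<in> I \<Longrightarrow> f i \<in> carrier A"
  shows "a \<otimes> finsum A f I = finsum A (\<lambda>i. a \<otimes> f i) I"
  using assms(2)
  by (induction I rule: infinite_finite_induct)
    (simp_all add: M.finsum_infinite mult_zero assms Pi_iff distr_r mult_closed M.finsum_closed)

lemma finsum_mult:
  assumes "a \<in> carrier A" "\<And>i. i \<in> I \<Longrightarrow> f i \<in> carrier A"
  shows "finsum A f I \<otimes> a = finsum A (\<lambda>i. f i \<otimes> a) I"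
  using assms(2)
  by (induction I rule: infinite_finite_induct)
    (simp_all add: M.finsum_infinite zero_mult assms Pi_iff distr_l mult_closed M.finsum_closed)

lemma star_finsum:
  assumes "\<And>i. i \<in> I \<Longrightarrow> f i \<in> carrier A"
  shows "star A (finsum A f I) = finsum A (\<lambda>i. star A (f i)) I"
  using assms
  by (induction I rule: infinite_finite_induct)
    (simp_all add: M.finsum_infinite star_zero Pi_iff star_add star_closed M.finsum_closed)

lemma seminorm_finsum:
  assumes p: "cstar_seminorm A p" and "\<And>i. i \<in> I \<Longrightarrow> f i \<in> carrier A"
  shows "p (finsum A f I) \<le> (\<Sum>i\<in>I. p (f i))"
  using assms(2)
proof (induction I rule: infinite_finite_induct)
  case (insert i I)
  then have "p (finsum A f (insert i I)) \<le> p (f i) + p (finsum A f I)"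
    by (simp add: Pi_iff cstar_seminormD(2)[OF p] M.finsum_closed)
  then show ?case using insert by simp
qed (simp_all add: M.finsum_infinite seminorm_zero[OF p])

lemma projection_norm:
  assumes p: "cstar_seminorm A p" and e: "e \<in> carrier A" "e \<otimes> e = e" "star A e = e"
  shows "p e \<le> 1"
proof -
  have "(p e)\<^sup>2 = p e" using cstar_seminormD(5)[OF p e(1)] e by simp
  then have "p e = 0 \<or> p e = 1" by (simp add: power2_eq_square)
  then show ?thesis by auto
qed

text \<open>Let \<open>q\<close> be one of the projections and \<open>c\<^sub>k = q e\<^sub>k q\<close>. Since \<open>1 - 2 e\<^sub>k\<close> is a symmetry, \<open>q - 2 c\<^sub>k\<close> is a
  contraction. The \<open>c\<^sub>k\<close> with \<open>e\<^sub>k \<noteq> q\<close> add up to zero, so \<open>- c\<^sub>j\<close> is the sum of the others; averaging shows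
  that \<open>q \<plusminus> \<lambda> c\<^sub>j\<close> are contractions for a small \<open>\<lambda>\<close>. By extremality \<open>c\<^sub>j = 0\<close>, and
  \<open>c\<^sub>j = (e\<^sub>j q)\<^sup>* (e\<^sub>j q)\<close>.\<close>

lemma projections_orthogonal:
  assumes p: "cstar_seminorm A p" and un: "unital A" and I: "finite I" "i \<in> I" "j \<in> I" "i \<noteq> j"
    and e: "\<And>k. k \<in> I \<Longrightarrow> e k \<in> carrier A" "\<And>k. k \<in> I \<Longrightarrow> e k \<otimes> e k = e k" "\<And>k. k \<in> I \<Longrightarrow> star A (e k) = e k"
    and sum: "finsum A e I = \<one>"
  shows "p (e j \<otimes> e i) = 0"
proof -
  have one: "\<one> \<in> carrier A" "\<And>x. x \<in> carrier A \<Longrightarrow> \<one> \<otimes> x = x" "\<And>x. x \<in> carrier A \<Longrightarrow> x \<otimes> \<one> = x"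
    using un by (auto simp: unital_def)
  note pD = cstar_seminormD[OF p]
  define q where "q = e i"
  have qq: "q \<in> carrier A" "q \<otimes> q = q" "star A q = q" using e I by (auto simp: q_def)
  interpret extremal_perturbation A p q by standard (use p qq in auto)
  define c where "c k = q \<otimes> (e k \<otimes> q)" for k
  have cc: "c k \<in> carrier A" if "k \<in> I" for k using that e qq by (simp add: c_def mult_closed)
  have pq: "p q \<le> 1" by (rule projection_norm[OF p]) (use qq in auto)
  have le: "p (q \<oplus> (-2) \<odot> c k) \<le> 1" if k: "k \<in> I" for k
  proof -
    let ?r = "\<one> \<oplus> (-2) \<odot> e k"
    have r: "?r \<in> carrier A" using e k one by simp
    have so: "star A \<one> = \<one>"
    proof -
      have "star A (star A \<one> \<otimes> \<one>) = star A \<one> \<otimes> star A (star A \<one>)"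
        by (rule star_mult) (simp_all add: one star_closed)
      then show ?thesis using one by (simp add: star_closed star_star)
    qed
    have "star A ?r \<otimes> ?r = \<one> \<oplus> ((-2) \<odot> e k \<oplus> ((-2) \<odot> e k \<oplus> 4 \<odot> e k))"
      using e[OF k] one so smult_assoc1[of "-2" "-2" "e k"]
      by (simp add: star_add star_smult distr_l distr_r smult_mult_l smult_mult_r smult_r_distr M.a_assoc)
    also have "(-2) \<odot> e k \<oplus> ((-2) \<odot> e k \<oplus> 4 \<odot> e k) = 0 \<odot> e k"
      using e[OF k] smult_l_distr[of "-2" 4 "e k"] smult_l_distr[of "-2" 2 "e k"] by simp
    finally have "star A ?r \<otimes> ?r = \<one>" using e[OF k] one by (simp add: smult_zero_complex)
    then have "(p ?r)\<^sup>2 \<le> 1" using pD(5)[OF r] seminorm_one_le[OF un star_algebra_axioms p] by simp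
    then have "p ?r \<le> 1" by (simp add: power2_le_iff_abs_le abs_le_iff power_le_one_iff abs_square_le_1)
    moreover have "q \<oplus> (-2) \<odot> c k = q \<otimes> (?r \<otimes> q)"
      using e[OF k] one qq by (simp add: c_def distr_l distr_r smult_mult_l smult_mult_r mult_closed)
    moreover have "p (q \<otimes> (?r \<otimes> q)) \<le> p q * (p ?r * p q)"
      using r qq by (intro order_trans[OF pD(4)] mult_left_mono pD(4) pD(1) mult_closed) auto
    moreover have "p q * (p ?r * p q) \<le> 1"
      using pq \<open>p ?r \<le> 1\<close> pD(1)[OF qq(1)] pD(1)[OF r] by (intro mult_le_one mult_nonneg_nonneg) auto
    ultimately show ?thesis by simp
  qed
  let ?J = "I - {i, j}" let ?N = "card ?J"
  have "finsum A c I = q"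
  proof -
    have "q \<otimes> (finsum A e I \<otimes> q) = finsum A c I"
      unfolding c_def using e qq by (simp add: finsum_mult mult_finsum mult_closed)
    then show ?thesis using qq one by (simp add: sum)
  qed
  moreover have "I = insert i (insert j ?J)" using I by blast
  then have "finsum A c I = c i \<oplus> (c j \<oplus> finsum A c ?J)"
    using I cc M.finsum_insert[of "insert j ?J" i c] M.finsum_insert[of ?J j c] by (simp add: Pi_iff)
  moreover have "c i = q" using qq by (simp add: c_def q_def[symmetric])
  ultimately have "q \<oplus> (c j \<oplus> finsum A c ?J) = q" by simp
  then have z: "c j \<oplus> finsum A c ?J = \<zero>"
  proof -
    have "finsum A c ?J \<in> carrier A" using cc by (intro M.finsum_closed) auto
    then show ?thesis using \<open>q \<oplus> (c j \<oplus> finsum A c ?J) = q\<close> qq cc[OF I(3)]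
      by (metis M.a_closed M.add.l_cancel_one M.add.r_cancel_one)
  qed
  have lin: "finsum A (\<lambda>k. q \<oplus> (-2) \<odot> c k) J = of_nat (card J) \<odot> q \<oplus> (-2) \<odot> finsum A c J" if "finite J" "J \<subseteq> I" for J
    using that
  proof (induction J)
    case empty
    then show ?case using qq smult_r_null[of "-2"] by (simp add: smult_zero_complex)
  next
    case (insert k J)
    have k: "c k \<in> carrier A" and J: "finsum A c J \<in> carrier A" "\<And>k. k \<in> J \<Longrightarrow> c k \<in> carrier A"
      using insert cc by (auto intro!: M.finsum_closed)
    have "(1 + of_nat (card J)) \<odot> q = q \<oplus> of_nat (card J) \<odot> q"
      using qq smult_l_distr[of 1 "of_nat (card J)" q] by simp
    then show ?case
      using insert qq k J by (simp add: Pi_iff smult_r_distr M.a_ac)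
  qed
  let ?D = "of_nat ?N \<odot> q \<oplus> 2 \<odot> c j"
  have "2 \<odot> c j = (-2) \<odot> finsum A c ?J"
  proof -
    have F: "finsum A c ?J \<in> carrier A" using cc by (intro M.finsum_closed) auto
    have "2 \<odot> c j \<oplus> 2 \<odot> finsum A c ?J = \<zero>"
      using z cc[OF I(3)] F smult_r_null[of 2] by (simp add: smult_r_distr[simplified, symmetric])
    moreover have "(-2) \<odot> finsum A c ?J \<oplus> 2 \<odot> finsum A c ?J = \<zero>"
      using F smult_l_distr[of "-2" 2 "finsum A c ?J"] by (simp add: smult_zero_complex)
    ultimately show ?thesis using cc[OF I(3)] F by (metis M.add.right_cancel smult_closed_complex)
  qed
  then have "?D = finsum A (\<lambda>k. q \<oplus> (-2) \<odot> c k) ?J" using lin[of ?J] I by simp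
  also have "p \<dots> \<le> (\<Sum>k\<in>?J. p (q \<oplus> (-2) \<odot> c k))" using qq cc by (intro seminorm_finsum[OF p]) auto
  also have "\<dots> \<le> (\<Sum>k\<in>?J. 1)" by (intro sum_mono le) auto
  finally have D: "p ?D \<le> ?N" by simp
  \<comment> \<open>small enough for both averages: \<open>q + l c\<^sub>j\<close> is an average of \<open>q\<close> and the \<open>q - 2 c\<^sub>k\<close> with \<open>k \<noteq> i, j\<close>, and \<open>q - l c\<^sub>j\<close> one of \<open>q\<close> and \<open>q - 2 c\<^sub>j\<close>\<close>
  define l where "l = 2 / (1 + real ?N)"
  have l: "l > 0" "l * ?N \<le> 2" "l \<le> 2" by (auto simp: l_def field_simps)
  have cj: "c j \<in> carrier A" using cc I by blast
  have "perturbation (l \<odot> c j)"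
    unfolding perturbation_def
  proof (intro conjI)
    show "complex_of_real l \<odot> c j \<in> carrier A" using cj by simp
    show "q \<otimes> (complex_of_real l \<odot> c j) = complex_of_real l \<odot> c j" "complex_of_real l \<odot> c j \<otimes> q = complex_of_real l \<odot> c j"
      using qq e I by (simp_all add: c_def smult_mult_l smult_mult_r mult_closed mult_assoc) (simp add: mult_assoc[symmetric] mult_closed)
    have combine: "a \<odot> x \<oplus> b \<odot> (c \<odot> x \<oplus> d \<odot> y) = (a + b * c) \<odot> x \<oplus> (b * d) \<odot> y"
      if "x \<in> carrier A" "y \<in> carrier A" for x y and a b c d :: complex
      using that smult_assoc1[simplified] smult_l_distr[simplified] by (simp add: smult_r_distr M.a_assoc)
    have convex: "p (complex_of_real a \<odot> y \<oplus> complex_of_real b \<odot> z) \<le> a * p y + b * p z"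
      if "a \<ge> 0" "b \<ge> 0" "y \<in> carrier A" "z \<in> carrier A" for a b y z
      using pD(2)[of "complex_of_real a \<odot> y" "complex_of_real b \<odot> z"] that by (simp add: pD(3))
    have "q \<oplus> complex_of_real l \<odot> c j = complex_of_real (1 - l * ?N / 2) \<odot> q \<oplus> complex_of_real (l / 2) \<odot> ?D"
    proof -
      have "complex_of_real (1 - l * ?N / 2) \<odot> q \<oplus> complex_of_real (l / 2) \<odot> ?D
        = (complex_of_real (1 - l * ?N / 2) + complex_of_real (l / 2) * of_nat ?N) \<odot> q \<oplus> (complex_of_real (l / 2) * 2) \<odot> c j"
        by (rule combine) (use qq cj in auto)
      then show ?thesis using qq by simp
    qed
    also have "p \<dots> \<le> (1 - l * ?N / 2) * p q + l / 2 * p ?D" using l qq cj by (intro convex) auto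
    also have "\<dots> \<le> (1 - l * ?N / 2) * 1 + l / 2 * ?N" using l pq D by (intro add_mono mult_left_mono) auto
    finally show "p (q \<oplus> complex_of_real l \<odot> c j) \<le> 1" by simp
    have "q \<oplus> (-1) \<odot> (complex_of_real l \<odot> c j) = complex_of_real (1 - l / 2) \<odot> q \<oplus> complex_of_real (l / 2) \<odot> (q \<oplus> (-2) \<odot> c j)"
    proof -
      have "complex_of_real (1 - l / 2) \<odot> q \<oplus> complex_of_real (l / 2) \<odot> (q \<oplus> (-2) \<odot> c j)
        = (complex_of_real (1 - l / 2) + complex_of_real (l / 2)) \<odot> q \<oplus> (complex_of_real (l / 2) * (-2)) \<odot> c j"
        using combine[of q "c j" _ "complex_of_real (l / 2)" 1 "-2"] qq cj by simp
      moreover have "(-1) \<odot> (complex_of_real l \<odot> c j) = (complex_of_real (l / 2) * (-2)) \<odot> c j"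
        using cj smult_assoc1[of "-1" "complex_of_real l" "c j"] by simp
      ultimately show ?thesis using qq by simp
    qed
    also have "p \<dots> \<le> (1 - l / 2) * p q + l / 2 * p (q \<oplus> (-2) \<odot> c j)" using l qq cj by (intro convex) auto
    also have "\<dots> \<le> (1 - l / 2) * 1 + l / 2 * 1" using l pq le[OF I(3)] by (intro add_mono mult_left_mono) auto
    finally show "p (q \<oplus> (-1) \<odot> (complex_of_real l \<odot> c j)) \<le> 1" by simp
  qed
  then have "p (complex_of_real l \<odot> c j) = 0" by (rule perturbation_null)
  then have "p (c j) = 0" using l cj by (simp add: pD(3))
  moreover have "star A (e j \<otimes> q) \<otimes> (e j \<otimes> q) = c j"
    using e[OF I(3)] qq by (simp add: c_def star_mult mult_assoc mult_closed) (simp add: mult_assoc[symmetric])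
  ultimately show ?thesis using pD(5)[of "e j \<otimes> q"] e I qq by (simp add: mult_closed q_def[symmetric])
qed

text \<open>For orthogonal projections the triangle inequality gives the bound with a factor \<open>card I\<close>. By the
  C*-identity the square of the norm is the norm of the combination with squared weights, so every bound with a
  factor \<open>\<kappa>\<close> implies the bound with \<open>\<surd>\<kappa>\<close>, and the factor tends to one. The same identity reduces the
  partial isometries \<open>W i\<close> to their range projections \<open>e i\<close>.\<close>

lemma orthogonal_norm:
  assumes p: "cstar_seminorm A p" and I: "finite I"
    and W: "\<And>i. i \<in> I \<Longrightarrow> W i \<in> carrier A" "\<And>i j. i \<in> I \<Longrightarrow> j \<in> I \<Longrightarrow> i \<noteq> j \<Longrightarrow> W i \<otimes> star A (W j) = \<zero>"
    and e: "\<And>i. i \<in> I \<Longrightarrow> W i \<otimes> star A (W i) = e i" "\<And>i. i \<in> I \<Longrightarrow> e i \<in> carrier A"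
      "\<And>i. i \<in> I \<Longrightarrow> e i \<otimes> e i = e i" "\<And>i. i \<in> I \<Longrightarrow> star A (e i) = e i"
      "\<And>i j. i \<in> I \<Longrightarrow> j \<in> I \<Longrightarrow> i \<noteq> j \<Longrightarrow> e i \<otimes> e j = \<zero>"
    and S: "\<And>i. i \<in> I \<Longrightarrow> cmod (d i) \<le> S" "S \<ge> 0"
  shows "p (finsum A (\<lambda>i. d i \<odot> W i) I) \<le> S"
proof -
  note pD = cstar_seminormD[OF p]
  have square: "(p (finsum A (\<lambda>i. d i \<odot> W i) I))\<^sup>2 = p (finsum A (\<lambda>i. complex_of_real ((cmod (d i))\<^sup>2) \<odot> e i) I)"
    if W: "\<And>i. i \<in> I \<Longrightarrow> W i \<in> carrier A" "\<And>i j. i \<in> I \<Longrightarrow> j \<in> I \<Longrightarrow> i \<noteq> j \<Longrightarrow> W i \<otimes> star A (W j) = \<zero>"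
     and We: "\<And>i. i \<in> I \<Longrightarrow> W i \<otimes> star A (W i) = e i" for W d
  proof -
    let ?x = "finsum A (\<lambda>i. d i \<odot> W i) I"
    have x: "?x \<in> carrier A" using W by (intro M.finsum_closed) auto
    have "?x \<otimes> star A ?x = finsum A (\<lambda>i. d i \<odot> W i \<otimes> star A ?x) I"
      using W x by (intro finsum_mult) (auto simp: star_closed)
    also have "\<dots> = finsum A (\<lambda>i. complex_of_real ((cmod (d i))\<^sup>2) \<odot> e i) I"
    proof (rule M.finsum_cong')
      fix i assume i: "i \<in> I"
      have "d i \<odot> W i \<otimes> star A ?x = finsum A (\<lambda>j. d i \<odot> W i \<otimes> (cnj (d j) \<odot> star A (W j))) I"
        using W i by (subst star_finsum) (auto simp: mult_finsum star_smult star_closed mult_closed intro!: M.finsum_cong')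
      also have "\<dots> = finsum A (\<lambda>j. if i = j then (d i * cnj (d i)) \<odot> e i else \<zero>) I"
        using W We e(2) i smult_r_null[simplified]
        by (intro M.finsum_cong')
          (auto simp: smult_mult_l smult_mult_r star_closed smult_assoc1[simplified, symmetric] mult.commute)
      also have "\<dots> = (d i * cnj (d i)) \<odot> e i"
        using i I e(2) by (intro M.finsum_singleton[of i I "\<lambda>j. (d i * cnj (d i)) \<odot> e i"]) auto
      finally show "d i \<odot> W i \<otimes> star A ?x = complex_of_real ((cmod (d i))\<^sup>2) \<odot> e i"
        by (simp only: complex_norm_square)
    qed (use e in auto)
    finally have "p (?x \<otimes> star A ?x) = p (finsum A (\<lambda>i. complex_of_real ((cmod (d i))\<^sup>2) \<odot> e i) I)" by simp
    then show ?thesis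
      using pD(5)[OF star_closed[OF x]] seminorm_star[OF p x] x by (simp add: star_star)
  qed
  define K where "K = max 1 (real (card I))"
  have bound: "p (finsum A (\<lambda>i. d i \<odot> e i) I) \<le> K powr (1 / 2 ^ n) * S"
    if "\<And>i. i \<in> I \<Longrightarrow> cmod (d i) \<le> S" "S \<ge> 0" for n d S
    using that
  proof (induction n arbitrary: d S)
    case 0
    have "p (finsum A (\<lambda>i. d i \<odot> e i) I) \<le> (\<Sum>i\<in>I. p (d i \<odot> e i))" by (rule seminorm_finsum[OF p]) (use e in auto)
    also have "\<dots> \<le> (\<Sum>i\<in>I. S * 1)"
    proof (rule sum_mono)
      fix i assume i: "i \<in> I"
      show "p (d i \<odot> e i) \<le> S * 1"
        using 0 projection_norm[OF p e(2-4)[OF i]] pD(1)[OF e(2)[OF i]] i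
        by (simp only: pD(3)[OF e(2)[OF i]]) (intro mult_mono, auto)
    qed
    also have "\<dots> = card I * S" by simp
    also have "\<dots> \<le> K * S" using 0 by (intro mult_right_mono) (auto simp: K_def)
    finally show ?case by (simp add: K_def)
  next
    case (Suc n)
    let ?x = "finsum A (\<lambda>i. d i \<odot> e i) I"
    have "(p ?x)\<^sup>2 = p (finsum A (\<lambda>i. complex_of_real ((cmod (d i))\<^sup>2) \<odot> e i) I)"
      using square[of e d] e by simp
    also have "\<dots> \<le> K powr (1 / 2 ^ n) * S\<^sup>2"
      by (rule Suc.IH) (use Suc.prems in \<open>auto simp: norm_power intro!: power_mono\<close>)
    also have "\<dots> = (K powr (1 / 2 ^ Suc n) * S)\<^sup>2"
      by (simp add: power_mult_distrib power2_eq_square powr_add[symmetric])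
    finally show ?case by (rule power2_le_imp_le) (use Suc.prems in auto)
  qed
  have e_le: "p (finsum A (\<lambda>i. d i \<odot> e i) I) \<le> S" if "\<And>i. i \<in> I \<Longrightarrow> cmod (d i) \<le> S" "S \<ge> 0" for d S
  proof (rule LIMSEQ_le_const)
    have "(\<lambda>n. 1 / 2 ^ n :: real) \<longlonglongrightarrow> 0"
      using LIMSEQ_power_zero[of "1 / 2 :: real"] by (simp add: power_one_over)
    then have "(\<lambda>n. K powr (1 / 2 ^ n)) \<longlonglongrightarrow> K powr 0"
      by (intro tendsto_powr tendsto_const) (auto simp: K_def)
    moreover have "K powr 0 = 1" by (simp add: K_def max_def)
    ultimately have "(\<lambda>n. K powr (1 / 2 ^ n)) \<longlonglongrightarrow> 1" by simp
    then have "(\<lambda>n. K powr (1 / 2 ^ n) * S) \<longlonglongrightarrow> 1 * S"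
      by (intro tendsto_mult tendsto_const)
    then show "(\<lambda>n. K powr (1 / 2 ^ n) * S) \<longlonglongrightarrow> S" by simp
    show "\<exists>N. \<forall>n\<ge>N. p (finsum A (\<lambda>i. d i \<odot> e i) I) \<le> K powr (1 / 2 ^ n) * S" using bound that by blast
  qed
  have "(p (finsum A (\<lambda>i. d i \<odot> W i) I))\<^sup>2 = p (finsum A (\<lambda>i. complex_of_real ((cmod (d i))\<^sup>2) \<odot> e i) I)"
    by (rule square) (use W e(1) in auto)
  also have "\<dots> \<le> S\<^sup>2" by (rule e_le) (use S in \<open>auto simp: norm_power intro!: power_mono\<close>)
  finally have "(p (finsum A (\<lambda>i. d i \<odot> W i) I))\<^sup>2 \<le> S\<^sup>2" .
  then show ?thesis by (rule power2_le_imp_le) (rule S)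
qed

end

section \<open>The norm of a combination of monomials\<close>

text \<open>Representatives may be prescribed for the classes of \<open>0\<close> and \<open>t\<close>; then \<open>CL4\<close> contains the projections
  \<open>s\<^sub>m s\<^sub>m\<^sup>*\<close> and \<open>u\<^sup>t s\<^sub>m s\<^sub>m\<^sup>* u\<^sup>-\<^sup>t\<close>, whose product vanishes.\<close>

lemma orthogonal_cl_family_of_cstar_norm:
  fixes s u :: "'r::idom \<Rightarrow> 'a" and A (structure)
  assumes family: "cl_family A s u" and p: "cstar_seminorm A p"
    and definite: "\<And>x. x \<in> carrier A \<Longrightarrow> p x = 0 \<Longrightarrow> x = \<zero>"
  shows "orthogonal_cl_family A s u"
proof (intro orthogonal_cl_family.intro orthogonal_cl_family_axioms.intro family)
  interpret cl_family A s u by (rule family)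
  fix m t :: 'r assume m: "m \<noteq> 0" and t: "\<not> m dvd t"
  let ?C = "\<lambda>l. (+) l ` range ((*) m)"
  define l where "l C = (if 0 \<in> C then 0 else if t \<in> C then t else SOME x. x \<in> C)" for C
  have C: "?C x \<in> residue_classes m" for x by (auto simp: residue_classes_def)
  have l: "l C \<in> C" if "C \<in> residue_classes m" for C
    using residue_reps(7)[OF fin[OF m] that] by (simp add: l_def)
  have "0 \<in> ?C 0" "t \<in> ?C t" "0 \<notin> ?C t" unfolding class_iff using t by simp_all
  then have l0: "l (?C 0) = 0" and lt: "l (?C t) = t" and ne: "?C 0 \<noteq> ?C t" unfolding l_def by auto
  have "p (proj m (l (?C t)) \<otimes> proj m (l (?C 0))) = 0"
    by (rule projections_orthogonal[OF p unital fin[OF m] C C ne, where e = "\<lambda>C. proj m (l C)"])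
      (use m in \<open>simp_all add: proj_idem proj_star sum_proj[OF m l]\<close>)
  then have z: "proj m t \<otimes> proj m 0 = \<zero>" unfolding l0 lt using m by (intro definite) simp_all
  have "star A (s m) \<otimes> (u (- t) \<otimes> s m) =
    star A (s m) \<otimes> (u (- t) \<otimes> ((proj m t \<otimes> proj m 0) \<otimes> s m))"
    using m by (simp add: proj_def mult_assoc u_mult' u_zero iso' iso)
  then have *: "star A (s m) \<otimes> (u (- t) \<otimes> s m) = \<zero>" using m by (simp add: z)
  show "star A (s m) \<otimes> (u t \<otimes> s m) = \<zero>"
    using arg_cong[OF *, of "star A"] m by (simp add: star_mult star_u star_star mult_assoc)
qed

text \<open>The degree of the monomial: \<open>(l, 1) (0, m) (0, k)\<^sup>-\<^sup>1 (- j, 1)\<close> in \<open>K \<rtimes> K\<^sup>\<times>\<close>.\<close>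

definition index_group :: "'r::idom \<times> 'r \<times> 'r \<times> 'r \<Rightarrow> 'r fract \<times> 'r fract" where
  "index_group = (\<lambda>(l, m, k, j). (to_fract l - to_fract j * (to_fract m / to_fract k), to_fract m / to_fract k))"

text \<open>Whether the point \<open>x \<in> R\<close> lies in the cylinder \<open>l + (m)\<close> of the monomial.\<close>

definition hits :: "'r::idom \<Rightarrow> 'r \<times> 'r \<times> 'r \<times> 'r \<Rightarrow> bool" where
  "hits x = (\<lambda>(l, m, k, j). m dvd x - l)"

definition weight_at :: "(complex \<times> 'r::idom \<times> 'r \<times> 'r \<times> 'r) list \<Rightarrow> 'r \<Rightarrow> complex" where
  "weight_at xs l = sum_list (map (\<lambda>x. if hits l (snd x) then fst x else 0) xs)"

text \<open>The degree and \<open>M\<close> determine \<open>K\<close>, and differences of \<open>l\<close> and of \<open>j\<close> correspond.\<close>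

lemma index_group_unique:
  assumes "M \<noteq> 0" "K \<noteq> 0" "K' \<noteq> 0" "index_group (l, M, K, j) = index_group (l', M, K', j')"
  shows "K = K'" "l - l' = d * M \<longleftrightarrow> j - j' = d * K"
proof -
  have 1: "to_fract M / to_fract K = to_fract M / to_fract K'"
    "to_fract l - to_fract j * (to_fract M / to_fract K) = to_fract l' - to_fract j' * (to_fract M / to_fract K')"
    using assms(4) by (auto simp: index_group_def)
  then show K: "K = K'" using assms(1-3) by (simp add: field_simps)
  have "(to_fract l - to_fract l') * to_fract K = (to_fract j - to_fract j') * to_fract M"
    using 1(2) assms(1-3) unfolding K[symmetric] by (simp add: field_simps)
  then have "to_fract ((l - l') * K) = to_fract ((j - j') * M)" by simp
  then have 2: "(l - l') * K = (j - j') * M" by (simp only: to_fract_eq_iff)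
  show "l - l' = d * M \<longleftrightarrow> j - j' = d * K"
  proof
    assume "l - l' = d * M"
    then have "M * (d * K) = M * (j - j')" using 2 by (simp add: ac_simps)
    then show "j - j' = d * K" using assms(1) by simp
  next
    assume jj: "j - j' = d * K"
    have "K * (l - l') = K * (d * M)" using 2 unfolding jj by (simp only: ac_simps)
    then show "l - l' = d * M" using assms(2) by (metis mult_left_cancel)
  qed
qed

context orthogonal_cl_family
begin

lemma combination_closed: "\<forall>x\<in>set xs. index_ok (snd x) \<Longrightarrow> combination A monomial xs \<in> carrier A"
  unfolding combination_def by (rule lsum_closed, rule smult_closed_complex, rule monomial_closed) blast

text \<open>Cutting a monomial down to a smaller cylinder gives zero or the monomial of the smaller cylinder.\<close>

lemma proj_monomial:
  assumes q: "index_ok (l0, m, k, j0)" and M: "M \<noteq> 0" "M = m * r"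
  shows "proj M l \<otimes> monomial (l0, m, k, j0) =
    (if m dvd l - l0 then monomial (l, M, k * r, j0 + k * exact_quot m (l - l0)) else \<zero>)"
proof -
  have n: "m \<noteq> 0" "k \<noteq> 0" "r \<noteq> 0" using q M by (auto simp: index_ok_def)
  have sM: "star A (s M) \<otimes> z = star A (s r) \<otimes> (star A (s m) \<otimes> z)" if "z \<in> carrier A" for z
    using n that by (simp add: star_s_mult' M mult.commute)
  have "proj M l \<otimes> monomial (l0, m, k, j0) =
    u l \<otimes> (s M \<otimes> (star A (s r) \<otimes> (star A (s m) \<otimes> (u (l0 - l) \<otimes> (s m \<otimes> (star A (s k) \<otimes> u (- j0)))))))"
    using n M(1) by (simp add: proj_def monomial_def mult_assoc u_mult' sM)
  also have "\<dots> = (if m dvd l - l0 then monomial (l, M, k * r, j0 + k * exact_quot m (l - l0)) else \<zero>)"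
  proof (cases "m dvd l - l0")
    case False
    then have "\<not> m dvd l0 - l" by (metis dvd_minus_iff minus_diff_eq)
    then show ?thesis using n M(1) False by (simp add: star_s_u_s')
  next
    case True
    define t where "t = exact_quot m (l - l0)"
    have t: "l - l0 = m * t" using exact_quot[OF True] by (simp add: t_def)
    then have "l0 - l = m * - t" by (metis minus_diff_eq mult_minus_right)
    then have "u (l0 - l) \<otimes> (s m \<otimes> (star A (s k) \<otimes> u (- j0))) = s m \<otimes> (u (- t) \<otimes> (star A (s k) \<otimes> u (- j0)))"
      using n by (simp only: s_u'[OF n(1)] mult_closed_simp u_closed s_closed not_False_eq_True)
    then have "star A (s m) \<otimes> (u (l0 - l) \<otimes> (s m \<otimes> (star A (s k) \<otimes> u (- j0)))) = u (- t) \<otimes> (star A (s k) \<otimes> u (- j0))"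
      using n by (simp add: iso')
    also have "\<dots> = star A (s k) \<otimes> u (- (j0 + k * t))"
    proof -
      have "k * - t + - j0 = - (j0 + k * t)" by simp
      then show ?thesis by (simp only: u_star_s'[OF n(2) u_closed] u_mult)
    qed
    finally show ?thesis
      using n M(1) True by (simp add: monomial_def star_s_mult' t_def mult.commute)
  qed
  finally show ?thesis .
qed

lemma refine_group:
  assumes q: "index_ok (l0, m, k, j0)" and M: "M \<noteq> 0" "M = m * r" and l: "m dvd l - l0"
  shows "index_group (l, M, k * r, j0 + k * exact_quot m (l - l0)) = index_group (l0, m, k, j0)"
    and "k * r \<noteq> 0"
proof -
  have n: "m \<noteq> 0" "k \<noteq> 0" "r \<noteq> 0" using q M by (auto simp: index_ok_def)
  then show "k * r \<noteq> 0" by simp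
  obtain t where t: "exact_quot m (l - l0) = t" by blast
  have l': "l = l0 + m * t" using exact_quot[OF l] by (simp add: t[symmetric] algebra_simps)
  show "index_group (l, M, k * r, j0 + k * exact_quot m (l - l0)) = index_group (l0, m, k, j0)"
    unfolding t index_group_def M(2) prod.case using n by (simp add: l') (simp add: field_simps)
qed

lemma monomial_range:
  assumes "M \<noteq> 0" "K \<noteq> 0"
  shows "monomial (l, M, K, j) \<otimes> star A (monomial (l, M, K, j)) = proj M l"
  using assms by (simp add: monomial_def proj_def star_mult star_star star_u mult_assoc u_mult' u_zero iso')

text \<open>Between the two monomials stands \<open>s\<^sub>K\<^sup>* u\<^bsup>j' - j\<^esup> s\<^sub>K\<close>, and \<open>K\<close> divides the exponent only if \<open>M\<close> divides
  \<open>l - l'\<close>, as the degrees agree.\<close>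

lemma monomial_orthogonal:
  assumes M: "M \<noteq> 0" and K: "K \<noteq> 0" "K' \<noteq> 0"
    and g: "index_group (l, M, K, j) = index_group (l', M, K', j')" and l: "\<not> M dvd l - l'"
  shows "monomial (l, M, K, j) \<otimes> star A (monomial (l', M, K', j')) = \<zero>"
proof -
  note un = index_group_unique[OF M K g]
  have "\<not> K dvd j - j'" using un(2) l by (metis dvd_def mult.commute)
  then have "\<not> K dvd - j + j'" using dvd_minus_iff[of K "j - j'"] by simp
  then show ?thesis
    using M K unfolding un(1)[symmetric]
    by (simp add: monomial_def star_mult star_star star_u mult_assoc u_mult' star_s_u_s')
qed

lemma proj_orthogonal: "M \<noteq> 0 \<Longrightarrow> \<not> M dvd l - l' \<Longrightarrow> proj M l \<otimes> proj M l' = \<zero>"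
proof -
  assume M: "M \<noteq> 0" "\<not> M dvd l - l'"
  have "proj M x = monomial (x, M, M, x)" for x by (simp add: proj_def monomial_def)
  moreover have "index_group (l, M, M, l) = index_group (l', M, M, l')" using M by (simp add: index_group_def)
  ultimately show ?thesis using monomial_orthogonal[OF M(1) M(1) M(1) _ M(2), of l l'] proj_star[OF M(1), of l'] by metis
qed

lemma lsum_smult: "W \<in> carrier A \<Longrightarrow> lsum A (\<lambda>x. f x \<odot> W) xs = sum_list (map f xs) \<odot> W"
  by (induction xs) (use smult_l_distr[simplified] in \<open>auto simp: smult_zero_complex\<close>)

text \<open>All cylinders in the list are unions of cosets of a common multiple \<open>M\<close>. Multiplying by the projection of
  the coset \<open>l + (M)\<close> leaves one monomial \<open>W l\<close>, determined by \<open>l\<close> and the degree, with the total weight of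
  the terms that hit \<open>l\<close>. So the combination is a sum of orthogonal partial isometries.\<close>

lemma homogeneous_norm:
  assumes p: "cstar_seminorm A p"
    and ok: "\<And>x. x \<in> set xs \<Longrightarrow> index_ok (snd x)" and g: "\<And>x. x \<in> set xs \<Longrightarrow> index_group (snd x) = g"
    and S: "\<And>l. cmod (weight_at xs l) \<le> S"
  shows "p (combination A monomial xs) \<le> S"
proof -
  define M where "M = prod_list (map (\<lambda>x. fst (snd (snd x))) xs)"
  have M: "M \<noteq> 0"
  proof -
    have "0 \<notin> set (map (\<lambda>x. fst (snd (snd x))) xs)"
    proof
      assume "0 \<in> set (map (\<lambda>x. fst (snd (snd x))) xs)"
      then obtain x where x: "x \<in> set xs" "0 = fst (snd (snd x))" unfolding set_map by (rule imageE)
      obtain c l m k j where "x = (c, l, m, k, j)" by (cases x)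
      with x ok[OF x(1)] show False unfolding index_ok_def by simp
    qed
    then show ?thesis by (simp add: M_def prod_list_zero_iff)
  qed
  have dvd: "m dvd M" if "(c, l, m, k, j) \<in> set xs" for c l m k j
  proof -
    have "m \<in> set (map (\<lambda>x. fst (snd (snd x))) xs)" using that by force
    then show ?thesis unfolding M_def by (rule prod_list_dvd)
  qed
  have S0: "S \<ge> 0" using S[of 0] norm_ge_zero order_trans by blast
  define P where "P l Q \<longleftrightarrow> (\<exists>K j. Q = (l, M, K, j) \<and> K \<noteq> 0 \<and> index_group Q = g)" for l Q
  define T where "T l = (SOME Q. P l Q)" for l
  define W where "W l = (if \<exists>x\<in>set xs. hits l (snd x) then monomial (T l) else \<zero>)" for l
  have hit: "proj M l \<otimes> monomial (snd x) = (if hits l (snd x) then W l else \<zero>)"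
    and Wcases: "W l = \<zero> \<or> (\<exists>K j. W l = monomial (l, M, K, j) \<and> K \<noteq> 0 \<and> index_group (l, M, K, j) = g)"
    if x: "x \<in> set xs" for x l
  proof -
    have one: "\<exists>K j. proj M l \<otimes> monomial (snd y) = monomial (l, M, K, j) \<and> K \<noteq> 0 \<and> index_group (l, M, K, j) = g"
      if y: "y \<in> set xs" "hits l (snd y)" for y
    proof -
      obtain c l0 m k j where y': "y = (c, l0, m, k, j)" by (cases y)
      obtain r where r: "M = m * r" using dvd y y' by blast
      have ok': "index_ok (l0, m, k, j)" and g': "index_group (l0, m, k, j) = g" using ok[OF y(1)] g[OF y(1)] by (auto simp: y')
      have "m dvd l - l0" using y(2) by (simp add: hits_def y')
      then show ?thesis
        using proj_monomial[OF ok' M r, of l] refine_group[OF ok' M r, of l] g' unfolding y' snd_conv by metis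
    qed
    have ex: "\<exists>K j. T l = (l, M, K, j) \<and> K \<noteq> 0 \<and> index_group (l, M, K, j) = g"
      if some_hit: "\<exists>x\<in>set xs. hits l (snd x)"
    proof -
      obtain y where "y \<in> set xs" "hits l (snd y)" using some_hit by blast
      then obtain K j where "K \<noteq> 0" "index_group (l, M, K, j) = g" using one by blast
      then have "P l (l, M, K, j)" unfolding P_def by blast
      then have "P l (T l)" unfolding T_def by (rule someI)
      then show ?thesis unfolding P_def by metis
    qed
    then show "W l = \<zero> \<or> (\<exists>K j. W l = monomial (l, M, K, j) \<and> K \<noteq> 0 \<and> index_group (l, M, K, j) = g)"
      unfolding W_def by metis
    show "proj M l \<otimes> monomial (snd x) = (if hits l (snd x) then W l else \<zero>)"
    proof (cases "hits l (snd x)")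
      case True
      obtain K j where 1: "proj M l \<otimes> monomial (snd x) = monomial (l, M, K, j)" "K \<noteq> 0" "index_group (l, M, K, j) = g"
        using one[OF x True] by blast
      obtain K' j' where 2: "T l = (l, M, K', j')" "K' \<noteq> 0" "index_group (l, M, K', j') = g"
        using ex x True by blast
      have 3: "index_group (l, M, K, j) = index_group (l, M, K', j')" using 1(3) 2(3) by simp
      have "K = K'" "j = j'"
        using index_group_unique(1)[OF M 1(2) 2(2) 3] index_group_unique(2)[OF M 1(2) 2(2) 3, of 0] by simp_all
      moreover have "W l = monomial (T l)" using True x unfolding W_def by metis
      ultimately show ?thesis using True 1(1) 2(1) by simp
    next
      case False
      obtain c l0 m k j where x': "x = (c, l0, m, k, j)" by (cases x)
      obtain r where r: "M = m * r" using dvd x x' by blast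
      show ?thesis using proj_monomial[OF _ M r, of l0 k j l] ok[OF x] False by (simp add: x' hits_def)
    qed
  qed
  show ?thesis
  proof (cases "xs = []")
    case True
    then show ?thesis using S0 by (simp add: combination_def seminorm_zero[OF p])
  next
    case False
    then have Wc: "W l = \<zero> \<or> (\<exists>K j. W l = monomial (l, M, K, j) \<and> K \<noteq> 0 \<and> index_group (l, M, K, j) = g)" for l
      using Wcases[of "hd xs" l] by simp
    then have Wcl: "W l \<in> carrier A" for l
    proof -
      have "monomial (l, M, K, j) \<in> carrier A" if "K \<noteq> 0" for K j
        by (rule monomial_closed) (simp add: index_ok_def M that)
      then show ?thesis using Wc[of l] M.zero_closed by metis
    qed
    let ?R = "set (residue_reps M)" let ?x = "combination A monomial xs"
    have xc: "?x \<in> carrier A" using ok by (intro combination_closed) blast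
    have px: "proj M l \<otimes> ?x = weight_at xs l \<odot> W l" for l
    proof -
      have "proj M l \<otimes> ?x = lsum A (\<lambda>x. fst x \<odot> (proj M l \<otimes> monomial (snd x))) xs"
        unfolding combination_def using ok M
        by (subst mult_lsum) (auto simp: smult_mult_r intro!: lsum_cong)
      also have "\<dots> = lsum A (\<lambda>x. (if hits l (snd x) then fst x else 0) \<odot> W l) xs"
        using Wcl smult_r_null[simplified] by (intro lsum_cong) (auto simp: hit smult_zero_complex)
      also have "\<dots> = weight_at xs l \<odot> W l" unfolding weight_at_def by (rule lsum_smult[OF Wcl])
      finally show ?thesis .
    qed
    have "?x = lsum A (proj M) (residue_reps M) \<otimes> ?x" using xc by (simp add: lsum_proj[OF M])
    also have "\<dots> = lsum A (\<lambda>l. proj M l \<otimes> ?x) (residue_reps M)" using xc M by (intro lsum_mult) auto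
    also have "\<dots> = finsum A (\<lambda>l. weight_at xs l \<odot> W l) ?R"
      using Wcl residue_reps(1)[OF fin[OF M]] by (simp add: px lsum_finsum)
    finally have x_eq: "?x = finsum A (\<lambda>l. weight_at xs l \<odot> W l) ?R" .
    define e where "e l = W l \<otimes> star A (W l)" for l
    have e: "e l = \<zero> \<or> e l = proj M l" for l
      using Wc[of l] M by (auto simp: e_def monomial_range)
    have distinct: "\<not> M dvd l - l'" if "l \<in> ?R" "l' \<in> ?R" "l \<noteq> l'" for l l'
      using residue_reps(3)[OF fin[OF M]] that by blast
    show ?thesis
      unfolding x_eq
    proof (rule orthogonal_norm[OF p, where e = e])
      fix l l' assume "l \<in> ?R" "l' \<in> ?R" "l \<noteq> l'"
      then have d: "\<not> M dvd l - l'" by (rule distinct)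
      show "W l \<otimes> star A (W l') = \<zero>"
      proof (cases "W l = \<zero> \<or> W l' = \<zero>")
        case True
        then show ?thesis using Wcl[of l] Wcl[of l'] by (auto simp: star_closed)
      next
        case False
        then obtain K j K' j' where "W l = monomial (l, M, K, j)" "W l' = monomial (l', M, K', j')" "K \<noteq> 0" "K' \<noteq> 0"
          "index_group (l, M, K, j) = index_group (l', M, K', j')"
          using Wc[of l] Wc[of l'] by metis
        then show ?thesis using monomial_orthogonal[OF M _ _ _ d] by metis
      qed
      show "e l \<otimes> e l' = \<zero>" using e[of l] e[of l'] proj_orthogonal[OF M d] zero_mult mult_zero proj_closed[OF M] M.zero_closed by metis
    next
      fix l show "e l \<otimes> e l = e l" "star A (e l) = e l" "e l \<in> carrier A"
        using e[of l] M by (auto simp: proj_idem proj_star)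
    qed (auto simp: Wcl e_def S S0)
  qed
qed

lemma combination_split:
  assumes "\<forall>x\<in>set xs. index_ok (snd x)"
  shows "combination A monomial xs =
    combination A monomial (filter P xs) \<oplus> combination A monomial (filter (\<lambda>x. \<not> P x) xs)"
  using assms
proof (induction xs)
  case Nil then show ?case by (simp add: combination_def)
next
  case (Cons x xs)
  have 1: "combination A monomial (x # xs) = fst x \<odot> monomial (snd x) \<oplus> combination A monomial xs" for xs
    by (simp add: combination_def)
  have c: "combination A monomial (filter P xs) \<in> carrier A" "combination A monomial (filter (\<lambda>x. \<not> P x) xs) \<in> carrier A"
    using Cons.prems by (auto intro!: combination_closed)
  show ?case using Cons c by (auto simp: 1 M.a_ac)
qed

text \<open>The degrees are separated by the triangle inequality, which is why the \<open>\<ell>\<^sup>1\<close>-norm over the group appears.\<close>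

lemma combination_norm:
  assumes p: "cstar_seminorm A p" and "finite T"
    and "\<forall>x\<in>set xs. index_ok (snd x) \<and> index_group (snd x) \<in> T"
    and "\<And>g l. cmod (weight_at (filter (\<lambda>x. index_group (snd x) = g) xs) l) \<le> S g"
  shows "p (combination A monomial xs) \<le> (\<Sum>g\<in>T. S g)"
  using assms(2-4)
proof (induction T arbitrary: xs)
  case empty
  then have "xs = []" by (metis empty_iff list.set_intros(1) neq_Nil_conv)
  then show ?case by (simp add: combination_def seminorm_zero[OF p])
next
  case (insert g T)
  let ?ys = "filter (\<lambda>x. index_group (snd x) = g) xs" and ?zs = "filter (\<lambda>x. index_group (snd x) \<noteq> g) xs"
  have S0: "S h \<ge> 0" for h using insert.prems(2)[of h 0] norm_ge_zero order_trans by blast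
  have "p (combination A monomial xs) \<le> p (combination A monomial ?ys) + p (combination A monomial ?zs)"
    using insert.prems(1) by (subst combination_split[of xs "\<lambda>x. index_group (snd x) = g"])
      (auto intro!: cstar_seminormD(2)[OF p] combination_closed)
  also have "p (combination A monomial ?ys) \<le> S g"
    by (rule homogeneous_norm[OF p]) (use insert.prems in auto)
  also have "p (combination A monomial ?zs) \<le> (\<Sum>h\<in>T. S h)"
  proof (rule insert.IH)
    show "\<forall>x\<in>set ?zs. index_ok (snd x) \<and> index_group (snd x) \<in> T" using insert.prems(1) by auto
    fix h l
    have "filter (\<lambda>x. index_group (snd x) = h) ?zs = (if h = g then [] else filter (\<lambda>x. index_group (snd x) = h) xs)"
      by (auto intro!: filter_cong)
    then show "cmod (weight_at (filter (\<lambda>x. index_group (snd x) = h) ?zs) l) \<le> S h"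
      using insert.prems(2)[of h l] S0[of h] by (auto simp: weight_at_def)
  qed
  finally show ?case using insert.hyps by simp
qed

end

section \<open>The relations in the crossed product\<close>

context clopen_partial_action
begin

definition delta :: "'x set \<Rightarrow> 'g \<Rightarrow> 'g \<Rightarrow> 'x \<Rightarrow> complex" where
  "delta S g = cp_single CA (indicator S) g"

definition clopen_in :: "'x set \<Rightarrow> 'g \<Rightarrow> bool" where
  "clopen_in S g \<longleftrightarrow> g \<in> carrier G \<and> S \<subseteq> V g \<and> openin X S \<and> closedin X S"

lemma indicator_ID:
  assumes "clopen_in S g" shows "(indicator S :: 'x \<Rightarrow> complex) \<in> ID g"
proof -
  have S: "openin X S" "closedin X S" "S \<subseteq> V g" using assms by (auto simp: clopen_in_def)
  have "continuous_map X euclidean (indicator S :: 'x \<Rightarrow> complex)"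
    unfolding continuous_map_def
  proof (intro conjI allI impI)
    fix U :: "complex set"
    have "{x \<in> topspace X. indicator S x \<in> U} = (if 1 \<in> U then S else {}) \<union> (if 0 \<in> U then topspace X - S else {})"
      using openin_subset[OF S(1)] by (auto simp: indicator_def)
    also have "openin X \<dots>" using S by (auto simp: closedin_def)
    finally show "openin X {x \<in> topspace X. indicator S x \<in> U}" .
  qed simp
  then show ?thesis using S openin_subset[OF S(1)] by (auto simp: ID_iff cont_alg_carrier indicator_def)
qed

lemma delta_closed: "clopen_in S g \<Longrightarrow> delta S g \<in> carrier L"
  unfolding delta_def by (intro single_carrier indicator_ID) (auto simp: clopen_in_def)

lemma delta_apply: "delta S g h x = (if h = g then indicator S x else 0)"
  by (simp add: delta_def cp_single_def cont_alg_simps)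

lemma delta_mult:
  assumes S: "clopen_in S g" and T: "clopen_in T h"
  shows "delta S g \<otimes>\<^bsub>L\<^esub> delta T h = delta {x \<in> S. \<theta> (inv g) x \<in> T} (g \<otimes> h)"
proof (intro ext)
  fix k x
  have gh: "g \<in> carrier G" "h \<in> carrier G" using S T by (auto simp: clopen_in_def)
  show "(delta S g \<otimes>\<^bsub>L\<^esub> delta T h) k x = delta {x \<in> S. \<theta> (inv g) x \<in> T} (g \<otimes> h) k x"
  proof (cases "k \<in> carrier G")
    case True
    have "inv g \<otimes> k = h \<longleftrightarrow> k = g \<otimes> h" using gh True by (auto simp: m_assoc[symmetric])
    then show ?thesis
      using single_mult[OF gh(1) indicator_ID[OF S] delta_closed[OF T] True, of x]
      by (auto simp: delta_def[of S] delta_apply indicator_def)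
  next
    case False
    then show ?thesis
      using L_mult_outside[OF delta_closed[OF S] delta_closed[OF T] False] gh by (auto simp: delta_apply)
  qed
qed

lemma clopen_V: "g \<in> carrier G \<Longrightarrow> clopen_in (V g) g"
  using clopen[of g] by (auto simp: clopen_in_def)

lemma clopen_V_Int: "a \<in> carrier G \<Longrightarrow> g \<in> carrier G \<Longrightarrow> clopen_in (V a \<inter> V g) g"
  using clopen[of g] clopen[of a] by (auto simp: clopen_in_def)

text \<open>The elements \<open>1\<^sub>V\<^sub>g \<delta>\<^sub>g\<close> form a partial representation of the group; the further intersection with
  \<open>V a\<close> allows longer products to be evaluated from the right.\<close>

lemma delta_V_mult:
  assumes "g \<in> carrier G" "a \<in> carrier G" "h \<in> carrier G"
  shows "delta (V g) g \<otimes>\<^bsub>L\<^esub> delta (V a \<inter> V h) h = delta (V g \<inter> V (g \<otimes> a) \<inter> V (g \<otimes> h)) (g \<otimes> h)"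
proof -
  have "{x \<in> V g. \<theta> (inv g) x \<in> V a \<inter> V h} = V g \<inter> V (g \<otimes> a) \<inter> V (g \<otimes> h)"
    using theta_dom_iff[of g] assms by auto
  then show ?thesis using delta_mult[OF clopen_V clopen_V_Int] assms by simp
qed

lemma delta_V_mult_V:
  assumes "g \<in> carrier G" "h \<in> carrier G"
  shows "delta (V g) g \<otimes>\<^bsub>L\<^esub> delta (V h) h = delta (V g \<inter> V (g \<otimes> h)) (g \<otimes> h)"
  using delta_V_mult[OF assms(1) assms(2) assms(2)] by (simp add: Int_assoc)

lemma delta_V_star:
  assumes g: "g \<in> carrier G" shows "star L (delta (V g) g) = delta (V (inv g)) (inv g)"
proof (intro ext)
  fix k x
  show "star L (delta (V g) g) k x = delta (V (inv g)) (inv g) k x"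
    using g theta_range[of g x] inv_inv[of g] inv_inv[of k]
    by (auto simp: L_simps(5) delta_apply indicator_def simp del: inv_inv)
qed

lemma delta_empty: "delta {} g = \<zero>\<^bsub>L\<^esub>"
  by (auto simp: fun_eq_iff delta_apply L_simps(2))

lemma one_eq_delta: "\<one>\<^bsub>L\<^esub> = delta (V \<one>) \<one>"
  by (auto simp: fun_eq_iff delta_apply L_simps(1) cp_single_def cont_alg_simps V_one)

lemma L_finsum_apply:
  assumes "\<And>i. i \<in> I \<Longrightarrow> F i \<in> carrier L"
  shows "finsum L F I g x = (\<Sum>i\<in>I. F i g x)"
proof -
  interpret Lalg: star_algebra L by (rule star_algebra_L)
  show ?thesis using assms
    by (induction I rule: infinite_finite_induct)
      (simp_all add: Lalg.M.finsum_infinite Pi_iff, simp_all add: L_simps(2,3))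
qed

end

text \<open>The type parameter only fixes the ring \<open>R\<close>, so that the hypothesis of finite quotients can be shared.\<close>

locale finite_residues =
  fixes ring_type :: "'r::idom itself"
  assumes finite_classes: "\<And>m::'r. m \<noteq> 0 \<Longrightarrow> finite (residue_classes m)"

sublocale finite_residues \<subseteq> H: clopen_partial_action
  "affine_group :: ('r fract \<times> 'r fract) monoid" hat_top hat_dom hat_theta
proof (intro clopen_partial_action.intro clopen_partial_action_axioms.intro group_affine)
  show "compact_space (hat_top :: ('r fract \<Rightarrow> 'r fract set) topology)" by (rule compact_hat[OF finite_classes])
  show "hat_dom \<one>\<^bsub>affine_group\<^esub> = topspace (hat_top :: ('r fract \<Rightarrow> 'r fract set) topology)"
  proof -
    have "x 1 = frac_coset 0 1" if x: "x \<in> hat_set" for x :: "'r fract \<Rightarrow> 'r fract set"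
      using hat_closed[OF x, of 1] by (auto simp: frac_quot_eq frac_coset_one)
    then show ?thesis by (auto simp: topspace_hat hat_dom_iff)
  qed
qed (auto simp: hat_dom_clopen hat_theta_cont[simplified] hat_theta_range hat_theta_one hat_theta_mult
    hat_theta_dom topspace_hat)

lemma hat_dom_eq: "u - v \<in> frac_ideal w \<Longrightarrow> hat_dom (u, w) = hat_dom (v, w)"
  using frac_coset_eq_iff[of u w v] by (auto simp: hat_dom_iff)

lemma hat_dom_mono:
  assumes "w \<noteq> 0" "w' \<noteq> 0" "frac_le w w'"
  shows "hat_dom (u, w') \<subseteq> hat_dom (u, w)"
proof
  fix x assume "x \<in> hat_dom (u, w')"
  then show "x \<in> hat_dom (u, w)"
    using hat_compat[OF _ assms, of x] frac_proj_coset[OF assms(3), of u] by (simp add: hat_dom_iff)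
qed

text \<open>A point of \<open>R\<^sub>K\<close> has coordinates in \<open>(R + (w)) / (w)\<close>, which is trivial for \<open>w = 1/k\<close>.\<close>

lemma hat_dom_inverse:
  assumes "k \<noteq> 0"
  shows "hat_dom (to_fract r / to_fract k, 1 / to_fract (k :: 'r::idom)) = hat_set"
proof -
  have "x (1 / to_fract k) = frac_coset (to_fract r / to_fract k) (1 / to_fract k)" if x: "x \<in> hat_set" for x
  proof -
    have "1 / to_fract k \<noteq> (0 :: 'r fract)" using assms by simp
    from hat_closed[OF x this] obtain t where "x (1 / to_fract k) = frac_coset (to_fract t) (1 / to_fract k)"
      by (auto simp: frac_quot_eq)
    moreover have "to_fract t - to_fract r / to_fract k = 1 / to_fract k * to_fract (t * k - r)"
      using assms by (simp add: field_simps)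
    then have "frac_coset (to_fract t) (1 / to_fract k) = frac_coset (to_fract r / to_fract k) (1 / to_fract k)"
      unfolding frac_coset_eq_iff frac_ideal_iff by blast
    ultimately show ?thesis by simp
  qed
  then show ?thesis by (auto simp: hat_dom_iff)
qed

lemma hat_dom_unit: "hat_dom (to_fract r, 1) = hat_set"
  using hat_dom_inverse[of 1 r] by simp

text \<open>The diagonal embedding of \<open>R\<close> into \<open>R\<^sub>K\<close>.\<close>

definition ring_point :: "'r::idom \<Rightarrow> 'r fract \<Rightarrow> 'r fract set" where
  "ring_point l = (\<lambda>w\<in>UNIV - {0}. frac_coset (to_fract l) w)"

lemma ring_point: "ring_point l \<in> hat_set"
  unfolding hat_set_def ring_point_def by (auto simp: frac_quot_eq frac_proj_coset)

lemma ring_point_iff: "w \<noteq> 0 \<Longrightarrow> ring_point l \<in> hat_dom (u, w) \<longleftrightarrow> to_fract l - u \<in> frac_ideal w"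
  using ring_point[of l] by (simp add: hat_dom_iff frac_coset_eq_iff ring_point_def)

lemma frac_ideal_to_fract: "to_fract a \<in> frac_ideal (to_fract m) \<longleftrightarrow> m dvd a"
  unfolding frac_ideal_iff by (metis dvd_def to_fract_eq_iff to_fract_mult)

lemma to_fract_diff_ideal: "to_fract a - to_fract b \<in> frac_ideal (to_fract m) \<longleftrightarrow> m dvd a - b"
  using frac_ideal_to_fract[of "a - b" m] by simp

context finite_residues
begin

abbreviation "LH \<equiv> cp_sums (affine_group :: ('r fract \<times> 'r fract) monoid) (cont_alg hat_top) hat_ideal hat_action"

lemma LH_eq: "LH = H.L"
proof -
  have "hat_ideal = (\<lambda>g. cont_ideal hat_top (hat_dom (g :: 'r fract \<times> _)))"
    by (simp add: hat_ideal_def fun_eq_iff)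
  then show ?thesis by (simp add: hat_action_def)
qed

abbreviation "v g \<equiv> H.delta (hat_dom g) g"

definition crossed_s :: "'r \<Rightarrow> 'r fract \<times> 'r fract \<Rightarrow> ('r fract \<Rightarrow> 'r fract set) \<Rightarrow> complex" where
  "crossed_s m = v (0, to_fract m)"

definition crossed_u :: "'r \<Rightarrow> 'r fract \<times> 'r fract \<Rightarrow> ('r fract \<Rightarrow> 'r fract set) \<Rightarrow> complex" where
  "crossed_u n = v (to_fract n, 1)"

lemma v_mult: "w \<noteq> 0 \<Longrightarrow> w' \<noteq> 0 \<Longrightarrow> v (x, w) \<otimes>\<^bsub>H.L\<^esub> v (x', w') =
   H.delta (hat_dom (x, w) \<inter> hat_dom (x + x' * w, w * w')) (x + x' * w, w * w')"
  using H.delta_V_mult_V[of "(x, w)" "(x', w')"] by simp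

lemma v_star: "w \<noteq> 0 \<Longrightarrow> star H.L (v (x, w)) = v (- x / w, 1 / w)"
  using H.delta_V_star[of "(x, w)"] by simp

lemma hat_dom_sub: "hat_dom g \<subseteq> hat_set"
  by (cases g) (auto simp: hat_dom_iff)

lemma hat_dom_zero_inverse: "k \<noteq> 0 \<Longrightarrow> hat_dom (0, 1 / to_fract (k::'r)) = hat_set"
  using hat_dom_inverse[of k 0] by simp

lemma hat_dom_zero_one: "hat_dom (0, 1 :: 'r fract) = hat_set"
  using hat_dom_unit[of 0] by simp

lemma frac_le_to_fract: "frac_le (to_fract m) (to_fract (m * m'))"
  by (auto simp: frac_le_def)

lemma star_s: "m \<noteq> 0 \<Longrightarrow> star H.L (crossed_s m) = v (0, 1 / to_fract m)"
  by (simp add: crossed_s_def v_star)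

lemma star_u: "star H.L (crossed_u n) = v (to_fract (- n), 1)"
  by (simp add: crossed_u_def v_star)

text \<open>The cylinder \<open>l + (m)\<close> of a monomial lies in the domain of its degree (take \<open>x = l\<close>).\<close>

lemma hat_dom_degree:
  fixes m k j :: 'r
  assumes "m \<noteq> 0" "k \<noteq> 0"
  shows "hat_dom (x, to_fract m) \<subseteq> hat_dom (x - to_fract j / to_fract k * to_fract m, to_fract m / to_fract k)"
proof -
  let ?m = "to_fract m" and ?k = "to_fract k" and ?j = "to_fract j"
  have n: "?m \<noteq> 0" "?k \<noteq> 0" using assms by simp_all
  have le: "frac_le (?m / ?k) ?m" unfolding frac_le_def by (rule exI[of _ k]) (use n in simp)
  have "x - (x - ?j / ?k * ?m) = ?m / ?k * to_fract j" by simp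
  then have "x - (x - ?j / ?k * ?m) \<in> frac_ideal (?m / ?k)" unfolding frac_ideal_iff by blast
  then have "hat_dom (x, ?m / ?k) = hat_dom (x - ?j / ?k * ?m, ?m / ?k)" by (rule hat_dom_eq)
  then show ?thesis using hat_dom_mono[OF _ n(1) le, of x] n by simp
qed

text \<open>Every factor is of the form \<open>1\<^sub>V\<^sub>g \<delta>\<^sub>g\<close>; the degrees multiply to \<open>index_group\<close>, and of the domains met on the
  way the cylinder \<open>l + (m)\<close> is the smallest.\<close>

lemma crossed_monomial:
  assumes "m \<noteq> 0" "k \<noteq> 0"
  shows "crossed_u l \<otimes>\<^bsub>H.L\<^esub> (crossed_s m \<otimes>\<^bsub>H.L\<^esub> (star H.L (crossed_s k) \<otimes>\<^bsub>H.L\<^esub> crossed_u (- j)))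
    = H.delta (hat_dom (to_fract l, to_fract m)) (index_group (l, m, k, j))"
proof -
  let ?m = "to_fract m" and ?k = "to_fract k" and ?l = "to_fract l" and ?j = "to_fract j"
  have n: "?m \<noteq> 0" "?k \<noteq> 0" using assms by simp_all
  have 1: "star H.L (crossed_s k) \<otimes>\<^bsub>H.L\<^esub> crossed_u (- j) = v (- ?j / ?k, 1 / ?k)"
    using n v_mult[of "1 / ?k" 1 0 "- ?j"] hat_dom_inverse[OF assms(2), of "- j"] hat_dom_zero_inverse[OF assms(2)]
    by (simp add: star_s assms crossed_u_def)
  have 2: "hat_dom (- ?j / ?k, 1 / ?k) = hat_set" using hat_dom_inverse[OF assms(2), of "- j"] by simp
  have sub: "hat_dom (0, ?m) \<subseteq> hat_dom (- ?j / ?k * ?m, ?m / ?k)"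
    using hat_dom_degree[OF assms, of 0 j] by simp
  have 3: "crossed_s m \<otimes>\<^bsub>H.L\<^esub> v (- ?j / ?k, 1 / ?k) = H.delta (hat_dom (0, ?m)) (- ?j / ?k * ?m, ?m / ?k)"
  proof -
    have "v (0, ?m) \<otimes>\<^bsub>H.L\<^esub> H.delta (hat_dom (0, 1) \<inter> hat_dom (- ?j / ?k, 1 / ?k)) (- ?j / ?k, 1 / ?k) =
      H.delta (hat_dom (0, ?m) \<inter> hat_dom (0, ?m) \<inter> hat_dom (- ?j / ?k * ?m, ?m / ?k)) (- ?j / ?k * ?m, ?m / ?k)"
      using H.delta_V_mult[of "(0, ?m)" "(0, 1)" "(- ?j / ?k, 1 / ?k)"] n by simp
    then show ?thesis using sub 2 hat_dom_zero_one by (simp add: crossed_s_def Int_absorb2)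
  qed
  have 4: "v (?l, 1) \<otimes>\<^bsub>H.L\<^esub> H.delta (hat_dom (0, ?m) \<inter> hat_dom (- ?j / ?k * ?m, ?m / ?k)) (- ?j / ?k * ?m, ?m / ?k) =
      H.delta (hat_dom (?l, 1) \<inter> hat_dom (?l, ?m) \<inter> hat_dom (?l - ?j / ?k * ?m, ?m / ?k)) (?l - ?j / ?k * ?m, ?m / ?k)"
    using H.delta_V_mult[of "(?l, 1)" "(0, ?m)" "(- ?j / ?k * ?m, ?m / ?k)"] n by simp
  have "hat_dom (?l, 1) \<inter> hat_dom (?l, ?m) \<inter> hat_dom (?l - ?j / ?k * ?m, ?m / ?k) = hat_dom (?l, ?m)"
    using hat_dom_degree[OF assms, of ?l j] hat_dom_sub[of "(?l, ?m)"] by (auto simp: hat_dom_unit)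
  then show ?thesis
    unfolding 1 3 crossed_u_def[of l] using 4 sub by (simp add: index_group_def Int_absorb2)
qed

lemma crossed_s_closed: "m \<noteq> 0 \<Longrightarrow> crossed_s m \<in> carrier H.L"
  unfolding crossed_s_def by (intro H.delta_closed H.clopen_V) simp

lemma crossed_u_closed: "crossed_u n \<in> carrier H.L"
  unfolding crossed_u_def by (intro H.delta_closed H.clopen_V) simp

lemma crossed_one: "\<one>\<^bsub>H.L\<^esub> = H.delta hat_set (0, 1)"
  using H.one_eq_delta by (simp add: hat_dom_zero_one)

text \<open>All relations but \<open>CL4\<close> compare two elements \<open>1\<^sub>S \<delta>\<^sub>g\<close>. The summands of \<open>CL4\<close> are the indicators of the
  cylinders \<open>l + (m)\<close>, and these partition \<open>R\<^sub>K\<close>.\<close>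

lemma crossed_relations:
  assumes "(a, b) \<in> cl_relations H.L crossed_s crossed_u"
  shows "a = b"
proof -
  interpret Lalg: star_algebra H.L by (rule H.star_algebra_L)
  note [simp] = crossed_s_closed crossed_u_closed Lalg.star_closed Lalg.mult_closed
  from assms show ?thesis
  proof cases
    case (isometry m)
    then show ?thesis
      using v_mult[of "1 / to_fract m" "to_fract m" 0 0] hat_dom_zero_inverse[of m]
      by (simp add: star_s crossed_one) (simp add: crossed_s_def hat_dom_zero_one)
  next
    case (unitary1 n)
    then show ?thesis
      using v_mult[of 1 1 "to_fract (- n)" "to_fract n"] hat_dom_unit[of "- n"]
      by (simp add: star_u crossed_one) (simp add: crossed_u_def hat_dom_zero_one)
  next
    case (unitary2 n)
    then show ?thesis
      using v_mult[of 1 1 "to_fract n" "to_fract (- n)"] hat_dom_unit[of n]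
      by (simp add: star_u crossed_one) (simp add: crossed_u_def hat_dom_zero_one)
  next
    case (CL1 m m')
    then show ?thesis
      using v_mult[of "to_fract m" "to_fract m'" 0 0] hat_dom_mono[OF _ _ frac_le_to_fract[of m m'], of 0]
      by (simp add: crossed_s_def Int_absorb1)
  next
    case (CL2 n n')
    then show ?thesis
      using v_mult[of 1 1 "to_fract n" "to_fract n'"] hat_dom_unit[of n] hat_dom_unit[of "n + n'"]
      by (simp add: crossed_u_def)
  next
    case (CL3 m n)
    have "to_fract n * to_fract m - 0 \<in> frac_ideal (to_fract m)"
      unfolding frac_ideal_iff by (intro exI[of _ n]) simp
    then have "hat_dom (to_fract n * to_fract m, to_fract m) = hat_dom (0, to_fract m)" by (rule hat_dom_eq)
    then show ?thesis
      using CL3 v_mult[of "to_fract m" 1 0 "to_fract n"] v_mult[of 1 "to_fract m" "to_fract (m * n)" 0]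
        hat_dom_unit[of "m * n"] hat_dom_sub[of "(0, to_fract m)"]
      by (simp add: crossed_u_def crossed_s_def mult.commute Int_absorb1)
  next
    case (CL4 m l)
    define F where "F C = crossed_u (l C) \<otimes>\<^bsub>H.L\<^esub> crossed_s m \<otimes>\<^bsub>H.L\<^esub> star H.L (crossed_s m) \<otimes>\<^bsub>H.L\<^esub> crossed_u (- l C)" for C
    have F: "F C = H.delta (hat_dom (to_fract (l C), to_fract m)) (0, 1)" for C
    proof -
      have "F C = crossed_u (l C) \<otimes>\<^bsub>H.L\<^esub> (crossed_s m \<otimes>\<^bsub>H.L\<^esub> (star H.L (crossed_s m) \<otimes>\<^bsub>H.L\<^esub> crossed_u (- l C)))"
        using CL4 by (simp add: F_def Lalg.mult_assoc)
      then show ?thesis using crossed_monomial[of m m "l C" "l C"] CL4 by (simp add: index_group_def)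
    qed
    have Fc: "F C \<in> carrier H.L" for C using CL4 by (simp add: F_def)
    have "finsum H.L F (residue_classes m) = \<one>\<^bsub>H.L\<^esub>"
    proof (intro ext)
      fix g x
      have one: "(\<Sum>C\<in>residue_classes m. indicator (hat_dom (to_fract (l C), to_fract m)) x :: complex) = 1" if x: "x \<in> hat_set"
      proof -
        have m: "to_fract m \<noteq> 0" using CL4 by simp
        obtain r where r: "x (to_fract m) = frac_coset (to_fract r) (to_fract m)"
          using hat_closed[OF x m] by (auto simp: frac_quot_eq)
        have iff: "x \<in> hat_dom (to_fract (l C), to_fract m) \<longleftrightarrow> m dvd r - l C" for C
          using x by (simp add: hat_dom_iff r frac_coset_eq_iff to_fract_diff_ideal del: to_fract_diff)
        let ?C = "(+) r ` range ((*) m)"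
        have C: "?C \<in> residue_classes m" by (auto simp: residue_classes_def)
        have "l ?C \<in> ?C" using CL4 C by blast
        then have dC: "m dvd r - l ?C" unfolding class_iff by (metis dvd_minus_iff minus_diff_eq)
        have uniq: "D = ?C" if D: "D \<in> residue_classes m" "m dvd r - l D" for D
        proof (rule class_eqI[OF D(1) C])
          show "l D \<in> D" using CL4 D by blast
          show "r \<in> ?C" unfolding class_iff by simp
          show "m dvd l D - r" using D(2) by (metis dvd_minus_iff minus_diff_eq)
        qed
        have "(\<Sum>C\<in>residue_classes m. indicator (hat_dom (to_fract (l C), to_fract m)) x :: complex)
          = (\<Sum>C\<in>{?C}. indicator (hat_dom (to_fract (l C), to_fract m)) x)"
        proof (rule sum.mono_neutral_right)
          show "\<forall>D\<in>residue_classes m - {?C}. (indicator (hat_dom (to_fract (l D), to_fract m)) x :: complex) = 0"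
          proof
            fix D assume "D \<in> residue_classes m - {?C}"
            then have "x \<notin> hat_dom (to_fract (l D), to_fract m)" using uniq iff by blast
            then show "(indicator (hat_dom (to_fract (l D), to_fract m)) x :: complex) = 0" by simp
          qed
        qed (use CL4 finite_classes C in auto)
        then show ?thesis using iff[of ?C] dC by simp
      qed
      have "finsum H.L F (residue_classes m) g x = (\<Sum>C\<in>residue_classes m. F C g x)"
        by (rule H.L_finsum_apply) (rule Fc)
      also have "\<dots> = \<one>\<^bsub>H.L\<^esub> g x"
      proof (cases "g = (0, 1) \<and> x \<in> hat_set")
        case True
        then show ?thesis using one by (simp add: F crossed_one H.delta_apply)
      next
        case False
        have "F C g x = 0" for C
          using False hat_dom_sub[of "(to_fract (l C), to_fract m)"] by (auto simp: F H.delta_apply indicator_def)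
        then show ?thesis using False by (auto simp: crossed_one H.delta_apply indicator_def)
      qed
      finally show "finsum H.L F (residue_classes m) g x = \<one>\<^bsub>H.L\<^esub> g x" .
    qed
    then show ?thesis using CL4 by (simp add: F_def[abs_def])
  qed
qed

text \<open>For the orthogonality, \<open>s\<^sub>m\<^sup>* u\<^sup>t s\<^sub>m\<close> is supported on the domain of \<open>(t / m, 1)\<close>, which is empty unless
  \<open>t / m \<in> R\<close>.\<close>

lemma crossed_family: "orthogonal_cl_family H.L crossed_s crossed_u"
proof (intro orthogonal_cl_family.intro cl_family.intro cl_family_axioms.intro orthogonal_cl_family_axioms.intro
    H.star_algebra_L H.unital_L)
  fix m t :: 'r assume m: "m \<noteq> 0" and t: "\<not> m dvd t"
  have m': "to_fract m \<noteq> 0" using m by simp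
  have 1: "crossed_u t \<otimes>\<^bsub>H.L\<^esub> crossed_s m = H.delta (hat_dom (to_fract t, 1) \<inter> hat_dom (to_fract t, to_fract m)) (to_fract t, to_fract m)"
    using v_mult[of 1 "to_fract m" "to_fract t" 0] m' by (simp add: crossed_u_def crossed_s_def)
  have "hat_dom (to_fract t / to_fract m, 1) = {}"
  proof -
    have "to_fract r - to_fract t / to_fract m \<notin> frac_ideal 1" for r
    proof
      assume "to_fract r - to_fract t / to_fract m \<in> frac_ideal 1"
      then obtain c where "to_fract r - to_fract t / to_fract m = to_fract c" by (auto simp: frac_ideal_iff)
      then have "to_fract t = to_fract (m * (r - c))" using m' by (simp add: field_simps)
      then have "t = m * (r - c)" by (simp only: to_fract_eq_iff)
      then show False using t by simp
    qed
    moreover have "\<exists>r. x 1 = frac_coset (to_fract r) 1" if "x \<in> hat_set" for x :: "'r fract \<Rightarrow> 'r fract set"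
      using hat_closed[OF that, of 1] by (auto simp: frac_quot_eq)
    ultimately show ?thesis using frac_coset_eq_iff by (fastforce simp: hat_dom_iff)
  qed
  then show "star H.L (crossed_s m) \<otimes>\<^bsub>H.L\<^esub> (crossed_u t \<otimes>\<^bsub>H.L\<^esub> crossed_s m) = \<zero>\<^bsub>H.L\<^esub>"
    using H.delta_V_mult[of "(0, 1 / to_fract m)" "(to_fract t, 1)" "(to_fract t, to_fract m)"] m'
    by (simp add: 1 star_s m H.delta_empty)
qed (auto simp: finite_classes crossed_s_closed crossed_u_closed intro: crossed_relations)

end

section \<open>Locally constant functions\<close>

text \<open>Numerators are upper bounds: \<open>a / b \<le> a\<close>. So the coordinates in \<open>R\<close> are cofinal.\<close>

lemma finite_upper_bound:
  assumes "finite J" "0 \<notin> J"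
  shows "\<exists>m::'r::idom. m \<noteq> 0 \<and> (\<forall>w\<in>J. frac_le w (to_fract m))"
  using assms
proof (induction J)
  case empty
  show ?case by (intro exI[of _ 1]) simp
next
  case (insert w J)
  then obtain m :: 'r where m: "m \<noteq> 0" "\<forall>w\<in>J. frac_le w (to_fract m)" by auto
  obtain v where v: "v \<noteq> 0" "frac_le w v" "frac_le (to_fract m) v"
    using frac_upper_bound[of w "to_fract m"] insert.prems m(1) by auto
  obtain a b :: 'r where ab: "b \<noteq> 0" "v = to_fract a / to_fract b" by (rule fract_eq_divide)
  have "frac_le v (to_fract a)" unfolding frac_le_def by (intro exI[of _ b]) (use ab in simp)
  moreover have "a \<noteq> 0" using ab v(1) by auto
  ultimately show ?case using v m(2) frac_le_trans by (intro exI[of _ a]) blast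
qed

lemma hat_agree_mono:
  assumes "x \<in> hat_set" "y \<in> hat_set" "w \<noteq> 0" "w' \<noteq> 0" "frac_le w w'" "x w' = y w'"
  shows "x w = y w"
  using hat_compat[OF assms(1,3,4,5)] hat_compat[OF assms(2,3,4,5)] assms(6) by simp

text \<open>A basic open set constrains finitely many coordinates, and these are all determined by the coordinate at a
  common upper bound.\<close>

lemma hat_nbhd:
  fixes U :: "('r::idom fract \<Rightarrow> 'r fract set) set"
  assumes U: "openin hat_top U" and x: "x \<in> U"
  shows "\<exists>m. m \<noteq> 0 \<and> (\<forall>y\<in>hat_set. y (to_fract m) = x (to_fract m) \<longrightarrow> y \<in> U)"
proof -
  let ?X = "\<lambda>w::'r fract. discrete_topology (frac_quot w)"
  obtain W where W: "openin (product_topology ?X (UNIV - {0})) W" "U = W \<inter> hat_set"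
    using U by (auto simp: hat_top_def openin_subtopology)
  have xW: "x \<in> W" "x \<in> hat_set" using x W(2) by auto
  obtain B where B: "finite {w \<in> UNIV - {0}. B w \<noteq> topspace (?X w)}"
    "x \<in> Pi\<^sub>E (UNIV - {0}) B" "Pi\<^sub>E (UNIV - {0}) B \<subseteq> W"
    using W(1) xW(1) unfolding openin_product_topology_alt by meson
  obtain m :: 'r where m: "m \<noteq> 0" "\<And>w. w \<noteq> 0 \<Longrightarrow> B w \<noteq> frac_quot w \<Longrightarrow> frac_le w (to_fract m)"
    using finite_upper_bound[OF B(1)] by auto
  have m': "to_fract m \<noteq> 0" using m by simp
  have "y \<in> U" if y: "y \<in> hat_set" "y (to_fract m) = x (to_fract m)" for y
  proof -
    have "y w \<in> B w" if w: "w \<noteq> 0" for w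
    proof (cases "B w = frac_quot w")
      case True then show ?thesis using hat_closed[OF y(1) w] by simp
    next
      case False
      have "y w = x w" by (rule hat_agree_mono[OF y(1) xW(2) w m' m(2)[OF w False] y(2)])
      then show ?thesis using B(2) w by (auto simp: PiE_iff)
    qed
    moreover have "y \<in> extensional (UNIV - {0})" using y(1) by (auto simp: hat_set_def PiE_iff)
    ultimately have "y \<in> Pi\<^sub>E (UNIV - {0}) B" by (auto simp: PiE_iff)
    then show ?thesis using B(3) W(2) y(1) by blast
  qed
  then show ?thesis using m(1) by blast
qed

context finite_residues
begin

text \<open>A Lebesgue number argument: cover \<open>R\<^sub>K\<close> by finitely many sets on which one coordinate is fixed and \<open>f\<close>
  oscillates little, and take \<open>m\<close> above all these coordinates.\<close>

lemma uniformly_locally_constant: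
  fixes w :: "'r fract"
  assumes f: "f \<in> carrier (cont_alg hat_top)" and e: "(e::real) > 0" and w: "w \<noteq> 0"
  shows "\<exists>m::'r. m \<noteq> 0 \<and> frac_le w (to_fract m) \<and>
    (\<forall>x\<in>hat_set. \<forall>y\<in>hat_set. x (to_fract m) = y (to_fract m) \<longrightarrow> cmod (f x - f y) < e)"
proof -
  have fc: "continuous_map hat_top euclidean f" using f by (simp add: cont_alg_carrier)
  have "\<exists>m. m \<noteq> 0 \<and> (\<forall>y\<in>hat_set. y (to_fract m) = x (to_fract m) \<longrightarrow> cmod (f y - f x) < e / 2)"
    if x: "x \<in> hat_set" for x :: "'r fract \<Rightarrow> 'r fract set"
  proof -
    let ?U = "{y \<in> topspace hat_top. f y \<in> ball (f x) (e / 2)}"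
    have "openin hat_top ?U" by (rule openin_continuous_map_preimage[OF fc]) simp
    moreover have "x \<in> ?U" using x e by (simp add: topspace_hat)
    ultimately obtain m where m: "m \<noteq> 0" "\<And>y. y \<in> hat_set \<Longrightarrow> y (to_fract m) = x (to_fract m) \<Longrightarrow> y \<in> ?U"
      using hat_nbhd[of ?U x] by blast
    have "cmod (f y - f x) < e / 2" if "y \<in> hat_set" "y (to_fract m) = x (to_fract m)" for y
      using m(2)[OF that] by (simp add: dist_norm norm_minus_commute)
    then show ?thesis using m(1) by blast
  qed
  then have "\<forall>x\<in>hat_set. \<exists>m::'r. m \<noteq> 0 \<and> (\<forall>y\<in>hat_set. y (to_fract m) = x (to_fract m) \<longrightarrow> cmod (f y - f x) < e / 2)"
    by blast
  from bchoice[OF this] obtain M :: "('r fract \<Rightarrow> 'r fract set) \<Rightarrow> 'r" where M: "\<And>x. x \<in> hat_set \<Longrightarrow> M x \<noteq> 0"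
    "\<And>x y. x \<in> hat_set \<Longrightarrow> y \<in> hat_set \<Longrightarrow> y (to_fract (M x)) = x (to_fract (M x)) \<Longrightarrow> cmod (f y - f x) < e / 2"
    by blast
  define N where "N x = {y \<in> hat_set. y (to_fract (M x)) = x (to_fract (M x))}" for x
  have N_open: "openin hat_top (N x)" if x: "x \<in> hat_set" for x
  proof -
    have "to_fract (M x) \<noteq> 0" using M(1)[OF x] by simp
    moreover obtain r where "x (to_fract (M x)) = frac_coset (to_fract r) (to_fract (M x))"
      using hat_closed[OF x calculation] by (auto simp: frac_quot_eq)
    then have "N x = hat_dom (to_fract r, to_fract (M x))" by (simp only: N_def hat_dom_def prod.case)
    ultimately show ?thesis by (simp add: hat_dom_clopen(1))
  qed
  have "compactin hat_top (hat_set :: ('r fract \<Rightarrow> 'r fract set) set)" using compact_hat[OF finite_classes] by (simp add: compact_space_def topspace_hat)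
  moreover have "\<forall>U\<in>N ` hat_set. openin hat_top U" "hat_set \<subseteq> \<Union> (N ` hat_set)"
    using N_open by (auto simp: N_def)
  ultimately obtain Z where Z: "finite Z" "Z \<subseteq> N ` hat_set" "hat_set \<subseteq> \<Union> Z"
    using compactinD[of hat_top hat_set "N ` hat_set"] by blast
  obtain X0 where X0: "X0 \<subseteq> hat_set" "finite X0" "Z = N ` X0"
    using finite_subset_image[OF Z(1,2)] by blast
  let ?J = "insert w ((\<lambda>x. to_fract (M x)) ` X0)"
  have "finite ?J" "0 \<notin> ?J" using X0 M(1) w by auto
  then obtain m :: 'r where m: "m \<noteq> 0" "\<forall>w\<in>?J. frac_le w (to_fract m)" using finite_upper_bound by blast
  have "cmod (f x - f y) < e" if xy: "x \<in> hat_set" "y \<in> hat_set" "x (to_fract m) = y (to_fract m)" for x y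
  proof -
    obtain z where z: "z \<in> X0" "x \<in> N z" using xy(1) Z(3) unfolding X0(3) by blast
    have zh: "z \<in> hat_set" using z X0 by blast
    have "x (to_fract (M z)) = y (to_fract (M z))"
      by (rule hat_agree_mono[OF xy(1,2) _ _ _ xy(3)]) (use M(1)[OF zh] m z in auto)
    then have "cmod (f x - f z) < e / 2" "cmod (f y - f z) < e / 2"
      using M(2)[OF zh xy(1)] M(2)[OF zh xy(2)] z(2) by (auto simp: N_def)
    then show ?thesis using norm_triangle_ineq4[of "f x - f z" "f y - f z"] by simp
  qed
  then show ?thesis using m by (intro exI[of _ m]) auto
qed

sublocale C: orthogonal_cl_family H.L crossed_s crossed_u by (rule crossed_family)

sublocale LN: normed_star_algebra H.L by (rule H.normed_star_algebra_L)

lemma monomial_eq_delta: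
  "index_ok (l, m, k, j) \<Longrightarrow> C.monomial (l, m, k, j) = H.delta (hat_dom (to_fract l, to_fract m)) (index_group (l, m, k, j))"
  using crossed_monomial[of m k l j] by (simp add: C.monomial_def index_ok_def)

text \<open>The coefficient function at \<open>g\<close> is the sum of the weighted indicators of the cylinders of degree \<open>g\<close>.\<close>

lemma combination_at_ring_point:
  assumes "\<forall>x\<in>set xs. index_ok (snd x)"
  shows "combination H.L C.monomial xs g (ring_point l) = weight_at (filter (\<lambda>x. index_group (snd x) = g) xs) l"
  using assms
proof (induction xs)
  case Nil
  then show ?case by (simp add: combination_def weight_at_def H.L_simps(2))
next
  case (Cons x xs)
  obtain c l' m k j where x: "x = (c, l', m, k, j)" by (cases x)
  have ok: "index_ok (l', m, k, j)" using Cons.prems x by simp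
  then have m: "to_fract m \<noteq> 0" by (simp add: index_ok_def)
  have "(ring_point l :: 'r fract \<Rightarrow> _) \<in> hat_dom (to_fract l', to_fract m) \<longleftrightarrow> m dvd l - l'"
    using ring_point_iff[OF m, of l "to_fract l'"] to_fract_diff_ideal[of l l' m] by simp
  then have "C.monomial (l', m, k, j) g (ring_point l) = (if index_group (l', m, k, j) = g \<and> m dvd l - l' then 1 else 0)"
    by (auto simp: monomial_eq_delta[OF ok] H.delta_apply)
  then show ?case
    using Cons by (auto simp: combination_def weight_at_def hits_def x H.L_simps(3,4))
qed

text \<open>The weights are values of coefficient functions, so the bound of \<open>combination_norm\<close> is the \<open>\<ell>\<^sup>1\<close>-norm in the
  crossed product.\<close>

lemma combination_weights:
  assumes p: "cstar_seminorm B p" and B: "orthogonal_cl_family B s u"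
    and ok: "\<forall>x\<in>set xs. index_ok (snd x)"
  shows "p (combination B (cl_family.monomial B s u) xs) \<le> nrm H.L (combination H.L C.monomial xs)"
proof -
  let ?a = "combination H.L C.monomial xs" and ?T = "(\<lambda>x. index_group (snd x)) ` set xs"
  have a: "?a \<in> carrier H.L" by (rule C.combination_closed[OF ok])
  have "p (combination B (cl_family.monomial B s u) xs) \<le> (\<Sum>g\<in>?T. nrm (cont_alg hat_top) (?a g))"
  proof (rule orthogonal_cl_family.combination_norm[OF B p])
    show "\<forall>x\<in>set xs. index_ok (snd x) \<and> index_group (snd x) \<in> ?T" using ok by blast
    fix g l
    show "cmod (weight_at (filter (\<lambda>x. index_group (snd x) = g) xs) l) \<le> nrm (cont_alg hat_top) (?a g)"
      using H.norm_bound[OF a, of g "ring_point l"] by (simp add: combination_at_ring_point[OF ok])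
  qed simp
  also have "\<dots> \<le> nrm H.L ?a" by (rule H.nrm_subset[OF a]) simp
  finally show ?thesis .
qed

section \<open>Density of the image of the free algebra\<close>

abbreviation "F \<equiv> free_star_alg (cl_gens :: 'r cl_gen set)"
abbreviation "rep \<equiv> free_value H.L C.gen_value"

sublocale V: free_evaluation H.L cl_gens C.gen_value by (rule C.free_evaluation)

definition rep_range :: "('r fract \<times> 'r fract \<Rightarrow> ('r fract \<Rightarrow> 'r fract set) \<Rightarrow> complex) set" where
  "rep_range = rep ` carrier F"

lemma rep_range_closed:
  shows "x \<in> rep_range \<Longrightarrow> y \<in> rep_range \<Longrightarrow> x \<otimes>\<^bsub>H.L\<^esub> y \<in> rep_range"
    and "x \<in> rep_range \<Longrightarrow> y \<in> rep_range \<Longrightarrow> x \<oplus>\<^bsub>H.L\<^esub> y \<in> rep_range"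
    and "x \<in> rep_range \<Longrightarrow> c \<odot>\<^bsub>H.L\<^esub> x \<in> rep_range" and "x \<in> rep_range \<Longrightarrow> star H.L x \<in> rep_range"
    and "\<zero>\<^bsub>H.L\<^esub> \<in> rep_range" and "x \<in> rep_range \<Longrightarrow> x \<in> carrier H.L"
  by (auto simp: rep_range_def V.value_closed simp flip: V.value_mult V.value_add V.value_smult V.value_star
      intro!: imageI F.mult_closed F.smult_closed_complex F.star_closed)
    (auto intro!: image_eqI[OF _ F.M.zero_closed] simp: star_hom_zero[OF star_algebra_free H.star_algebra_L V.value_hom])

lemma rep_range_finsum: "(\<And>i. i \<in> I \<Longrightarrow> f i \<in> rep_range) \<Longrightarrow> finsum H.L f I \<in> rep_range"
proof (induction I rule: infinite_finite_induct)
  case (insert i I)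
  then show ?case using rep_range_closed(2,6) by (simp add: Pi_iff)
qed (simp_all add: C.M.finsum_infinite rep_range_closed(5))

lemma rep_gen: "m \<noteq> 0 \<Longrightarrow> rep (free_gen (GenS m)) = crossed_s m" "rep (free_gen (GenU n)) = crossed_u n"
  by (simp_all add: V.value_gen cl_gens_iff C.gen_value_def)

lemma rep_range_gen: "m \<noteq> 0 \<Longrightarrow> crossed_s m \<in> rep_range" "crossed_u n \<in> rep_range"
  using imageI[OF cl_gens_closed(1), of m rep] imageI[OF cl_gens_closed(2), of rep n]
  by (simp_all add: rep_range_def rep_gen)

lemma rep_range_monomial: "index_ok q \<Longrightarrow> C.monomial q \<in> rep_range"
proof -
  assume q: "index_ok q"
  obtain l m k j where q_eq: "q = (l, m, k, j)" by (cases q)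
  have mk: "m \<noteq> 0" "k \<noteq> 0" using q by (auto simp: q_eq index_ok_def)
  have "crossed_u l \<otimes>\<^bsub>H.L\<^esub> (crossed_s m \<otimes>\<^bsub>H.L\<^esub> (star H.L (crossed_s k) \<otimes>\<^bsub>H.L\<^esub> crossed_u (- j))) \<in> rep_range"
    by (rule rep_range_closed(1)[OF rep_range_gen(2) rep_range_closed(1)[OF rep_range_gen(1)[OF mk(1)]
          rep_range_closed(1)[OF rep_range_closed(4)[OF rep_range_gen(1)[OF mk(2)]] rep_range_gen(2)]]])
  then show ?thesis by (simp add: q_eq C.monomial_def)
qed

text \<open>Divisibility of \<open>m\<close> by \<open>w\<close> and \<open>i \<in> x + (w)\<close> are what is needed to solve \<open>index_group (i, m, k, j) = (x, w)\<close>
  for \<open>k\<close> and \<open>j\<close> in \<open>R\<close>.\<close>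

lemma cylinder_in_range:
  assumes w: "w \<noteq> 0" and m: "m \<noteq> 0" and le: "frac_le w (to_fract m)" and i: "to_fract i - x \<in> frac_ideal w"
  shows "H.delta (hat_dom (to_fract i, to_fract m)) (x, w) \<in> rep_range"
proof -
  obtain k where k: "to_fract m = w * to_fract k" using le by (auto simp: frac_le_def)
  obtain j where j: "to_fract i - x = w * to_fract j" using i by (auto simp: frac_ideal_iff)
  have k0: "k \<noteq> 0" using k m by auto
  have "index_group (i, m, k, j) = (x, w)" using k j k0 by (simp add: index_group_def algebra_simps)
  then show ?thesis
    using rep_range_monomial[of "(i, m, k, j)"] monomial_eq_delta[of i m k j] m k0 by (simp add: index_ok_def)
qed

text \<open>Choose \<open>m\<close> so fine that \<open>f\<close> is almost constant on the cosets of \<open>(m)\<close> and that the domain of \<open>g\<close> is a union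
  of such cosets, and sample \<open>f\<close> at representatives. On the cosets outside the domain \<open>f\<close> vanishes.\<close>

lemma single_approx:
  assumes g: "g \<in> carrier affine_group" and f: "f \<in> cont_ideal hat_top (hat_dom g)" and e: "e > 0"
  shows "\<exists>y\<in>rep_range. nrm H.L (cp_single (cont_alg hat_top) f g \<ominus>\<^bsub>H.L\<^esub> y) < e"
proof -
  obtain x0 w where g': "g = (x0, w)" "w \<noteq> 0" using g by (cases g) auto
  have fc: "f \<in> carrier (cont_alg hat_top)" using f by (simp add: cont_ideal_def)
  obtain m :: 'r where m: "m \<noteq> 0" "frac_le w (to_fract m)" and
    close: "\<And>x y. x \<in> hat_set \<Longrightarrow> y \<in> hat_set \<Longrightarrow> x (to_fract m) = y (to_fract m) \<Longrightarrow> cmod (f x - f y) < e / 2"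
    using uniformly_locally_constant[OF fc half_gt_zero[OF e] g'(2)] by metis
  have m': "to_fract m \<noteq> 0" using m by simp
  define I where "I = {i \<in> set (residue_reps m). to_fract i - x0 \<in> frac_ideal w}"
  let ?D = "\<lambda>i. H.delta (hat_dom (to_fract i, to_fract m)) g"
  define y where "y = finsum H.L (\<lambda>i. f (ring_point i) \<odot>\<^bsub>H.L\<^esub> ?D i) I"
  have D: "?D i \<in> rep_range" if "i \<in> I" for i
    unfolding g' by (rule cylinder_in_range[OF g'(2) m]) (use that in \<open>simp add: I_def\<close>)
  have y: "y \<in> rep_range" unfolding y_def using D by (intro rep_range_finsum rep_range_closed(3))
  have Dc: "f (ring_point i) \<odot>\<^bsub>H.L\<^esub> ?D i \<in> carrier H.L" if "i \<in> I" for i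
    by (rule rep_range_closed(6)[OF rep_range_closed(3)[OF D[OF that]]])
  let ?z = "cp_single (cont_alg hat_top) f g \<ominus>\<^bsub>H.L\<^esub> y"
  have s: "cp_single (cont_alg hat_top) f g \<in> carrier H.L" by (rule H.single_carrier[OF g f])
  have yc: "y \<in> carrier H.L" by (rule rep_range_closed(6)[OF y])
  have z: "?z \<in> carrier H.L" using s yc by simp
  have y_apply: "y h x = (if h = g then \<Sum>i\<in>I. f (ring_point i) * indicator (hat_dom (to_fract i, to_fract m)) x else 0)" for h x
  proof -
    have "y h x = (\<Sum>i\<in>I. (f (ring_point i) \<odot>\<^bsub>H.L\<^esub> ?D i) h x)"
      unfolding y_def by (rule H.L_finsum_apply) (rule Dc)
    then show ?thesis by (simp add: H.L_simps(4) H.delta_apply)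
  qed
  have z_apply: "?z h x = (if h = g then f x - y g x else 0)" for h x
    using s yc by (simp add: C.minus_eq_smult H.L_simps(3,4)) (simp add: cp_single_def cont_alg_simps y_apply)
  have "cmod (f x - y g x) \<le> e / 2" if x: "x \<in> hat_set" for x
  proof -
    obtain r where r: "x (to_fract m) = frac_coset (to_fract r) (to_fract m)"
      using hat_closed[OF x m'] by (auto simp: frac_quot_eq)
    obtain i where i: "i \<in> set (residue_reps m)" "m dvd r - i" using residue_reps(2)[OF finite_classes[OF m(1)]] by blast
    have iff: "x \<in> hat_dom (to_fract l, to_fract m) \<longleftrightarrow> m dvd r - l" for l
      using x by (simp add: hat_dom_iff r frac_coset_eq_iff to_fract_diff_ideal del: to_fract_diff)
    have uniq: "l = i" if l: "l \<in> set (residue_reps m)" "m dvd r - l" for l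
    proof -
      have "l - i = (r - i) - (r - l)" by simp
      then have "m dvd l - i" using i(2) l(2) by (metis dvd_diff)
      then show ?thesis using residue_reps(3)[OF finite_classes[OF m(1)] l(1) i(1)] by blast
    qed
    have agree: "x (to_fract m) = ring_point i (to_fract m)"
      using iff[of i] i(2) m' by (simp add: hat_dom_iff ring_point_def)
    have "y g x = (\<Sum>l\<in>I. if l = i then f (ring_point i) else 0)"
    proof -
      have "f (ring_point l) * indicator (hat_dom (to_fract l, to_fract m)) x = (if l = i then f (ring_point i) else 0)"
        if "l \<in> I" for l
      proof (cases "l = i")
        case True
        then have "x \<in> hat_dom (to_fract l, to_fract m)" using iff[of l] i(2) by blast
        then show ?thesis using True by simp
      next
        case False
        then have "x \<notin> hat_dom (to_fract l, to_fract m)" using iff[of l] uniq[of l] that I_def by blast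
        then show ?thesis using False by simp
      qed
      then show ?thesis by (simp add: y_apply)
    qed
    also have "\<dots> = (if i \<in> I then f (ring_point i) else 0)" by (simp add: I_def)
    also have "\<dots> = f (ring_point i)"
      using f i(1) ring_point_iff[OF g'(2), of i x0] by (auto simp: I_def cont_ideal_def g')
    finally show ?thesis using close[OF x ring_point agree] by simp
  qed
  then have "nrm (cont_alg hat_top) (?z g) \<le> e / 2" using e by (intro cont_norm_le) (auto simp: z_apply topspace_hat)
  moreover have "nrm H.L ?z = nrm (cont_alg hat_top) (?z g)"
  proof -
    have "H.supp ?z \<subseteq> {g}"
    proof
      fix h assume "h \<in> H.supp ?z"
      then show "h \<in> {g}" unfolding H.supp_iff fun_eq_iff z_apply by (auto split: if_splits)
    qed
    then show ?thesis using H.nrm_superset[OF z, of "{g}"] by simp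
  qed
  ultimately have "nrm H.L ?z < e" using e by linarith
  then show ?thesis using y by (rule bexI)
qed

lemma rep_dense:
  assumes a: "a \<in> carrier H.L" and e: "(e::real) > 0"
  shows "\<exists>b\<in>carrier F. nrm H.L (a \<ominus>\<^bsub>H.L\<^esub> rep b) < e"
proof -
  have "\<exists>y\<in>rep_range. nrm H.L (a \<ominus>\<^bsub>H.L\<^esub> y) < e"
    if "finite T" "T \<subseteq> carrier affine_group" "a \<in> carrier H.L" "H.supp a \<subseteq> T" "e > 0" for T a and e :: real
    using that
  proof (induction T arbitrary: a e)
    case empty
    then have "a g = (\<lambda>x. 0)" for g using H.supp_iff[of g a] by auto
    then have "a = \<zero>\<^bsub>H.L\<^esub>" by (intro ext) (simp add: H.L_simps(2))
    moreover have "nrm H.L (\<zero>\<^bsub>H.L\<^esub> \<ominus>\<^bsub>H.L\<^esub> \<zero>\<^bsub>H.L\<^esub>) = 0"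
      using LN.nrm_smult[of "\<zero>\<^bsub>H.L\<^esub>" 0] C.smult_zero_complex[of "\<zero>\<^bsub>H.L\<^esub>"] by (simp add: a_minus_def C.M.r_neg)
    ultimately show ?case using rep_range_closed(5) empty.prems by (intro bexI[of _ "\<zero>\<^bsub>H.L\<^esub>"]) auto
  next
    case (insert g T)
    let ?s = "cp_single (cont_alg hat_top) (a g) g"
    let ?b = "a \<ominus>\<^bsub>H.L\<^esub> ?s"
    have g: "g \<in> carrier affine_group" using insert.prems by blast
    have ag: "a g \<in> cont_ideal hat_top (hat_dom g)" using insert.prems(2) g by (auto simp: H.L_carrier)
    have s: "?s \<in> carrier H.L" by (rule H.single_carrier[OF g ag])
    have b: "?b \<in> carrier H.L" using insert.prems s by simp
    have b_apply: "?b h x = (if h = g then 0 else a h x)" for h x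
      using insert.prems(2) s by (simp add: C.minus_eq_smult H.L_simps(3,4)) (simp add: cp_single_def cont_alg_simps)
    have "H.supp ?b \<subseteq> T"
    proof
      fix h assume "h \<in> H.supp ?b"
      then have "h \<noteq> g" "a h \<noteq> (\<lambda>x. 0)" unfolding H.supp_iff fun_eq_iff b_apply by (auto split: if_splits)
      then show "h \<in> T" using insert.prems(3) H.supp_iff[of h a] by blast
    qed
    then obtain y where y: "y \<in> rep_range" "nrm H.L (?b \<ominus>\<^bsub>H.L\<^esub> y) < e / 2"
      using insert.IH[OF _ b, of "e / 2"] insert.prems by auto
    obtain z where z: "z \<in> rep_range" "nrm H.L (?s \<ominus>\<^bsub>H.L\<^esub> z) < e / 2"
      using single_approx[OF g ag half_gt_zero[OF insert.prems(4)]] by blast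
    note yz = rep_range_closed(6)[OF y(1)] rep_range_closed(6)[OF z(1)]
    have "a = ?b \<oplus>\<^bsub>H.L\<^esub> ?s" using insert.prems(2) s by (simp add: a_minus_def C.M.a_assoc C.M.l_neg)
    then have "a \<ominus>\<^bsub>H.L\<^esub> (y \<oplus>\<^bsub>H.L\<^esub> z) = (?b \<ominus>\<^bsub>H.L\<^esub> y) \<oplus>\<^bsub>H.L\<^esub> (?s \<ominus>\<^bsub>H.L\<^esub> z)"
      using C.add_minus_add[OF b s yz] by simp
    then have "nrm H.L (a \<ominus>\<^bsub>H.L\<^esub> (y \<oplus>\<^bsub>H.L\<^esub> z)) < e"
      using LN.nrm_add[of "?b \<ominus>\<^bsub>H.L\<^esub> y" "?s \<ominus>\<^bsub>H.L\<^esub> z"] b s yz y(2) z(2) by simp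
    then show ?case using rep_range_closed(2)[OF y(1) z(1)] by blast
  qed
  then show ?thesis
    using H.L_finite[OF a] H.L_supp[OF a] a e unfolding rep_range_def by blast
qed

end

section \<open>The isomorphism\<close>

lemma cl_generators_in_carrier:
  "m \<noteq> 0 \<Longrightarrow> cl_s m \<in> carrier cl_algebra" "cl_u n \<in> carrier cl_algebra"
  using CL.U.to_completion_hom cl_gens_closed
  by (auto simp: star_hom_def Pi_iff cl_s_def cl_u_def universal_gen_def cl_algebra_def universal_cstar_def)

lemma cl_algebra_family:
  assumes fin: "\<And>m::'r::idom. m \<noteq> 0 \<Longrightarrow> finite (residue_classes m)"
  shows "orthogonal_cl_family cl_algebra (cl_s :: 'r \<Rightarrow> _) cl_u"
proof -
  interpret A: cstar_algebra "cl_algebra :: (nat \<Rightarrow> ('r cl_gen \<times> bool) list \<Rightarrow> complex) set normed_star_alg"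
    by (rule cl_algebra_cstar)
  have "cl_family cl_algebra (cl_s :: 'r \<Rightarrow> _) cl_u"
    by (rule cl_family.intro[OF A.star_algebra_axioms cl_family_axioms.intro[OF fin cl_algebra_cstar(2)
          cl_generators_in_carrier cl_algebra_relations]])
  then show ?thesis by (rule orthogonal_cl_family_of_cstar_norm[OF _ A.cstar_norm A.norm_zeroD])
qed

text \<open>Both sides are unital *-homomorphisms with the same values on the generators.\<close>

lemma to_completion_is_evaluation:
  fixes a :: "('r::idom cl_gen \<times> bool) list \<Rightarrow> complex"
  assumes fin: "\<And>m::'r::idom. m \<noteq> 0 \<Longrightarrow> finite (residue_classes m)" and a: "a \<in> carrier (free_star_alg cl_gens)"
  shows "to_completion (free_star_alg cl_gens) (universal_norm cl_gens cl_rels) a =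
    free_value cl_algebra (orthogonal_cl_family.gen_value cl_algebra cl_s cl_u) a"
proof (rule free_evaluation.value_unique[OF orthogonal_cl_family.free_evaluation[OF cl_algebra_family[OF fin]] _ _ _ a])
  show "star_hom (free_star_alg cl_gens) cl_algebra
    (to_completion (free_star_alg (cl_gens :: 'r cl_gen set)) (universal_norm cl_gens cl_rels))"
    unfolding cl_algebra_def universal_cstar_def by (rule CL.U.to_completion_hom)
  show "to_completion (free_star_alg (cl_gens :: 'r cl_gen set)) (universal_norm cl_gens cl_rels) \<one>\<^bsub>free_star_alg cl_gens\<^esub> = \<one>\<^bsub>cl_algebra\<^esub>"
    by (simp add: to_completion_def cl_algebra_def universal_cstar_def CL.U.one_B)
  show "to_completion (free_star_alg (cl_gens :: 'r cl_gen set)) (universal_norm cl_gens cl_rels) (free_gen x)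
    = orthogonal_cl_family.gen_value cl_algebra cl_s cl_u x"
    if "x \<in> cl_gens" for x
    using that orthogonal_cl_family.gen_value_def[OF cl_algebra_family[OF fin], of x]
    by (cases x) (simp_all add: cl_gens_iff cl_s_def cl_u_def universal_gen_def)
qed

context finite_residues
begin

text \<open>The estimate behind the isometry: \<open>a\<close> has one normal form in both algebras, and there the C*-norm is bounded
  by the \<open>\<ell>\<^sup>1\<close>-norm.\<close>

lemma universal_norm_le_l1:
  assumes a: "a \<in> carrier F"
  shows "universal_norm cl_gens cl_rels a \<le> nrm H.L (rep a)"
proof -
  have fam: "orthogonal_cl_family cl_algebra (cl_s :: 'r \<Rightarrow> _) cl_u" by (rule cl_algebra_family[OF finite_classes])
  have norm: "cstar_seminorm (cl_algebra :: (nat \<Rightarrow> ('r cl_gen \<times> bool) list \<Rightarrow> complex) set normed_star_alg) (nrm cl_algebra)"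
    by (rule cstar_algebra.cstar_norm[OF cl_algebra_cstar(1)])
  obtain xs where xs: "\<forall>x\<in>set xs. index_ok (snd x)"
    "free_value cl_algebra (orthogonal_cl_family.gen_value cl_algebra cl_s cl_u) a
      = combination cl_algebra (cl_family.monomial cl_algebra cl_s cl_u) xs"
    "rep a = combination H.L C.monomial xs"
    using common_normal_form[OF fam crossed_family a] by blast
  have "universal_norm cl_gens cl_rels a = nrm cl_algebra (to_completion F (universal_norm cl_gens cl_rels) a)"
    unfolding cl_algebra_def universal_cstar_def to_completion_def by (rule CL.U.nrm_B_const[OF a, symmetric])
  also have "\<dots> = nrm cl_algebra (combination cl_algebra (cl_family.monomial cl_algebra cl_s cl_u) xs)"
  proof -
    have "to_completion F (universal_norm cl_gens cl_rels) a
      = free_value cl_algebra (orthogonal_cl_family.gen_value cl_algebra cl_s cl_u) a"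
      by (rule to_completion_is_evaluation[OF finite_classes a])
    then show ?thesis using xs(2) by (metis)
  qed
  also have "\<dots> \<le> nrm H.L (combination H.L C.monomial xs)"
    by (rule combination_weights[OF norm fam xs(1)])
  finally show ?thesis by (simp only: xs(3))
qed

lemma enveloping_seminorm: "cstar_seminorm H.L (enveloping_norm H.L)"
  by (rule enveloping_norm_cstar[OF H.star_algebra_L LN.nrm_nonneg])

lemma rep_relations: assumes ab: "(a, b) \<in> cl_rels" shows "rep a = rep b"
proof -
  have sub: "(a, b) \<in> cl_relations H.L crossed_s crossed_u"
    if "(a, b) \<in> cl_relations H.L t crossed_u" "\<And>m. m \<noteq> 0 \<Longrightarrow> t m = crossed_s m" for t a b
    using that(1) by cases (simp_all add: that(2) cl_relations.intros)
  have "(rep a, rep b) \<in> cl_relations H.L (\<lambda>m. rep (free_gen (GenS m))) (\<lambda>n. rep (free_gen (GenU n)))"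
    using cl_relations_hom(1)[where A = F and B = H.L and h = rep
        and s = "\<lambda>m. free_gen (GenS m)" and u = "\<lambda>n. free_gen (GenU n)",
        OF star_algebra_free unital_free H.star_algebra_L V.value_hom V.value_one cl_gens_closed ab[unfolded cl_rels_def]] .
  then have "(rep a, rep b) \<in> cl_relations H.L (\<lambda>m. rep (free_gen (GenS m))) crossed_u"
    by (simp only: rep_gen(2))
  then have "(rep a, rep b) \<in> cl_relations H.L crossed_s crossed_u"
    by (rule sub) (rule rep_gen(1))
  then show "rep a = rep b" by (rule crossed_relations)
qed

text \<open>One inequality is the universality of \<open>\<AA>[R]\<close>. For the other, the universal norm descends to a C*-seminorm on
  \<open>L\<close> below the \<open>\<ell>\<^sup>1\<close>-norm, so it takes part in the supremum that defines the enveloping norm.\<close>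

lemma rep_isometric:
  assumes a: "a \<in> carrier F"
  shows "enveloping_norm H.L (rep a) = universal_norm cl_gens cl_rels a"
proof (rule antisym)
  note eD = cstar_seminormD[OF enveloping_seminorm]
  have "(\<lambda>a. enveloping_norm H.L (rep a)) \<in> relation_seminorms (cl_gens :: 'r cl_gen set) cl_rels"
    unfolding relation_seminorms_def
  proof (intro CollectI conjI)
    show "cstar_seminorm F (\<lambda>a. enveloping_norm H.L (rep a))"
      unfolding cstar_seminorm_def
      by (simp add: V.value_closed V.value_add V.value_smult V.value_mult V.value_star F.mult_closed F.star_closed eD)
    show "\<forall>(a, b)\<in>cl_rels. enveloping_norm H.L (rep (a \<ominus>\<^bsub>F\<^esub> b)) = 0"
    proof clarify
      fix a b :: "('r cl_gen \<times> bool) list \<Rightarrow> complex" assume ab: "(a, b) \<in> cl_rels"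
      have c: "a \<in> carrier F" "b \<in> carrier F" using CL.rels_carrier ab by auto
      then have "rep (a \<ominus>\<^bsub>F\<^esub> b) = rep a \<ominus>\<^bsub>H.L\<^esub> rep b"
        by (simp add: F.minus_eq_smult C.minus_eq_smult V.value_add V.value_smult V.value_closed)
      then show "enveloping_norm H.L (rep (a \<ominus>\<^bsub>F\<^esub> b)) = 0"
        using C.seminorm_self[OF enveloping_seminorm V.value_closed[OF c(2)]] by (simp only: rep_relations[OF ab])
    qed
  qed
  from CL.universal_norm_upper[OF this a]
  show "enveloping_norm H.L (rep a) \<le> universal_norm cl_gens cl_rels a" .
  have "\<exists>q. cstar_seminorm H.L q \<and> (\<forall>x\<in>carrier H.L. q x \<le> nrm H.L x) \<and>
    (\<forall>a\<in>carrier F. q (rep a) = universal_norm cl_gens cl_rels a)"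
  proof (rule LN.extend_cstar_seminorm[where F = F and h = rep and p = "universal_norm cl_gens cl_rels",
        OF star_algebra_free V.value_hom CL.universal_norm universal_norm_le_l1 rep_dense])
    fix q assume "cstar_seminorm H.L q" "\<And>x. x \<in> carrier H.L \<Longrightarrow> q x \<le> nrm H.L x"
      "\<And>a. a \<in> carrier F \<Longrightarrow> q (rep a) = universal_norm cl_gens cl_rels a"
    then show ?thesis by (intro exI[of _ q] conjI ballI)
  qed
  then obtain q where q: "cstar_seminorm H.L q" "\<And>x. x \<in> carrier H.L \<Longrightarrow> q x \<le> nrm H.L x"
    "\<And>a. a \<in> carrier F \<Longrightarrow> q (rep a) = universal_norm cl_gens cl_rels a"
    by blast
  have "q (rep a) \<le> enveloping_norm H.L (rep a)"
    unfolding enveloping_norm_def sup_seminorm_def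
  proof (rule cSUP_upper)
    show "q \<in> {p. cstar_seminorm H.L p \<and> (\<forall>x\<in>carrier H.L. p x \<le> nrm H.L x)}" using q(1,2) by blast
    show "bdd_above ((\<lambda>p. p (rep a)) ` {p. cstar_seminorm H.L p \<and> (\<forall>x\<in>carrier H.L. p x \<le> nrm H.L x)})"
      by (rule bdd_aboveI[of _ "nrm H.L (rep a)"]) (use V.value_closed[OF a] in blast)
  qed
  then show "universal_norm cl_gens cl_rels a \<le> enveloping_norm H.L (rep a)" using q(3)[OF a] by simp
qed

lemma enveloping_le:
  assumes x: "x \<in> carrier H.L" shows "enveloping_norm H.L x \<le> nrm H.L x"
  unfolding enveloping_norm_def sup_seminorm_def
proof (rule cSUP_least)
  have "(\<lambda>x. 0) \<in> {p. cstar_seminorm H.L p \<and> (\<forall>x\<in>carrier H.L. p x \<le> nrm H.L x)}"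
    using LN.nrm_nonneg by (simp add: cstar_seminorm_def)
  then show "{p. cstar_seminorm H.L p \<and> (\<forall>x\<in>carrier H.L. p x \<le> nrm H.L x)} \<noteq> {}" by blast
qed (use x in blast)

theorem crossed_product_iso:
  "\<exists>\<Phi>. star_iso (cl_algebra :: (nat \<Rightarrow> ('r cl_gen \<times> bool) list \<Rightarrow> complex) set normed_star_alg)
      (enveloping_cstar H.L) \<Phi> \<and>
    (\<forall>n. \<Phi> (cl_u n) = to_completion H.L (enveloping_norm H.L) (crossed_u n)) \<and>
    (\<forall>m. m \<noteq> 0 \<longrightarrow> \<Phi> (cl_s m) = to_completion H.L (enveloping_norm H.L) (crossed_s m))"
proof -
  have sF: "seminormed_star_algebra F (universal_norm cl_gens cl_rels)" by (rule CL.U.seminormed_star_algebra_axioms)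
  have sL: "seminormed_star_algebra H.L (enveloping_norm H.L)"
    by (rule seminormed_star_algebra.intro[OF H.star_algebra_L seminormed_star_algebra_axioms.intro[OF enveloping_seminorm]])
  have dense: "\<exists>a\<in>carrier F. enveloping_norm H.L (x \<ominus>\<^bsub>H.L\<^esub> rep a) < e"
    if x: "x \<in> carrier H.L" and e: "e > 0" for x and e :: real
  proof -
    obtain a where a: "a \<in> carrier F" "nrm H.L (x \<ominus>\<^bsub>H.L\<^esub> rep a) < e" using rep_dense[OF x e] by blast
    have "enveloping_norm H.L (x \<ominus>\<^bsub>H.L\<^esub> rep a) \<le> nrm H.L (x \<ominus>\<^bsub>H.L\<^esub> rep a)"
      by (rule enveloping_le[OF C.M.minus_closed[OF x V.value_closed[OF a(1)]]])
    then have "enveloping_norm H.L (x \<ominus>\<^bsub>H.L\<^esub> rep a) < e" using a(2) by linarith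
    then show ?thesis using a(1) by (rule bexI)
  qed
  have "\<exists>\<Phi>. star_iso (completion F (universal_norm cl_gens cl_rels)) (completion H.L (enveloping_norm H.L)) \<Phi> \<and>
    (\<forall>a\<in>carrier F. \<Phi> (to_completion F (universal_norm cl_gens cl_rels) a) = to_completion H.L (enveloping_norm H.L) (rep a))"
  proof (rule completion_iso[where h = rep and M = "enveloping_norm H.L" and L = H.L, OF sF sL V.value_hom rep_isometric dense])
    fix \<Phi> assume "star_iso (completion F (universal_norm cl_gens cl_rels)) (completion H.L (enveloping_norm H.L)) \<Phi>"
      "\<And>a. a \<in> carrier F \<Longrightarrow>
        \<Phi> (to_completion F (universal_norm cl_gens cl_rels) a) = to_completion H.L (enveloping_norm H.L) (rep a)"
    then show ?thesis by (intro exI[of _ \<Phi>] conjI ballI)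
  qed
  then obtain \<Phi> where iso: "star_iso (completion F (universal_norm cl_gens cl_rels)) (completion H.L (enveloping_norm H.L)) \<Phi>"
    and \<Phi>: "\<And>a. a \<in> carrier F \<Longrightarrow>
      \<Phi> (to_completion F (universal_norm cl_gens cl_rels) a) = to_completion H.L (enveloping_norm H.L) (rep a)"
    by blast
  have "\<Phi> (cl_u n) = to_completion H.L (enveloping_norm H.L) (crossed_u n)" for n
    using \<Phi>[OF cl_gens_closed(2)[of n]] by (simp only: cl_u_def universal_gen_def rep_gen(2))
  moreover have "\<Phi> (cl_s m) = to_completion H.L (enveloping_norm H.L) (crossed_s m)" if "m \<noteq> 0" for m
    using \<Phi>[OF cl_gens_closed(1)[OF that]] by (simp only: cl_s_def universal_gen_def rep_gen(1)[OF that])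
  ultimately show ?thesis
    using iso unfolding cl_algebra_def universal_cstar_def enveloping_cstar_def by blast
qed

end

theorem theorem4p7:
  assumes "\<And>m::'r::idom. m \<noteq> 0 \<Longrightarrow> finite (residue_classes m)"
  shows "\<exists>\<Phi>. star_iso (cl_algebra :: (nat \<Rightarrow> ('r cl_gen \<times> bool) list \<Rightarrow> complex) set normed_star_alg)
      (partial_crossed_product affine_group (cont_alg hat_top) hat_ideal hat_action) \<Phi> \<and>
    (\<forall>n::'r. \<Phi> (cl_u n) =
      cp_delta affine_group (cont_alg hat_top) hat_ideal hat_action
        \<one>\<^bsub>cont_alg hat_top\<^esub> (to_fract n, 1)) \<and>
    (\<forall>m::'r. m \<noteq> 0 \<longrightarrow> \<Phi> (cl_s m) =
      cp_delta affine_group (cont_alg hat_top) hat_ideal hat_action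
        (indicator (hat_dom (0, to_fract m))) (0, to_fract m))"
proof -
  interpret finite_residues "TYPE('r)" by (rule finite_residues.intro) (rule assms)
  have one: "\<one>\<^bsub>cont_alg hat_top\<^esub> = (indicator hat_set :: ('r fract \<Rightarrow> 'r fract set) \<Rightarrow> complex)"
    by (rule ext) (simp add: cont_alg_simps topspace_hat indicator_def)
  have u: "cp_single (cont_alg hat_top) \<one>\<^bsub>cont_alg hat_top\<^esub> (to_fract n, 1) = crossed_u n" for n :: 'r
    unfolding crossed_u_def H.delta_def hat_dom_unit one ..
  have s: "cp_single (cont_alg hat_top) (indicator (hat_dom (0, to_fract m))) (0, to_fract m) = crossed_s m" for m :: 'r
    unfolding crossed_s_def H.delta_def ..
  show ?thesis
    using crossed_product_iso unfolding partial_crossed_product_def cp_delta_def LH_eq u s .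
qed

end
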